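(* Let $H$ be a Hopf algebra with bijective antipode over a field $\Bbbk$, and let $(R,R^\vee)$ be a dual pair of Hopf algebras in ${}^H_H\mathcal{YD}$ with bijective antipodes and with bilinear form $\langle\ ,\ \rangle:R^\vee\otimes R\to\Bbbk$. A monoidal isomorphism $$(F,\varphi):\mathcal{YD}^{R\#H}_{H}\to{}^{\ \ \ \ \ H}_{R^\vee\#H}\mathcal{YD}_{\mathrm{rat}}$$ is defined as follows. For any $M\in\mathcal{YD}^{R\#H}_H$ with right $R\#H$-coaction $\delta_M:M\to M\otimes R\#H$, $m\mapsto m_{[0]}\otimes m_{[1]}$, let $F(M)=M$ as a vector space, with left $H$-action, left $H$-coaction $\delta^H_{F(M)}$ and left $R^\vee$-action given respectively by $$hm=m\,\mathcal S^{-1}(h),\qquad \delta^H_{F(M)}(m)=\pi\mathcal S(m_{[1]})\otimes m_{[0]},\qquad \xi m=\langle\xi,\vartheta\mathcal S(m_{[1]})\rangle m_{[0]}$$ for all $h\in H$, $m\in M$, $\xi\in R^\vee$. For any morphism $f$ let $F(f)=f$. The natural transformation $\varphi$ is $$\varphi_{M,N}:F(M)\otimes F(N)\to F(M\otimes N),\quad m\otimes n\mapsto m\,\pi\mathcal S^{-1}(n_{[1]})\otimes n_{[0]},$$ for all $M,N\in\mathcal{YD}^{R\#H}_H$.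
   Context: Yetter-Drinfeld modules. ${}^H_H\mathcal{YD}$ is the category of left $H$-modules and left $H$-comodules $V$ (action $h\cdot v$, coaction $\delta(v)=v_{(-1)}\otimes v_{(0)}$) with $\delta(h\cdot v)=h_{(1)}v_{(-1)}\mathcal S(h_{(3)})\otimes h_{(2)}\cdot v_{(0)}$; it is monoidal (diagonal action and coaction) and braided by $c_{V,W}(v\otimes w)=v_{(-1)}\cdot w\otimes v_{(0)}$. Bosonization. For a Hopf algebra $R$ in ${}^H_H\mathcal{YD}$ (comultiplication $r\mapsto r^{(1)}\otimes r^{(2)}$), $R\#H$ is the Hopf algebra $R\otimes H$ with $(r\#h)(r'\#h')=r(h_{(1)}\cdot r')\#h_{(2)}h'$ and $\Delta(r\#h)=(r^{(1)}\#(r^{(2)})_{(-1)}h_{(1)})\otimes((r^{(2)})_{(0)}\#h_{(2)})$; it contains $R$ and $H$ as subalgebras, and its antipode is denoted $\mathcal S$ (bijective if the antipode of $R$ is bijective). Put $\pi:R\#H\to H$, $r\#h\mapsto\varepsilon_R(r)h$, and $\vartheta:R\#H\to R$, $r\#h\mapsto r\varepsilon(h)$; similarly for $R^\vee\#H$. Dual pairs. Let $R,R^\vee$ be Hopf algebras in ${}^H_H\mathcal{YD}$ and $\langle\ ,\ \rangle:R^\vee\otimes R\to\Bbbk$ a bilinear form. For $X\subseteq R$, $X'\subseteq R^\vee$ let ${}^\perp X=\{\xi\in R^\vee\mid\langle\xi,x\rangle=0\ \forall x\in X\}$ and $X'^\perp=\{x\in R\mid\langle\xi,x\rangle=0\ \forall\xi\in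 X'\}$. $R^\vee$ is topologized with the subspaces ${}^\perp E$ ($E\subseteq R$ a finite-dimensional subspace) as a basis of neighbourhoods of $0$, and $R$ with the subspaces $E'^\perp$ ($E'\subseteq R^\vee$ a finite-dimensional subspace). If $V,W$ have bases $\{V_i\},\{W_j\}$ of neighbourhoods of $0$ consisting of subspaces, then $V\otimes W$ has $\{V_i\otimes W+V\otimes W_j\}$. Assume that every finite-dimensional subspace of $R$ (resp. $R^\vee$) is contained in a finite-dimensional subobject in ${}^H_H\mathcal{YD}$ of $R$ (resp. $R^\vee$). Then $(R,R^\vee)$ with $\langle\ ,\ \rangle$ is a dual pair of Hopf algebras in ${}^H_H\mathcal{YD}$ if $\langle\ ,\ \rangle$ is non-degenerate (${}^\perp R=0$, $(R^\vee)^\perp=0$), and for all $x,y\in R$, $\xi,\eta\in R^\vee$, $h\in H$: $\langle h\cdot\xi,x\rangle=\langle\xi,\mathcal S(h)\cdot x\rangle$; $\xi_{(-1)}\langle\xi_{(0)},x\rangle=\mathcal S^{-1}(x_{(-1)})\langle\xi,x_{(0)}\rangle$; $\langle\xi,xy\rangle=\langle\xi^{(1)},y\rangle\langle\xi^{(2)},x\rangle$, $\langle1,x\rangle=\varepsilon(x)$; $\langle\xi\eta,x\rangle=\langle\xi,x^{(2)}\rangle\langle\eta,x^{(1)}\rangle$, $\langle\xi,1\rangle=\varepsilon(\xi)$; and $\Delta_{R^\vee}$ and $\Delta_R$ are continuous. A left $R^\vee$-module is rational if each of its elements is annihilated by ${}^\perp E$ for some finite-dimensional subspace $E\subseteq R$.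 Categories. $\mathcal{YD}^{R\#H}_H$ is the category of right $H$-modules and right $R\#H$-comodules $M$ with $\delta(mh)=m_{[0]}h_{(2)}\otimes\mathcal S(h_{(1)})m_{[1]}h_{(3)}$ for $m\in M$, $h\in H$; morphisms are $H$-linear and $R\#H$-colinear maps. ${}^{\ \ \ \ \ H}_{R^\vee\#H}\mathcal{YD}_{\mathrm{rat}}$ is the category of left $R^\vee\#H$-modules and left $H$-comodules $X$ which are rational as $R^\vee$-modules and satisfy $\delta(bx)=\pi(b_{(1)})x_{(-1)}\pi\mathcal S(b_{(3)})\otimes b_{(2)}x_{(0)}$ for $b\in R^\vee\#H$, $x\in X$; morphisms are $R^\vee\#H$-linear and $H$-colinear maps. Both are monoidal with diagonal actions and coactions on the tensor product of vector spaces. A monoidal functor $(F,\varphi)$ is a functor $F$ preserving the unit object together with natural isomorphisms $\varphi_{X,Y}:F(X)\otimes F(Y)\to F(X\otimes Y)$ satisfying the usual unit and associativity conditions; it is a monoidal isomorphism if $F$ is an isomorphism of categories. *)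

theory Defs
  imports "HOL-Library.Poly_Mapping" "HOL-Library.FuncSet" "HOL-Analysis.Abstract_Topology"
begin

section \<open>Vector spaces and tensor products\<close>

text \<open>
  A category of vector spaces that is closed under tensor products needs one HOL type that
  contains the tensor products of its objects. We use the vector space over the field \<open>'k\<close> whose
  basis consists of all finite binary trees with leaves in \<open>'a\<close>, together with a special leaf
  \<open>UnitIx\<close> which spans the unit object. Here \<open>'a\<close> is an arbitrary type. Vector spaces are the
  linear subspaces of \<open>('a, 'k) univ\<close>. By \<open>univ_embedding\<close> below, every vector space with
  elements in \<open>'a\<close> is isomorphic to one of these.
  The pairing of trees induces a bilinear operation \<open>\<otimes>\<^sub>k\<close> on \<open>('a, 'k) univ\<close>, and the span of
  all \<open>v \<otimes>\<^sub>k w\<close> with \<open>v \<in> V\<close> and \<open>w \<in> W\<close> is a tensor product of \<open>V\<close> and \<open>W\<close>; its universal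
  property is \<open>tensor_universal\<close> below.
\<close>

datatype 'a tree_ix = GenIx 'a | UnitIx | PairIx "'a tree_ix" "'a tree_ix"

type_synonym ('a, 'k) univ = "'a tree_ix \<Rightarrow>\<^sub>0 'k"

definition scal :: "'k::field \<Rightarrow> ('a, 'k) univ \<Rightarrow> ('a, 'k) univ" (infixr "*\<^sub>k" 75)
  where "c *\<^sub>k x = Poly_Mapping.map (times c) x"

lemma lookup_scal [simp]: "Poly_Mapping.lookup (c *\<^sub>k x) i = c * Poly_Mapping.lookup x i"
  by (simp add: scal_def Poly_Mapping.map.rep_eq when_def)

global_interpretation univ: vector_space scal
  by unfold_locales (auto intro!: poly_mapping_eqI simp: lookup_add algebra_simps)

definition tens :: "('a, 'k::field) univ \<Rightarrow> ('a, 'k) univ \<Rightarrow> ('a, 'k) univ" (infixr "\<otimes>\<^sub>k" 72)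
  where "x \<otimes>\<^sub>k y = (\<Sum>i\<in>Poly_Mapping.keys x. \<Sum>j\<in>Poly_Mapping.keys y. Poly_Mapping.single (PairIx i j) (Poly_Mapping.lookup x i * Poly_Mapping.lookup y j))"

definition tensor_space :: "('a, 'k::field) univ set \<Rightarrow> ('a, 'k) univ set \<Rightarrow> ('a, 'k) univ set"
    (infixr "\<otimes>\<^sub>V" 72)
  where "V \<otimes>\<^sub>V W = univ.span {v \<otimes>\<^sub>k w | v w. v \<in> V \<and> w \<in> W}"

definition unit_vec :: "('a, 'k::field) univ"
  where "unit_vec = Poly_Mapping.single UnitIx 1"

definition unit_space :: "('a, 'k::field) univ set"
  where "unit_space = univ.span {unit_vec}"

text \<open>Inverse to the identification \<open>c \<mapsto> c *\<^sub>k unit_vec\<close> of \<open>'k\<close> with \<^const>\<open>unit_space\<close>.\<close>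
definition unit_coeff :: "('a, 'k::field) univ \<Rightarrow> 'k"
  where "unit_coeff x = Poly_Mapping.lookup x UnitIx"

definition linear_on ::
  "('a, 'k::field) univ set \<Rightarrow> ('a, 'k) univ set \<Rightarrow> (('a, 'k) univ \<Rightarrow> ('a, 'k) univ) \<Rightarrow> bool"
  where "linear_on V W f \<longleftrightarrow> (\<forall>x\<in>V. f x \<in> W) \<and>
    (\<forall>x\<in>V. \<forall>y\<in>V. f (x + y) = f x + f y) \<and> (\<forall>c. \<forall>x\<in>V. f (c *\<^sub>k x) = c *\<^sub>k f x)"

definition bilinear_on ::
  "('a, 'k::field) univ set \<Rightarrow> ('a, 'k) univ set \<Rightarrow> ('a, 'k) univ set
    \<Rightarrow> (('a, 'k) univ \<Rightarrow> ('a, 'k) univ \<Rightarrow> ('a, 'k) univ) \<Rightarrow> bool"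
  where "bilinear_on V W X f \<longleftrightarrow>
    (\<forall>v\<in>V. linear_on W X (f v)) \<and> (\<forall>w\<in>W. linear_on V X (\<lambda>v. f v w))"

definition linear_form_on :: "('a, 'k::field) univ set \<Rightarrow> (('a, 'k) univ \<Rightarrow> 'k) \<Rightarrow> bool"
  where "linear_form_on V f \<longleftrightarrow>
    (\<forall>x\<in>V. \<forall>y\<in>V. f (x + y) = f x + f y) \<and> (\<forall>c. \<forall>x\<in>V. f (c *\<^sub>k x) = c * f x)"

definition bilinear_form_on ::
  "('a, 'k::field) univ set \<Rightarrow> ('a, 'k) univ set \<Rightarrow> (('a, 'k) univ \<Rightarrow> ('a, 'k) univ \<Rightarrow> 'k) \<Rightarrow> bool"
  where "bilinear_form_on V W f \<longleftrightarrow>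
    (\<forall>v\<in>V. linear_form_on W (f v)) \<and> (\<forall>w\<in>W. linear_form_on V (\<lambda>v. f v w))"

definition fin_dim :: "('a, 'k::field) univ set \<Rightarrow> bool"
  where "fin_dim V \<longleftrightarrow> (\<exists>B. finite B \<and> V = univ.span B)"

text \<open>
  Sweedler sums: for \<open>t = (\<Sum>i. v\<^sub>i \<otimes>\<^sub>k w\<^sub>i)\<close> in \<open>V \<otimes>\<^sub>V W\<close> and \<open>f\<close> bilinear on \<open>V \<times> W\<close>,
  \<open>sw V W t f\<close> is \<open>(\<Sum>i. f v\<^sub>i w\<^sub>i)\<close>, the value at \<open>t\<close> of the linear map on \<open>V \<otimes>\<^sub>V W\<close> induced
  by \<open>f\<close>. The linear map in the definition is determined by \<open>f\<close> on \<open>V \<otimes>\<^sub>V W\<close>, and arbitrary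
  outside. \<open>sw_form\<close> is the variant for scalar-valued \<open>f\<close>.
\<close>
definition sw ::
  "('a, 'k::field) univ set \<Rightarrow> ('a, 'k) univ set \<Rightarrow> ('a, 'k) univ
    \<Rightarrow> (('a, 'k) univ \<Rightarrow> ('a, 'k) univ \<Rightarrow> ('a, 'k) univ) \<Rightarrow> ('a, 'k) univ"
  where "sw V W t f =
    (SOME L. Vector_Spaces.linear scal scal L \<and> (\<forall>v\<in>V. \<forall>w\<in>W. L (v \<otimes>\<^sub>k w) = f v w)) t"

definition sw_form ::
  "('a, 'k::field) univ set \<Rightarrow> ('a, 'k) univ set \<Rightarrow> ('a, 'k) univ
    \<Rightarrow> (('a, 'k) univ \<Rightarrow> ('a, 'k) univ \<Rightarrow> 'k) \<Rightarrow> 'k"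
  where "sw_form V W t f =
    (SOME L. Vector_Spaces.linear scal times L \<and> (\<forall>v\<in>V. \<forall>w\<in>W. L (v \<otimes>\<^sub>k w) = f v w)) t"

subsection \<open>Adequacy of the model\<close>

lemma lookup_tens_Pair: "Poly_Mapping.lookup (x \<otimes>\<^sub>k y) (PairIx i j) = Poly_Mapping.lookup x i * Poly_Mapping.lookup y j"
proof -
  have "Poly_Mapping.lookup (x \<otimes>\<^sub>k y) (PairIx i j) =
      (\<Sum>i'\<in>Poly_Mapping.keys x. \<Sum>j'\<in>Poly_Mapping.keys y. if i' = i then (if j' = j then Poly_Mapping.lookup x i * Poly_Mapping.lookup y j else 0) else 0)"
    unfolding tens_def lookup_sum
    by (intro sum.cong refl) (auto simp: lookup_single when_def)
  also have "\<dots> = (\<Sum>i'\<in>Poly_Mapping.keys x. if i' = i then (\<Sum>j'\<in>Poly_Mapping.keys y. if j' = j then Poly_Mapping.lookup x i * Poly_Mapping.lookup y j else 0) else 0)"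
    by (intro sum.cong refl) auto
  also have "\<dots> = Poly_Mapping.lookup x i * Poly_Mapping.lookup y j"
    by (auto simp: in_keys_iff)
  finally show ?thesis .
qed

lemma lookup_tens_other:
  "Poly_Mapping.lookup (x \<otimes>\<^sub>k y) (GenIx a) = 0" "Poly_Mapping.lookup (x \<otimes>\<^sub>k y) UnitIx = 0"
  by (simp_all add: tens_def lookup_sum lookup_single)

lemma tens_linear:
  "(x + y) \<otimes>\<^sub>k z = x \<otimes>\<^sub>k z + y \<otimes>\<^sub>k z" "z \<otimes>\<^sub>k (x + y) = z \<otimes>\<^sub>k x + z \<otimes>\<^sub>k y"
  "(c *\<^sub>k x) \<otimes>\<^sub>k z = c *\<^sub>k (x \<otimes>\<^sub>k z)" "z \<otimes>\<^sub>k (c *\<^sub>k x) = c *\<^sub>k (z \<otimes>\<^sub>k x)"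
proof -
  have "Poly_Mapping.lookup ((x + y) \<otimes>\<^sub>k z) i = Poly_Mapping.lookup (x \<otimes>\<^sub>k z + y \<otimes>\<^sub>k z) i"
    "Poly_Mapping.lookup (z \<otimes>\<^sub>k (x + y)) i = Poly_Mapping.lookup (z \<otimes>\<^sub>k x + z \<otimes>\<^sub>k y) i"
    "Poly_Mapping.lookup ((c *\<^sub>k x) \<otimes>\<^sub>k z) i = Poly_Mapping.lookup (c *\<^sub>k (x \<otimes>\<^sub>k z)) i"
    "Poly_Mapping.lookup (z \<otimes>\<^sub>k (c *\<^sub>k x)) i = Poly_Mapping.lookup (c *\<^sub>k (z \<otimes>\<^sub>k x)) i" for i
    by (cases i; simp add: lookup_tens_Pair lookup_tens_other lookup_add algebra_simps)+
  then show "(x + y) \<otimes>\<^sub>k z = x \<otimes>\<^sub>k z + y \<otimes>\<^sub>k z" "z \<otimes>\<^sub>k (x + y) = z \<otimes>\<^sub>k x + z \<otimes>\<^sub>k y"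
    "(c *\<^sub>k x) \<otimes>\<^sub>k z = c *\<^sub>k (x \<otimes>\<^sub>k z)" "z \<otimes>\<^sub>k (c *\<^sub>k x) = c *\<^sub>k (z \<otimes>\<^sub>k x)"
    by (blast intro: poly_mapping_eqI)+
qed

lemma tens_bilinear: "bilinear_on V W (V \<otimes>\<^sub>V W) (\<otimes>\<^sub>k)"
  by (auto simp: bilinear_on_def linear_on_def tens_linear tensor_space_def intro!: univ.span_base)

lemma tens_ext:
  fixes L :: "('a, 'k::field) univ \<Rightarrow> 'b::ab_group_add"
  assumes "Vector_Spaces.linear scal s L" "Vector_Spaces.linear scal s L'"
    and "\<And>v w. v \<in> V \<Longrightarrow> w \<in> W \<Longrightarrow> L (v \<otimes>\<^sub>k w) = L' (v \<otimes>\<^sub>k w)" and "t \<in> V \<otimes>\<^sub>V W"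
  shows "L t = L' t"
proof -
  interpret vector_space_pair "scal :: 'k \<Rightarrow> ('a, 'k) univ \<Rightarrow> _" s
    using assms(1) unfolding Vector_Spaces.linear_def vector_space_pair_def by simp
  show ?thesis
    using linear_eq_on[OF assms(1,2) assms(4)[unfolded tensor_space_def]] assms(3) by blast
qed

lemma subspace_retract:
  assumes "univ.subspace V"
  shows "\<exists>p. Vector_Spaces.linear scal scal p \<and> (\<forall>x. p x \<in> V) \<and> (\<forall>x\<in>V. p x = x)"
proof -
  interpret vector_space_pair "scal :: 'a \<Rightarrow> ('b, 'a) univ \<Rightarrow> _" scal ..
  show ?thesis
    using linear_exists_left_inverse_on[OF univ.linear_ident assms inj_on_id2] by auto
qed

lemma tensor_universal_gen:
  fixes s :: "'k::field \<Rightarrow> 'b::ab_group_add \<Rightarrow> 'b" and f :: "('a, 'k) univ \<Rightarrow> ('a, 'k) univ \<Rightarrow> 'b"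
  assumes "vector_space s" "univ.subspace V" "univ.subspace W"
    and add1: "\<And>v v' w. v \<in> V \<Longrightarrow> v' \<in> V \<Longrightarrow> w \<in> W \<Longrightarrow> f (v + v') w = f v w + f v' w"
    and add2: "\<And>v w w'. v \<in> V \<Longrightarrow> w \<in> W \<Longrightarrow> w' \<in> W \<Longrightarrow> f v (w + w') = f v w + f v w'"
    and scal1: "\<And>c v w. v \<in> V \<Longrightarrow> w \<in> W \<Longrightarrow> f (c *\<^sub>k v) w = s c (f v w)"
    and scal2: "\<And>c v w. v \<in> V \<Longrightarrow> w \<in> W \<Longrightarrow> f v (c *\<^sub>k w) = s c (f v w)"
  shows "\<exists>L. Vector_Spaces.linear scal s L \<and> (\<forall>v\<in>V. \<forall>w\<in>W. L (v \<otimes>\<^sub>k w) = f v w)"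
proof -
  interpret s: vector_space s by fact
  interpret vector_space_pair "scal :: 'k \<Rightarrow> ('a, 'k) univ \<Rightarrow> _" s ..
  obtain p where p: "Vector_Spaces.linear scal scal p" "\<And>x. p x \<in> V" "\<And>x. x \<in> V \<Longrightarrow> p x = x"
    using subspace_retract[OF assms(2)] by blast
  obtain q where q: "Vector_Spaces.linear scal scal q" "\<And>x. q x \<in> W" "\<And>x. x \<in> W \<Longrightarrow> q x = x"
    using subspace_retract[OF assms(3)] by blast
  interpret p: Vector_Spaces.linear scal scal p by fact
  interpret q: Vector_Spaces.linear scal scal q by fact
  define e where "e i = (Poly_Mapping.single i 1 :: ('a, 'k) univ)" for i
  define g where "g k = (case k of PairIx i j \<Rightarrow> f (p (e i)) (q (e j)) | _ \<Rightarrow> 0)" for k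
  define L where "L t = (\<Sum>k\<in>Poly_Mapping.keys t. s (Poly_Mapping.lookup t k) (g k))" for t
  have L_sup: "L t = (\<Sum>k\<in>A. s (Poly_Mapping.lookup t k) (g k))" if "finite A" "Poly_Mapping.keys t \<subseteq> A" for t A
    unfolding L_def using that by (intro sum.mono_neutral_left) (auto simp: in_keys_iff)
  have L_lin: "Vector_Spaces.linear scal s L"
  proof (unfold_locales)
    fix x y :: "('a, 'k) univ" and c :: 'k
    show "L (x + y) = L x + L y"
      using L_sup[of "Poly_Mapping.keys x \<union> Poly_Mapping.keys y" x] L_sup[of "Poly_Mapping.keys x \<union> Poly_Mapping.keys y" y]
        L_sup[of "Poly_Mapping.keys x \<union> Poly_Mapping.keys y" "x + y"] Poly_Mapping.keys_add[of x y]
      by (simp add: lookup_add s.scale_left_distrib sum.distrib)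
    show "L (c *\<^sub>k x) = s c (L x)"
      using L_sup[of "Poly_Mapping.keys x" "c *\<^sub>k x"] L_sup[of "Poly_Mapping.keys x" x]
      by (simp add: s.scale_sum_right subset_iff in_keys_iff)
  qed
  interpret L: Vector_Spaces.linear scal s L by (fact L_lin)
  have T: "Vector_Spaces.linear scal scal (\<lambda>v. v \<otimes>\<^sub>k w)" "Vector_Spaces.linear scal scal (\<lambda>v. w \<otimes>\<^sub>k v)"
    for w :: "('a, 'k) univ"
    by (unfold_locales; rule tens_linear)+
  have F1: "Vector_Spaces.linear scal s (\<lambda>v. f (p v) (q w))" for w
    by unfold_locales (simp_all add: p.add p.scale add1 scal1 p(2) q(2))
  have F2: "Vector_Spaces.linear scal s (\<lambda>v. f (p w) (q v))" for w
    by unfold_locales (simp_all add: q.add q.scale add2 scal2 p(2) q(2))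
  have basis: "x \<in> univ.span (range e)" for x
  proof -
    have "x = (\<Sum>i\<in>Poly_Mapping.keys x. Poly_Mapping.lookup x i *\<^sub>k e i)"
      by (rule poly_mapping_eqI)
        (auto simp: lookup_sum e_def lookup_single when_def in_keys_iff if_distrib cong: if_cong)
    moreover have "\<dots> \<in> univ.span (range e)"
      by (intro univ.span_sum univ.span_scale univ.span_base) auto
    ultimately show ?thesis by simp
  qed
  have ee: "e i \<otimes>\<^sub>k e j = e (PairIx i j)" for i j
    by (simp add: tens_def e_def)
  have 1: "L (e i \<otimes>\<^sub>k e j) = f (p (e i)) (q (e j))" for i j
    by (simp add: ee L_def) (simp add: e_def g_def)
  have 2: "L (v \<otimes>\<^sub>k e j) = f (p v) (q (e j))" for v j
  proof (rule linear_eq_on[OF _ F1 basis])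
    show "Vector_Spaces.linear scal s (\<lambda>v. L (v \<otimes>\<^sub>k e j))"
      using Vector_Spaces.linear_compose[OF T(1) L_lin] by (simp only: o_def)
  qed (auto simp: 1)
  have 3: "L (v \<otimes>\<^sub>k w) = f (p v) (q w)" for v w
  proof (rule linear_eq_on[OF _ F2 basis])
    show "Vector_Spaces.linear scal s (\<lambda>w. L (v \<otimes>\<^sub>k w))"
      using Vector_Spaces.linear_compose[OF T(2) L_lin] by (simp only: o_def)
  qed (auto simp: 2)
  show ?thesis
    using L_lin 3 p(3) q(3) by auto
qed

lemma tensor_universal:
  assumes "univ.subspace V" "univ.subspace W" "bilinear_on V W X f"
  shows "\<exists>L. Vector_Spaces.linear scal scal L \<and> (\<forall>v\<in>V. \<forall>w\<in>W. L (v \<otimes>\<^sub>k w) = f v w)"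
  using assms(3) unfolding bilinear_on_def linear_on_def
  by (intro tensor_universal_gen[OF univ.vector_space_axioms assms(1,2)]) blast+

lemma sw_tens:
  assumes "univ.subspace V" "univ.subspace W" "bilinear_on V W X f"
  shows "Vector_Spaces.linear scal scal (\<lambda>t. sw V W t f)"
    and "\<And>v w. v \<in> V \<Longrightarrow> w \<in> W \<Longrightarrow> sw V W (v \<otimes>\<^sub>k w) f = f v w"
  using someI_ex[OF tensor_universal[OF assms]] unfolding sw_def by auto

lemma sw_form_tens:
  assumes "univ.subspace V" "univ.subspace W" "bilinear_form_on V W f"
  shows "Vector_Spaces.linear scal times (\<lambda>t. sw_form V W t f)"
    and "\<And>v w. v \<in> V \<Longrightarrow> w \<in> W \<Longrightarrow> sw_form V W (v \<otimes>\<^sub>k w) f = f v w"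
proof -
  have "vector_space (times :: 'a \<Rightarrow> 'a \<Rightarrow> 'a)"
    by unfold_locales (auto simp: algebra_simps)
  from tensor_universal_gen[OF this assms(1,2), of f] assms(3)
  have "\<exists>L. Vector_Spaces.linear scal times L \<and> (\<forall>v\<in>V. \<forall>w\<in>W. L (v \<otimes>\<^sub>k w) = f v w)"
    unfolding bilinear_form_on_def linear_form_on_def by blast
  from someI_ex[OF this]
  show "Vector_Spaces.linear scal times (\<lambda>t. sw_form V W t f)"
    and "\<And>v w. v \<in> V \<Longrightarrow> w \<in> W \<Longrightarrow> sw_form V W (v \<otimes>\<^sub>k w) f = f v w"
    unfolding sw_form_def by auto
qed

lemma univ_embedding:
  fixes s :: "'k::field \<Rightarrow> 'v::ab_group_add \<Rightarrow> 'v"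
  assumes "vector_space s"
  shows "\<exists>j :: 'v \<Rightarrow> ('v, 'k) univ. Vector_Spaces.linear s scal j \<and> inj j"
proof -
  interpret s: vector_space s by fact
  interpret vector_space_pair s "scal :: 'k \<Rightarrow> ('v, 'k) univ \<Rightarrow> _" ..
  define e where "e b = (Poly_Mapping.single (GenIx b) 1 :: ('v, 'k) univ)" for b
  obtain B where B: "s.independent B" "s.span B = UNIV"
    using s.maximal_independent_subset[of UNIV] by (metis top.extremum_uniqueI)
  obtain j where j: "Vector_Spaces.linear s scal j" "\<And>b. b \<in> B \<Longrightarrow> j b = e b"
    using linear_independent_extend[OF B(1), of e] by blast
  interpret j: Vector_Spaces.linear s scal j by fact
  have "x = 0" if "j x = 0" for x
  proof -
    from B(2) have "x \<in> s.span B" by simp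
    then obtain t r where t: "finite t" "t \<subseteq> B" and x: "x = (\<Sum>a\<in>t. s (r a) a)"
      unfolding s.span_explicit by blast
    have "j x = (\<Sum>a\<in>t. r a *\<^sub>k e a)"
      using t j(2) by (auto simp: x j.sum j.scale intro!: sum.cong)
    then have "Poly_Mapping.lookup (j x) (GenIx b) = r b" if "b \<in> t" for b
      using that t by (simp add: lookup_sum e_def lookup_single when_def if_distrib cong: if_cong)
    with \<open>j x = 0\<close> have "\<And>b. b \<in> t \<Longrightarrow> r b = 0" by simp
    then show ?thesis by (simp add: x)
  qed
  then have "inj j" by (simp add: j.inj_iff_eq_0)
  with j(1) show ?thesis by blast
qed

section \<open>Hopf algebras and Yetter-Drinfeld modules\<close>

record (overloaded) ('a, 'k) bialg_data =
  carr :: "('a, 'k) univ set"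
  mul :: "('a, 'k) univ \<Rightarrow> ('a, 'k) univ \<Rightarrow> ('a, 'k) univ"
  one :: "('a, 'k) univ"
  comul :: "('a, 'k) univ \<Rightarrow> ('a, 'k) univ"
  counit :: "('a, 'k) univ \<Rightarrow> 'k"

text \<open>\<open>sw2 A x (\<lambda>x1 x2. f x1 x2)\<close> and \<open>sw3 A x (\<lambda>x1 x2 x3. f x1 x2 x3)\<close> are \<open>f\<close> applied to the
  tensors \<open>\<Delta>(x)\<close> and \<open>(id \<otimes> \<Delta>)\<Delta>(x)\<close>.\<close>
definition "sw2 A x f = sw (carr A) (carr A) (comul A x) f"
definition "sw3 A x f = sw2 A x (\<lambda>x1 x'. sw2 A x' (\<lambda>x2 x3. f x1 x2 x3))"

definition algebra_on :: "('a, 'k::field, 'z) bialg_data_scheme \<Rightarrow> bool"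
  where "algebra_on A \<longleftrightarrow> univ.subspace (carr A) \<and>
    bilinear_on (carr A) (carr A) (carr A) (mul A) \<and> one A \<in> carr A \<and>
    (\<forall>x\<in>carr A. \<forall>y\<in>carr A. \<forall>z\<in>carr A. mul A (mul A x y) z = mul A x (mul A y z)) \<and>
    (\<forall>x\<in>carr A. mul A (one A) x = x \<and> mul A x (one A) = x)"

definition coalgebra_on :: "('a, 'k::field, 'z) bialg_data_scheme \<Rightarrow> bool"
  where "coalgebra_on C \<longleftrightarrow> univ.subspace (carr C) \<and>
    linear_on (carr C) (carr C \<otimes>\<^sub>V carr C) (comul C) \<and> linear_form_on (carr C) (counit C) \<and>
    (\<forall>x\<in>carr C. sw2 C x (\<lambda>x' x3. sw2 C x' (\<lambda>x1 x2. x1 \<otimes>\<^sub>k x2 \<otimes>\<^sub>k x3)) = sw3 C x (\<lambda>x1 x2 x3. x1 \<otimes>\<^sub>k x2 \<otimes>\<^sub>k x3)) \<and>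
    (\<forall>x\<in>carr C. sw2 C x (\<lambda>x1 x2. counit C x1 *\<^sub>k x2) = x \<and> sw2 C x (\<lambda>x1 x2. counit C x2 *\<^sub>k x1) = x)"

definition is_antipode ::
  "('a, 'k::field, 'z) bialg_data_scheme \<Rightarrow> (('a, 'k) univ \<Rightarrow> ('a, 'k) univ) \<Rightarrow> bool"
  where "is_antipode A S \<longleftrightarrow> linear_on (carr A) (carr A) S \<and> S \<in> extensional (carr A) \<and>
    (\<forall>x\<in>carr A. sw2 A x (\<lambda>x1 x2. mul A (S x1) x2) = counit A x *\<^sub>k one A \<and>
                sw2 A x (\<lambda>x1 x2. mul A x1 (S x2)) = counit A x *\<^sub>k one A)"

definition antipode :: "('a, 'k::field, 'z) bialg_data_scheme \<Rightarrow> ('a, 'k) univ \<Rightarrow> ('a, 'k) univ"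
  where "antipode A = (THE S. is_antipode A S)"

definition bijective_antipode :: "('a, 'k::field, 'z) bialg_data_scheme \<Rightarrow> bool"
  where "bijective_antipode A \<longleftrightarrow> bij_betw (antipode A) (carr A) (carr A)"

definition antipode_inv :: "('a, 'k::field, 'z) bialg_data_scheme \<Rightarrow> ('a, 'k) univ \<Rightarrow> ('a, 'k) univ"
  where "antipode_inv A = the_inv_into (carr A) (antipode A)"

locale hopf_algebra =
  fixes H :: "('a, 'k::field) bialg_data"
  assumes algebra: "algebra_on H"
    and coalgebra: "coalgebra_on H"
    and comul_mul: "\<And>x y. x \<in> carr H \<Longrightarrow> y \<in> carr H \<Longrightarrow> comul H (mul H x y) =
          sw2 H x (\<lambda>x1 x2. sw2 H y (\<lambda>y1 y2. mul H x1 y1 \<otimes>\<^sub>k mul H x2 y2))"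
    and comul_one: "comul H (one H) = one H \<otimes>\<^sub>k one H"
    and counit_mul: "\<And>x y. x \<in> carr H \<Longrightarrow> y \<in> carr H \<Longrightarrow> counit H (mul H x y) = counit H x * counit H y"
    and counit_one: "counit H (one H) = 1"
    and antipode_ex: "\<exists>S. is_antipode H S"

text \<open>
  A vector space with an action and a coaction. For left modules \<open>mact X b x\<close> is \<open>b x\<close>, for right
  modules \<open>mact M m h\<close> is \<open>m h\<close>. Coactions take values in \<open>C \<otimes>\<^sub>V X\<close> for left comodules and
  in \<open>M \<otimes>\<^sub>V C\<close> for right comodules.
\<close>
record (overloaded) ('a, 'k) mod_data =
  msp :: "('a, 'k) univ set"
  mact :: "('a, 'k) univ \<Rightarrow> ('a, 'k) univ \<Rightarrow> ('a, 'k) univ"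
  mcoact :: "('a, 'k) univ \<Rightarrow> ('a, 'k) univ"

definition left_module :: "('a, 'k::field, 'z) bialg_data_scheme \<Rightarrow> ('a, 'k) mod_data \<Rightarrow> bool"
  where "left_module B X \<longleftrightarrow> univ.subspace (msp X) \<and>
    bilinear_on (carr B) (msp X) (msp X) (mact X) \<and>
    (\<forall>a\<in>carr B. \<forall>b\<in>carr B. \<forall>x\<in>msp X. mact X (mul B a b) x = mact X a (mact X b x)) \<and>
    (\<forall>x\<in>msp X. mact X (one B) x = x)"

definition right_module :: "('a, 'k::field, 'z) bialg_data_scheme \<Rightarrow> ('a, 'k) mod_data \<Rightarrow> bool"
  where "right_module B M \<longleftrightarrow> univ.subspace (msp M) \<and>
    bilinear_on (msp M) (carr B) (msp M) (mact M) \<and>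
    (\<forall>m\<in>msp M. \<forall>a\<in>carr B. \<forall>b\<in>carr B. mact M m (mul B a b) = mact M (mact M m a) b) \<and>
    (\<forall>m\<in>msp M. mact M m (one B) = m)"

definition left_comodule :: "('a, 'k::field, 'z) bialg_data_scheme \<Rightarrow> ('a, 'k) mod_data \<Rightarrow> bool"
  where "left_comodule C X \<longleftrightarrow> univ.subspace (msp X) \<and>
    linear_on (msp X) (carr C \<otimes>\<^sub>V msp X) (mcoact X) \<and>
    (\<forall>x\<in>msp X.
      sw (carr C) (msp X) (mcoact X x) (\<lambda>c x0. sw2 C c (\<lambda>c1 c2. c1 \<otimes>\<^sub>k c2 \<otimes>\<^sub>k x0)) =
      sw (carr C) (msp X) (mcoact X x) (\<lambda>c x0. c \<otimes>\<^sub>k mcoact X x0)) \<and>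
    (\<forall>x\<in>msp X. sw (carr C) (msp X) (mcoact X x) (\<lambda>c x0. counit C c *\<^sub>k x0) = x)"

definition right_comodule :: "('a, 'k::field, 'z) bialg_data_scheme \<Rightarrow> ('a, 'k) mod_data \<Rightarrow> bool"
  where "right_comodule C M \<longleftrightarrow> univ.subspace (msp M) \<and>
    linear_on (msp M) (msp M \<otimes>\<^sub>V carr C) (mcoact M) \<and>
    (\<forall>m\<in>msp M.
      sw (msp M) (carr C) (mcoact M m) (\<lambda>m0 c. sw (msp M) (carr C) (mcoact M m0) (\<lambda>m00 c'. m00 \<otimes>\<^sub>k c' \<otimes>\<^sub>k c)) =
      sw (msp M) (carr C) (mcoact M m) (\<lambda>m0 c. m0 \<otimes>\<^sub>k comul C c)) \<and>
    (\<forall>m\<in>msp M. sw (msp M) (carr C) (mcoact M m) (\<lambda>m0 c. counit C c *\<^sub>k m0) = m)"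

text \<open>
  Left modules over \<open>B\<close> and left comodules over \<open>C\<close> which satisfy
  \<open>\<delta>(b x) = p(b\<^sub>1) x\<^sub>-\<^sub>1 p(S(b\<^sub>3)) \<otimes> b\<^sub>2 x\<^sub>0\<close>, where \<open>p\<close> is a map from \<open>B\<close> to \<open>C\<close>. With \<open>B = C = H\<close> and
  \<open>p = id\<close> these are the Yetter-Drinfeld modules over \<open>H\<close>; with \<open>B = R\<^sup>\<or>#H\<close>, \<open>C = H\<close> and \<open>p = \<pi>\<close>
  this is the condition for the target category of the functor.
\<close>
definition left_yd ::
  "('a, 'k::field) bialg_data \<Rightarrow> ('a, 'k) bialg_data \<Rightarrow> (('a, 'k) univ \<Rightarrow> ('a, 'k) univ) \<Rightarrow> ('a, 'k) mod_data \<Rightarrow> bool"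
  where "left_yd B C p X \<longleftrightarrow> left_module B X \<and> left_comodule C X \<and>
    (\<forall>b\<in>carr B. \<forall>x\<in>msp X. mcoact X (mact X b x) =
      sw3 B b (\<lambda>b1 b2 b3. sw (carr C) (msp X) (mcoact X x) (\<lambda>c x0.
        mul C (mul C (p b1) c) (p (antipode B b3)) \<otimes>\<^sub>k mact X b2 x0)))"

definition left_hom ::
  "('a, 'k::field) bialg_data \<Rightarrow> ('a, 'k) bialg_data \<Rightarrow> ('a, 'k) mod_data \<Rightarrow> ('a, 'k) mod_data
    \<Rightarrow> (('a, 'k) univ \<Rightarrow> ('a, 'k) univ) \<Rightarrow> bool"
  where "left_hom B C X Y f \<longleftrightarrow> linear_on (msp X) (msp Y) f \<and>
    (\<forall>b\<in>carr B. \<forall>x\<in>msp X. f (mact X b x) = mact Y b (f x)) \<and>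
    (\<forall>x\<in>msp X. mcoact Y (f x) = sw (carr C) (msp X) (mcoact X x) (\<lambda>c x0. c \<otimes>\<^sub>k f x0))"

definition right_hom ::
  "('a, 'k::field) bialg_data \<Rightarrow> ('a, 'k) bialg_data \<Rightarrow> ('a, 'k) mod_data \<Rightarrow> ('a, 'k) mod_data
    \<Rightarrow> (('a, 'k) univ \<Rightarrow> ('a, 'k) univ) \<Rightarrow> bool"
  where "right_hom B C M N f \<longleftrightarrow> linear_on (msp M) (msp N) f \<and>
    (\<forall>m\<in>msp M. \<forall>b\<in>carr B. f (mact M m b) = mact N (f m) b) \<and>
    (\<forall>m\<in>msp M. mcoact N (f m) = sw (msp M) (carr C) (mcoact M m) (\<lambda>m0 c. f m0 \<otimes>\<^sub>k c))"

text \<open>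
  Equality of objects is relevant for isomorphisms of categories. So actions and coactions of
  objects are taken to be \<^const>\<open>undefined\<close> outside of their domains.
\<close>
definition restrict2 :: "'x set \<Rightarrow> 'y set \<Rightarrow> ('x \<Rightarrow> 'y \<Rightarrow> 'z) \<Rightarrow> 'x \<Rightarrow> 'y \<Rightarrow> 'z"
  where "restrict2 A B f = (\<lambda>x y. if x \<in> A \<and> y \<in> B then f x y else undefined)"

definition left_tensor ::
  "('a, 'k::field) bialg_data \<Rightarrow> ('a, 'k) bialg_data \<Rightarrow> ('a, 'k) mod_data \<Rightarrow> ('a, 'k) mod_data \<Rightarrow> ('a, 'k) mod_data"
  where "left_tensor B C X Y = \<lparr>
    msp = msp X \<otimes>\<^sub>V msp Y,
    mact = restrict2 (carr B) (msp X \<otimes>\<^sub>V msp Y) (\<lambda>b t.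
      sw2 B b (\<lambda>b1 b2. sw (msp X) (msp Y) t (\<lambda>x y. mact X b1 x \<otimes>\<^sub>k mact Y b2 y))),
    mcoact = restrict (\<lambda>t. sw (msp X) (msp Y) t (\<lambda>x y.
      sw (carr C) (msp X) (mcoact X x) (\<lambda>c x0. sw (carr C) (msp Y) (mcoact Y y) (\<lambda>d y0.
        mul C c d \<otimes>\<^sub>k (x0 \<otimes>\<^sub>k y0))))) (msp X \<otimes>\<^sub>V msp Y) \<rparr>"

definition right_tensor ::
  "('a, 'k::field) bialg_data \<Rightarrow> ('a, 'k) bialg_data \<Rightarrow> ('a, 'k) mod_data \<Rightarrow> ('a, 'k) mod_data \<Rightarrow> ('a, 'k) mod_data"
  where "right_tensor B C M N = \<lparr>
    msp = msp M \<otimes>\<^sub>V msp N,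
    mact = restrict2 (msp M \<otimes>\<^sub>V msp N) (carr B) (\<lambda>t b.
      sw2 B b (\<lambda>b1 b2. sw (msp M) (msp N) t (\<lambda>m n. mact M m b1 \<otimes>\<^sub>k mact N n b2))),
    mcoact = restrict (\<lambda>t. sw (msp M) (msp N) t (\<lambda>m n.
      sw (msp M) (carr C) (mcoact M m) (\<lambda>m0 c. sw (msp N) (carr C) (mcoact N n) (\<lambda>n0 d.
        (m0 \<otimes>\<^sub>k n0) \<otimes>\<^sub>k mul C c d)))) (msp M \<otimes>\<^sub>V msp N) \<rparr>"

definition left_unit :: "('a, 'k::field) bialg_data \<Rightarrow> ('a, 'k) bialg_data \<Rightarrow> ('a, 'k) mod_data"
  where "left_unit B C = \<lparr>
    msp = unit_space,
    mact = restrict2 (carr B) unit_space (\<lambda>b x. counit B b *\<^sub>k x),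
    mcoact = restrict (\<lambda>x. one C \<otimes>\<^sub>k x) unit_space \<rparr>"

definition right_unit :: "('a, 'k::field) bialg_data \<Rightarrow> ('a, 'k) bialg_data \<Rightarrow> ('a, 'k) mod_data"
  where "right_unit B C = \<lparr>
    msp = unit_space,
    mact = restrict2 unit_space (carr B) (\<lambda>x b. counit B b *\<^sub>k x),
    mcoact = restrict (\<lambda>x. x \<otimes>\<^sub>k one C) unit_space \<rparr>"

section \<open>Hopf algebras in the category of Yetter-Drinfeld modules, bosonization\<close>

record (overloaded) ('a, 'k) yd_bialg_data = "('a, 'k) bialg_data" +
  hact :: "('a, 'k) univ \<Rightarrow> ('a, 'k) univ \<Rightarrow> ('a, 'k) univ"
  hcoact :: "('a, 'k) univ \<Rightarrow> ('a, 'k) univ"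

definition yd_obj :: "('a, 'k) yd_bialg_data \<Rightarrow> ('a, 'k) mod_data"
  where "yd_obj R = \<lparr> msp = carr R, mact = hact R, mcoact = hcoact R \<rparr>"

definition yd_braiding ::
  "('a, 'k::field) bialg_data \<Rightarrow> ('a, 'k) mod_data \<Rightarrow> ('a, 'k) mod_data \<Rightarrow> ('a, 'k) univ \<Rightarrow> ('a, 'k) univ"
  where "yd_braiding H V W t = sw (msp V) (msp W) t (\<lambda>v w.
    sw (carr H) (msp V) (mcoact V v) (\<lambda>h v0. mact W h w \<otimes>\<^sub>k v0))"

locale yd_hopf_algebra = hopf_algebra H
  for H :: "('a, 'k::field) bialg_data" +
  fixes R :: "('a, 'k) yd_bialg_data"
  assumes yd: "left_yd H H id (yd_obj R)"
    and algebra_R: "algebra_on R"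
    and coalgebra_R: "coalgebra_on R"
    and mul_hom: "left_hom H H (left_tensor H H (yd_obj R) (yd_obj R)) (yd_obj R) (\<lambda>t. sw (carr R) (carr R) t (mul R))"
    and one_hom: "left_hom H H (left_unit H H) (yd_obj R) (\<lambda>c. unit_coeff c *\<^sub>k one R)"
    and comul_hom: "left_hom H H (yd_obj R) (left_tensor H H (yd_obj R) (yd_obj R)) (comul R)"
    and counit_hom: "left_hom H H (yd_obj R) (left_unit H H) (\<lambda>x. counit R x *\<^sub>k unit_vec)"
    and comul_mul_R: "\<And>x y. x \<in> carr R \<Longrightarrow> y \<in> carr R \<Longrightarrow> comul R (mul R x y) =
          sw2 R x (\<lambda>x1 x2. sw2 R y (\<lambda>y1 y2.
            sw (carr R) (carr R) (yd_braiding H (yd_obj R) (yd_obj R) (x2 \<otimes>\<^sub>k y1)) (\<lambda>u v.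
              mul R x1 u \<otimes>\<^sub>k mul R v y2)))"
    and comul_one_R: "comul R (one R) = one R \<otimes>\<^sub>k one R"
    and counit_mul_R: "\<And>x y. x \<in> carr R \<Longrightarrow> y \<in> carr R \<Longrightarrow> counit R (mul R x y) = counit R x * counit R y"
    and counit_one_R: "counit R (one R) = 1"
    and antipode_ex_R: "\<exists>S. is_antipode R S \<and> left_hom H H (yd_obj R) (yd_obj R) S"

definition bosonization ::
  "('a, 'k::field) bialg_data \<Rightarrow> ('a, 'k) yd_bialg_data \<Rightarrow> ('a, 'k) bialg_data"
  where "bosonization H R = \<lparr>
    carr = carr R \<otimes>\<^sub>V carr H,
    mul = (\<lambda>s t. sw (carr R) (carr H) s (\<lambda>r h. sw (carr R) (carr H) t (\<lambda>r' h'.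
      sw2 H h (\<lambda>h1 h2. mul R r (hact R h1 r') \<otimes>\<^sub>k mul H h2 h')))),
    one = one R \<otimes>\<^sub>k one H,
    comul = (\<lambda>t. sw (carr R) (carr H) t (\<lambda>r h. sw2 R r (\<lambda>r1 r2. sw2 H h (\<lambda>h1 h2.
      sw (carr H) (carr R) (hcoact R r2) (\<lambda>g r2'. (r1 \<otimes>\<^sub>k mul H g h1) \<otimes>\<^sub>k (r2' \<otimes>\<^sub>k h2)))))),
    counit = (\<lambda>t. sw_form (carr R) (carr H) t (\<lambda>r h. counit R r * counit H h)) \<rparr>"

definition proj_H ::
  "('a, 'k::field) bialg_data \<Rightarrow> ('a, 'k) yd_bialg_data \<Rightarrow> ('a, 'k) univ \<Rightarrow> ('a, 'k) univ"
  where "proj_H H R t = sw (carr R) (carr H) t (\<lambda>r h. counit R r *\<^sub>k h)"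

definition proj_R ::
  "('a, 'k::field) bialg_data \<Rightarrow> ('a, 'k) yd_bialg_data \<Rightarrow> ('a, 'k) univ \<Rightarrow> ('a, 'k) univ"
  where "proj_R H R t = sw (carr R) (carr H) t (\<lambda>r h. counit H h *\<^sub>k r)"

definition incl_H :: "('a, 'k::field) yd_bialg_data \<Rightarrow> ('a, 'k) univ \<Rightarrow> ('a, 'k) univ"
  where "incl_H R h = one R \<otimes>\<^sub>k h"

definition incl_R :: "('a, 'k::field) bialg_data \<Rightarrow> ('a, 'k) univ \<Rightarrow> ('a, 'k) univ"
  where "incl_R H r = r \<otimes>\<^sub>k one H"

section \<open>Dual pairs\<close>

definition left_perp ::
  "('a, 'k::field) univ set \<Rightarrow> (('a, 'k) univ \<Rightarrow> ('a, 'k) univ \<Rightarrow> 'k) \<Rightarrow> ('a, 'k) univ set \<Rightarrow> ('a, 'k) univ set"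
  where "left_perp Rv form X = {\<xi> \<in> Rv. \<forall>x\<in>X. form \<xi> x = 0}"

definition right_perp ::
  "('a, 'k::field) univ set \<Rightarrow> (('a, 'k) univ \<Rightarrow> ('a, 'k) univ \<Rightarrow> 'k) \<Rightarrow> ('a, 'k) univ set \<Rightarrow> ('a, 'k) univ set"
  where "right_perp R form X' = {x \<in> R. \<forall>\<xi>\<in>X'. form \<xi> x = 0}"

definition fin_subspaces :: "('a, 'k::field) univ set \<Rightarrow> ('a, 'k) univ set set"
  where "fin_subspaces V = {E. univ.subspace E \<and> E \<subseteq> V \<and> fin_dim E}"

text \<open>The translation-invariant topology on \<open>V\<close> in which the set \<open>\<N>\<close> of subspaces of \<open>V\<close> is a
  basis of neighbourhoods of \<open>0\<close>.\<close>
definition linear_topology :: "('a, 'k::field) univ set \<Rightarrow> ('a, 'k) univ set set \<Rightarrow> ('a, 'k) univ topology"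
  where "linear_topology V \<N> = topology (\<lambda>U. U \<subseteq> V \<and> (\<forall>x\<in>U. \<exists>N\<in>\<N>. (\<lambda>y. x + y) ` N \<subseteq> U))"

definition tensor_nbhds ::
  "('a, 'k::field) univ set \<Rightarrow> ('a, 'k) univ set set \<Rightarrow> ('a, 'k) univ set \<Rightarrow> ('a, 'k) univ set set
    \<Rightarrow> ('a, 'k) univ set set"
  where "tensor_nbhds V \<N> W \<M> = {{a + b | a b. a \<in> N \<otimes>\<^sub>V W \<and> b \<in> V \<otimes>\<^sub>V M} | N M. N \<in> \<N> \<and> M \<in> \<M>}"

definition comul_continuous :: "('a, 'k::field) yd_bialg_data \<Rightarrow> ('a, 'k) univ set set \<Rightarrow> bool"
  where "comul_continuous R \<N> \<longleftrightarrow>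
    continuous_map (linear_topology (carr R) \<N>)
      (linear_topology (carr R \<otimes>\<^sub>V carr R) (tensor_nbhds (carr R) \<N> (carr R) \<N>)) (comul R)"

definition yd_subobject :: "('a, 'k::field) bialg_data \<Rightarrow> ('a, 'k) mod_data \<Rightarrow> ('a, 'k) univ set \<Rightarrow> bool"
  where "yd_subobject H V U \<longleftrightarrow> univ.subspace U \<and> U \<subseteq> msp V \<and>
    (\<forall>h\<in>carr H. \<forall>u\<in>U. mact V h u \<in> U) \<and> (\<forall>u\<in>U. mcoact V u \<in> carr H \<otimes>\<^sub>V U)"

definition yd_locally_finite :: "('a, 'k::field) bialg_data \<Rightarrow> ('a, 'k) mod_data \<Rightarrow> bool"
  where "yd_locally_finite H V \<longleftrightarrow>
    (\<forall>E\<in>fin_subspaces (msp V). \<exists>U. yd_subobject H V U \<and> fin_dim U \<and> E \<subseteq> U)"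

locale dual_pair = R: yd_hopf_algebra H R + Rv: yd_hopf_algebra H Rv
  for H :: "('a, 'k::field) bialg_data" and R Rv :: "('a, 'k) yd_bialg_data" +
  fixes form :: "('a, 'k) univ \<Rightarrow> ('a, 'k) univ \<Rightarrow> 'k"
  assumes form_bilinear: "bilinear_form_on (carr Rv) (carr R) form"
    and locally_finite_R: "yd_locally_finite H (yd_obj R)"
    and locally_finite_Rv: "yd_locally_finite H (yd_obj Rv)"
    and nondegenerate_left: "left_perp (carr Rv) form (carr R) = {0}"
    and nondegenerate_right: "right_perp (carr R) form (carr Rv) = {0}"
    and form_act: "\<And>h \<xi> x. h \<in> carr H \<Longrightarrow> \<xi> \<in> carr Rv \<Longrightarrow> x \<in> carr R \<Longrightarrow>
          form (hact Rv h \<xi>) x = form \<xi> (hact R (antipode H h) x)"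
    and form_coact: "\<And>\<xi> x. \<xi> \<in> carr Rv \<Longrightarrow> x \<in> carr R \<Longrightarrow>
          sw (carr H) (carr Rv) (hcoact Rv \<xi>) (\<lambda>g \<xi>0. form \<xi>0 x *\<^sub>k g) =
          sw (carr H) (carr R) (hcoact R x) (\<lambda>g x0. form \<xi> x0 *\<^sub>k antipode_inv H g)"
    and form_mul_R: "\<And>\<xi> x y. \<xi> \<in> carr Rv \<Longrightarrow> x \<in> carr R \<Longrightarrow> y \<in> carr R \<Longrightarrow>
          form \<xi> (mul R x y) = sw_form (carr Rv) (carr Rv) (comul Rv \<xi>) (\<lambda>\<xi>1 \<xi>2. form \<xi>1 y * form \<xi>2 x)"
    and form_one_Rv: "\<And>x. x \<in> carr R \<Longrightarrow> form (one Rv) x = counit R x"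
    and form_mul_Rv: "\<And>\<xi> \<eta> x. \<xi> \<in> carr Rv \<Longrightarrow> \<eta> \<in> carr Rv \<Longrightarrow> x \<in> carr R \<Longrightarrow>
          form (mul Rv \<xi> \<eta>) x = sw_form (carr R) (carr R) (comul R x) (\<lambda>x1 x2. form \<xi> x2 * form \<eta> x1)"
    and form_one_R: "\<And>\<xi>. \<xi> \<in> carr Rv \<Longrightarrow> form \<xi> (one R) = counit Rv \<xi>"
    and comul_continuous_Rv: "comul_continuous Rv (left_perp (carr Rv) form ` fin_subspaces (carr R))"
    and comul_continuous_R: "comul_continuous R (right_perp (carr R) form ` fin_subspaces (carr Rv))"

section \<open>Monoidal categories and functors\<close>

record ('o, 'm) category_data =
  Ob :: "'o set"
  Arr :: "'m set"
  Dom :: "'m \<Rightarrow> 'o"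
  Cod :: "'m \<Rightarrow> 'o"
  Ide :: "'o \<Rightarrow> 'm"
  Comp :: "'m \<Rightarrow> 'm \<Rightarrow> 'm"

definition homs :: "('o, 'm, 'z) category_data_scheme \<Rightarrow> 'o \<Rightarrow> 'o \<Rightarrow> 'm set"
  where "homs C X Y = {f \<in> Arr C. Dom C f = X \<and> Cod C f = Y}"

locale category =
  fixes C :: "('o, 'm, 'z) category_data_scheme"
  assumes dom_ob: "\<And>f. f \<in> Arr C \<Longrightarrow> Dom C f \<in> Ob C"
    and cod_ob: "\<And>f. f \<in> Arr C \<Longrightarrow> Cod C f \<in> Ob C"
    and ide_hom: "\<And>X. X \<in> Ob C \<Longrightarrow> Ide C X \<in> homs C X X"
    and comp_hom: "\<And>f g X Y Z. f \<in> homs C X Y \<Longrightarrow> g \<in> homs C Y Z \<Longrightarrow> Comp C g f \<in> homs C X Z"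
    and comp_assoc: "\<And>f g h W X Y Z. f \<in> homs C W X \<Longrightarrow> g \<in> homs C X Y \<Longrightarrow> h \<in> homs C Y Z \<Longrightarrow>
          Comp C h (Comp C g f) = Comp C (Comp C h g) f"
    and comp_ide: "\<And>f X Y. f \<in> homs C X Y \<Longrightarrow> Comp C f (Ide C X) = f \<and> Comp C (Ide C Y) f = f"

definition isos :: "('o, 'm, 'z) category_data_scheme \<Rightarrow> 'o \<Rightarrow> 'o \<Rightarrow> 'm set"
  where "isos C X Y = {f \<in> homs C X Y. \<exists>g\<in>homs C Y X. Comp C g f = Ide C X \<and> Comp C f g = Ide C Y}"

record ('o, 'm) monoidal_data = "('o, 'm) category_data" +
  TenO :: "'o \<Rightarrow> 'o \<Rightarrow> 'o"
  TenA :: "'m \<Rightarrow> 'm \<Rightarrow> 'm"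
  UnitO :: 'o
  Assoc :: "'o \<Rightarrow> 'o \<Rightarrow> 'o \<Rightarrow> 'm"
  LUnit :: "'o \<Rightarrow> 'm"
  RUnit :: "'o \<Rightarrow> 'm"

locale monoidal_category = category C
  for C :: "('o, 'm, 'z) monoidal_data_scheme" +
  assumes tenO: "\<And>X Y. X \<in> Ob C \<Longrightarrow> Y \<in> Ob C \<Longrightarrow> TenO C X Y \<in> Ob C"
    and tenA: "\<And>f g X X' Y Y'. f \<in> homs C X X' \<Longrightarrow> g \<in> homs C Y Y' \<Longrightarrow>
          TenA C f g \<in> homs C (TenO C X Y) (TenO C X' Y')"
    and ten_ide: "\<And>X Y. X \<in> Ob C \<Longrightarrow> Y \<in> Ob C \<Longrightarrow> TenA C (Ide C X) (Ide C Y) = Ide C (TenO C X Y)"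
    and ten_comp: "\<And>f f' g g' X X' X'' Y Y' Y''.
          f \<in> homs C X X' \<Longrightarrow> f' \<in> homs C X' X'' \<Longrightarrow> g \<in> homs C Y Y' \<Longrightarrow> g' \<in> homs C Y' Y'' \<Longrightarrow>
          TenA C (Comp C f' f) (Comp C g' g) = Comp C (TenA C f' g') (TenA C f g)"
    and unit_ob: "UnitO C \<in> Ob C"
    and assoc_iso: "\<And>X Y Z. X \<in> Ob C \<Longrightarrow> Y \<in> Ob C \<Longrightarrow> Z \<in> Ob C \<Longrightarrow>
          Assoc C X Y Z \<in> isos C (TenO C (TenO C X Y) Z) (TenO C X (TenO C Y Z))"
    and assoc_natural: "\<And>f g h X X' Y Y' Z Z'.
          f \<in> homs C X X' \<Longrightarrow> g \<in> homs C Y Y' \<Longrightarrow> h \<in> homs C Z Z' \<Longrightarrow>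
          Comp C (Assoc C X' Y' Z') (TenA C (TenA C f g) h) = Comp C (TenA C f (TenA C g h)) (Assoc C X Y Z)"
    and lunit_iso: "\<And>X. X \<in> Ob C \<Longrightarrow> LUnit C X \<in> isos C (TenO C (UnitO C) X) X"
    and lunit_natural: "\<And>f X X'. f \<in> homs C X X' \<Longrightarrow>
          Comp C (LUnit C X') (TenA C (Ide C (UnitO C)) f) = Comp C f (LUnit C X)"
    and runit_iso: "\<And>X. X \<in> Ob C \<Longrightarrow> RUnit C X \<in> isos C (TenO C X (UnitO C)) X"
    and runit_natural: "\<And>f X X'. f \<in> homs C X X' \<Longrightarrow>
          Comp C (RUnit C X') (TenA C f (Ide C (UnitO C))) = Comp C f (RUnit C X)"
    and pentagon: "\<And>W X Y Z. W \<in> Ob C \<Longrightarrow> X \<in> Ob C \<Longrightarrow> Y \<in> Ob C \<Longrightarrow> Z \<in> Ob C \<Longrightarrow>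
          Comp C (Assoc C W X (TenO C Y Z)) (Assoc C (TenO C W X) Y Z) =
          Comp C (TenA C (Ide C W) (Assoc C X Y Z))
            (Comp C (Assoc C W (TenO C X Y) Z) (TenA C (Assoc C W X Y) (Ide C Z)))"
    and triangle: "\<And>X Y. X \<in> Ob C \<Longrightarrow> Y \<in> Ob C \<Longrightarrow>
          Comp C (TenA C (Ide C X) (LUnit C Y)) (Assoc C X (UnitO C) Y) = TenA C (RUnit C X) (Ide C Y)"

locale cat_functor = C: category C + D: category D
  for C :: "('o, 'm, 'z) category_data_scheme" and D :: "('p, 'n, 'y) category_data_scheme" +
  fixes Fo :: "'o \<Rightarrow> 'p" and Fa :: "'m \<Rightarrow> 'n"
  assumes ob: "\<And>X. X \<in> Ob C \<Longrightarrow> Fo X \<in> Ob D"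
    and hom: "\<And>f X Y. f \<in> homs C X Y \<Longrightarrow> Fa f \<in> homs D (Fo X) (Fo Y)"
    and ide: "\<And>X. X \<in> Ob C \<Longrightarrow> Fa (Ide C X) = Ide D (Fo X)"
    and comp: "\<And>f g X Y Z. f \<in> homs C X Y \<Longrightarrow> g \<in> homs C Y Z \<Longrightarrow> Fa (Comp C g f) = Comp D (Fa g) (Fa f)"

definition isomorphism_of_categories ::
  "('o, 'm, 'z) category_data_scheme \<Rightarrow> ('p, 'n, 'y) category_data_scheme \<Rightarrow> ('o \<Rightarrow> 'p) \<Rightarrow> ('m \<Rightarrow> 'n) \<Rightarrow> bool"
  where "isomorphism_of_categories C D Fo Fa \<longleftrightarrow> cat_functor C D Fo Fa \<and>
    (\<exists>Go Ga. cat_functor D C Go Ga \<and>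
      (\<forall>X\<in>Ob C. Go (Fo X) = X) \<and> (\<forall>f\<in>Arr C. Ga (Fa f) = f) \<and>
      (\<forall>Y\<in>Ob D. Fo (Go Y) = Y) \<and> (\<forall>g\<in>Arr D. Fa (Ga g) = g))"

locale monoidal_functor = C: monoidal_category C + D: monoidal_category D + cat_functor C D Fo Fa
  for C :: "('o, 'm, 'z) monoidal_data_scheme" and D :: "('p, 'n, 'y) monoidal_data_scheme"
    and Fo :: "'o \<Rightarrow> 'p" and Fa :: "'m \<Rightarrow> 'n" +
  fixes \<phi> :: "'o \<Rightarrow> 'o \<Rightarrow> 'n"
  assumes unit_preserved: "Fo (UnitO C) = UnitO D"
    and phi_iso: "\<And>X Y. X \<in> Ob C \<Longrightarrow> Y \<in> Ob C \<Longrightarrow> \<phi> X Y \<in> isos D (TenO D (Fo X) (Fo Y)) (Fo (TenO C X Y))"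
    and phi_natural: "\<And>f g X X' Y Y'. f \<in> homs C X X' \<Longrightarrow> g \<in> homs C Y Y' \<Longrightarrow>
          Comp D (\<phi> X' Y') (TenA D (Fa f) (Fa g)) = Comp D (Fa (TenA C f g)) (\<phi> X Y)"
    and phi_assoc: "\<And>X Y Z. X \<in> Ob C \<Longrightarrow> Y \<in> Ob C \<Longrightarrow> Z \<in> Ob C \<Longrightarrow>
          Comp D (Fa (Assoc C X Y Z)) (Comp D (\<phi> (TenO C X Y) Z) (TenA D (\<phi> X Y) (Ide D (Fo Z)))) =
          Comp D (\<phi> X (TenO C Y Z)) (Comp D (TenA D (Ide D (Fo X)) (\<phi> Y Z)) (Assoc D (Fo X) (Fo Y) (Fo Z)))"
    and phi_lunit: "\<And>X. X \<in> Ob C \<Longrightarrow> Comp D (Fa (LUnit C X)) (\<phi> (UnitO C) X) = LUnit D (Fo X)"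
    and phi_runit: "\<And>X. X \<in> Ob C \<Longrightarrow> Comp D (Fa (RUnit C X)) (\<phi> X (UnitO C)) = RUnit D (Fo X)"

definition monoidal_isomorphism ::
  "('o, 'm, 'z) monoidal_data_scheme \<Rightarrow> ('p, 'n, 'y) monoidal_data_scheme
    \<Rightarrow> ('o \<Rightarrow> 'p) \<Rightarrow> ('m \<Rightarrow> 'n) \<Rightarrow> ('o \<Rightarrow> 'o \<Rightarrow> 'n) \<Rightarrow> bool"
  where "monoidal_isomorphism C D Fo Fa \<phi> \<longleftrightarrow>
    monoidal_functor C D Fo Fa \<phi> \<and> isomorphism_of_categories C D Fo Fa"

section \<open>The two categories\<close>

type_synonym ('a, 'k) mod_arrow =
  "('a, 'k) mod_data \<times> (('a, 'k) univ \<Rightarrow> ('a, 'k) univ) \<times> ('a, 'k) mod_data"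

text \<open>
  The data of a monoidal category of vector spaces with additional structure, with the
  associativity and unit isomorphisms of vector spaces. Its arguments are the set of objects, the
  predicate for morphisms, and the tensor product and unit object. An arrow consists of its domain,
  its underlying map and its codomain.
\<close>
definition concrete_monoidal ::
  "('a, 'k::field) mod_data set
    \<Rightarrow> (('a, 'k) mod_data \<Rightarrow> ('a, 'k) mod_data \<Rightarrow> (('a, 'k) univ \<Rightarrow> ('a, 'k) univ) \<Rightarrow> bool)
    \<Rightarrow> (('a, 'k) mod_data \<Rightarrow> ('a, 'k) mod_data \<Rightarrow> ('a, 'k) mod_data) \<Rightarrow> ('a, 'k) mod_data
    \<Rightarrow> (('a, 'k) mod_data, ('a, 'k) mod_arrow) monoidal_data"
  where "concrete_monoidal Obj is_hom ten un = \<lparr>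
    Ob = Obj,
    Arr = {(X, f, Y). X \<in> Obj \<and> Y \<in> Obj \<and> f \<in> extensional (msp X) \<and> is_hom X Y f},
    Dom = (\<lambda>(X, f, Y). X),
    Cod = (\<lambda>(X, f, Y). Y),
    Ide = (\<lambda>X. (X, restrict (\<lambda>x. x) (msp X), X)),
    Comp = (\<lambda>(Y, g, Z) (X, f, Y'). (X, compose (msp X) g f, Z)),
    TenO = ten,
    TenA = (\<lambda>(X, f, X') (Y, g, Y').
      (ten X Y, restrict (\<lambda>t. sw (msp X) (msp Y) t (\<lambda>x y. f x \<otimes>\<^sub>k g y)) (msp X \<otimes>\<^sub>V msp Y), ten X' Y')),
    UnitO = un,
    Assoc = (\<lambda>X Y Z. (ten (ten X Y) Z,
      restrict (\<lambda>t. sw (msp X \<otimes>\<^sub>V msp Y) (msp Z) t (\<lambda>s z. sw (msp X) (msp Y) s (\<lambda>x y. x \<otimes>\<^sub>k y \<otimes>\<^sub>k z)))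
        ((msp X \<otimes>\<^sub>V msp Y) \<otimes>\<^sub>V msp Z),
      ten X (ten Y Z))),
    LUnit = (\<lambda>X. (ten un X,
      restrict (\<lambda>t. sw unit_space (msp X) t (\<lambda>c x. unit_coeff c *\<^sub>k x)) (unit_space \<otimes>\<^sub>V msp X), X)),
    RUnit = (\<lambda>X. (ten X un,
      restrict (\<lambda>t. sw (msp X) unit_space t (\<lambda>x c. unit_coeff c *\<^sub>k x)) (msp X \<otimes>\<^sub>V unit_space), X)) \<rparr>"

definition YD_right_obs :: "('a, 'k::field) bialg_data \<Rightarrow> ('a, 'k) yd_bialg_data \<Rightarrow> ('a, 'k) mod_data set"
  where "YD_right_obs H R = (let A = bosonization H R in {M.
    right_module H M \<and> right_comodule A M \<and>
    mact M = restrict2 (msp M) (carr H) (mact M) \<and> mcoact M \<in> extensional (msp M) \<and>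
    (\<forall>m\<in>msp M. \<forall>h\<in>carr H. mcoact M (mact M m h) =
      sw3 H h (\<lambda>h1 h2 h3. sw (msp M) (carr A) (mcoact M m) (\<lambda>m0 m1.
        mact M m0 h2 \<otimes>\<^sub>k mul A (mul A (incl_H R (antipode H h1)) m1) (incl_H R h3))))})"

definition YD_right ::
  "('a, 'k::field) bialg_data \<Rightarrow> ('a, 'k) yd_bialg_data
    \<Rightarrow> (('a, 'k) mod_data, ('a, 'k) mod_arrow) monoidal_data"
  where "YD_right H R = (let A = bosonization H R in
    concrete_monoidal (YD_right_obs H R) (right_hom H A) (right_tensor H A) (right_unit H A))"

definition rational ::
  "('a, 'k::field) bialg_data \<Rightarrow> ('a, 'k) yd_bialg_data \<Rightarrow> ('a, 'k) yd_bialg_data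
    \<Rightarrow> (('a, 'k) univ \<Rightarrow> ('a, 'k) univ \<Rightarrow> 'k) \<Rightarrow> ('a, 'k) mod_data \<Rightarrow> bool"
  where "rational H R Rv form X \<longleftrightarrow> (\<forall>x\<in>msp X. \<exists>E\<in>fin_subspaces (carr R).
    \<forall>\<xi>\<in>left_perp (carr Rv) form E. mact X (incl_R H \<xi>) x = 0)"

definition YD_rat_obs ::
  "('a, 'k::field) bialg_data \<Rightarrow> ('a, 'k) yd_bialg_data \<Rightarrow> ('a, 'k) yd_bialg_data
    \<Rightarrow> (('a, 'k) univ \<Rightarrow> ('a, 'k) univ \<Rightarrow> 'k) \<Rightarrow> ('a, 'k) mod_data set"
  where "YD_rat_obs H R Rv form = (let B = bosonization H Rv in {X.
    left_yd B H (proj_H H Rv) X \<and> rational H R Rv form X \<and>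
    mact X = restrict2 (carr B) (msp X) (mact X) \<and> mcoact X \<in> extensional (msp X)})"

definition YD_rat ::
  "('a, 'k::field) bialg_data \<Rightarrow> ('a, 'k) yd_bialg_data \<Rightarrow> ('a, 'k) yd_bialg_data
    \<Rightarrow> (('a, 'k) univ \<Rightarrow> ('a, 'k) univ \<Rightarrow> 'k) \<Rightarrow> (('a, 'k) mod_data, ('a, 'k) mod_arrow) monoidal_data"
  where "YD_rat H R Rv form = (let B = bosonization H Rv in
    concrete_monoidal (YD_rat_obs H R Rv form) (left_hom B H) (left_tensor B H) (left_unit B H))"

section \<open>The functor\<close>

definition F_act_H :: "('a, 'k::field) bialg_data \<Rightarrow> ('a, 'k) mod_data \<Rightarrow> ('a, 'k) univ \<Rightarrow> ('a, 'k) univ \<Rightarrow> ('a, 'k) univ"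
  where "F_act_H H M h m = mact M m (antipode_inv H h)"

definition F_coact ::
  "('a, 'k::field) bialg_data \<Rightarrow> ('a, 'k) yd_bialg_data \<Rightarrow> ('a, 'k) mod_data \<Rightarrow> ('a, 'k) univ \<Rightarrow> ('a, 'k) univ"
  where "F_coact H R M m = (let A = bosonization H R in
    sw (msp M) (carr A) (mcoact M m) (\<lambda>m0 m1. proj_H H R (antipode A m1) \<otimes>\<^sub>k m0))"

definition F_act_Rv ::
  "('a, 'k::field) bialg_data \<Rightarrow> ('a, 'k) yd_bialg_data \<Rightarrow> (('a, 'k) univ \<Rightarrow> ('a, 'k) univ \<Rightarrow> 'k)
    \<Rightarrow> ('a, 'k) mod_data \<Rightarrow> ('a, 'k) univ \<Rightarrow> ('a, 'k) univ \<Rightarrow> ('a, 'k) univ"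
  where "F_act_Rv H R form M \<xi> m = (let A = bosonization H R in
    sw (msp M) (carr A) (mcoact M m) (\<lambda>m0 m1. form \<xi> (proj_R H R (antipode A m1)) *\<^sub>k m0))"

text \<open>Since \<open>\<xi>#h\<close> is the product of \<open>\<xi>\<close> and \<open>h\<close> in \<open>R\<^sup>\<or>#H\<close>, it acts by \<open>m \<mapsto> \<xi>(hm)\<close>.\<close>
definition F_obj ::
  "('a, 'k::field) bialg_data \<Rightarrow> ('a, 'k) yd_bialg_data \<Rightarrow> ('a, 'k) yd_bialg_data
    \<Rightarrow> (('a, 'k) univ \<Rightarrow> ('a, 'k) univ \<Rightarrow> 'k) \<Rightarrow> ('a, 'k) mod_data \<Rightarrow> ('a, 'k) mod_data"
  where "F_obj H R Rv form M = \<lparr>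
    msp = msp M,
    mact = restrict2 (carr (bosonization H Rv)) (msp M) (\<lambda>b m.
      sw (carr Rv) (carr H) b (\<lambda>\<xi> h. F_act_Rv H R form M \<xi> (F_act_H H M h m))),
    mcoact = restrict (F_coact H R M) (msp M) \<rparr>"

definition F_arr ::
  "('a, 'k::field) bialg_data \<Rightarrow> ('a, 'k) yd_bialg_data \<Rightarrow> ('a, 'k) yd_bialg_data
    \<Rightarrow> (('a, 'k) univ \<Rightarrow> ('a, 'k) univ \<Rightarrow> 'k) \<Rightarrow> ('a, 'k) mod_arrow \<Rightarrow> ('a, 'k) mod_arrow"
  where "F_arr H R Rv form = (\<lambda>(M, f, N). (F_obj H R Rv form M, f, F_obj H R Rv form N))"

definition F_phi ::
  "('a, 'k::field) bialg_data \<Rightarrow> ('a, 'k) yd_bialg_data \<Rightarrow> ('a, 'k) yd_bialg_data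
    \<Rightarrow> (('a, 'k) univ \<Rightarrow> ('a, 'k) univ \<Rightarrow> 'k) \<Rightarrow> ('a, 'k) mod_data \<Rightarrow> ('a, 'k) mod_data \<Rightarrow> ('a, 'k) mod_arrow"
  where "F_phi H R Rv form M N = (let A = bosonization H R in
    (left_tensor (bosonization H Rv) H (F_obj H R Rv form M) (F_obj H R Rv form N),
     restrict (\<lambda>t. sw (msp M) (msp N) t (\<lambda>m n. sw (msp N) (carr A) (mcoact N n) (\<lambda>n0 n1.
       mact M m (proj_H H R (antipode_inv A n1)) \<otimes>\<^sub>k n0))) (msp M \<otimes>\<^sub>V msp N),
     F_obj H R Rv form (right_tensor H A M N)))"

end

theory Submission
  imports Defs
begin

text \<open>
  The antipode of \<open>R#H\<close> turns the right coaction of \<open>M\<close> into the left coaction \<open>m \<mapsto> S(m\<^sub>1) \<otimes> m\<^sub>0\<close>,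
  which is determined by its components \<open>\<lambda>(m) = \<pi>S(m\<^sub>1) \<otimes> m\<^sub>0\<close> and \<open>\<rho>(m) = \<theta>S(m\<^sub>1) \<otimes> m\<^sub>0\<close>.
  With the action \<open>hm = m S\<^sup>-\<^sup>1(h)\<close> and the coaction \<open>\<lambda>\<close>, \<open>M\<close> becomes a Yetter-Drinfeld module over \<open>H\<close>
  and \<open>\<rho>\<close> a coaction of \<open>R\<close> in this category; all such comodules arise from a unique \<open>M\<close>. Evaluation of
  \<open>\<rho>\<close> at \<open>\<xi> \<in> R\<^sup>\<or>\<close> gives a rational action of \<open>R\<^sup>\<or>\<close>. Conversely, if \<open>\<xi> \<mapsto> \<xi>x\<close> vanishes on the annihilator of a
  finite-dimensional subspace of \<open>R\<close>, then it is the evaluation of an element \<open>\<rho>(x)\<close> of \<open>R \<otimes> M\<close>, and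
  non-degeneracy shows that \<open>\<rho>(x)\<close> is unique and that \<open>\<rho>\<close> is a coaction. In these terms the natural
  transformation is \<open>m \<otimes> n \<mapsto> S\<^sup>-\<^sup>1(n\<^sub>-\<^sub>1)m \<otimes> n\<^sub>0\<close>, with inverse \<open>m \<otimes> n \<mapsto> n\<^sub>-\<^sub>1m \<otimes> n\<^sub>0\<close>.
\<close>

section \<open>Linear maps and Sweedler sums\<close>

text \<open>Every t in R#H equals \<theta>(t1) # \<pi>(t2), written with \<Delta>(t) = t1 \<otimes>
  t2; at t = S(m1) this recovers the right coaction from its two components by S^{-1}. An inverse
  functor comes for free: F changes neither underlying spaces nor underlying maps, so it suffices
  that F is bijective on objects and that on both sides the morphism condition says the same, namely
  that the map is a morphism of comodules. The natural transformation compensates for the antipode: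
  S reverses products, so the H-coaction of F(M \<otimes> N) multiplies the two components in the
  opposite order to that of F(M) \<otimes> F(N), and S^{-1} exchanges the halves of \<Delta>(h) in
  the action. The obstacle is that \<open>sw\<close> is controlled only for maps that are bilinear
  on given subspaces, so a direct calculation would carry membership conditions through every step.
  Therefore every structure is extended along a linear projection to the whole of
  \<open>univ\<close>, all identities are proved there, and they are read off on the carriers only
  at the end.\<close>

definition lin :: "(('a, 'k::field) univ \<Rightarrow> ('a, 'k) univ) \<Rightarrow> bool"
  where "lin f \<longleftrightarrow> (\<forall>x y. f (x + y) = f x + f y) \<and> (\<forall>c x. f (c *\<^sub>k x) = c *\<^sub>k f x)"

definition linf :: "(('a, 'k::field) univ \<Rightarrow> 'k) \<Rightarrow> bool"
  where "linf f \<longleftrightarrow> (\<forall>x y. f (x + y) = f x + f y) \<and> (\<forall>c x. f (c *\<^sub>k x) = c * f x)"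

definition bil :: "(('a, 'k::field) univ \<Rightarrow> ('a, 'k) univ \<Rightarrow> ('a, 'k) univ) \<Rightarrow> bool"
  where "bil f \<longleftrightarrow> (\<forall>y. lin (\<lambda>x. f x y)) \<and> (\<forall>x. lin (\<lambda>y. f x y))"

lemma bilI: "(\<And>y. lin (\<lambda>x. f x y)) \<Longrightarrow> (\<And>x. lin (\<lambda>y. f x y)) \<Longrightarrow> bil f"
  by (simp add: bil_def)

text \<open>Unlike \<^const>\<open>sw\<close>, this sum is linear in both arguments without any condition, and two such
  sums commute.\<close>
definition swt :: "('a, 'k::field) univ \<Rightarrow> (('a, 'k) univ \<Rightarrow> ('a, 'k) univ \<Rightarrow> ('a, 'k) univ) \<Rightarrow> ('a, 'k) univ"
  where "swt t f = (\<Sum>k\<in>Poly_Mapping.keys t. Poly_Mapping.lookup t k *\<^sub>k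
    (case k of PairIx i j \<Rightarrow> f (Poly_Mapping.single i 1) (Poly_Mapping.single j 1) | _ \<Rightarrow> 0))"

lemma swt_superset:
  assumes "finite A" "Poly_Mapping.keys t \<subseteq> A"
  shows "swt t f = (\<Sum>k\<in>A. Poly_Mapping.lookup t k *\<^sub>k
    (case k of PairIx i j \<Rightarrow> f (Poly_Mapping.single i 1) (Poly_Mapping.single j 1) | _ \<Rightarrow> 0))"
  unfolding swt_def using assms by (intro sum.mono_neutral_left) (auto simp: in_keys_iff)

lemma lin_swt_arg: "lin (\<lambda>t. swt t f)"
proof -
  have "swt (x + y) f = swt x f + swt y f" for x y
    using swt_superset[of "Poly_Mapping.keys x \<union> Poly_Mapping.keys y" x f]
      swt_superset[of "Poly_Mapping.keys x \<union> Poly_Mapping.keys y" y f]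
      swt_superset[of "Poly_Mapping.keys x \<union> Poly_Mapping.keys y" "x + y" f] Poly_Mapping.keys_add[of x y]
    by (simp add: lookup_add univ.scale_left_distrib sum.distrib)
  moreover have "swt (c *\<^sub>k x) f = c *\<^sub>k swt x f" for c x
    using swt_superset[of "Poly_Mapping.keys x" "c *\<^sub>k x" f] swt_superset[of "Poly_Mapping.keys x" x f]
    by (simp add: univ.scale_sum_right subset_iff in_keys_iff)
  ultimately show ?thesis by (simp add: lin_def)
qed

lemma lin_add: "lin f \<Longrightarrow> f (x + y) = f x + f y" and lin_scal: "lin f \<Longrightarrow> f (c *\<^sub>k x) = c *\<^sub>k f x"
  by (auto simp: lin_def)
lemma lin_0: "lin f \<Longrightarrow> f 0 = 0"
  using lin_scal[of f 0 0] by simp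
lemma lin_diff: "lin f \<Longrightarrow> f (x - y) = f x - f y"
  using lin_add[of f "x - y" y] by simp
lemma lin_sum: "lin f \<Longrightarrow> f (sum g A) = (\<Sum>i\<in>A. f (g i))"
  by (induction A rule: infinite_finite_induct) (auto simp: lin_0 lin_add)
lemma lin_comp: "lin f \<Longrightarrow> lin g \<Longrightarrow> lin (\<lambda>x. f (g x))"
  by (simp add: lin_def)
lemma linf_comp: "linf f \<Longrightarrow> lin g \<Longrightarrow> linf (\<lambda>x. f (g x))"
  by (simp add: lin_def linf_def)

lemma swt_0 [simp]: "swt t (\<lambda>a b. 0) = 0"
  by (auto simp: swt_def intro!: sum.neutral split: tree_ix.splits)

lemma lin_iff: "lin f \<longleftrightarrow> Vector_Spaces.linear scal scal f"
  by (auto simp: lin_def Vector_Spaces.linear_def module_hom_def module_hom_axioms_def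
      univ.vector_space_axioms univ.module_axioms)

lemma lin_swt: "lin L \<Longrightarrow> L (swt t f) = swt t (\<lambda>a b. L (f a b))"
  unfolding swt_def by (subst lin_sum, assumption)
    (auto simp: lin_scal lin_0 intro!: sum.cong split: tree_ix.splits)

lemma lin_swt_fun [simp]: "(\<And>a b. lin (\<lambda>x. f x a b)) \<Longrightarrow> lin (\<lambda>x. swt t (f x))"
  unfolding lin_def swt_def
  by (auto simp: sum.distrib[symmetric] univ.scale_right_distrib univ.scale_sum_right mult.commute
    intro!: sum.cong split: tree_ix.splits)

lemma swt_swap: "swt t (\<lambda>a b. swt s (\<lambda>c d. f a b c d)) = swt s (\<lambda>c d. swt t (\<lambda>a b. f a b c d))"
proof -
  have [simp]: "(case k of PairIx i j \<Rightarrow> sum (F i j) A | _ \<Rightarrow> 0) = (\<Sum>x\<in>A. case k of PairIx i j \<Rightarrow> F i j x | _ \<Rightarrow> 0)"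
    for k A and F :: "_ \<Rightarrow> _ \<Rightarrow> _ \<Rightarrow> _"
    by (auto split: tree_ix.splits)
  show ?thesis
    unfolding swt_def
    by (simp add: univ.scale_sum_right) (subst sum.swap, auto intro!: sum.cong split: tree_ix.splits simp: mult.commute)
qed

lemma linf_scal_r [simp]: "linf f \<Longrightarrow> linf (\<lambda>x. c * f x)"
  by (simp add: linf_def algebra_simps)
lemma linf_scal_l [simp]: "linf f \<Longrightarrow> linf (\<lambda>x. f x * c)"
  by (simp add: linf_def algebra_simps)
lemma lin_ident [simp]: "lin (\<lambda>x. x)" by (simp add: lin_def)
lemma lin_scal_r [simp]: "lin f \<Longrightarrow> lin (\<lambda>x. c *\<^sub>k f x)" by (simp add: lin_def univ.scale_right_distrib mult.commute)
lemma lin_scal_l [simp]: "linf f \<Longrightarrow> lin (\<lambda>x. f x *\<^sub>k v)" by (simp add: lin_def linf_def univ.scale_left_distrib)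
lemma lin_tens_l [simp]: "lin f \<Longrightarrow> lin (\<lambda>x. f x \<otimes>\<^sub>k v)" by (simp add: lin_def tens_linear)
lemma lin_tens_r [simp]: "lin f \<Longrightarrow> lin (\<lambda>x. v \<otimes>\<^sub>k f x)" by (simp add: lin_def tens_linear)
lemma lin_swt_t [simp]: "lin g \<Longrightarrow> lin (\<lambda>x. swt (g x) f)" by (rule lin_comp[OF lin_swt_arg])

lemma tens_0 [simp]: "0 \<otimes>\<^sub>k x = 0" "x \<otimes>\<^sub>k 0 = 0"
  by (simp_all add: tens_def)

lemma poly_mapping_basis: "x = (\<Sum>i\<in>Poly_Mapping.keys x. Poly_Mapping.lookup x i *\<^sub>k Poly_Mapping.single i 1)"
  by (rule poly_mapping_eqI)
        (auto simp: lookup_sum lookup_single when_def in_keys_iff if_distrib cong: if_cong)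

lemma lin_ext:
  assumes "lin f" "lin g" "\<And>i. f (Poly_Mapping.single i 1) = g (Poly_Mapping.single i 1)"
  shows "f x = g x"
  by (subst (1 2) poly_mapping_basis) (simp add: lin_sum[OF assms(1)] lin_sum[OF assms(2)] lin_scal[OF assms(1)] lin_scal[OF assms(2)] assms(3))

text \<open>This is where bilinearity enters: \<open>swt\<close> inspects f only on pairs of basis
  vectors. The identity is extended from the basis by linearity, one argument at a time.\<close>

lemma swt_tens [simp]:
  assumes "\<And>y. lin (\<lambda>x. f x y)" "\<And>x. lin (f x)"
  shows "swt (v \<otimes>\<^sub>k w) f = f v w"
proof -
  have "Poly_Mapping.single i 1 \<otimes>\<^sub>k Poly_Mapping.single j 1 = Poly_Mapping.single (PairIx i j) (1::'b)" for i j :: "'a tree_ix"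
    by (simp add: tens_def)
  then have 1: "swt (Poly_Mapping.single i 1 \<otimes>\<^sub>k Poly_Mapping.single j 1) f = f (Poly_Mapping.single i 1) (Poly_Mapping.single j 1)" for i j
    by (simp add: swt_def)
  have 2: "swt (v \<otimes>\<^sub>k Poly_Mapping.single j 1) f = f v (Poly_Mapping.single j 1)" for j
    by (rule lin_ext[of "\<lambda>v. swt (v \<otimes>\<^sub>k Poly_Mapping.single j 1) f"]) (simp_all add: assms 1)
  show ?thesis
    by (rule lin_ext[of "\<lambda>w. swt (v \<otimes>\<^sub>k w) f"]) (simp_all add: assms 2)
qed

lemma swt_swt [simp]: "swt (swt t g) f = swt t (\<lambda>a b. swt (g a b) f)"
  by (rule lin_swt) (rule lin_swt_arg)
lemma swt_scal_arg [simp]: "swt (c *\<^sub>k t) f = c *\<^sub>k swt t f"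
  using lin_scal[OF lin_swt_arg] .
lemma swt_scal_fun [simp]: "swt t (\<lambda>a b. c *\<^sub>k f a b) = c *\<^sub>k swt t f"
  using lin_swt[of "\<lambda>x. c *\<^sub>k x" t f] by simp
text \<open>Moves a constant scalar out of the sum when it stands behind scalars that depend on the
  summation variables.\<close>

lemma swt_scal_fun2 [simp]: "swt t (\<lambda>a b. c' a b *\<^sub>k c *\<^sub>k f a b) = c *\<^sub>k swt t (\<lambda>a b. c' a b *\<^sub>k f a b)"
  "swt t (\<lambda>a b. c'' a b *\<^sub>k c' a b *\<^sub>k c *\<^sub>k f a b) = c *\<^sub>k swt t (\<lambda>a b. c'' a b *\<^sub>k c' a b *\<^sub>k f a b)"
  by (simp_all only: univ.scale_left_commute[of _ c] swt_scal_fun)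
lemma tens_swt [simp]: "swt t f \<otimes>\<^sub>k y = swt t (\<lambda>a b. f a b \<otimes>\<^sub>k y)" "y \<otimes>\<^sub>k swt t f = swt t (\<lambda>a b. y \<otimes>\<^sub>k f a b)"
  by (auto intro: lin_swt[of "\<lambda>x. x \<otimes>\<^sub>k y"] lin_swt[of "\<lambda>x. y \<otimes>\<^sub>k x"])
lemma tens_scal [simp]: "(c *\<^sub>k x) \<otimes>\<^sub>k z = c *\<^sub>k (x \<otimes>\<^sub>k z)" "z \<otimes>\<^sub>k (c *\<^sub>k x) = c *\<^sub>k (z \<otimes>\<^sub>k x)"
  by (rule tens_linear)+

declare univ.scale_scale [simp del]
text \<open>The library orientation is reversed: a product of scalars is split into nested scalings,
  so that the counit rules, whose patterns contain a single factor \<open>e a\<close>, can consume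
  the factors one by one.\<close>

lemma scal_mult [simp]: "(a * b) *\<^sub>k x = a *\<^sub>k b *\<^sub>k x"
  by (simp add: univ.scale_scale)

lemma unit_vec_nonzero [simp]: "(unit_vec :: ('a, 'k::field) univ) \<noteq> 0"
  by (metis lookup_single_eq lookup_zero one_neq_zero unit_vec_def)

lemma linf_unit_coeff: "linf unit_coeff" by (simp add: linf_def unit_coeff_def lookup_add)

lemma scal_unit_vec_iff [simp]: "c *\<^sub>k (unit_vec :: ('a, 'k::field) univ) = c' *\<^sub>k unit_vec \<longleftrightarrow> c = c'"
  by simp

text \<open>Bilinearity packaged as rewrite rules: once instantiated for an operation, sums and
  scalars move out of both its arguments and linearity side conditions are solved by the
  simplifier.\<close>

lemma bil_op:
  assumes "bil m"
  shows "\<And>g c. lin g \<Longrightarrow> lin (\<lambda>x. m (g x) c)" "\<And>g c. lin g \<Longrightarrow> lin (\<lambda>x. m c (g x))"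
    "\<And>t f y. m (swt t f) y = swt t (\<lambda>a b. m (f a b) y)" "\<And>t f y. m y (swt t f) = swt t (\<lambda>a b. m y (f a b))"
    "\<And>c x y. m (c *\<^sub>k x) y = c *\<^sub>k m x y" "\<And>c x y. m y (c *\<^sub>k x) = c *\<^sub>k m y x"
proof -
  have l: "lin (\<lambda>x. m x y)" "lin (m y)" for y using assms by (auto simp: bil_def)
  show "\<And>g c. lin g \<Longrightarrow> lin (\<lambda>x. m (g x) c)" "\<And>g c. lin g \<Longrightarrow> lin (\<lambda>x. m c (g x))"
    "\<And>t f y. m (swt t f) y = swt t (\<lambda>a b. m (f a b) y)" "\<And>t f y. m y (swt t f) = swt t (\<lambda>a b. m y (f a b))"
    "\<And>c x y. m (c *\<^sub>k x) y = c *\<^sub>k m x y" "\<And>c x y. m y (c *\<^sub>k x) = c *\<^sub>k m y x"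
    using lin_comp[OF l(1)] lin_comp[OF l(2)] lin_swt[OF l(1)] lin_swt[OF l(2)] lin_scal[OF l(1)] lin_scal[OF l(2)]
    by blast+
qed

lemma lin_op:
  assumes "lin s"
  shows "\<And>g. lin g \<Longrightarrow> lin (\<lambda>x. s (g x))" "\<And>t f. s (swt t f) = swt t (\<lambda>a b. s (f a b))"
    "\<And>c x. s (c *\<^sub>k x) = c *\<^sub>k s x"
  using assms lin_comp lin_swt lin_scal by blast+

section \<open>Hopf algebras\<close>

text \<open>
  A coalgebra is given by operations on the whole of \<open>('a, 'k) univ\<close> that factor through a
  projection \<open>p\<close> onto it, and likewise for all structures below. In this form the Sweedler
  calculus is unconditional rewriting.
\<close>
locale total_coalgebra =
  fixes p :: "('a, 'k::field) univ \<Rightarrow> ('a, 'k) univ" and d :: "('a, 'k) univ \<Rightarrow> ('a, 'k) univ" and e :: "('a, 'k) univ \<Rightarrow> 'k"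
  assumes lin_p: "lin p" and lin_d: "lin d" and linf_e: "linf e"
    and p_p [simp]: "p (p x) = p x"
    and d_p [simp]: "d (p x) = d x" and e_p [simp]: "e (p x) = e x"
    and coassoc0: "swt (d x) (\<lambda>a b. swt (d a) (\<lambda>a1 a2. a1 \<otimes>\<^sub>k a2 \<otimes>\<^sub>k b)) = swt (d x) (\<lambda>a b. swt (d b) (\<lambda>b1 b2. a \<otimes>\<^sub>k b1 \<otimes>\<^sub>k b2))"
    and counit_l0: "swt (d x) (\<lambda>a b. e a *\<^sub>k b) = p x"
    and counit_r0: "swt (d x) (\<lambda>a b. e b *\<^sub>k a) = p x"
    and d_pp: "swt (d x) (\<lambda>a b. p a \<otimes>\<^sub>k p b) = d x"
begin
lemma swt_d_p: assumes "bil f" shows "swt (d x) (\<lambda>a b. f (p a) (p b)) = swt (d x) f"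
proof -
  have "swt (swt (d x) (\<lambda>a b. p a \<otimes>\<^sub>k p b)) f = swt (d x) f" by (simp only: d_pp)
  then show ?thesis using assms by (simp add: bil_def)
qed
lemmas p_op [simp] = lin_op[OF lin_p]
lemmas lin_d_op [simp] = lin_comp[OF lin_d] lin_op(2,3)[OF lin_d]
lemmas lin_e_op [simp] = linf_comp[OF linf_e]
lemma linf_e' [simp]: "linf e" by (fact linf_e)
text \<open>\<open>swt\<close> has only vector values, so a scalar-valued Sweedler sum is always
  expressed by letting the scalar act on a vector v.\<close>

lemma e_swt [simp]: "e (swt t f) *\<^sub>k v = swt t (\<lambda>a b. e (f a b) *\<^sub>k v)"
  by (rule lin_swt) simp
lemma e_scal [simp]: "e (c *\<^sub>k x) = c * e x" using linf_e by (simp add: linf_def)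

text \<open>Evaluation of \<open>coassoc0\<close> at a trilinear map. As a rewrite rule it brings
  iterated comultiplications into right-nested form, which is the normal form of the calculations
  below.\<close>

lemma coassoc [simp]:
  assumes "\<And>b c. lin (\<lambda>a. f a b c)" "\<And>a c. lin (\<lambda>b. f a b c)" "\<And>a b. lin (f a b)"
  shows "swt (d x) (\<lambda>a b. swt (d a) (\<lambda>a1 a2. f a1 a2 b)) = swt (d x) (\<lambda>a b. swt (d b) (\<lambda>b1 b2. f a b1 b2))"
proof -
  have "swt (swt (d x) (\<lambda>a b. swt (d a) (\<lambda>a1 a2. a1 \<otimes>\<^sub>k a2 \<otimes>\<^sub>k b))) (\<lambda>u v. swt v (f u)) =
    swt (swt (d x) (\<lambda>a b. swt (d b) (\<lambda>b1 b2. a \<otimes>\<^sub>k b1 \<otimes>\<^sub>k b2))) (\<lambda>u v. swt v (f u))"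
    by (simp only: coassoc0)
  then show ?thesis by (simp add: assms)
qed

lemma counit_l [simp]: assumes "lin f" shows "swt (d x) (\<lambda>a b. e a *\<^sub>k f b) = f (p x)"
  using lin_swt[OF assms, of "d x" "\<lambda>a b. e a *\<^sub>k b"] lin_scal[OF assms] by (simp add: counit_l0)
lemma counit_r [simp]: assumes "lin f" shows "swt (d x) (\<lambda>a b. e b *\<^sub>k f a) = f (p x)"
  using lin_swt[OF assms, of "d x" "\<lambda>a b. e b *\<^sub>k a"] lin_scal[OF assms] by (simp add: counit_r0)

text \<open>These rules move the sum of a Sweedler component next to the sum which it depends on.\<close>
lemma d_adj [simp]:
  "swt (d x) (\<lambda>a b. swt (d (s b)) (\<lambda>v w. swt (d a) (f a b v w))) =
   swt (d x) (\<lambda>a b. swt (d a) (\<lambda>a1 a2. swt (d (s b)) (\<lambda>v w. f a b v w a1 a2)))"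
  "swt (d x) (\<lambda>a b. swt (d y) (\<lambda>v w. swt (d b) (f a b v w))) =
   swt (d x) (\<lambda>a b. swt (d b) (\<lambda>a1 a2. swt (d y) (\<lambda>v w. f a b v w a1 a2)))"
  by (rule arg_cong[of _ _ "swt (d x)"], intro ext, rule swt_swap)+

lemma d_adj2 [simp]:
  "swt (d x) (\<lambda>a b. swt (d (s b)) (\<lambda>v w. swt (d (z b v w)) (\<lambda>v' w'. swt (d a) (f a b v w v' w')))) =
   swt (d x) (\<lambda>a b. swt (d a) (\<lambda>a1 a2. swt (d (s b)) (\<lambda>v w. swt (d (z b v w)) (\<lambda>v' w'. f a b v w v' w' a1 a2))))"
  "swt (d x) (\<lambda>a b. swt (d y) (\<lambda>v w. swt (d (z2 v w)) (\<lambda>v' w'. swt (d b) (f a b v w v' w')))) =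
   swt (d x) (\<lambda>a b. swt (d b) (\<lambda>a1 a2. swt (d y) (\<lambda>v w. swt (d (z2 v w)) (\<lambda>v' w'. f a b v w v' w' a1 a2))))"
  by (rule arg_cong[of _ _ "swt (d x)"], intro ext, rule trans, rule arg_cong[of _ _ "swt (d _)"], intro ext, rule swt_swap, rule swt_swap)+

lemma d_adj3 [simp]:
  "swt (d x) (\<lambda>a b. swt (d (s b)) (\<lambda>v w. swt (d (z b v w)) (\<lambda>v' w'. swt (d (q b v w v' w')) (\<lambda>v'' w''. swt (d a) (f a b v w v' w' v'' w''))))) =
   swt (d x) (\<lambda>a b. swt (d a) (\<lambda>a1 a2. swt (d (s b)) (\<lambda>v w. swt (d (z b v w)) (\<lambda>v' w'. swt (d (q b v w v' w')) (\<lambda>v'' w''. f a b v w v' w' v'' w'' a1 a2)))))"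
  "swt (d x) (\<lambda>a b. swt (d y) (\<lambda>v w. swt (d (z2 v w)) (\<lambda>v' w'. swt (d (q2 v w v' w')) (\<lambda>v'' w''. swt (d b) (f a b v w v' w' v'' w''))))) =
   swt (d x) (\<lambda>a b. swt (d b) (\<lambda>a1 a2. swt (d y) (\<lambda>v w. swt (d (z2 v w)) (\<lambda>v' w'. swt (d (q2 v w v' w')) (\<lambda>v'' w''. f a b v w v' w' v'' w'' a1 a2)))))"
  by (rule arg_cong[of _ _ "swt (d x)"], intro ext, rule trans, rule arg_cong[of _ _ "swt (d _)"], intro ext, rule trans, rule arg_cong[of _ _ "swt (d _)"], intro ext, rule swt_swap, rule swt_swap, rule swt_swap)+

end

locale total_algebra =
  fixes p :: "('a, 'k::field) univ \<Rightarrow> ('a, 'k) univ" and m :: "('a, 'k) univ \<Rightarrow> ('a, 'k) univ \<Rightarrow> ('a, 'k) univ" and u :: "('a, 'k) univ"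
  assumes lin_p': "lin p" and bil_m: "bil m" and p_p': "p (p x) = p x"
    and p_m [simp]: "p (m x y) = m x y" and m_p [simp]: "m (p x) y = m x y" "m x (p y) = m x y"
    and p_u [simp]: "p u = u"
    and assoc [simp]: "m (m x y) z = m x (m y z)"
    and m_u [simp]: "m u x = p x" "m x u = p x"
begin
lemmas m_op [simp] = bil_op[OF bil_m]
end

locale total_bialgebra = total_coalgebra p d e + total_algebra p m u
  for p :: "('a, 'k::field) univ \<Rightarrow> ('a, 'k) univ" and m u d e +
  assumes d_m0: "d (m x y) = swt (d x) (\<lambda>x1 x2. swt (d y) (\<lambda>y1 y2. m x1 y1 \<otimes>\<^sub>k m x2 y2))"
    and d_u [simp]: "d u = u \<otimes>\<^sub>k u"
    and e_m [simp]: "e (m x y) = e x * e y" and e_u [simp]: "e u = 1"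
begin
lemmas d_m [simp] = d_m0
end

locale total_hopf = total_bialgebra p m u d e
  for p :: "('a, 'k::field) univ \<Rightarrow> ('a, 'k) univ" and m u d e +
  fixes S :: "('a, 'k) univ \<Rightarrow> ('a, 'k) univ"
  assumes lin_S: "lin S" and p_S [simp]: "p (S x) = S x" and S_p [simp]: "S (p x) = S x"
    and S_l0: "swt (d x) (\<lambda>a b. m (S a) b) = e x *\<^sub>k u"
    and S_r0: "swt (d x) (\<lambda>a b. m a (S b)) = e x *\<^sub>k u"
begin
lemmas S_op [simp] = lin_op[OF lin_S]

lemma S_u [simp]: "S u = u"
  using S_l0[of u] by simp

text \<open>Uniqueness of the convolution inverse of the multiplication map, written out: a factor
  e(x2 y2) is inserted and expanded by the antipode axiom for the product x2 y2, after which S(x1)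
  x2 and then S(y1) y2 collapse.\<close>

lemma S_m [simp]: "S (m x y) = m (S y) (S x)"
proof -
  have "m (S y) (S x) = swt (d x) (\<lambda>x1 x2. swt (d y) (\<lambda>y1 y2. m (m (S y1) (S x1)) (e (m x2 y2) *\<^sub>k u)))"
    by simp
  also have "\<dots> = swt (d x) (\<lambda>x1 x2. swt (d y) (\<lambda>y1 y2. m (m (S y1) (S x1)) (swt (d (m x2 y2)) (\<lambda>a b. m a (S b)))))"
    by (simp only: S_r0)
  also have "\<dots> = swt (d x) (\<lambda>x1 x2. swt (d y) (\<lambda>y1 y2. m (S y1) (m (swt (d x1) (\<lambda>a b. m (S a) b)) (swt (d y2) (\<lambda>a b. m a (S (m x2 b)))))))"
    by simp
  also have "\<dots> = swt (d y) (\<lambda>y1 y2. swt (d y2) (\<lambda>a b. m (S y1) (m a (S (m x b)))))"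
    by (simp add: S_l0)
  also have "\<dots> = swt (d y) (\<lambda>y1 y2. m (swt (d y1) (\<lambda>a b. m (S a) b)) (S (m x y2)))"
    by simp
  also have "\<dots> = S (m x y)"
    by (simp add: S_l0)
  finally show ?thesis by simp
qed

text \<open>Dual to the previous lemma: the coproduct of x3 S(x4), a disguised unit, is inserted
  next to S(x2) \<otimes> S(x1). Its first leg cancels S(x2), and after that its second leg cancels
  S(x1), leaving \<Delta>(S(x)).\<close>

lemma d_S [simp]: "d (S x) = swt (d x) (\<lambda>a b. S b \<otimes>\<^sub>k S a)"
proof -
  have "swt (d x) (\<lambda>a b. S b \<otimes>\<^sub>k S a) = swt (d x) (\<lambda>x1 y. swt (d y) (\<lambda>x2 x3.
      swt (d (swt (d x3) (\<lambda>a b. m a (S b)))) (\<lambda>v w. m (S x2) v \<otimes>\<^sub>k m (S x1) w)))"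
    by (simp add: S_r0)
  also have "\<dots> = swt (d x) (\<lambda>x1 y. swt (d y) (\<lambda>z y'. swt (d y') (\<lambda>x4 x5. swt (d (S x5)) (\<lambda>v w.
      m (swt (d z) (\<lambda>a b. m (S a) b)) v \<otimes>\<^sub>k m (S x1) (m x4 w)))))"
    by simp
  also have "\<dots> = swt (d x) (\<lambda>x1 y. swt (d y) (\<lambda>x4 x5. swt (d (S x5)) (\<lambda>v w.
      p v \<otimes>\<^sub>k m (S x1) (m x4 w))))"
    by (simp add: S_l0)
  also have "\<dots> = swt (d x) (\<lambda>y x5. swt (d (S x5)) (\<lambda>v w. p v \<otimes>\<^sub>k m (swt (d y) (\<lambda>a b. m (S a) b)) w))"
    by simp
  also have "\<dots> = swt (d (S x)) (\<lambda>v w. p v \<otimes>\<^sub>k p w)"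
    by (simp add: S_l0)
  finally show ?thesis by (simp add: d_pp)
qed

lemma e_S [simp]: "e (S x) = e x"
proof -
  have "e (S x) *\<^sub>k unit_vec = swt (d x) (\<lambda>a b. e (m (S a) b) *\<^sub>k unit_vec)"
    using counit_r[of "\<lambda>a. e (S a) *\<^sub>k unit_vec"] by (simp add: univ.scale_left_commute)
  also have "\<dots> = e (swt (d x) (\<lambda>a b. m (S a) b)) *\<^sub>k unit_vec"
    by (simp del: e_m)
  also have "\<dots> = e x *\<^sub>k unit_vec"
    by (simp add: S_l0)
  finally show ?thesis by simp
qed
end

locale total_hopf_bij = total_hopf p m u d e S
  for p :: "('a, 'k::field) univ \<Rightarrow> ('a, 'k) univ" and m u d e S +
  fixes Si :: "('a, 'k) univ \<Rightarrow> ('a, 'k) univ"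
  assumes lin_Si: "lin Si" and p_Si [simp]: "p (Si x) = Si x" and Si_p [simp]: "Si (p x) = Si x"
    and S_Si [simp]: "S (Si x) = p x" and Si_S [simp]: "Si (S x) = p x"
begin
lemmas Si_op [simp] = lin_op[OF lin_Si]
lemma Si_u [simp]: "Si u = u" using Si_S[of u] by simp
lemma e_Si [simp]: "e (Si x) = e x" using e_S[of "Si x"] by simp
lemma Si_m [simp]: "Si (m x y) = m (Si y) (Si x)"
proof -
  have "Si (S (m (Si y) (Si x))) = m (Si y) (Si x)" by (simp del: S_m)
  then show ?thesis by simp
qed
text \<open>The inverse antipode is an antipode for the opposite multiplication, which explains the
  exchanged order of the two Sweedler components.\<close>

lemma Si_l0: "swt (d x) (\<lambda>a b. m (Si b) a) = e x *\<^sub>k u"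
proof -
  have "swt (d x) (\<lambda>a b. m (Si b) a) = Si (swt (d x) (\<lambda>a b. m (S a) b))" by simp
  then show ?thesis by (simp only: S_l0) simp
qed
lemma Si_r0: "swt (d x) (\<lambda>a b. m b (Si a)) = e x *\<^sub>k u"
proof -
  have "swt (d x) (\<lambda>a b. m b (Si a)) = Si (swt (d x) (\<lambda>a b. m a (S b)))" by simp
  then show ?thesis by (simp only: S_r0) simp
qed
lemma d_Si [simp]: "d (Si x) = swt (d x) (\<lambda>a b. Si b \<otimes>\<^sub>k Si a)"
proof -
  have "swt (d (Si x)) (\<lambda>a b. p a \<otimes>\<^sub>k p b) = swt (d (S (Si x))) (\<lambda>a b. Si b \<otimes>\<^sub>k Si a)"
    by (simp del: S_Si)
  then show ?thesis by (simp add: d_pp)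
qed
end

section \<open>Yetter-Drinfeld modules and bosonization\<close>

locale total_module = total_hopf_bij p m u d e S Si
  for p :: "('a, 'k::field) univ \<Rightarrow> ('a, 'k) univ" and m u d e S Si +
  fixes q :: "('a, 'k) univ \<Rightarrow> ('a, 'k) univ" and ac :: "('a, 'k) univ \<Rightarrow> ('a, 'k) univ \<Rightarrow> ('a, 'k) univ"
  assumes lin_q: "lin q" and bil_ac: "bil ac" and q_q [simp]: "q (q x) = q x"
    and q_ac [simp]: "q (ac h x) = ac h x" and ac_p [simp]: "ac (p h) x = ac h x" and ac_q [simp]: "ac h (q x) = ac h x"
    and ac_m [simp]: "ac (m g h) x = ac g (ac h x)" and ac_u [simp]: "ac u x = q x"
begin
lemmas q_op [simp] = lin_op[OF lin_q]
lemmas ac_op [simp] = bil_op[OF bil_ac]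
end

locale total_comodule = total_coalgebra p d e
  for p :: "('a, 'k::field) univ \<Rightarrow> ('a, 'k) univ" and d e +
  fixes q :: "('a, 'k) univ \<Rightarrow> ('a, 'k) univ" and co :: "('a, 'k) univ \<Rightarrow> ('a, 'k) univ"
  assumes lin_q': "lin q" and lin_co: "lin co" and q_q': "q (q x) = q x"
    and co_q [simp]: "co (q x) = co x"
    and co_pq: "swt (co x) (\<lambda>g y. p g \<otimes>\<^sub>k q y) = co x"
    and co_co0: "swt (co x) (\<lambda>g y. swt (co y) (\<lambda>g' y'. g \<otimes>\<^sub>k g' \<otimes>\<^sub>k y')) = swt (co x) (\<lambda>g y. swt (d g) (\<lambda>g1 g2. g1 \<otimes>\<^sub>k g2 \<otimes>\<^sub>k y))"
    and co_e0: "swt (co x) (\<lambda>g y. e g *\<^sub>k y) = q x"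
begin
lemmas lin_co_op [simp] = lin_comp[OF lin_co] lin_op(2,3)[OF lin_co]

lemma swt_co_q: assumes "bil f" shows "swt (co x) (\<lambda>g y. f g (q y)) = swt (co x) f"
proof -
  have [simp]: "lin (\<lambda>a. f (g a) c)" "lin (\<lambda>a. f c (g a))" if "lin g" for g c
    using bil_op(1,2)[OF assms that] .
  have "swt (swt (co x) (\<lambda>g y. p g \<otimes>\<^sub>k q y)) (\<lambda>a b. f a (q b)) = swt (swt (co x) (\<lambda>g y. p g \<otimes>\<^sub>k q y)) f"
    by (simp add: q_q' lin_op[OF lin_q'])
  then show ?thesis by (simp only: co_pq)
qed

lemma co_co [simp]:
  assumes "\<And>b c. lin (\<lambda>a. f a b c)" "\<And>a c. lin (\<lambda>b. f a b c)" "\<And>a b. lin (f a b)"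
  shows "swt (co x) (\<lambda>g y. swt (co y) (f g)) = swt (co x) (\<lambda>g y. swt (d g) (\<lambda>g1 g2. f g1 g2 y))"
  using arg_cong[OF co_co0, of "\<lambda>t. swt t (\<lambda>u v. swt v (f u))" x] by (simp add: assms)

lemma co_e [simp]: assumes "lin f" shows "swt (co x) (\<lambda>g y. e g *\<^sub>k f y) = f (q x)"
  using lin_swt[OF assms, of "co x" "\<lambda>a b. e a *\<^sub>k b"] lin_scal[OF assms] by (simp add: co_e0)

lemma d_co [simp]: "swt (d h) (\<lambda>a b. swt (co x) (f a b)) = swt (co x) (\<lambda>g y. swt (d h) (\<lambda>a b. f a b g y))"
  by (rule swt_swap)

text \<open>As for the comultiplication above: a sum over \<open>d g\<close> is moved directly
  behind the coaction that produces g, past comultiplications of other elements, so that the rules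
  for coactions and antipodes find their patterns.\<close>

lemma co_adj [simp]:
  "swt (co x) (\<lambda>g y. swt (d h) (\<lambda>v w. swt (d g) (f g y v w))) =
   swt (co x) (\<lambda>g y. swt (d g) (\<lambda>g1 g2. swt (d h) (\<lambda>v w. f g y v w g1 g2)))"
  by (rule arg_cong[of _ _ "swt (co x)"], intro ext, rule swt_swap)

lemma co_adj2 [simp]:
  "swt (co x) (\<lambda>g y. swt (d h) (\<lambda>v w. swt (d (z v w)) (\<lambda>v' w'. swt (d g) (f g y v w v' w')))) =
   swt (co x) (\<lambda>g y. swt (d g) (\<lambda>g1 g2. swt (d h) (\<lambda>v w. swt (d (z v w)) (\<lambda>v' w'. f g y v w v' w' g1 g2))))"
  by (rule arg_cong[of _ _ "swt (co x)"], intro ext, rule trans, rule arg_cong[of _ _ "swt (d _)"], intro ext, rule swt_swap, rule swt_swap)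

lemma co2_adj [simp]:
  "swt (co x) (\<lambda>g y. swt (co (s y)) (\<lambda>g' y'. swt (d h) (\<lambda>v w. swt (d g) (f g y g' y' v w)))) =
   swt (co x) (\<lambda>g y. swt (co (s y)) (\<lambda>g' y'. swt (d g) (\<lambda>g1 g2. swt (d h) (\<lambda>v w. f g y g' y' v w g1 g2))))"
  by (rule arg_cong[of _ _ "swt (co x)"], intro ext, rule arg_cong[of _ _ "swt (co _)"], intro ext, rule swt_swap)

lemma co2_adj2 [simp]:
  "swt (co x) (\<lambda>g y. swt (co (s y)) (\<lambda>g' y'. swt (d h) (\<lambda>v w. swt (d (z v w)) (\<lambda>v' w'. swt (d g) (f g y g' y' v w v' w'))))) =
   swt (co x) (\<lambda>g y. swt (co (s y)) (\<lambda>g' y'. swt (d g) (\<lambda>g1 g2. swt (d h) (\<lambda>v w. swt (d (z v w)) (\<lambda>v' w'. f g y g' y' v w v' w' g1 g2)))))"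
  by (rule arg_cong[of _ _ "swt (co x)"], intro ext, rule arg_cong[of _ _ "swt (co _)"], intro ext, rule trans, rule arg_cong[of _ _ "swt (d _)"], intro ext, rule swt_swap, rule swt_swap)
end

locale total_yd = total_module p m u d e S Si q ac + total_comodule p d e q co
  for p :: "('a, 'k::field) univ \<Rightarrow> ('a, 'k) univ" and m u d e S Si q ac co +
  assumes co_ac [simp]: "co (ac h x) = swt (co x) (\<lambda>g y. swt (d h) (\<lambda>h1 t. swt (d t) (\<lambda>h2 h3. m h1 (m g (S h3)) \<otimes>\<^sub>k ac h2 y)))"

text \<open>
  The parameters with \<open>R\<close> in their names, \<open>ac\<close> and \<open>co\<close> are the structure of the Hopf algebra \<open>R\<close>
  in Yetter-Drinfeld modules; the others are that of \<open>H\<close>. \<open>SRi\<close> and \<open>Si\<close> are the inverse antipodes.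
\<close>
locale total_yd_hopf = total_hopf_bij p m u d e S Si + R: total_algebra pR mR uR + R: total_coalgebra pR dR eR + total_yd p m u d e S Si pR ac co
  for p :: "('a, 'k::field) univ \<Rightarrow> ('a, 'k) univ" and m u d e S Si pR mR uR dR eR ac co +
  fixes SR SRi :: "('a, 'k) univ \<Rightarrow> ('a, 'k) univ"
  assumes ac_mR [simp]: "ac h (mR x y) = swt (d h) (\<lambda>h1 h2. mR (ac h1 x) (ac h2 y))"
    and ac_uR [simp]: "ac h uR = e h *\<^sub>k uR"
    and co_mR [simp]: "co (mR x y) = swt (co x) (\<lambda>g x0. swt (co y) (\<lambda>g' y0. m g g' \<otimes>\<^sub>k mR x0 y0))"
    and co_uR [simp]: "co uR = u \<otimes>\<^sub>k uR"
    and dR_ac [simp]: "dR (ac h x) = swt (dR x) (\<lambda>x1 x2. swt (d h) (\<lambda>h1 h2. ac h1 x1 \<otimes>\<^sub>k ac h2 x2))"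
    and eR_ac [simp]: "eR (ac h x) = e h * eR x"
    and co_dR0: "swt (co x) (\<lambda>g y. swt (dR y) (\<lambda>y1 y2. g \<otimes>\<^sub>k y1 \<otimes>\<^sub>k y2)) = swt (dR x) (\<lambda>x1 x2. swt (co x1) (\<lambda>g y1. swt (co x2) (\<lambda>g' y2. m g g' \<otimes>\<^sub>k y1 \<otimes>\<^sub>k y2)))"
    and co_eR0: "swt (co x) (\<lambda>g y. eR y *\<^sub>k g) = eR x *\<^sub>k u"
    and dR_mR [simp]: "dR (mR x y) = swt (dR x) (\<lambda>x1 x2. swt (dR y) (\<lambda>y1 y2. swt (co x2) (\<lambda>g x20. mR x1 (ac g y1) \<otimes>\<^sub>k mR x20 y2)))"
    and dR_uR [simp]: "dR uR = uR \<otimes>\<^sub>k uR" and eR_mR [simp]: "eR (mR x y) = eR x * eR y" and eR_uR [simp]: "eR uR = 1"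
    and lin_SR: "lin SR" and pR_SR [simp]: "pR (SR x) = SR x" and SR_pR [simp]: "SR (pR x) = SR x"
    and lin_SRi: "lin SRi" and pR_SRi [simp]: "pR (SRi x) = SRi x" and SRi_pR [simp]: "SRi (pR x) = SRi x"
    and SR_SRi [simp]: "SR (SRi x) = pR x" and SRi_SR [simp]: "SRi (SR x) = pR x"
    and SR_l0: "swt (dR x) (\<lambda>a b. mR (SR a) b) = eR x *\<^sub>k uR"
    and SR_r0: "swt (dR x) (\<lambda>a b. mR a (SR b)) = eR x *\<^sub>k uR"
begin
lemmas SR_op [simp] = lin_op[OF lin_SR]
lemma SR_uR [simp]: "SR uR = uR"
  using SR_l0[of uR] by simp
lemma eR_SR [simp]: "eR (SR x) = eR x"
proof -
  have "eR (SR x) *\<^sub>k (unit_vec :: ('a, 'k) univ) = swt (dR x) (\<lambda>a b. eR (mR (SR a) b) *\<^sub>k unit_vec)"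
    using R.counit_r[of "\<lambda>a. eR (SR a) *\<^sub>k (unit_vec :: ('a, 'k) univ)" x] by (simp add: univ.scale_left_commute)
  also have "\<dots> = eR (swt (dR x) (\<lambda>a b. mR (SR a) b)) *\<^sub>k unit_vec"
    by (simp del: eR_mR)
  also have "\<dots> = eR x *\<^sub>k unit_vec"
    by (simp add: SR_l0)
  finally show ?thesis by simp
qed
lemmas SRi_op [simp] = lin_op[OF lin_SRi]

lemma co_dR [simp]:
  assumes "\<And>b c. lin (\<lambda>a. f a b c)" "\<And>a c. lin (\<lambda>b. f a b c)" "\<And>a b. lin (f a b)"
  shows "swt (co x) (\<lambda>g y. swt (dR y) (f g)) = swt (dR x) (\<lambda>x1 x2. swt (co x1) (\<lambda>g y1. swt (co x2) (\<lambda>g' y2. f (m g g') y1 y2)))"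
  using arg_cong[OF co_dR0, of "\<lambda>t. swt t (\<lambda>u v. swt v (f u))" x] by (simp add: assms)
lemma co_eR [simp]: assumes "lin f" shows "swt (co x) (\<lambda>g y. eR y *\<^sub>k f g) = eR x *\<^sub>k f u"
  using lin_swt[OF assms, of "co x" "\<lambda>g y. eR y *\<^sub>k g"] lin_scal[OF assms] by (simp add: co_eR0)
lemma swaps [simp]:
  "swt (d h) (\<lambda>a b. swt (dR x) (f a b)) = swt (dR x) (\<lambda>g y. swt (d h) (\<lambda>a b. f a b g y))"
  "swt (co h) (\<lambda>a b. swt (dR x) (f a b)) = swt (dR x) (\<lambda>g y. swt (co h) (\<lambda>a b. f a b g y))"
  by (rule swt_swap)+
lemma dR_co_co [simp]:
  "swt (dR x) (\<lambda>a b. swt (co b) (\<lambda>v w. swt (co a) (f a b v w))) =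
   swt (dR x) (\<lambda>a b. swt (co a) (\<lambda>a1 a2. swt (co b) (\<lambda>v w. f a b v w a1 a2)))"
  by (rule arg_cong[of _ _ "swt (dR x)"], intro ext, rule swt_swap)

section \<open>The bosonization as a bialgebra\<close>

definition "pA t = swt t (\<lambda>r h. pR r \<otimes>\<^sub>k p h)"
definition "mA s t = swt s (\<lambda>r h. swt t (\<lambda>r' h'. swt (d h) (\<lambda>h1 h2. mR r (ac h1 r') \<otimes>\<^sub>k m h2 h')))"
definition "uA = uR \<otimes>\<^sub>k u"
definition "dA t = swt t (\<lambda>r h. swt (dR r) (\<lambda>r1 r2. swt (co r2) (\<lambda>g r2'. swt (d h) (\<lambda>h1 h2. (pR r1 \<otimes>\<^sub>k m g h1) \<otimes>\<^sub>k (pR r2' \<otimes>\<^sub>k p h2)))))"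
text \<open>The scalar is read off as the coefficient of \<open>unit_vec\<close>, since
  \<open>swt\<close> produces vectors only.\<close>

definition "eA t = unit_coeff (swt t (\<lambda>r h. eR r *\<^sub>k e h *\<^sub>k unit_vec))"
text \<open>Radford's formula for the antipode of a biproduct, S(r#h) = (1 # S(r_{-1} h)) (S_R(r_0)
  # 1).\<close>

definition "SA t = swt t (\<lambda>r h. swt (co r) (\<lambda>g r0. mA (uR \<otimes>\<^sub>k S (m g h)) (SR r0 \<otimes>\<^sub>k u)))"

lemma eA_scal [simp]: "eA t *\<^sub>k v = swt t (\<lambda>r h. eR r *\<^sub>k e h *\<^sub>k v)"
proof -
  have u: "unit_coeff (c *\<^sub>k unit_vec) = c" for c :: 'k by (simp add: unit_coeff_def unit_vec_def lookup_single)
  have "unit_coeff (swt t f) *\<^sub>k v = swt t (\<lambda>r h. unit_coeff (f r h) *\<^sub>k v)" for f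
    by (rule lin_swt) (simp add: linf_unit_coeff)
  then show ?thesis by (simp add: eA_def) (simp add: scal_mult[symmetric] u del: scal_mult)
qed

lemma bil_mA: "bil mA" by (simp add: mA_def[abs_def] bil_def)
lemma lin_pA: "lin pA" by (simp add: pA_def[abs_def])
lemma lin_dA: "lin dA" by (simp add: dA_def[abs_def])
lemma linf_eA: "linf eA" unfolding eA_def[abs_def] by (rule linf_comp[OF linf_unit_coeff]) simp
lemmas A_lin [simp] = lin_op(1)[OF lin_pA] lin_op(1)[OF lin_dA] bil_op(1,2)[OF bil_mA] linf_comp[OF linf_eA]

text \<open>All operations see their arguments only through \<open>swt\<close>; this reduces
  identities to arguments of the form r \<otimes> h without any membership condition.\<close>

lemma mA_swt_left: "mA x y = swt x (\<lambda>r h. mA (r \<otimes>\<^sub>k h) y)"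
  and mA_swt_right: "mA y x = swt x (\<lambda>r h. mA y (r \<otimes>\<^sub>k h))"
  and dA_swt: "dA x = swt x (\<lambda>r h. dA (r \<otimes>\<^sub>k h))"
  by (simp_all add: mA_def dA_def swt_swap[where s = x])

lemma total_algebra_A: "total_algebra pA mA uA"
proof unfold_locales
  show "lin pA" by (fact lin_pA)
  show "bil mA" by (fact bil_mA)
  fix x y z
  show "pA (pA x) = pA x" by (simp add: pA_def)
  show "pA (mA x y) = mA x y" by (simp add: pA_def mA_def)
  show "mA (pA x) y = mA x y" by (simp add: pA_def mA_def)
  show "mA x (pA y) = mA x y" by (simp add: pA_def mA_def)
  show "pA uA = uA" by (simp add: pA_def uA_def)
  show "mA uA x = pA x" by (simp add: pA_def mA_def uA_def)
  show "mA x uA = pA x" by (simp add: pA_def mA_def uA_def)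
  have "mA (mA (r \<otimes>\<^sub>k h) (r' \<otimes>\<^sub>k h')) (r'' \<otimes>\<^sub>k h'') = mA (r \<otimes>\<^sub>k h) (mA (r' \<otimes>\<^sub>k h') (r'' \<otimes>\<^sub>k h''))" for r h r' h' r'' h''
    by (simp add: mA_def swt_swap[where s = "d h"])
  then show "mA (mA x y) z = mA x (mA y z)"
    by (simp add: bil_op[OF bil_mA] mA_swt_left[where x = x] mA_swt_left[where x = y] mA_swt_right[where x = y] mA_swt_right[where x = z] swt_swap[where s = z])
qed

lemma total_coalgebra_A: "total_coalgebra pA dA eA"
proof unfold_locales
  show "lin pA" by (fact lin_pA)
  show "lin dA" by (fact lin_dA)
  show "linf eA" by (fact linf_eA)
  fix x
  show "pA (pA x) = pA x" by (simp add: pA_def)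
  show "dA (pA x) = dA x" by (simp add: pA_def dA_def)
  show "eA (pA x) = eA x" by (simp add: pA_def eA_def)
  show "swt (dA x) (\<lambda>a b. swt (dA a) (\<lambda>a1 a2. a1 \<otimes>\<^sub>k a2 \<otimes>\<^sub>k b)) = swt (dA x) (\<lambda>a b. swt (dA b) (\<lambda>b1 b2. a \<otimes>\<^sub>k b1 \<otimes>\<^sub>k b2))"
    by (simp add: dA_def)
  show "swt (dA x) (\<lambda>a b. eA a *\<^sub>k b) = pA x"
    by (simp add: dA_def pA_def)
  show "swt (dA x) (\<lambda>a b. eA b *\<^sub>k a) = pA x"
    by (simp add: dA_def pA_def)
  show "swt (dA x) (\<lambda>a b. pA a \<otimes>\<^sub>k pA b) = dA x"
    by (simp add: dA_def pA_def)
qed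

sublocale A: total_algebra pA mA uA by (rule total_algebra_A)
sublocale A: total_coalgebra pA dA eA by (rule total_coalgebra_A)

text \<open>For multiplicativity of the comultiplication, r#h is factored as (r#1)(1#h), and left
  multiplication by each factor is treated separately. For r#1 the braided multiplicativity
  \<open>dR_mR\<close> is what is needed, for 1#h the Yetter-Drinfeld condition.\<close>

lemma total_bialgebra_A: "total_bialgebra pA mA uA dA eA"
proof unfold_locales
  fix x y
  show "dA (mA x y) = swt (dA x) (\<lambda>x1 x2. swt (dA y) (\<lambda>y1 y2. mA x1 y1 \<otimes>\<^sub>k mA x2 y2))"
  proof -
    \<comment> \<open>The multiplication of A \<otimes> A. Its associativity allows the two factors
      to be recombined at the end.\<close>
    define m2 where "m2 s t = swt s (\<lambda>x1 x2. swt t (\<lambda>y1 y2. mA x1 y1 \<otimes>\<^sub>k mA x2 y2))" for s t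
    have m2_assoc: "m2 (m2 s t) w = m2 s (m2 t w)" for s t w
      by (simp add: m2_def swt_swap[where s = w])
    have b: "bil m2" unfolding m2_def by (simp add: bil_def)
    have r: "dA (mA (r \<otimes>\<^sub>k u) (r' \<otimes>\<^sub>k h')) = m2 (dA (r \<otimes>\<^sub>k u)) (dA (r' \<otimes>\<^sub>k h'))" for r r' h'
      by (simp add: dA_def mA_def m2_def)
    have h: "dA (mA (uR \<otimes>\<^sub>k h) (r' \<otimes>\<^sub>k h')) = m2 (dA (uR \<otimes>\<^sub>k h)) (dA (r' \<otimes>\<^sub>k h'))" (is "?l = ?r") for h r' h'
    proof -
      \<comment> \<open>The coaction of h r' contributes an S of a Sweedler component of h directly
        in front of the next component. This pair is isolated as the inner sum over z, which
        \<open>S_l0\<close> removes.\<close>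
      have "?l = swt (dR r') (\<lambda>ga ya. swt (co ya) (\<lambda>gc ya0.
        swt (d h) (\<lambda>h1 t. swt (d t) (\<lambda>h2 t. swt (d t) (\<lambda>h3 t. swt (d t) (\<lambda>z h6. swt (d h') (\<lambda>k1 k2.
         (ac h1 ga \<otimes>\<^sub>k m h2 (m gc (m (swt (d z) (\<lambda>a b. m (S a) b)) k1))) \<otimes>\<^sub>k ac h3 ya0 \<otimes>\<^sub>k m h6 k2)))))))"
        by (simp add: dA_def mA_def)
      also have "\<dots> = ?r"
        by (simp add: S_l0) (simp add: dA_def mA_def m2_def)
      finally show ?thesis .
    qed
    have rh: "dA (r \<otimes>\<^sub>k h) = m2 (dA (r \<otimes>\<^sub>k u)) (dA (uR \<otimes>\<^sub>k h))" for r h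
      by (simp add: dA_def mA_def m2_def)
    have r': "dA (mA (r \<otimes>\<^sub>k u) y) = m2 (dA (r \<otimes>\<^sub>k u)) (dA y)" for r y
      by (simp add: mA_swt_right[where x = y] dA_swt[where x = y] bil_op[OF b] r)
    have h': "dA (mA (uR \<otimes>\<^sub>k h) y) = m2 (dA (uR \<otimes>\<^sub>k h)) (dA y)" for h y
      by (simp add: mA_swt_right[where x = y] dA_swt[where x = y] bil_op[OF b] h)
    have "dA (mA (r \<otimes>\<^sub>k h) y) = m2 (dA (r \<otimes>\<^sub>k h)) (dA y)" for r h
    proof -
      have "mA (r \<otimes>\<^sub>k h) y = mA (r \<otimes>\<^sub>k u) (mA (uR \<otimes>\<^sub>k h) y)"
        by (simp add: mA_def)
      then show ?thesis by (simp only: r' h' rh[of r h] m2_assoc)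
    qed
    then have "dA (mA x y) = m2 (dA x) (dA y)"
      by (simp add: bil_op[OF bil_mA] mA_swt_left[where x = x] dA_swt[where x = x] bil_op[OF b])
    then show ?thesis by (simp add: m2_def)
  qed
  show "dA uA = uA \<otimes>\<^sub>k uA" by (simp add: dA_def uA_def)
  show "eA (mA x y) = eA x * eA y"
  proof -
    have "eA (mA x y) *\<^sub>k unit_vec = (eA x * eA y) *\<^sub>k (unit_vec :: ('a, 'k) univ)"
      by (simp add: mA_def)
    then show ?thesis by (simp only: scal_unit_vec_iff)
  qed
  show "eA uA = 1"
  proof -
    have "eA uA *\<^sub>k unit_vec = 1 *\<^sub>k (unit_vec :: ('a, 'k) univ)" by (simp add: uA_def)
    then show ?thesis by (simp only: scal_unit_vec_iff)
  qed
qed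

sublocale A: total_bialgebra pA mA uA dA eA by (rule total_bialgebra_A)

section \<open>The antipode of the bosonization and its inverse\<close>

lemma mA_RH: "mA (r \<otimes>\<^sub>k u) (r' \<otimes>\<^sub>k h') = mR r r' \<otimes>\<^sub>k p h'"
  and mA_HH: "mA (uR \<otimes>\<^sub>k h) (uR \<otimes>\<^sub>k h') = uR \<otimes>\<^sub>k m h h'"
  and mA_split: "mA (pR r \<otimes>\<^sub>k m g h) z = mA (r \<otimes>\<^sub>k u) (mA (uR \<otimes>\<^sub>k m g h) z)"
  by (simp_all add: mA_def)
lemma mA_HHz: "mA (uR \<otimes>\<^sub>k g) (mA (uR \<otimes>\<^sub>k h) z) = mA (uR \<otimes>\<^sub>k m g h) z"
  by (simp add: mA_HH A.assoc[symmetric] del: A.assoc)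

text \<open>Since the comultiplication of R is colinear, the coaction can be applied to r before r_0
  is comultiplied. Then the antipode axiom of R applies inside the product, and that of H to what
  remains.\<close>

lemma SA_l0: "swt (dA x) (\<lambda>a b. mA (SA a) b) = eA x *\<^sub>k uA"
proof -
  have "swt (dA (r \<otimes>\<^sub>k h)) (\<lambda>a b. mA (SA a) b) = eA (r \<otimes>\<^sub>k h) *\<^sub>k uA" for r h
  proof -
    have "swt (dA (r \<otimes>\<^sub>k h)) (\<lambda>a b. mA (SA a) b) = swt (co r) (\<lambda>g r0. swt (d h) (\<lambda>h1 h2.
        mA (uR \<otimes>\<^sub>k S (m g h1)) (swt (dR r0) (\<lambda>a b. mR (SR a) b) \<otimes>\<^sub>k p h2)))"
      by (simp add: dA_def mA_RH SA_def)
    also have "\<dots> = eR r *\<^sub>k (uR \<otimes>\<^sub>k (swt (d h) (\<lambda>a b. m (S a) b)))"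
      by (simp add: SR_l0) (simp add: mA_def)
    also have "\<dots> = eA (r \<otimes>\<^sub>k h) *\<^sub>k uA"
      by (simp add: S_l0 uA_def)
    finally show ?thesis .
  qed
  then show ?thesis by (simp add: dA_swt[where x = x] del: eA_scal) (simp add: uA_def)
qed

text \<open>Three cancellations from the inside outwards: h1 S(h2), then g1 S(g2) for the coaction
  component g of r2, and finally r1 S_R(r2).\<close>

lemma SA_r0: "swt (dA x) (\<lambda>a b. mA a (SA b)) = eA x *\<^sub>k uA"
proof -
  have "swt (dA (r \<otimes>\<^sub>k h)) (\<lambda>a b. mA a (SA b)) = eA (r \<otimes>\<^sub>k h) *\<^sub>k uA" for r h
  proof -
    have "swt (dA (r \<otimes>\<^sub>k h)) (\<lambda>a b. mA a (SA b)) = swt (dR r) (\<lambda>r1 r2. swt (co r2) (\<lambda>g r20. swt (d g) (\<lambda>g1 g2.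
      mA (r1 \<otimes>\<^sub>k u) (mA (uR \<otimes>\<^sub>k m g1 (m (swt (d h) (\<lambda>a b. m a (S b))) (S g2))) (SR r20 \<otimes>\<^sub>k u)))))"
      by (simp add: dA_def mA_split mA_HHz SA_def)
    also have "\<dots> = e h *\<^sub>k swt (dR r) (\<lambda>r1 r2. swt (co r2) (\<lambda>g r20. swt (d g) (\<lambda>g1 g2.
      mA (r1 \<otimes>\<^sub>k u) (mA (uR \<otimes>\<^sub>k m g1 (S g2)) (SR r20 \<otimes>\<^sub>k u)))))"
      by (simp add: S_r0)
    also have "\<dots> = e h *\<^sub>k swt (dR r) (\<lambda>r1 r2. swt (co r2) (\<lambda>g r20.
      mA (r1 \<otimes>\<^sub>k u) (mA (uR \<otimes>\<^sub>k swt (d g) (\<lambda>g1 g2. m g1 (S g2))) (SR r20 \<otimes>\<^sub>k u))))"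
      by simp
    also have "\<dots> = e h *\<^sub>k (swt (dR r) (\<lambda>r1 r2. mR r1 (SR r2)) \<otimes>\<^sub>k u)"
      by (simp add: S_r0) (simp add: mA_def)
    also have "\<dots> = eA (r \<otimes>\<^sub>k h) *\<^sub>k uA"
      by (simp add: SR_r0 uA_def univ.scale_left_commute)
    finally show ?thesis .
  qed
  then show ?thesis by (simp add: dA_swt[where x = x] del: eA_scal) (simp add: uA_def)
qed

text \<open>The antipode is \<open>r \<otimes> h \<mapsto> S(r\<^sub>-\<^sub>1 h) S\<^sub>R(r\<^sub>0)\<close>, a composition of three bijections.\<close>
definition "tau t = swt t (\<lambda>r h. swt (co r) (\<lambda>g r0. pR r0 \<otimes>\<^sub>k m g h))"
definition "tau' t = swt t (\<lambda>r h. swt (co r) (\<lambda>g r0. pR r0 \<otimes>\<^sub>k m (Si g) h))"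
definition "sig t = swt t (\<lambda>r h. SR r \<otimes>\<^sub>k S h)"
definition "sig' t = swt t (\<lambda>r h. SRi r \<otimes>\<^sub>k Si h)"
definition "mu t = swt t (\<lambda>r h. swt (d h) (\<lambda>h1 h2. ac h1 r \<otimes>\<^sub>k p h2))"
definition "mu' t = swt t (\<lambda>r h. swt (d h) (\<lambda>h1 h2. ac (Si h1) r \<otimes>\<^sub>k p h2))"
definition "SAi t = tau' (sig' (mu' t))"

lemma tau_tau': "tau (tau' t) = pA t"
proof -
  have "tau (tau' t) = swt t (\<lambda>r h. swt (co r) (\<lambda>g r0. pR r0 \<otimes>\<^sub>k m (swt (d g) (\<lambda>a b. m b (Si a))) h))"
    by (simp add: tau_def tau'_def)
  also have "\<dots> = pA t" by (simp add: Si_r0 pA_def)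
  finally show ?thesis .
qed

lemma tau'_tau: "tau' (tau t) = pA t"
proof -
  have "tau' (tau t) = swt t (\<lambda>r h. swt (co r) (\<lambda>g r0. pR r0 \<otimes>\<^sub>k m (swt (d g) (\<lambda>a b. m (Si b) a)) h))"
    by (simp add: tau_def tau'_def)
  also have "\<dots> = pA t" by (simp add: Si_l0 pA_def)
  finally show ?thesis .
qed

lemma mu_mu': "mu (mu' t) = pA t"
proof -
  have "mu (mu' t) = swt t (\<lambda>r h. swt (d h) (\<lambda>h1 h2. ac (swt (d h1) (\<lambda>a b. m b (Si a))) r \<otimes>\<^sub>k p h2))"
    by (simp add: mu_def mu'_def)
  also have "\<dots> = pA t" by (simp add: Si_r0 pA_def)
  finally show ?thesis .
qed

lemma mu'_mu: "mu' (mu t) = pA t"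
proof -
  have "mu' (mu t) = swt t (\<lambda>r h. swt (d h) (\<lambda>h1 h2. ac (swt (d h1) (\<lambda>a b. m (Si b) a)) r \<otimes>\<^sub>k p h2))"
    by (simp add: mu_def mu'_def)
  also have "\<dots> = pA t" by (simp add: Si_l0 pA_def)
  finally show ?thesis .
qed

lemma SA_eq: "SA t = mu (sig (tau t))"
  by (simp add: SA_def mu_def sig_def tau_def mA_def)

lemma abs_pA [simp]: "mu (pA t) = mu t" "sig (pA t) = sig t" "tau (pA t) = tau t" "mu' (pA t) = mu' t" "sig' (pA t) = sig' t" "tau' (pA t) = tau' t"
  "pA (mu t) = mu t" "pA (sig t) = sig t" "pA (tau t) = tau t" "pA (mu' t) = mu' t" "pA (sig' t) = sig' t" "pA (tau' t) = tau' t"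
  "sig (sig' t) = pA t" "sig' (sig t) = pA t"
  by (simp_all add: pA_def mu_def sig_def tau_def mu'_def sig'_def tau'_def)

sublocale A: total_hopf_bij pA mA uA dA eA SA SAi
proof unfold_locales
  show "lin SA" by (simp add: SA_def[abs_def])
  show "lin SAi" by (simp add: SAi_def[abs_def] tau'_def sig'_def mu'_def)
  fix x
  show "pA (SA x) = SA x" "SA (pA x) = SA x"
    unfolding SA_eq by simp_all
  show "pA (SAi x) = SAi x" "SAi (pA x) = SAi x"
    unfolding SAi_def by simp_all
  show "SA (SAi x) = pA x"
    unfolding SA_eq SAi_def by (simp add: mu_mu' tau_tau')
  show "SAi (SA x) = pA x"
    unfolding SA_eq SAi_def by (simp add: mu'_mu tau'_tau)
qed (rule SA_l0 SA_r0)+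

section \<open>Projections of the bosonization onto H and R, and the inclusions\<close>

definition "piA t = swt t (\<lambda>r h. eR r *\<^sub>k p h)"
definition "thA t = swt t (\<lambda>r h. e h *\<^sub>k pR r)"
definition "iH h = uR \<otimes>\<^sub>k p h"
definition "iR r = pR r \<otimes>\<^sub>k u"

lemma lin_piA: "lin piA" and lin_thA: "lin thA" and lin_iH: "lin iH" and lin_iR: "lin iR"
  by (simp_all add: piA_def[abs_def] thA_def[abs_def] iH_def[abs_def] iR_def[abs_def])
lemmas pi_th_op [simp] = lin_op[OF lin_piA] lin_op[OF lin_thA] lin_op[OF lin_iH] lin_op[OF lin_iR]

lemma piA_tens: "piA (r \<otimes>\<^sub>k h) = eR r *\<^sub>k p h" and thA_tens: "thA (r \<otimes>\<^sub>k h) = e h *\<^sub>k pR r"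
  by (simp_all add: piA_def thA_def)

lemma pi_th_abs [simp]: "piA (pA t) = piA t" "p (piA t) = piA t" "thA (pA t) = thA t" "pR (thA t) = thA t"
  "pA (iH h) = iH h" "iH (p h) = iH h" "pA (iR r) = iR r" "iR (pR r) = iR r"
  by (simp_all add: pA_def piA_def thA_def iH_def iR_def)

lemma pi_u [simp]: "piA uA = u" "thA uA = uR" "iH u = uA" "iR uR = uA"
  by (simp_all add: uA_def piA_def thA_def iH_def iR_def)

lemma pi_i [simp]: "piA (iH h) = p h" "thA (iH h) = e h *\<^sub>k uR" "piA (iR r) = eR r *\<^sub>k u" "thA (iR r) = pR r"
  by (simp_all add: piA_def thA_def iH_def iR_def)

lemma iH_m [simp]: "iH (m g h) = mA (iH g) (iH h)" and iR_m [simp]: "iR (mR r s) = mA (iR r) (iR s)"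
  by (simp_all add: mA_def iH_def iR_def)

lemma iR_iH: "mA (iR r) (iH h) = pR r \<otimes>\<^sub>k p h"
  by (simp add: mA_def iH_def iR_def)
lemma iH_iR: "mA (iH h) (iR r) = swt (d h) (\<lambda>h1 h2. mA (iR (ac h1 r)) (iH h2))"
  by (simp add: mA_def iH_def iR_def)

lemma dA_iH [simp]: "dA (iH h) = swt (d h) (\<lambda>h1 h2. iH h1 \<otimes>\<^sub>k iH h2)"
  by (simp add: dA_def iH_def)
lemma dA_iR [simp]: "dA (iR r) = swt (dR r) (\<lambda>r1 r2. swt (co r2) (\<lambda>g r0. mA (iR r1) (iH g) \<otimes>\<^sub>k iR r0))"
  by (simp add: dA_def iH_def iR_def mA_def)

lemma piA_mA [simp]: "piA (mA s t) = m (piA s) (piA t)"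
  by (simp add: piA_def mA_def swt_swap[where s = t])
lemma d_piA [simp]: "d (piA t) = swt (dA t) (\<lambda>a b. piA a \<otimes>\<^sub>k piA b)"
  by (simp add: dA_def piA_tens) (simp add: piA_def d_pp)
text \<open>The projection to R is a coalgebra map. It is not multiplicative in general;
  \<open>thA_mA_gen\<close> gives its values on products.\<close>

lemma dR_thA [simp]: "dR (thA t) = swt (dA t) (\<lambda>a b. thA a \<otimes>\<^sub>k thA b)"
  by (simp add: dA_def thA_tens) (simp add: thA_def R.d_pp)
lemma e_piA [simp]: "e (piA t) = eA t"
proof -
  have "e (piA t) *\<^sub>k (unit_vec :: ('a, 'k) univ) = eA t *\<^sub>k unit_vec"
    by (simp add: piA_def)
  then show ?thesis by (simp only: scal_unit_vec_iff)
qed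
lemma eR_thA [simp]: "eR (thA t) = eA t"
proof -
  have "eR (thA t) *\<^sub>k (unit_vec :: ('a, 'k) univ) = eA t *\<^sub>k unit_vec"
    by (simp add: thA_def univ.scale_left_commute)
  then show ?thesis by (simp only: scal_unit_vec_iff)
qed
lemma eA_i [simp]: "eA (iR r) = eR r"
  using eR_thA[of "iR r"] by (simp del: eR_thA)

lemma piA_SA [simp]: "piA (SA t) = S (piA t)"
proof -
  have "piA (SA t) = swt t (\<lambda>r h. swt (co r) (\<lambda>g r0. eR (SR r0) *\<^sub>k S (m g h)))"
    by (simp add: SA_def piA_tens mA_HH)
  also have "\<dots> = S (piA t)"
    by (simp add: piA_def)
  finally show ?thesis .
qed
lemma SA_iH [simp]: "SA (iH h) = iH (S h)"
  by (simp add: SA_def iH_def mA_HH)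
end

section \<open>Right comodules over the bosonization\<close>

context total_yd_hopf begin

text \<open>An element of R#H is recovered from its components as \<theta>(t1) \<otimes> \<pi>(t2).
  This is why the pair \<open>lam\<close>, \<open>rho\<close> determines the coaction of
  R#H.\<close>

lemma dA_th_pi: assumes "lin f"
  shows "swt (dA t) (\<lambda>a b. f (thA a \<otimes>\<^sub>k piA b)) = f (pA t)"
proof -
  have "swt (dA t) (\<lambda>a b. thA a \<otimes>\<^sub>k piA b) = pA t"
    by (simp add: dA_def thA_tens piA_tens) (simp add: pA_def)
  then show ?thesis using lin_swt[OF assms, of "dA t" "\<lambda>a b. thA a \<otimes>\<^sub>k piA b"] by simp
qed

text \<open>On t = r \<otimes> h both sides are r_{-1} h \<otimes> r_0, by the coaction in the
  comultiplication of the bosonization. At t = S(a) it becomes the colinearity of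
  \<open>rho\<close>.\<close>

lemma dA_pi_th:
  assumes f: "bil f"
  shows "swt (dA t) (\<lambda>a b. f (piA a) (thA b)) = swt (dA t) (\<lambda>a b. swt (co (thA a)) (\<lambda>g r. f (m g (piA b)) r))"
proof -
  note [simp] = bil_op[OF f]
  have "swt (dA t) (\<lambda>a b. f (piA a) (thA b)) = swt (dA t) (\<lambda>a b. swt (co (thA a)) (\<lambda>g r. f (m g (piA b)) (pR r)))"
    by (simp add: dA_def thA_tens piA_tens)
  moreover have "swt (co x) (\<lambda>g r. f (m g b) (pR r)) = swt (co x) (\<lambda>g r. f (m g b) r)" for x b
    using swt_co_q[of "\<lambda>g r. f (m g b) r" x] by (simp add: bil_def)
  ultimately show ?thesis by simp
qed

text \<open>Computes b1, b2, b3 under \<pi>, id, \<pi>S for b = r \<otimes> h: only the first leg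
  keeps a coaction component of r, and the last is S(h3). It makes the compatibility condition of
  the target category explicit.\<close>

lemma dA3_pi:
  assumes "\<And>b c. lin (\<lambda>a. f a b c)" "\<And>a c. lin (\<lambda>b. f a b c)" "\<And>a b. lin (\<lambda>c. f a b c)"
  shows "swt (dA b) (\<lambda>b1 t. swt (dA t) (\<lambda>b2 b3. f (piA b1) b2 (piA (SA b3)))) =
    swt b (\<lambda>r h. swt (co r) (\<lambda>g r0. swt (d h) (\<lambda>h1 t. swt (d t) (\<lambda>h2 h3. f (m g h1) (pR r0 \<otimes>\<^sub>k p h2) (S h3)))))"
proof -
  note [simp] = lin_op[OF assms(1)] lin_op[OF assms(2)] lin_op[OF assms(3)]
  show ?thesis by (simp add: dA_def piA_tens)
qed

lemma thA_mA [simp]: "thA (mA (iH h) t) = ac h (thA t)" "thA (mA t (iH h)) = e h *\<^sub>k thA t"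
  by (simp_all add: iH_def mA_def thA_def)
text \<open>Used for tensor products of comodules, whose \<open>rho\<close> is \<theta> of a product
  S(b) S(a).\<close>

lemma thA_mA_gen: "thA (mA s t) = swt (dA s) (\<lambda>a b. mR (thA a) (ac (piA b) (thA t)))"
proof -
  have "thA (mA s t) = swt s (\<lambda>r h. mR r (ac h (thA t)))"
    by (simp add: mA_def thA_def swt_swap[where s = t])
  also have "\<dots> = swt (swt (dA s) (\<lambda>a b. thA a \<otimes>\<^sub>k piA b)) (\<lambda>r h. mR r (ac h (thA t)))"
    using dA_th_pi[of "\<lambda>x. x" s] by (simp add: pA_def)
  finally show ?thesis by simp
qed

lemma SAi_iH [simp]: "SAi (iH h) = iH (Si h)"
  using A.Si_S[of "iH (Si h)"] by (simp del: A.Si_S)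
lemma piA_SAi [simp]: "piA (SAi t) = Si (piA t)"
  using Si_S[of "piA (SAi t)"] by (simp add: piA_SA[symmetric] del: piA_SA Si_S)
lemma swapA [simp]:
  "swt (d h) (\<lambda>a b. swt (dA x) (f a b)) = swt (dA x) (\<lambda>g y. swt (d h) (\<lambda>a b. f a b g y))"
  "swt (co h) (\<lambda>a b. swt (dA x) (f a b)) = swt (dA x) (\<lambda>g y. swt (co h) (\<lambda>a b. f a b g y))"
  "swt (dR h) (\<lambda>a b. swt (dA x) (f a b)) = swt (dA x) (\<lambda>g y. swt (dR h) (\<lambda>a b. f a b g y))"
  by (rule swt_swap)+
end

locale total_right_comodule = total_coalgebra p d e
  for p :: "('a, 'k::field) univ \<Rightarrow> ('a, 'k) univ" and d e +
  fixes q :: "('a, 'k) univ \<Rightarrow> ('a, 'k) univ" and dl :: "('a, 'k) univ \<Rightarrow> ('a, 'k) univ"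
  assumes lin_q': "lin q" and lin_dl: "lin dl" and q_q': "q (q x) = q x"
    and dl_q [simp]: "dl (q x) = dl x"
    and dl_qp: "swt (dl x) (\<lambda>y a. q y \<otimes>\<^sub>k p a) = dl x"
    and dl_dl0: "swt (dl x) (\<lambda>y a. swt (dl y) (\<lambda>z b. z \<otimes>\<^sub>k b \<otimes>\<^sub>k a)) = swt (dl x) (\<lambda>y a. swt (d a) (\<lambda>b c. y \<otimes>\<^sub>k b \<otimes>\<^sub>k c))"
    and dl_e0: "swt (dl x) (\<lambda>y a. e a *\<^sub>k y) = q x"
begin
lemmas lin_dl_op [simp] = lin_comp[OF lin_dl] lin_op(2,3)[OF lin_dl]

lemma dl_dl [simp]:
  assumes "\<And>b c. lin (\<lambda>a. f a b c)" "\<And>a c. lin (\<lambda>b. f a b c)" "\<And>a b. lin (f a b)"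
  shows "swt (dl x) (\<lambda>y a. swt (dl y) (\<lambda>z b. f z b a)) = swt (dl x) (\<lambda>y a. swt (d a) (\<lambda>b c. f y b c))"
  using arg_cong[OF dl_dl0, of "\<lambda>t. swt t (\<lambda>u v. swt v (f u))" x] by (simp add: assms)

lemma dl_e [simp]: assumes "lin f" shows "swt (dl x) (\<lambda>y a. e a *\<^sub>k f y) = f (q x)"
  using lin_swt[OF assms, of "dl x" "\<lambda>a b. e b *\<^sub>k a"] lin_scal[OF assms] by (simp add: dl_e0)

lemma d_dl [simp]: "swt (d h) (\<lambda>a b. swt (dl x) (f a b)) = swt (dl x) (\<lambda>g y. swt (d h) (\<lambda>a b. f a b g y))"
  by (rule swt_swap)
end

text \<open>
  Objects of the source category: \<open>ra\<close> is the right action of \<open>H\<close> and \<open>dl\<close> the right coaction of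
  \<open>R#H\<close>. The antipode turns \<open>dl\<close> into the left coaction \<open>x \<mapsto> S(x\<^sub>1) \<otimes> x\<^sub>0\<close>, of which \<open>lam\<close> and \<open>rho\<close>
  are the components with respect to \<open>H\<close> and \<open>R\<close>.
\<close>
locale right_yd_object = total_yd_hopf p m u d e S Si pR mR uR dR eR ac co SR SRi
  + M: total_right_comodule "total_yd_hopf.pA p pR" "total_yd_hopf.dA p m d pR dR co" "total_yd_hopf.eA e eR" q dl
  for p :: "('a, 'k::field) univ \<Rightarrow> ('a, 'k) univ" and m u d e S Si pR mR uR dR eR ac co SR SRi q dl +
  fixes ra :: "('a, 'k) univ \<Rightarrow> ('a, 'k) univ \<Rightarrow> ('a, 'k) univ"
  assumes bil_ra: "bil ra" and q_ra [simp]: "q (ra x h) = ra x h" and ra_p [simp]: "ra x (p h) = ra x h" and ra_q [simp]: "ra (q x) h = ra x h"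
    and ra_ra [simp]: "ra (ra x g) h = ra x (m g h)" and ra_u [simp]: "ra x u = q x"
    and dl_ra [simp]: "dl (ra x h) = swt (dl x) (\<lambda>y a. swt (d h) (\<lambda>h1 t. swt (d t) (\<lambda>h2 h3. ra y h2 \<otimes>\<^sub>k mA (iH (S h1)) (mA a (iH h3)))))"
begin
lemmas ra_op [simp] = bil_op[OF bil_ra]
lemmas q_op' [simp] = lin_op[OF M.lin_q']
lemmas [simp] = M.q_q'
definition "lac h x = ra x (Si h)"
definition "lam x = swt (dl x) (\<lambda>y a. piA (SA a) \<otimes>\<^sub>k q y)"
definition "rho x = swt (dl x) (\<lambda>y a. thA (SA a) \<otimes>\<^sub>k q y)"
lemma swaps_dl [simp]:
  "swt (d h) (\<lambda>a b. swt (dl x) (f a b)) = swt (dl x) (\<lambda>g y. swt (d h) (\<lambda>a b. f a b g y))"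
  "swt (co h) (\<lambda>a b. swt (dl x) (f a b)) = swt (dl x) (\<lambda>g y. swt (co h) (\<lambda>a b. f a b g y))"
  "swt (dR h) (\<lambda>a b. swt (dl x) (f a b)) = swt (dl x) (\<lambda>g y. swt (dR h) (\<lambda>a b. f a b g y))"
  by (rule swt_swap)+
end

text \<open>
  Left \<open>R\<close>-comodules in the category of Yetter-Drinfeld modules over \<open>H\<close>. The constructions of
  \<open>ra\<close> and \<open>dl\<close> here and of \<open>lac\<close>, \<open>lam\<close> and \<open>rho\<close> above are mutually inverse.
\<close>
locale yd_comodule = total_yd_hopf p m u d e S Si pR mR uR dR eR ac co SR SRi + M: total_yd p m u d e S Si q lac lam
  for p :: "('a, 'k::field) univ \<Rightarrow> ('a, 'k) univ" and m u d e S Si pR mR uR dR eR ac co SR SRi q lac lam +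
  fixes rho :: "('a, 'k) univ \<Rightarrow> ('a, 'k) univ"
  assumes rho: "total_comodule pR dR eR q rho"
    and rho_ac [simp]: "rho (lac h x) = swt (rho x) (\<lambda>r y. swt (d h) (\<lambda>h1 h2. ac h1 r \<otimes>\<^sub>k lac h2 y))"
    and lam_rho0: "swt (lam x) (\<lambda>g y. swt (rho y) (\<lambda>r z. g \<otimes>\<^sub>k r \<otimes>\<^sub>k z)) = swt (rho x) (\<lambda>r y. swt (co r) (\<lambda>k r0. swt (lam y) (\<lambda>g z. m k g \<otimes>\<^sub>k r0 \<otimes>\<^sub>k z)))"
begin
sublocale rho: total_comodule pR dR eR q rho by (rule rho)
lemma lam_rho [simp]:
  assumes "\<And>b c. lin (\<lambda>a. f a b c)" "\<And>a c. lin (\<lambda>b. f a b c)" "\<And>a b. lin (f a b)"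
  shows "swt (lam x) (\<lambda>g y. swt (rho y) (f g)) = swt (rho x) (\<lambda>r y. swt (co r) (\<lambda>k r0. swt (lam y) (\<lambda>g z. f (m k g) r0 z)))"
  using arg_cong[OF lam_rho0, of "\<lambda>t. swt t (\<lambda>u v. swt v (f u))" x] by (simp add: assms)
lemma swaps_yd_comodule [simp]:
  "swt (d h) (\<lambda>a b. swt (rho x) (f a b)) = swt (rho x) (\<lambda>g y. swt (d h) (\<lambda>a b. f a b g y))"
  "swt (co h) (\<lambda>a b. swt (rho x) (f a b)) = swt (rho x) (\<lambda>g y. swt (co h) (\<lambda>a b. f a b g y))"
  "swt (dR h) (\<lambda>a b. swt (rho x) (f a b)) = swt (rho x) (\<lambda>g y. swt (dR h) (\<lambda>a b. f a b g y))"
  "swt (co h) (\<lambda>a b. swt (lam x) (f a b)) = swt (lam x) (\<lambda>g y. swt (co h) (\<lambda>a b. f a b g y))"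
  "swt (dR h) (\<lambda>a b. swt (lam x) (f a b)) = swt (lam x) (\<lambda>g y. swt (dR h) (\<lambda>a b. f a b g y))"
  by (rule swt_swap)+
definition "ra x h = lac (S h) x"
text \<open>The element S(x1) of R#H has components r and g, hence equals r \<otimes> g, and
  \<open>SAi\<close> returns x1.\<close>

definition "dl x = swt (rho x) (\<lambda>r y. swt (lam y) (\<lambda>g z. q z \<otimes>\<^sub>k SAi (pR r \<otimes>\<^sub>k p g)))"
end

context right_yd_object begin

text \<open>S reverses the comultiplication, so \<open>lam\<close> is a left coaction; S^{-1}
  reverses the product, so \<open>lac\<close> is a left action. Applying \<pi>S to S(h1) m1 h3 and
  replacing h by S^{-1}(h) gives h1 \<pi>S(m1) S(h3), the condition for left Yetter-Drinfeld
  modules.\<close>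

lemma total_yd_lam: "total_yd p m u d e S Si q lac lam"
proof unfold_locales
  show "lin q" by (rule M.lin_q')
  show "bil lac" by (simp add: lac_def[abs_def] bil_def)
  show lam: "lin lam" by (simp add: lam_def[abs_def])
  fix x h g
  show "q (q x) = q x" by (rule M.q_q')
  show "q (lac h x) = lac h x" "lac (p h) x = lac h x" "lac h (q x) = lac h x" "lac (m g h) x = lac g (lac h x)" "lac u x = q x"
    by (simp_all add: lac_def)
  show "lam (q x) = lam x" by (simp add: lam_def)
  show "swt (lam x) (\<lambda>g y. p g \<otimes>\<^sub>k q y) = lam x" by (simp add: lam_def)
  show "swt (lam x) (\<lambda>g y. swt (lam y) (\<lambda>g' y'. g \<otimes>\<^sub>k g' \<otimes>\<^sub>k y')) = swt (lam x) (\<lambda>g y. swt (d g) (\<lambda>g1 g2. g1 \<otimes>\<^sub>k g2 \<otimes>\<^sub>k y))"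
    by (simp add: lam_def)
  show "swt (lam x) (\<lambda>g y. e g *\<^sub>k y) = q x" by (simp add: lam_def del: eA_scal)
  show "lam (lac h x) = swt (lam x) (\<lambda>g y. swt (d h) (\<lambda>h1 t. swt (d t) (\<lambda>h2 h3. m h1 (m g (S h3)) \<otimes>\<^sub>k lac h2 y)))"
    by (simp add: lam_def lac_def)
qed

lemma total_comodule_rho: "total_comodule pR dR eR q rho"
proof unfold_locales
  show "lin q" by (rule M.lin_q')
  show "lin rho" by (simp add: rho_def[abs_def])
  fix x
  show "q (q x) = q x" by (rule M.q_q')
  show "rho (q x) = rho x" by (simp add: rho_def)
  show "swt (rho x) (\<lambda>g y. pR g \<otimes>\<^sub>k q y) = rho x" by (simp add: rho_def)
  show "swt (rho x) (\<lambda>g y. swt (rho y) (\<lambda>g' y'. g \<otimes>\<^sub>k g' \<otimes>\<^sub>k y')) = swt (rho x) (\<lambda>g y. swt (dR g) (\<lambda>g1 g2. g1 \<otimes>\<^sub>k g2 \<otimes>\<^sub>k y))"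
    by (simp add: rho_def)
  show "swt (rho x) (\<lambda>g y. eR g *\<^sub>k y) = q x" by (simp add: rho_def del: eA_scal)
qed

text \<open>The compatibility of \<open>rho\<close> with \<open>lam\<close> is
  \<open>dA_pi_th\<close> at S(a), a coaction component of x.\<close>

lemma yd_comodule: "yd_comodule p m u d e S Si pR mR uR dR eR ac co SR SRi q lac lam rho"
proof (intro yd_comodule.intro yd_comodule_axioms.intro total_yd_lam total_comodule_rho total_yd_hopf_axioms)
  fix x h
  show "rho (lac h x) = swt (rho x) (\<lambda>r y. swt (d h) (\<lambda>h1 h2. ac h1 r \<otimes>\<^sub>k lac h2 y))"
    by (simp add: rho_def lac_def)
  show "swt (lam x) (\<lambda>g y. swt (rho y) (\<lambda>r z. g \<otimes>\<^sub>k r \<otimes>\<^sub>k z)) = swt (rho x) (\<lambda>r y. swt (co r) (\<lambda>k r0. swt (lam y) (\<lambda>g z. m k g \<otimes>\<^sub>k r0 \<otimes>\<^sub>k z)))"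
    (is "?l = ?r")
  proof -
    have "?l = swt (dl x) (\<lambda>y a. swt (dA (SA a)) (\<lambda>b c. piA b \<otimes>\<^sub>k thA c \<otimes>\<^sub>k q y))"
      by (simp add: rho_def lam_def)
    also have "\<dots> = ?r"
      by (subst dA_pi_th) (simp_all add: rho_def lam_def bil_def)
    finally show ?thesis .
  qed
qed

text \<open>One half of the mutual inverseness: after coassociativity the expression contains
  \<theta>(S(a)1) \<otimes> \<pi>(S(a)2), which \<open>dA_th_pi\<close> reassembles to S(a).\<close>

lemma dl_yd_comodule: "yd_comodule.dl p m d Si pR ac co SRi q lam rho x = dl x"
proof -
  interpret X: yd_comodule p m u d e S Si pR mR uR dR eR ac co SR SRi q lac lam rho by (rule yd_comodule)
  have "X.dl x = swt (dl x) (\<lambda>y a. swt (dA (SA a)) (\<lambda>b c. q y \<otimes>\<^sub>k SAi (thA b \<otimes>\<^sub>k piA c)))"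
    unfolding X.dl_def by (simp add: rho_def lam_def)
  also have "\<dots> = dl x"
    by (subst dA_th_pi) (simp_all add: M.dl_qp)
  finally show ?thesis .
qed
lemma ra_yd_comodule: "yd_comodule.ra S lac x h = ra x h"
proof -
  interpret X: yd_comodule p m u d e S Si pR mR uR dR eR ac co SR SRi q lac lam rho by (rule yd_comodule)
  show ?thesis by (simp add: X.ra_def lac_def)
qed
end

context yd_comodule begin
lemma right_yd_object: "right_yd_object p m u d e S Si pR mR uR dR eR ac co SR SRi q dl ra"
proof unfold_locales
  show "lin q" by (rule M.lin_q)
  show "lin dl" by (simp add: dl_def[abs_def])
  show "bil ra" by (simp add: ra_def[abs_def] bil_def)
  fix x h g
  show "q (q x) = q x" by simp
  show "q (ra x h) = ra x h" "ra x (p h) = ra x h" "ra (q x) h = ra x h" "ra (ra x g) h = ra x (m g h)" "ra x u = q x"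
    by (simp_all add: ra_def)
  show "dl (q x) = dl x" by (simp add: dl_def)
  show "swt (dl x) (\<lambda>y a. q y \<otimes>\<^sub>k pA a) = dl x" by (simp add: dl_def)
  show "swt (dl x) (\<lambda>y a. swt (dl y) (\<lambda>z b. z \<otimes>\<^sub>k b \<otimes>\<^sub>k a)) = swt (dl x) (\<lambda>y a. swt (dA a) (\<lambda>b c. y \<otimes>\<^sub>k b \<otimes>\<^sub>k c))"
    by (simp add: dl_def) (simp add: dA_def)
  show "swt (dl x) (\<lambda>y a. eA a *\<^sub>k y) = q x"
    by (simp add: dl_def del: eA_scal) simp
  show "dl (ra x h) = swt (dl x) (\<lambda>y a. swt (d h) (\<lambda>h1 t. swt (d t) (\<lambda>h2 h3. ra y h2 \<otimes>\<^sub>k mA (iH (S h1)) (mA a (iH h3)))))" (is "?l = ?r")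
  proof -
    \<comment> \<open>The terms produced by \<open>rho_ac\<close> and by the Yetter-Drinfeld
      condition assemble to (1#h)(r#g)(1#k). \<open>SAi\<close> reverses this product, which yields
      the two outer factors of the condition for \<open>dl\<close>.\<close>
    have key: "swt (d h) (\<lambda>a b. ac a r \<otimes>\<^sub>k m b (m g k)) = mA (iH h) (mA (pR r \<otimes>\<^sub>k p g) (iH k))" for h r g k
      by (simp add: mA_def iH_def)
    have "?l = swt (rho x) (\<lambda>r y. swt (lam y) (\<lambda>g z. swt (d h) (\<lambda>h1 t. swt (d t) (\<lambda>h2 h3.
        lac (S h2) z \<otimes>\<^sub>k SAi (swt (d (S h3)) (\<lambda>a b. ac a r \<otimes>\<^sub>k m b (m g (S (S h1)))))))))"
      by (simp add: dl_def ra_def)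
    also have "\<dots> = swt (rho x) (\<lambda>r y. swt (lam y) (\<lambda>g z. swt (d h) (\<lambda>h1 t. swt (d t) (\<lambda>h2 h3.
        lac (S h2) z \<otimes>\<^sub>k SAi (mA (iH (S h3)) (mA (pR r \<otimes>\<^sub>k p g) (iH (S (S h1)))))))))"
      by (simp only: key)
    also have "\<dots> = ?r" by (simp add: dl_def ra_def)
    finally show ?thesis .
  qed
qed

lemma lam_right_yd_object: "right_yd_object.lam p m u d S mR uR eR ac co SR q dl x = lam x"
proof -
  interpret X: right_yd_object p m u d e S Si pR mR uR dR eR ac co SR SRi q dl ra by (rule right_yd_object)
  show ?thesis by (simp add: X.lam_def dl_def piA_tens M.co_pq)
qed

lemma rho_right_yd_object: "right_yd_object.rho m u d e S pR mR uR ac co SR q dl x = rho x"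
proof -
  interpret X: right_yd_object p m u d e S Si pR mR uR dR eR ac co SR SRi q dl ra by (rule right_yd_object)
  show ?thesis by (simp add: X.rho_def dl_def thA_tens rho.co_pq)
qed

lemma lac_right_yd_object: "right_yd_object.lac Si ra h x = lac h x"
proof -
  interpret X: right_yd_object p m u d e S Si pR mR uR dR eR ac co SR SRi q dl ra by (rule right_yd_object)
  show ?thesis by (simp add: X.lac_def ra_def)
qed
end

section \<open>Left modules over the bosonization\<close>

text \<open>
  Left \<open>R\<^sup>\<or>\<close>-modules in the category of Yetter-Drinfeld modules over \<open>H\<close>, with action \<open>xa\<close>. They
  correspond to the objects of the target category, where \<open>ba\<close> is the action of \<open>R\<^sup>\<or>#H\<close>.
\<close>
locale yd_module = V: total_yd_hopf p m u d e S Si pV mV uV dV eV acv cov SV SVi + M: total_yd p m u d e S Si q lac lam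
  for p :: "('a, 'k::field) univ \<Rightarrow> ('a, 'k) univ" and m u d e S Si pV mV uV dV eV acv cov SV SVi q lac lam +
  fixes xa :: "('a, 'k) univ \<Rightarrow> ('a, 'k) univ \<Rightarrow> ('a, 'k) univ"
  assumes bil_xa: "bil xa" and q_xa [simp]: "q (xa \<xi> x) = xa \<xi> x" and xa_q [simp]: "xa \<xi> (q x) = xa \<xi> x"
    and xa_pV [simp]: "xa (pV \<xi>) x = xa \<xi> x"
    and xa_mV [simp]: "xa (mV \<xi> \<eta>) x = xa \<xi> (xa \<eta> x)" and xa_uV [simp]: "xa uV x = q x"
    and lac_xa [simp]: "lac h (xa \<xi> x) = swt (d h) (\<lambda>h1 h2. xa (acv h1 \<xi>) (lac h2 x))"
    and lam_xa [simp]: "lam (xa \<xi> x) = swt (cov \<xi>) (\<lambda>k \<xi>0. swt (lam x) (\<lambda>g y. m k g \<otimes>\<^sub>k xa \<xi>0 y))"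
begin
lemmas xa_op [simp] = bil_op[OF bil_xa]
lemma swaps_yd_module [simp]:
  "swt (cov h) (\<lambda>a b. swt (lam x) (f a b)) = swt (lam x) (\<lambda>g y. swt (cov h) (\<lambda>a b. f a b g y))"
  "swt (dV h) (\<lambda>a b. swt (lam x) (f a b)) = swt (lam x) (\<lambda>g y. swt (dV h) (\<lambda>a b. f a b g y))"
  by (rule swt_swap)+
definition "ba b x = swt b (\<lambda>\<xi> h. xa \<xi> (lac h x))"
end

locale left_yd_object = V: total_yd_hopf p m u d e S Si pV mV uV dV eV acv cov SV SVi + M: total_comodule p d e q lam
  for p :: "('a, 'k::field) univ \<Rightarrow> ('a, 'k) univ" and m u d e S Si pV mV uV dV eV acv cov SV SVi q lam +
  fixes ba :: "('a, 'k) univ \<Rightarrow> ('a, 'k) univ \<Rightarrow> ('a, 'k) univ"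
  assumes ba: "total_module V.pA V.mA V.uA V.dA V.eA V.SA V.SAi q ba"
    and lam_ba [simp]: "lam (ba b x) = swt (V.dA b) (\<lambda>b1 t. swt (V.dA t) (\<lambda>b2 b3. swt (lam x) (\<lambda>g y. m (V.piA b1) (m g (V.piA (V.SA b3))) \<otimes>\<^sub>k ba b2 y)))"
begin
sublocale B: total_module V.pA V.mA V.uA V.dA V.eA V.SA V.SAi q ba by (rule ba)
definition "lac h x = ba (V.iH h) x"
definition "xa \<xi> x = ba (V.iR \<xi>) x"
end

context yd_module begin
text \<open>After \<open>V.dA3_pi\<close> the compatibility with the H-coaction follows from the
  colinearity of \<open>xa\<close> together with the Yetter-Drinfeld condition for
  \<open>lac\<close>.\<close>

lemma left_yd_object: "left_yd_object p m u d e S Si pV mV uV dV eV acv cov SV SVi q lam ba"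
proof (intro left_yd_object.intro left_yd_object_axioms.intro V.total_yd_hopf_axioms M.total_comodule_axioms)
  show "total_module V.pA V.mA V.uA V.dA V.eA V.SA V.SAi q ba"
  proof unfold_locales
    show "lin q" by (rule M.lin_q)
    show "bil ba" by (simp add: ba_def[abs_def] bil_def)
    fix b b' x
    show "q (q x) = q x" by simp
    show "q (ba b x) = ba b x" by (simp add: ba_def)
    show "ba (V.pA b) x = ba b x" by (simp add: ba_def V.pA_def)
    show "ba b (q x) = ba b x" by (simp add: ba_def)
    show "ba (V.mA b b') x = ba b (ba b' x)" by (simp add: ba_def V.mA_def swt_swap[where s = b'])
    show "ba V.uA x = q x" by (simp add: ba_def V.uA_def)
  qed
  fix b x
  show "lam (ba b x) = swt (V.dA b) (\<lambda>b1 t. swt (V.dA t) (\<lambda>b2 b3. swt (lam x) (\<lambda>g y. m (V.piA b1) (m g (V.piA (V.SA b3))) \<otimes>\<^sub>k ba b2 y)))"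
    (is "?l = ?r")
  proof -
    have [simp]: "lin g \<Longrightarrow> lin (\<lambda>x. ba (g x) y)" for g y by (simp add: ba_def[abs_def])
    have "?l = swt (lam x) (\<lambda>g y. swt b (\<lambda>\<xi> h. swt (cov \<xi>) (\<lambda>k \<xi>0. swt (d h) (\<lambda>h1 t. swt (d t) (\<lambda>h2 h3.
        m (m k h1) (m g (S h3)) \<otimes>\<^sub>k ba (pV \<xi>0 \<otimes>\<^sub>k p h2) y)))))"
      by (simp add: ba_def) (simp add: swt_swap[where t = b and s = "lam x"])
    also have "\<dots> = swt (lam x) (\<lambda>g y. swt (V.dA b) (\<lambda>b1 t. swt (V.dA t) (\<lambda>b2 b3. m (V.piA b1) (m g (V.piA (V.SA b3))) \<otimes>\<^sub>k ba b2 y)))"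
      by (subst V.dA3_pi) (simp_all)
    also have "\<dots> = ?r" by (simp only: swt_swap[where s = "lam x"])
    finally show ?thesis .
  qed
qed
end

context left_yd_object begin
lemma yd_module: "yd_module p m u d e S Si pV mV uV dV eV acv cov SV SVi q lac lam xa"
proof (intro yd_module.intro yd_module_axioms.intro V.total_yd_hopf_axioms)
  \<comment> \<open>The compatibility condition in coordinates. At b = 1#h it is the Yetter-Drinfeld
    condition, at b = \<xi>#1 the colinearity of the action of \<open>pV\<close>.\<close>
  have lam_ba': "lam (ba b x) = swt (lam x) (\<lambda>g y. swt b (\<lambda>\<xi> h. swt (cov \<xi>) (\<lambda>k \<xi>0. swt (d h) (\<lambda>h1 t. swt (d t) (\<lambda>h2 h3.
        m (m k h1) (m g (S h3)) \<otimes>\<^sub>k ba (pV \<xi>0 \<otimes>\<^sub>k p h2) y)))))" for b x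
  proof -
    have "lam (ba b x) = swt (lam x) (\<lambda>g y. swt (V.dA b) (\<lambda>b1 t. swt (V.dA t) (\<lambda>b2 b3. m (V.piA b1) (m g (V.piA (V.SA b3))) \<otimes>\<^sub>k ba b2 y)))"
      by (simp only: lam_ba swt_swap[where s = "lam x"])
    then show ?thesis
      by (subst (asm) V.dA3_pi) (simp_all)
  qed
  show "total_yd p m u d e S Si q lac lam"
  proof unfold_locales
    show "lin q" by (rule M.lin_q')
    show "bil lac" by (simp add: lac_def[abs_def] bil_def)
    fix x g h
    show "q (q x) = q x" by simp
    show "q (lac h x) = lac h x" "lac (p h) x = lac h x" "lac h (q x) = lac h x" "lac (m g h) x = lac g (lac h x)" "lac u x = q x"
      by (simp_all add: lac_def)
    show "lam (lac h x) = swt (lam x) (\<lambda>g y. swt (d h) (\<lambda>h1 t. swt (d t) (\<lambda>h2 h3. m h1 (m g (S h3)) \<otimes>\<^sub>k lac h2 y)))"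
      unfolding lac_def by (simp add: lam_ba' V.iH_def del: lam_ba)
  qed
  show "bil xa" by (simp add: xa_def[abs_def] bil_def)
  fix \<xi> \<eta> x h
  show "q (xa \<xi> x) = xa \<xi> x" "xa \<xi> (q x) = xa \<xi> x" "xa (pV \<xi>) x = xa \<xi> x" "xa (mV \<xi> \<eta>) x = xa \<xi> (xa \<eta> x)" "xa uV x = q x"
    by (simp_all add: xa_def)
  show "lac h (xa \<xi> x) = swt (d h) (\<lambda>h1 h2. xa (acv h1 \<xi>) (lac h2 x))"
    unfolding xa_def lac_def by (simp add: B.ac_m[symmetric] V.iH_iR del: B.ac_m)
  show "lam (xa \<xi> x) = swt (cov \<xi>) (\<lambda>k \<xi>0. swt (lam x) (\<lambda>g y. m k g \<otimes>\<^sub>k xa \<xi>0 y))"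
    unfolding xa_def by (simp add: lam_ba' V.iR_def swt_swap[where s = "lam x"] del: lam_ba)
qed
lemma ba_yd_module: "yd_module.ba lac xa b x = ba b x"
proof -
  interpret X: yd_module p m u d e S Si pV mV uV dV eV acv cov SV SVi q lac lam xa by (rule yd_module)
  have "X.ba b x = swt b (\<lambda>\<xi> h. ba (pV \<xi> \<otimes>\<^sub>k p h) x)"
    by (simp add: X.ba_def xa_def lac_def B.ac_m[symmetric] V.iR_iH del: B.ac_m)
  also have "\<dots> = ba (V.pA b) x" by (simp add: V.pA_def del: B.ac_p)
  finally show ?thesis by simp
qed
end

section \<open>Dual pairs\<close>

text \<open>\<open>fm_mR\<close> and \<open>fm_mV\<close> carry a vector w because their right sides
  are scalar-valued Sweedler sums. \<open>nondeg\<close> says that the pairing separates the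
  elements of R.\<close>

locale total_dual_pair = total_yd_hopf p m u d e S Si pR mR uR dR eR ac co SR SRi
  + V: total_yd_hopf p m u d e S Si pV mV uV dV eV acv cov SV SVi
  for p :: "('a, 'k::field) univ \<Rightarrow> ('a, 'k) univ" and m u d e S Si pR mR uR dR eR ac co SR SRi pV mV uV dV eV acv cov SV SVi +
  fixes fm :: "('a, 'k) univ \<Rightarrow> ('a, 'k) univ \<Rightarrow> 'k"
  assumes fm_lin: "linf (fm \<xi>)" "linf (\<lambda>\<xi>. fm \<xi> x)"
    and fm_pV: "fm (pV \<xi>) x = fm \<xi> x" and fm_pR: "fm \<xi> (pR x) = fm \<xi> x"
    and fm_act: "fm (acv h \<xi>) x = fm \<xi> (ac (S h) x)"
    and fm_co: "swt (cov \<xi>) (\<lambda>g \<xi>0. fm \<xi>0 x *\<^sub>k g) = swt (co x) (\<lambda>g x0. fm \<xi> x0 *\<^sub>k Si g)"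
    and fm_mR: "fm \<xi> (mR x y) *\<^sub>k w = swt (dV \<xi>) (\<lambda>\<xi>1 \<xi>2. fm \<xi>1 y *\<^sub>k fm \<xi>2 x *\<^sub>k w)"
    and fm_mV: "fm (mV \<xi> \<eta>) x *\<^sub>k w = swt (dR x) (\<lambda>x1 x2. fm \<xi> x2 *\<^sub>k fm \<eta> x1 *\<^sub>k w)"
    and fm_uV: "fm uV x = eR x" and fm_uR: "fm \<xi> uR = eV \<xi>"
    and nondeg: "(\<And>\<xi>. fm \<xi> x = 0) \<Longrightarrow> pR x = 0"
begin

text \<open>Scalars \<open>\<langle>\<xi>, x\<rangle>\<close> are treated as an operation, so that they do not obstruct the
  rearrangement of sums.\<close>
definition "fs \<xi> x w = fm \<xi> x *\<^sub>k w"

lemma fs_lin: "lin (\<lambda>\<xi>. fs \<xi> x w)" "lin (\<lambda>x. fs \<xi> x w)" "lin (fs \<xi> x)"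
  by (simp_all add: fs_def[abs_def] fm_lin)
lemmas fs_op [simp] = lin_op[OF fs_lin(1)] lin_op[OF fs_lin(2)] lin_op[OF fs_lin(3)]
lemma fs_tens [simp]: "fs \<xi> x v \<otimes>\<^sub>k w = fs \<xi> x (v \<otimes>\<^sub>k w)" "w \<otimes>\<^sub>k fs \<xi> x v = fs \<xi> x (w \<otimes>\<^sub>k v)"
  by (simp_all add: fs_def)
lemma swt_fs [simp]: "swt (fs \<xi> x t) f = swt t (\<lambda>a b. fs \<xi> x (f a b))"
  by (simp add: fs_def)
lemma fs_out: "lin L \<Longrightarrow> L (fs \<xi> x w) = fs \<xi> x (L w)"
  by (simp add: fs_def lin_scal)
lemma fs_out_bil: "bil f \<Longrightarrow> f (fs \<xi> x v) w = fs \<xi> x (f v w)" "bil f \<Longrightarrow> f w (fs \<xi> x v) = fs \<xi> x (f w v)"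
  by (simp_all add: fs_def bil_op)
lemmas fs_H [simp] = fs_out_bil[OF bil_m] fs_out[OF lin_p] fs_out[OF R.lin_p]
lemma fs_comm: "fs \<xi> x (fs \<eta> y w) = fs \<eta> y (fs \<xi> x w)"
  by (simp add: fs_def univ.scale_left_commute)
lemma fs_p [simp]: "fs (pV \<xi>) x w = fs \<xi> x w" "fs \<xi> (pR x) w = fs \<xi> x w"
  by (simp_all add: fs_def fm_pV fm_pR)
lemma fs_acv [simp]: "fs (acv h \<xi>) x w = fs \<xi> (ac (S h) x) w"
  by (simp add: fs_def fm_act)
lemma fs_m: "fs \<xi> (mR x y) w = swt (dV \<xi>) (\<lambda>\<xi>1 \<xi>2. fs \<xi>1 y (fs \<xi>2 x w))"
  "fs (mV \<xi> \<eta>) x w = swt (dR x) (\<lambda>x1 x2. fs \<xi> x2 (fs \<eta> x1 w))"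
  by (simp_all add: fs_def fm_mR fm_mV)
text \<open>An equation of functions, because \<open>fs\<close> also occurs partially applied, as in
  \<open>swt t (fs \<xi>)\<close>.\<close>

lemma fs_mV: "fs (mV \<xi> \<eta>) = (\<lambda>x w. swt (dR x) (\<lambda>x1 x2. fs \<xi> x2 (fs \<eta> x1 w)))"
  by (intro ext fs_m)
lemma fs_u [simp]: "fs \<xi> uR w = eV \<xi> *\<^sub>k w" "fs uV x w = eR x *\<^sub>k w"
  by (simp_all add: fs_def fm_uV fm_uR)
lemma fs_uV [simp]: "fs uV = (\<lambda>x w. eR x *\<^sub>k w)"
  by (intro ext) simp
lemma fs_co: assumes "lin f" shows "swt (cov \<xi>) (\<lambda>g \<xi>0. fs \<xi>0 x (f g)) = swt (co x) (\<lambda>g x0. fs \<xi> x0 (f (Si g)))"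
  using arg_cong[OF fm_co, of f \<xi> x] by (simp add: lin_swt[OF assms] lin_scal[OF assms] fs_def)

text \<open>Non-degeneracy for elements of R \<otimes> X: they are determined by their contractions
  with all \<xi>. The first two hypotheses say that the left legs lie in R. This uniqueness is the
  source of every property of \<open>rho\<close> on the module side.\<close>

lemma separate:
  assumes "swt t (\<lambda>r y. pR r \<otimes>\<^sub>k y) = t" "swt t' (\<lambda>r y. pR r \<otimes>\<^sub>k y) = t'"
    and "\<And>\<xi>. swt t (fs \<xi>) = swt t' (fs \<xi>)"
  shows "t = t'"
proof -
  define s where "s = t - t'"
  have s1: "swt s (\<lambda>r y. pR r \<otimes>\<^sub>k y) = s" and s2: "swt s (fs \<xi>) = 0" for \<xi>
    by (simp_all add: s_def lin_diff[OF lin_swt_arg] assms)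
  \<comment> \<open>The coordinate functionals of \<open>univ\<close>. Applied to the right leg of
    s, they leave an element of R.\<close>
  define c where "c j x = Poly_Mapping.lookup x j" for j and x :: "('a, 'k) univ"
  have c: "linf (c j)" for j by (simp add: linf_def c_def lookup_add)
  have [simp]: "lin (\<lambda>x. c j (g x) *\<^sub>k w)" if "lin g" for j w and g :: "('a,'k) univ \<Rightarrow> ('a, 'k) univ"
    by (simp add: linf_comp[OF c that])
  \<comment> \<open>Pairing this element of R with \<xi> gives the coordinate j of the contraction
    of s with \<xi>, which is 0; so \<open>nondeg\<close> applies.\<close>
  have z: "swt s (\<lambda>r y. c j y *\<^sub>k pR r) = 0" for j
  proof -
    have "fm \<xi> (swt s (\<lambda>r y. c j y *\<^sub>k r)) *\<^sub>k (unit_vec :: ('a, 'k) univ) = 0" for \<xi>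
    proof -
      have l: "lin (\<lambda>x. c j x *\<^sub>k unit_vec)" by (simp add: c)
      have "fm \<xi> (swt s (\<lambda>r y. c j y *\<^sub>k r)) *\<^sub>k unit_vec = fs \<xi> (swt s (\<lambda>r y. c j y *\<^sub>k r)) unit_vec" by (simp only: fs_def)
      also have "\<dots> = swt s (\<lambda>r y. c j (fs \<xi> r y) *\<^sub>k unit_vec)"
        using lin_scal[OF l] by (simp) (simp add: fs_def univ.scale_left_commute)
      also have "\<dots> = c j (swt s (fs \<xi>)) *\<^sub>k unit_vec"
        using lin_swt[OF l, of s "fs \<xi>"] by simp
      also have "\<dots> = 0" by (simp add: s2 c_def)
      finally show ?thesis .
    qed
    then have "pR (swt s (\<lambda>r y. c j y *\<^sub>k r)) = 0"
      by (intro nondeg) simp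
    then show ?thesis by simp
  qed
  have "s = 0"
  proof (rule poly_mapping_eqI)
    fix k
    have l: "lin (\<lambda>x. c k x *\<^sub>k unit_vec)" by (simp add: c)
    have *: "c k s *\<^sub>k (unit_vec :: ('a, 'k) univ) = swt s (\<lambda>r y. c k (pR r \<otimes>\<^sub>k y) *\<^sub>k unit_vec)"
      using lin_swt[OF l, of s "\<lambda>r y. pR r \<otimes>\<^sub>k y"] by (simp add: s1)
    have "c k s *\<^sub>k (unit_vec :: ('a, 'k) univ) = 0"
    proof (cases k)
      case (PairIx i j)
      have li: "lin (\<lambda>x. c i x *\<^sub>k unit_vec)" by (simp add: c)
      have "swt s (\<lambda>r y. c k (pR r \<otimes>\<^sub>k y) *\<^sub>k (unit_vec :: ('a, 'k) univ)) = swt s (\<lambda>r y. c i (c j y *\<^sub>k pR r) *\<^sub>k unit_vec)"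
        by (simp add: c_def PairIx lookup_tens_Pair univ.scale_left_commute flip: scal_mult)
          (simp add: mult.commute)
      also have "\<dots> = c i (swt s (\<lambda>r y. c j y *\<^sub>k pR r)) *\<^sub>k unit_vec"
        using lin_swt[OF li] by simp
      finally show ?thesis using * by (simp add: z) (simp add: c_def)
    next
      case (GenIx a)
      then show ?thesis unfolding * by (simp add: c_def lookup_tens_other)
    next
      case UnitIx
      then show ?thesis unfolding * by (simp add: c_def lookup_tens_other)
    qed
    then have "c k s = 0" by simp
    then show "Poly_Mapping.lookup s k = Poly_Mapping.lookup 0 k" by (simp add: c_def)
  qed
  then show ?thesis by (simp add: s_def)
qed
end

locale dual_yd_comodule = total_dual_pair p m u d e S Si pR mR uR dR eR ac co SR SRi pV mV uV dV eV acv cov SV SVi fm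
  + M: yd_comodule p m u d e S Si pR mR uR dR eR ac co SR SRi q lac lam rho
  for p :: "('a, 'k::field) univ \<Rightarrow> ('a, 'k) univ" and m u d e S Si pR mR uR dR eR ac co SR SRi pV mV uV dV eV acv cov SV SVi fm q lac lam rho
begin
lemmas fs_M [simp] = fs_out_bil[OF M.M.bil_ac] fs_out[OF M.M.lin_q] fs_out[OF M.M.lin_co] fs_out[OF M.rho.lin_co]
definition "xa \<xi> x = swt (rho x) (\<lambda>r y. fs \<xi> r (q y))"
lemma swaps_dual_yd_comodule [simp]:
  "swt (cov h) (\<lambda>a b. swt (rho x) (f a b)) = swt (rho x) (\<lambda>g y. swt (cov h) (\<lambda>a b. f a b g y))"
  "swt (cov h) (\<lambda>a b. swt (lam x) (f a b)) = swt (lam x) (\<lambda>g y. swt (cov h) (\<lambda>a b. f a b g y))"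
  "swt (cov h) (\<lambda>a b. swt (co x') (f a b)) = swt (co x') (\<lambda>g y. swt (cov h) (\<lambda>a b. f a b g y))"
  by (rule swt_swap)+

text \<open>The flipped order in \<langle>\<xi>\<eta>, x\<rangle> = \<langle>\<xi>,
  x2\<rangle>\<langle>\<eta>, x1\<rangle> is what makes evaluation of a left coaction a left action.
  In the compatibility with H, the rule for \<langle>h\<xi>, x\<rangle> leads to S(h1) h2; in the
  colinearity, \<open>fs_co\<close> produces the S^{-1} that cancels the coaction of r.\<close>

lemma yd_module: "yd_module p m u d e S Si pV mV uV dV eV acv cov SV SVi q lac lam xa"
proof (intro yd_module.intro yd_module_axioms.intro V.total_yd_hopf_axioms M.M.total_yd_axioms)
  show "bil xa" by (simp add: xa_def[abs_def] bil_def)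
  fix \<xi> \<eta> x h
  show "q (xa \<xi> x) = xa \<xi> x" "xa \<xi> (q x) = xa \<xi> x" "xa (pV \<xi>) x = xa \<xi> x" "xa uV x = q x"
    by (simp_all add: xa_def)
  show "xa (mV \<xi> \<eta>) x = xa \<xi> (xa \<eta> x)"
    by (simp add: xa_def fs_m) (simp add: fs_comm[of \<xi> _ \<eta>])
  show "lac h (xa \<xi> x) = swt (d h) (\<lambda>h1 h2. xa (acv h1 \<xi>) (lac h2 x))" (is "_ = ?r")
  proof -
    have "?r = swt (rho x) (\<lambda>r y. swt (d h) (\<lambda>h1 h2. fs \<xi> (ac (swt (d h1) (\<lambda>a b. m (S a) b)) r) (lac h2 y)))"
      by (simp add: xa_def)
    then show ?thesis by (simp add: S_l0) (simp add: xa_def)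
  qed
  show "lam (xa \<xi> x) = swt (cov \<xi>) (\<lambda>k \<xi>0. swt (lam x) (\<lambda>g y. m k g \<otimes>\<^sub>k xa \<xi>0 y))" (is "_ = ?r")
  proof -
    have "?r = swt (rho x) (\<lambda>r y. swt (co r) (\<lambda>k' r0. swt (lam y) (\<lambda>g z. fs \<xi> r0 (m (swt (d k') (\<lambda>a b. m (Si b) a)) g \<otimes>\<^sub>k q z))))"
      by (simp add: xa_def fs_co)
    also have "\<dots> = swt (rho x) (\<lambda>r y. fs \<xi> r (swt (lam y) (\<lambda>g z. p g \<otimes>\<^sub>k q z)))"
      by (simp add: Si_l0)
    also have "\<dots> = lam (xa \<xi> x)"
      by (simp only: M.M.co_pq) (simp add: xa_def)
    finally show ?thesis by simp
  qed
qed
end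

text \<open>
  The map \<open>rho\<close> with \<open>\<langle>\<xi>, rho x\<rangle> = \<xi> x\<close> exists if and only if the module is rational. By
  non-degeneracy it is then a coaction of \<open>R\<close>.
\<close>
locale dual_yd_module = total_dual_pair p m u d e S Si pR mR uR dR eR ac co SR SRi pV mV uV dV eV acv cov SV SVi fm
  + M: yd_module p m u d e S Si pV mV uV dV eV acv cov SV SVi q lac lam xa
  for p :: "('a, 'k::field) univ \<Rightarrow> ('a, 'k) univ" and m u d e S Si pR mR uR dR eR ac co SR SRi pV mV uV dV eV acv cov SV SVi fm q lac lam xa +
  fixes rho :: "('a, 'k) univ \<Rightarrow> ('a, 'k) univ"
  assumes rho_pq: "swt (rho x) (\<lambda>r y. pR r \<otimes>\<^sub>k q y) = rho x"
    and rho_xa: "swt (rho x) (fs \<xi>) = xa \<xi> x"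
begin
lemmas fs_M [simp] = fs_out_bil[OF M.M.bil_ac] fs_out[OF M.M.lin_q] fs_out[OF M.M.lin_co] fs_out_bil[OF M.bil_xa]

lemma swaps_dual_yd_module [simp]:
  "swt (co x') (\<lambda>a b. swt (lam x) (f a b)) = swt (lam x) (\<lambda>g y. swt (co x') (\<lambda>a b. f a b g y))"
  by (rule swt_swap)

lemma rho_p: "swt (rho x) (\<lambda>r y. pR r \<otimes>\<^sub>k y) = rho x"
proof -
  have "swt (swt (rho x) (\<lambda>r y. pR r \<otimes>\<^sub>k q y)) (\<lambda>r y. pR r \<otimes>\<^sub>k y) = swt (rho x) (\<lambda>r y. pR r \<otimes>\<^sub>k q y)"
    by simp
  then show ?thesis by (simp only: rho_pq)
qed

text \<open>\<open>rho\<close> is given pointwise, as some element with the prescribed contractions;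
  it is linear because this element is unique and the action is linear.\<close>

lemma lin_rho: "lin rho"
  unfolding lin_def
proof safe
  fix x y c
  show "rho (x + y) = rho x + rho y"
    by (rule separate) (simp_all add: rho_p rho_xa lin_add[OF lin_swt_arg] lin_add[OF M.xa_op(2)[OF lin_ident]])
  show "rho (c *\<^sub>k x) = c *\<^sub>k rho x"
    by (rule separate) (simp_all add: rho_p rho_xa)
qed
lemmas rho_lin [simp] = lin_op[OF lin_rho] fs_out[OF lin_rho]
lemma rho_q [simp]: "rho (q x) = rho x"
  by (rule separate) (simp_all add: rho_p rho_xa)

lemma rho_xa_gen: assumes "lin f" shows "swt (rho x) (\<lambda>r y. fs \<xi> r (f y)) = f (xa \<xi> x)"
  using lin_swt[OF assms, of "rho x" "fs \<xi>"] by (simp add: rho_xa fs_out[OF assms])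

text \<open>The rule for \<langle>h\<xi>, x\<rangle> read backwards, with h = S(S^{-1}(h)).\<close>

lemma fs_ac: "fs \<xi> (ac h r) w = fs (acv (Si h) \<xi>) r w"
proof -
  have "fs (acv (Si h) \<xi>) r w = fs \<xi> (ac (p h) r) w" by (simp del: ac_p)
  then show ?thesis by simp
qed

text \<open>\<open>separate\<close> is applied twice, to the first and to the second factor R. The
  contractions with \<xi> and then \<eta> are \<eta>(\<xi>x) and (\<eta>\<xi>)x.\<close>

lemma rho_coassoc: "swt (rho x) (\<lambda>r y. swt (rho y) (\<lambda>r' z. r \<otimes>\<^sub>k r' \<otimes>\<^sub>k z)) = swt (rho x) (\<lambda>r y. swt (dR r) (\<lambda>r1 r2. r1 \<otimes>\<^sub>k r2 \<otimes>\<^sub>k y))"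
  (is "?l = ?r")
proof (rule separate)
  show "swt ?l (\<lambda>r y. pR r \<otimes>\<^sub>k y) = ?l"
  proof -
    have "swt ?l (\<lambda>r y. pR r \<otimes>\<^sub>k y) = swt (swt (rho x) (\<lambda>r y. pR r \<otimes>\<^sub>k y)) (\<lambda>r y. swt (rho y) (\<lambda>r' z. r \<otimes>\<^sub>k r' \<otimes>\<^sub>k z))"
      by simp
    then show ?thesis by (simp only: rho_p)
  qed
  show "swt ?r (\<lambda>r y. pR r \<otimes>\<^sub>k y) = ?r"
  proof -
    have "swt (dR r) (\<lambda>r1 r2. pR r1 \<otimes>\<^sub>k r2 \<otimes>\<^sub>k y) = swt (dR r) (\<lambda>r1 r2. r1 \<otimes>\<^sub>k r2 \<otimes>\<^sub>k y)" for r y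
      using R.swt_d_p[of "\<lambda>r1 r2. pR r1 \<otimes>\<^sub>k r2 \<otimes>\<^sub>k y" r] R.swt_d_p[of "\<lambda>r1 r2. r1 \<otimes>\<^sub>k r2 \<otimes>\<^sub>k y" r] by (simp add: bil_def)
    then show ?thesis by simp
  qed
  fix \<xi>
  show "swt ?l (fs \<xi>) = swt ?r (fs \<xi>)" (is "?l' = ?r'")
  proof (rule separate)
    have l': "?l' = rho (xa \<xi> x)"
    proof -
      have *: "swt (rho y) (\<lambda>r' z. fs \<xi> r (r' \<otimes>\<^sub>k z)) = fs \<xi> r (rho y)" for r y
      proof -
        have "swt (rho y) (\<lambda>r' z. fs \<xi> r (r' \<otimes>\<^sub>k z)) = fs \<xi> r (swt (rho y) (\<otimes>\<^sub>k))"
          by simp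
        also have "swt (rho y) (\<otimes>\<^sub>k) = rho y"
        proof -
          have "swt (swt (rho y) (\<lambda>r y. pR r \<otimes>\<^sub>k y)) (\<otimes>\<^sub>k) = swt (rho y) (\<lambda>r y. pR r \<otimes>\<^sub>k y)" by simp
          then show ?thesis by (simp only: rho_p)
        qed
        finally show ?thesis .
      qed
      show ?thesis by (simp add: * rho_xa_gen[OF lin_rho])
    qed
    show "swt ?l' (\<lambda>r y. pR r \<otimes>\<^sub>k y) = ?l'" by (simp only: l' rho_p)
    show "swt ?r' (\<lambda>r y. pR r \<otimes>\<^sub>k y) = ?r'"
    proof -
      have "swt (dR r) (\<lambda>r1 r2. fs \<xi> r1 (pR r2 \<otimes>\<^sub>k y)) = swt (dR r) (\<lambda>r1 r2. fs \<xi> r1 (r2 \<otimes>\<^sub>k y))" for r y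
        using R.swt_d_p[of "\<lambda>r1 r2. fs \<xi> r1 (pR r2 \<otimes>\<^sub>k y)" r] R.swt_d_p[of "\<lambda>r1 r2. fs \<xi> r1 (r2 \<otimes>\<^sub>k y)" r] by (simp add: bil_def)
      then show ?thesis by simp
    qed
    fix \<eta>
    \<comment> \<open>Contracting both legs of \<Delta>(r) is pairing r with \<eta>\<xi>.\<close>
    have "swt ?r' (fs \<eta>) = swt (rho x) (fs (mV \<eta> \<xi>))"
      by (simp add: fs_mV) (simp add: fs_comm[of \<eta> _ \<xi>])
    then show "swt ?l' (fs \<eta>) = swt ?r' (fs \<eta>)"
      by (simp only: l' rho_xa M.xa_mV)
  qed
qed

lemma yd_comodule: "yd_comodule p m u d e S Si pR mR uR dR eR ac co SR SRi q lac lam rho"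
proof (intro yd_comodule.intro yd_comodule_axioms.intro total_yd_hopf_axioms M.M.total_yd_axioms)
  show "total_comodule pR dR eR q rho"
  proof unfold_locales
    show "lin q" by (rule M.M.lin_q)
    show "lin rho" by (rule lin_rho)
    fix x
    show "q (q x) = q x" "rho (q x) = rho x" by simp_all
    show "swt (rho x) (\<lambda>g y. pR g \<otimes>\<^sub>k q y) = rho x" by (rule rho_pq)
    show "swt (rho x) (\<lambda>g y. swt (rho y) (\<lambda>g' y'. g \<otimes>\<^sub>k g' \<otimes>\<^sub>k y')) = swt (rho x) (\<lambda>g y. swt (dR g) (\<lambda>g1 g2. g1 \<otimes>\<^sub>k g2 \<otimes>\<^sub>k y))"
      by (rule rho_coassoc)
    show "swt (rho x) (\<lambda>g y. eR g *\<^sub>k y) = q x"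
      using rho_xa[of x uV] by simp
  qed
  fix x h
  show "rho (lac h x) = swt (rho x) (\<lambda>r y. swt (d h) (\<lambda>h1 h2. ac h1 r \<otimes>\<^sub>k lac h2 y))" (is "_ = ?r")
  proof (rule separate)
    show "swt ?r (\<lambda>r y. pR r \<otimes>\<^sub>k y) = ?r" by simp
    fix \<xi>
    have "swt ?r (fs \<xi>) = swt (d h) (\<lambda>h1 h2. swt (rho x) (\<lambda>r y. fs (acv (Si h1) \<xi>) r (lac h2 y)))"
      by (simp add: fs_ac swt_swap[where s = "rho x"] del: fs_acv)
    also have "\<dots> = swt (d h) (\<lambda>h1 h2. xa (acv (swt (d h1) (\<lambda>a b. m b (Si a))) \<xi>) (lac h2 x))"
      by (simp add: rho_xa_gen[OF M.M.ac_op(2)[OF lin_ident]] del: fs_acv)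
    also have "\<dots> = xa \<xi> (lac h x)" by (simp add: Si_r0)
    finally show "swt (rho (lac h x)) (fs \<xi>) = swt ?r (fs \<xi>)" by (simp add: rho_xa)
  qed (rule rho_p)
  show "swt (lam x) (\<lambda>g y. swt (rho y) (\<lambda>r z. g \<otimes>\<^sub>k r \<otimes>\<^sub>k z)) = swt (rho x) (\<lambda>r y. swt (co r) (\<lambda>k r0. swt (lam y) (\<lambda>g z. m k g \<otimes>\<^sub>k r0 \<otimes>\<^sub>k z)))"
    (is "?l = ?r")
  proof -
    \<comment> \<open>Exchanges the first two legs, because \<open>separate\<close> contracts the
      first one and the leg in R stands second here. A second application undoes the
      exchange.\<close>
    define sw where "sw t = swt t (\<lambda>a s. swt s (\<lambda>b c. b \<otimes>\<^sub>k a \<otimes>\<^sub>k c))" for t :: "('a, 'k) univ"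
    have "sw ?l = sw ?r" (is "?l' = ?r'")
    proof (rule separate)
      have 1: "swt (rho x) (\<lambda>r z. pR r \<otimes>\<^sub>k g \<otimes>\<^sub>k z) = swt (rho x) (\<lambda>r z. r \<otimes>\<^sub>k g \<otimes>\<^sub>k z)" for g x
        using arg_cong[OF rho_p[of x], of "\<lambda>t. swt t (\<lambda>r z. r \<otimes>\<^sub>k g \<otimes>\<^sub>k z)"] by simp
      show "swt ?l' (\<lambda>r y. pR r \<otimes>\<^sub>k y) = ?l'"
        by (simp add: sw_def 1)
      have 2: "swt (co r) (\<lambda>k r0. pR r0 \<otimes>\<^sub>k m k g \<otimes>\<^sub>k z) = swt (co r) (\<lambda>k r0. r0 \<otimes>\<^sub>k m k g \<otimes>\<^sub>k z)" for r g z
        by (rule swt_co_q[of "\<lambda>k r0. r0 \<otimes>\<^sub>k m k g \<otimes>\<^sub>k z"]) (simp add: bil_def)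
      show "swt ?r' (\<lambda>r y. pR r \<otimes>\<^sub>k y) = ?r'"
        by (simp add: sw_def 2)
      fix \<xi>
      \<comment> \<open>Writing k as S^{-1}(S(k)) brings the term into the shape in which
        \<open>fs_co\<close> turns the coaction of r into the coaction of \<xi>.\<close>
      have "swt ?r' (fs \<xi>) = swt (rho x) (\<lambda>r y. swt (lam y) (\<lambda>g z. swt (co r) (\<lambda>k r0. fs \<xi> r0 (m (Si (S k)) g \<otimes>\<^sub>k z))))"
        by (simp add: sw_def)
      also have "\<dots> = swt (rho x) (\<lambda>r y. swt (lam y) (\<lambda>g z. swt (cov \<xi>) (\<lambda>k \<xi>0. fs \<xi>0 r (m (S k) g \<otimes>\<^sub>k z))))"
        by (subst fs_co) simp_all
      also have "\<dots> = swt (cov \<xi>) (\<lambda>k \<xi>0. swt (rho x) (\<lambda>r y. fs \<xi>0 r (swt (lam y) (\<lambda>g z. m (S k) g \<otimes>\<^sub>k z))))"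
        by (simp add: swt_swap[where t = "cov \<xi>"])
      also have "\<dots> = swt (lam x) (\<lambda>g y. swt (cov \<xi>) (\<lambda>k \<xi>0. m (swt (d k) (\<lambda>a b. m (S a) b)) g \<otimes>\<^sub>k xa \<xi>0 y))"
        by (subst rho_xa_gen) simp_all
      also have "\<dots> = swt (lam x) (\<lambda>g y. p g \<otimes>\<^sub>k xa \<xi> y)"
        by (simp add: S_l0)
      also have "\<dots> = swt (swt (lam x) (\<lambda>g y. p g \<otimes>\<^sub>k q y)) (\<lambda>g y. g \<otimes>\<^sub>k xa \<xi> y)"
        by simp
      also have "\<dots> = swt (lam x) (\<lambda>g y. swt (rho y) (\<lambda>r z. fs \<xi> r (g \<otimes>\<^sub>k z)))"
        by (subst rho_xa_gen) (simp_all only: M.M.co_pq, simp)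
      also have "\<dots> = swt ?l' (fs \<xi>)"
        by (simp add: sw_def)
      finally show "swt ?l' (fs \<xi>) = swt ?r' (fs \<xi>)" by simp
    qed
    then have "sw ?l' = sw ?r'" by simp
    then show ?thesis by (simp add: sw_def)
  qed
qed
end

section \<open>Tensor products and unit objects\<close>

locale right_yd_pair = total_yd_hopf p m u d e S Si pR mR uR dR eR ac co SR SRi
  + M: right_yd_object p m u d e S Si pR mR uR dR eR ac co SR SRi q dl ra
  + N: right_yd_object p m u d e S Si pR mR uR dR eR ac co SR SRi q' dl' ra'
  for p :: "('a, 'k::field) univ \<Rightarrow> ('a, 'k) univ" and m u d e S Si pR mR uR dR eR ac co SR SRi q dl ra q' dl' ra'
begin
definition "qT t = swt t (\<lambda>x y. q x \<otimes>\<^sub>k q' y)"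
definition "raT t h = swt t (\<lambda>x y. swt (d h) (\<lambda>h1 h2. ra x h1 \<otimes>\<^sub>k ra' y h2))"
definition "dlT t = swt t (\<lambda>x y. swt (dl x) (\<lambda>x0 a. swt (dl' y) (\<lambda>y0 b. (q x0 \<otimes>\<^sub>k q' y0) \<otimes>\<^sub>k mA a b)))"
lemma swaps_dl2 [simp]:
  "swt (dl' y) (\<lambda>a b. swt (dl x) (f a b)) = swt (dl x) (\<lambda>g y'. swt (dl' y) (\<lambda>a b. f a b g y'))"
  "swt (dA c) (\<lambda>a b. swt (dl x) (f a b)) = swt (dl x) (\<lambda>g y'. swt (dA c) (\<lambda>a b. f a b g y'))"
  "swt (dA c) (\<lambda>a b. swt (dl' x) (f a b)) = swt (dl' x) (\<lambda>g y'. swt (dA c) (\<lambda>a b. f a b g y'))"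
  by (rule swt_swap)+

lemma right_yd_object_tensor: "right_yd_object p m u d e S Si pR mR uR dR eR ac co SR SRi qT dlT raT"
proof unfold_locales
  show "lin qT" by (simp add: qT_def[abs_def])
  show "lin dlT" by (simp add: dlT_def[abs_def])
  show "bil raT" by (simp add: raT_def[abs_def] bil_def)
  fix t h g
  show "qT (qT t) = qT t" by (simp add: qT_def)
  show "qT (raT t h) = raT t h" "raT t (p h) = raT t h" "raT (qT t) h = raT t h" "raT t u = qT t"
    by (simp_all add: qT_def raT_def)
  show "raT (raT t g) h = raT t (m g h)"
    by (simp add: raT_def)
  show "dlT (qT t) = dlT t" by (simp add: qT_def dlT_def)
  show "swt (dlT t) (\<lambda>y a. qT y \<otimes>\<^sub>k pA a) = dlT t" by (simp add: qT_def dlT_def)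
  show "swt (dlT t) (\<lambda>y a. swt (dlT y) (\<lambda>z b. z \<otimes>\<^sub>k b \<otimes>\<^sub>k a)) = swt (dlT t) (\<lambda>y a. swt (dA a) (\<lambda>b c. y \<otimes>\<^sub>k b \<otimes>\<^sub>k c))"
    by (simp add: dlT_def)
  show "swt (dlT t) (\<lambda>y a. eA a *\<^sub>k y) = qT t"
    by (simp add: dlT_def qT_def del: eA_scal)
  show "dlT (raT t h) = swt (dlT t) (\<lambda>y a. swt (d h) (\<lambda>h1 t. swt (d t) (\<lambda>h2 h3. raT y h2 \<otimes>\<^sub>k mA (iH (S h1)) (mA a (iH h3)))))"
    (is "_ = ?r")
  proof -
    \<comment> \<open>Between the coaction components a and b stands h3 S(h4). It is collected in
      the inner sum over z and removed by \<open>S_r0\<close>.\<close>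
    have "dlT (raT t h) = swt t (\<lambda>x y. swt (dl x) (\<lambda>x0 a. swt (dl' y) (\<lambda>y0 b. swt (d h) (\<lambda>h1 t. swt (d t) (\<lambda>h2 t. swt (d t) (\<lambda>z t. swt (d t) (\<lambda>h5 h6.
       (ra x0 h2 \<otimes>\<^sub>k ra' y0 h5) \<otimes>\<^sub>k mA (iH (S h1)) (mA a (mA (iH (swt (d z) (\<lambda>a b. m a (S b)))) (mA b (iH h6)))))))))))"
      by (simp add: dlT_def raT_def)
    also have "\<dots> = ?r"
      by (simp add: S_r0) (simp add: dlT_def raT_def)
    finally show ?thesis .
  qed
qed
end

context total_yd_hopf begin
definition qU :: "('a, 'k) univ \<Rightarrow> ('a, 'k) univ" where "qU x = unit_coeff x *\<^sub>k unit_vec"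
definition "raU x h = e h *\<^sub>k qU x"
definition "dlU x = qU x \<otimes>\<^sub>k uA"
lemma lin_qU: "lin qU" unfolding qU_def[abs_def] by (simp add: linf_unit_coeff)
lemmas qU_op [simp] = lin_op[OF lin_qU]
lemma qU_qU [simp]: "qU (qU x) = qU x"
  by (simp add: qU_def unit_coeff_def unit_vec_def lookup_single)

lemma right_yd_object_unit: "right_yd_object p m u d e S Si pR mR uR dR eR ac co SR SRi qU dlU raU"
proof unfold_locales
  show "lin qU" by (rule lin_qU)
  show "lin dlU" by (simp add: dlU_def[abs_def])
  show "bil raU" by (simp add: raU_def[abs_def] bil_def)
  fix t h g
  show "qU (qU t) = qU t" by simp
  show "qU (raU t h) = raU t h" "raU t (p h) = raU t h" "raU (qU t) h = raU t h" "raU t u = qU t"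
    by (simp_all add: raU_def)
  show "raU (raU t g) h = raU t (m g h)"
    by (simp add: raU_def univ.scale_left_commute)
  show "dlU (qU t) = dlU t" by (simp add: dlU_def)
  show "swt (dlU t) (\<lambda>y a. qU y \<otimes>\<^sub>k pA a) = dlU t" by (simp add: dlU_def)
  show "swt (dlU t) (\<lambda>y a. swt (dlU y) (\<lambda>z b. z \<otimes>\<^sub>k b \<otimes>\<^sub>k a)) = swt (dlU t) (\<lambda>y a. swt (dA a) (\<lambda>b c. y \<otimes>\<^sub>k b \<otimes>\<^sub>k c))"
    by (simp add: dlU_def)
  show "swt (dlU t) (\<lambda>y a. eA a *\<^sub>k y) = qU t"
    by (simp add: dlU_def del: eA_scal)
  show "dlU (raU t h) = swt (dlU t) (\<lambda>y a. swt (d h) (\<lambda>h1 t. swt (d t) (\<lambda>h2 h3. raU y h2 \<otimes>\<^sub>k mA (iH (S h1)) (mA a (iH h3)))))"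
    (is "_ = ?r")
  proof -
    have "?r = swt (d h) (\<lambda>a b. qU t \<otimes>\<^sub>k iH (m (S a) b))"
      by (simp add: dlU_def raU_def)
    also have "\<dots> = qU t \<otimes>\<^sub>k iH (swt (d h) (\<lambda>a b. m (S a) b))" by simp
    also have "\<dots> = dlU (raU t h)" by (simp add: S_l0) (simp add: dlU_def raU_def)
    finally show ?thesis by simp
  qed
qed
end

locale left_yd_pair = V: total_yd_hopf p m u d e S Si pV mV uV dV eV acv cov SV SVi
  + X: left_yd_object p m u d e S Si pV mV uV dV eV acv cov SV SVi q lam ba
  + Y: left_yd_object p m u d e S Si pV mV uV dV eV acv cov SV SVi q' lam' ba'
  for p :: "('a, 'k::field) univ \<Rightarrow> ('a, 'k) univ" and m u d e S Si pV mV uV dV eV acv cov SV SVi q lam ba q' lam' ba'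
begin
definition "qT t = swt t (\<lambda>x y. q x \<otimes>\<^sub>k q' y)"
definition "baT b t = swt t (\<lambda>x y. swt (V.dA b) (\<lambda>b1 b2. ba b1 x \<otimes>\<^sub>k ba' b2 y))"
definition "lamT t = swt t (\<lambda>x y. swt (lam x) (\<lambda>g x0. swt (lam' y) (\<lambda>g' y0. m g g' \<otimes>\<^sub>k (q x0 \<otimes>\<^sub>k q' y0))))"
lemma swaps_lam2 [simp]:
  "swt (lam' y) (\<lambda>a b. swt (lam x) (f a b)) = swt (lam x) (\<lambda>g y'. swt (lam' y) (\<lambda>a b. f a b g y'))"
  "swt (V.dA c) (\<lambda>a b. swt (lam x) (f a b)) = swt (lam x) (\<lambda>g y'. swt (V.dA c) (\<lambda>a b. f a b g y'))"
  "swt (V.dA c) (\<lambda>a b. swt (lam' x) (f a b)) = swt (lam' x) (\<lambda>g y'. swt (V.dA c) (\<lambda>a b. f a b g y'))"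
  by (rule swt_swap)+

lemma left_yd_object_tensor: "left_yd_object p m u d e S Si pV mV uV dV eV acv cov SV SVi qT lamT baT"
proof (intro left_yd_object.intro left_yd_object_axioms.intro V.total_yd_hopf_axioms)
  show "total_comodule p d e qT lamT"
  proof unfold_locales
    show "lin qT" by (simp add: qT_def[abs_def])
    show "lin lamT" by (simp add: lamT_def[abs_def])
    fix t
    show "qT (qT t) = qT t" by (simp add: qT_def)
    show "lamT (qT t) = lamT t" by (simp add: qT_def lamT_def)
    show "swt (lamT t) (\<lambda>g y. p g \<otimes>\<^sub>k qT y) = lamT t" by (simp add: qT_def lamT_def)
    show "swt (lamT t) (\<lambda>g y. swt (lamT y) (\<lambda>g' y'. g \<otimes>\<^sub>k g' \<otimes>\<^sub>k y')) = swt (lamT t) (\<lambda>g y. swt (d g) (\<lambda>g1 g2. g1 \<otimes>\<^sub>k g2 \<otimes>\<^sub>k y))"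
      by (simp add: lamT_def)
    show "swt (lamT t) (\<lambda>g y. e g *\<^sub>k y) = qT t" by (simp add: lamT_def qT_def)
  qed
  show "total_module V.pA V.mA V.uA V.dA V.eA V.SA V.SAi qT baT"
  proof unfold_locales
    show "lin qT" by (simp add: qT_def[abs_def])
    show "bil baT" by (simp add: baT_def[abs_def] bil_def)
    fix b c t
    show "qT (qT t) = qT t" by (simp add: qT_def)
    show "qT (baT b t) = baT b t" "baT (V.pA b) t = baT b t" "baT b (qT t) = baT b t" "baT V.uA t = qT t"
      by (simp_all add: qT_def baT_def)
    show "baT (V.mA b c) t = baT b (baT c t)" by (simp add: baT_def swt_swap[where s = "V.dA c"])
  qed
  fix b t
  show "lamT (baT b t) = swt (V.dA b) (\<lambda>b1 s. swt (V.dA s) (\<lambda>b2 b3. swt (lamT t) (\<lambda>g y. m (V.piA b1) (m g (V.piA (V.SA b3))) \<otimes>\<^sub>k baT b2 y)))"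
    (is "_ = ?r")
  proof -
    \<comment> \<open>The image of the antipode axiom of the bosonization under \<pi>. It cancels
      the factors that meet between the coaction components of x and y.\<close>
    have c: "swt (V.dA z) (\<lambda>a b. m (S (V.piA a)) (V.piA b)) = V.eA z *\<^sub>k u" for z
    proof -
      have "swt (V.dA z) (\<lambda>a b. m (S (V.piA a)) (V.piA b)) = V.piA (swt (V.dA z) (\<lambda>a b. V.mA (V.SA a) b))"
        by simp
      then show ?thesis by (simp only: V.SA_l0) (simp del: V.eA_scal)
    qed
    have "lamT (baT b t) = swt t (\<lambda>x y. swt (lam x) (\<lambda>g x0. swt (lam' y) (\<lambda>g' y0.
       swt (V.dA b) (\<lambda>b1 s. swt (V.dA s) (\<lambda>b2 s. swt (V.dA s) (\<lambda>z s. swt (V.dA s) (\<lambda>b5 b6.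
         m (V.piA b1) (m g (m (swt (V.dA z) (\<lambda>a b. m (S (V.piA a)) (V.piA b))) (m g' (S (V.piA b6))))) \<otimes>\<^sub>k ba b2 x0 \<otimes>\<^sub>k ba' b5 y0)))))))"
      by (simp add: lamT_def baT_def)
    also have "\<dots> = ?r"
      by (simp add: c del: V.eA_scal) (simp add: lamT_def baT_def swt_swap[where s = t])
    finally show ?thesis .
  qed
qed
end

context total_yd_hopf begin
definition "lamU x = u \<otimes>\<^sub>k qU x"
definition "baU b x = eA b *\<^sub>k qU x"
lemma left_yd_object_unit: "left_yd_object p m u d e S Si pR mR uR dR eR ac co SR SRi qU lamU baU"
proof (intro left_yd_object.intro left_yd_object_axioms.intro total_yd_hopf_axioms)
  show "total_comodule p d e qU lamU"
    by unfold_locales (simp_all add: lamU_def lamU_def[abs_def] lin_qU)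
  show "total_module pA mA uA dA eA SA SAi qU baU"
  proof unfold_locales
    show "lin qU" by (rule lin_qU)
    show "bil baU" unfolding baU_def[abs_def] bil_def by simp
  qed (simp_all add: baU_def univ.scale_left_commute del: eA_scal)
  fix b x
  show "lamU (baU b x) = swt (dA b) (\<lambda>b1 s. swt (dA s) (\<lambda>b2 b3. swt (lamU x) (\<lambda>g y. m (piA b1) (m g (piA (SA b3))) \<otimes>\<^sub>k baU b2 y)))"
  proof -
    have "swt (dA b) (\<lambda>b1 s. swt (dA s) (\<lambda>b2 b3. swt (lamU x) (\<lambda>g y. m (piA b1) (m g (piA (SA b3))) \<otimes>\<^sub>k baU b2 y)))
      = swt (dA b) (\<lambda>b1 b3. piA (mA b1 (SA b3)) \<otimes>\<^sub>k qU x)"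
      by (simp add: lamU_def baU_def del: eA_scal)
    also have "\<dots> = piA (swt (dA b) (\<lambda>b1 b3. mA b1 (SA b3))) \<otimes>\<^sub>k qU x" by simp
    also have "\<dots> = lamU (baU b x)"
      by (simp only: SA_r0) (simp add: lamU_def baU_def del: eA_scal)
    finally show ?thesis by simp
  qed
qed
end

section \<open>The monoidal structure\<close>

context dual_yd_comodule begin
sublocale T: yd_module p m u d e S Si pV mV uV dV eV acv cov SV SVi q lac lam xa by (rule yd_module)
lemma ba_iH [simp]: "T.ba (V.iH h) x = lac h x" by (simp add: T.ba_def V.iH_def)
lemma ba_iR [simp]: "T.ba (V.iR \<xi>) x = xa \<xi> x" by (simp add: T.ba_def V.iR_def)
end

locale dual_yd_comodule_pair = total_dual_pair p m u d e S Si pR mR uR dR eR ac co SR SRi pV mV uV dV eV acv cov SV SVi fm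
  + X: dual_yd_comodule p m u d e S Si pR mR uR dR eR ac co SR SRi pV mV uV dV eV acv cov SV SVi fm q lac lam rho
  + Y: dual_yd_comodule p m u d e S Si pR mR uR dR eR ac co SR SRi pV mV uV dV eV acv cov SV SVi fm q' lac' lam' rho'
  for p :: "('a, 'k::field) univ \<Rightarrow> ('a, 'k) univ" and m u d e S Si pR mR uR dR eR ac co SR SRi pV mV uV dV eV acv cov SV SVi fm q lac lam rho q' lac' lam' rho'
begin
sublocale FF: left_yd_pair p m u d e S Si pV mV uV dV eV acv cov SV SVi q lam X.T.ba q' lam' Y.T.ba
  by (intro left_yd_pair.intro V.total_yd_hopf_axioms X.T.left_yd_object Y.T.left_yd_object)

text \<open>The R-coaction of F(M) \<otimes> F(N). Its formula is found by dualizing the diagonal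
  action of \<xi>; see \<open>baT_rhoF\<close>.\<close>

definition "rhoF t = swt t (\<lambda>x y. swt (rho x) (\<lambda>r x'. swt (rho' y) (\<lambda>r' y'. swt (co r') (\<lambda>k r0. swt (d k) (\<lambda>k1 k2.
  mR r0 (ac (Si k2) r) \<otimes>\<^sub>k lac (Si k1) x' \<otimes>\<^sub>k q' y')))))"
text \<open>This and the next two operations belong to F(M \<otimes> N). The exchanged h1 and h2,
  and the product \<open>m g' g\<close>, are due to S^{-1} and S reversing comultiplication and
  multiplication.\<close>

definition "lacM h t = swt t (\<lambda>x y. swt (d h) (\<lambda>h1 h2. lac h2 x \<otimes>\<^sub>k lac' h1 y))"
definition "lamM t = swt t (\<lambda>x y. swt (lam x) (\<lambda>g x0. swt (lam' y) (\<lambda>g' y0. m g' g \<otimes>\<^sub>k q x0 \<otimes>\<^sub>k q' y0)))"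
definition "rhoM t = swt t (\<lambda>x y. swt (rho x) (\<lambda>r x'. swt (rho' y) (\<lambda>r' y'. swt (lam' y') (\<lambda>g y0.
  mR r' (ac g r) \<otimes>\<^sub>k q x' \<otimes>\<^sub>k q' y0))))"
definition "phi t = swt t (\<lambda>x y. swt (lam' y) (\<lambda>g y0. lac (Si g) x \<otimes>\<^sub>k q' y0))"
definition "phii t = swt t (\<lambda>x y. swt (lam' y) (\<lambda>g y0. lac g x \<otimes>\<^sub>k q' y0))"

lemma swaps_dual_yd_comodule_pair [simp]:
  "swt (rho' y) (\<lambda>a b. swt (rho x) (f a b)) = swt (rho x) (\<lambda>g y'. swt (rho' y) (\<lambda>a b. f a b g y'))"
  "swt (rho' y) (\<lambda>a b. swt (lam x) (f a b)) = swt (lam x) (\<lambda>g y'. swt (rho' y) (\<lambda>a b. f a b g y'))"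
  "swt (lam' y) (\<lambda>a b. swt (rho x) (f a b)) = swt (rho x) (\<lambda>g y'. swt (lam' y) (\<lambda>a b. f a b g y'))"
  "swt (dV y) (\<lambda>a b. swt (rho x) (f a b)) = swt (rho x) (\<lambda>g y'. swt (dV y) (\<lambda>a b. f a b g y'))"
  "swt (dV y) (\<lambda>a b. swt (rho' x) (f a b)) = swt (rho' x) (\<lambda>g y'. swt (dV y) (\<lambda>a b. f a b g y'))"
  "swt (co x') (\<lambda>a b. swt (dV y) (f a b)) = swt (dV y) (\<lambda>g y'. swt (co x') (\<lambda>a b. f a b g y'))"
  by (rule swt_swap)+

text \<open>S^{-1} of the coaction component h2 g S(h4) of h2 y is h4 S^{-1}(g) S^{-1}(h2). The last
  factor meets h1, which acts on x, and S^{-1}(h2) h1 collapses.\<close>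

lemma phi_lac: "phi (swt t (\<lambda>x y. swt (d h) (\<lambda>h1 h2. lac h1 x \<otimes>\<^sub>k lac' h2 y))) = lacM h (phi t)"
proof -
  have "phi (swt t (\<lambda>x y. swt (d h) (\<lambda>h1 h2. lac h1 x \<otimes>\<^sub>k lac' h2 y))) = swt t (\<lambda>x y. swt (lam' y) (\<lambda>g y0. swt (d h) (\<lambda>z s. swt (d s) (\<lambda>h3 h4.
      lac (m h4 (m (Si g) (swt (d z) (\<lambda>a b. m (Si b) a)))) x \<otimes>\<^sub>k lac' h3 y0))))"
    by (simp add: phi_def)
  also have "\<dots> = lacM h (phi t)" by (simp add: Si_l0) (simp add: phi_def lacM_def)
  finally show ?thesis .
qed

text \<open>The coaction of S^{-1}(k)x begins with an S^{-1} of a component of k; the preceding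
  factor from the coaction of y is the next component, so the two cancel. The factor that remains on
  the right restores the product in the order of F(M) \<otimes> F(N).\<close>

lemma phi_lam: "lamM (phi t) = swt (FF.lamT t) (\<lambda>g y. g \<otimes>\<^sub>k phi y)"
proof -
  have "lamM (phi t) = swt t (\<lambda>x y. swt (lam x) (\<lambda>g x0. swt (lam' y) (\<lambda>k y0. swt (d k) (\<lambda>k1 s. swt (d s) (\<lambda>k2 z.
      m (swt (d z) (\<lambda>a b. m b (Si a))) (m g k1) \<otimes>\<^sub>k lac (Si k2) x0 \<otimes>\<^sub>k q' y0)))))"
    by (simp add: phi_def lamM_def)
  also have "\<dots> = swt (FF.lamT t) (\<lambda>g y. g \<otimes>\<^sub>k phi y)" by (simp add: Si_r0) (simp add: phi_def FF.lamT_def)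
  finally show ?thesis .
qed

text \<open>By colinearity of \<open>rho'\<close> the element acting on r is g3 S^{-1}(g2)
  S^{-1}(k2), with k from the coaction of r' and g from that of y'; the first two factors
  cancel.\<close>

lemma phi_rho: "rhoM (phi t) = swt (rhoF t) (\<lambda>r y. r \<otimes>\<^sub>k phi y)"
proof -
  have "rhoM (phi t) = swt t (\<lambda>x y. swt (rho x) (\<lambda>r x'. swt (rho' y) (\<lambda>r' y'. swt (lam' y') (\<lambda>g y0. swt (co r') (\<lambda>k r0. swt (d k) (\<lambda>k1 k2. swt (d g) (\<lambda>g1 z.
      mR r0 (ac (m (swt (d z) (\<lambda>a b. m b (Si a))) (Si k2)) r) \<otimes>\<^sub>k lac (m (Si g1) (Si k1)) x' \<otimes>\<^sub>k q' y0)))))))"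
    by (simp add: phi_def rhoM_def)
  also have "\<dots> = swt (rhoF t) (\<lambda>r y. r \<otimes>\<^sub>k phi y)" by (simp add: Si_r0) (simp add: phi_def rhoF_def)
  finally show ?thesis .
qed

lemma phi_phii: "phi (phii t) = FF.qT t"
proof -
  have "phi (phii t) = swt t (\<lambda>x y. swt (lam' y) (\<lambda>g y0. lac (swt (d g) (\<lambda>a b. m (Si b) a)) x \<otimes>\<^sub>k q' y0))"
    by (simp add: phi_def phii_def)
  then show ?thesis by (simp add: Si_l0) (simp add: FF.qT_def)
qed
lemma phii_phi: "phii (phi t) = FF.qT t"
proof -
  have "phii (phi t) = swt t (\<lambda>x y. swt (lam' y) (\<lambda>g y0. lac (swt (d g) (\<lambda>a b. m b (Si a))) x \<otimes>\<^sub>k q' y0))"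
    by (simp add: phi_def phii_def)
  then show ?thesis by (simp add: Si_r0) (simp add: FF.qT_def)
qed
text \<open>In the bosonization of the dual, \<Delta>(\<xi>) = \<xi>1 (\<xi>2)_{-1} \<otimes>
  (\<xi>2)_0. \<open>fs_co\<close> moves the coaction from \<xi>2 to r', and \<open>fs_m\<close>
  combines the two pairings into one with a product in R.\<close>

lemma baT_rhoF: "FF.baT (V.iR \<xi>) t = swt (rhoF t) (fs \<xi>)"
proof -
  have "FF.baT (V.iR \<xi>) t = swt t (\<lambda>x y. swt (rho x) (\<lambda>r x'. swt (rho' y) (\<lambda>r' y'. swt (dV \<xi>) (\<lambda>\<xi>1 \<xi>2. swt (cov \<xi>2) (\<lambda>g \<xi>20.
     fs \<xi>20 r' (swt (d g) (\<lambda>g1 g2. fs \<xi>1 (ac g1 r) (lac g2 x' \<otimes>\<^sub>k q' y'))))))))"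
    by (simp add: FF.baT_def X.xa_def Y.xa_def fs_comm)
  also have "\<dots> = swt t (\<lambda>x y. swt (rho x) (\<lambda>r x'. swt (rho' y) (\<lambda>r' y'. swt (dV \<xi>) (\<lambda>\<xi>1 \<xi>2. swt (co r') (\<lambda>g r0.
     fs \<xi>2 r0 (swt (d (Si g)) (\<lambda>g1 g2. fs \<xi>1 (ac g1 r) (lac g2 x' \<otimes>\<^sub>k q' y'))))))))"
    by (subst fs_co) simp_all
  also have "\<dots> = swt (rhoF t) (fs \<xi>)"
    by (simp add: rhoF_def fs_m fs_comm)
  finally show ?thesis .
qed
end

section \<open>Passage to the carriers\<close>

definition retr :: "(('a, 'k::field) univ \<Rightarrow> ('a, 'k) univ) \<Rightarrow> ('a, 'k) univ set \<Rightarrow> bool"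
  where "retr p V \<longleftrightarrow> lin p \<and> (\<forall>x. p x \<in> V) \<and> (\<forall>x\<in>V. p x = x)"

definition pj :: "('a, 'k::field) univ set \<Rightarrow> ('a, 'k) univ \<Rightarrow> ('a, 'k) univ"
  where "pj V = (SOME p. retr p V)"

lemma retr_pj: "univ.subspace V \<Longrightarrow> retr (pj V) V"
proof -
  assume "univ.subspace V"
  then have "\<exists>p. retr p V" using subspace_retract by (simp add: retr_def lin_iff)
  then show ?thesis unfolding pj_def by (rule someI_ex)
qed

lemma retrD: assumes "retr p V" shows "lin p" "p x \<in> V" "x \<in> V \<Longrightarrow> p x = x" "p (p x) = p x"
  using assms by (auto simp: retr_def)

lemma retr_subspace: assumes "retr p V" shows "univ.subspace V"
proof -
  note r = retrD[OF assms]
  have "0 \<in> V" using r(2)[of 0] by (simp add: lin_0[OF r(1)])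
  moreover have "x + y \<in> V" "c *\<^sub>k x \<in> V" if "x \<in> V" "y \<in> V" for x y c
    using r(2)[of "x + y"] r(2)[of "c *\<^sub>k x"] r(3)[OF that(1)] r(3)[OF that(2)]
    by (simp_all add: lin_add[OF r(1)] lin_scal[OF r(1)])
  ultimately show ?thesis by (simp add: univ.subspace_def)
qed

lemma lin_Linear: "lin f \<Longrightarrow> Vector_Spaces.linear scal scal f" by (simp add: lin_iff)

lemma subspace_tensor [simp]: "univ.subspace (V \<otimes>\<^sub>V W)"
  by (simp add: tensor_space_def univ.subspace_span)
lemma tens_in [simp]: "v \<in> V \<Longrightarrow> w \<in> W \<Longrightarrow> v \<otimes>\<^sub>k w \<in> V \<otimes>\<^sub>V W"
  by (auto simp: tensor_space_def intro!: univ.span_base)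
lemma subspace_scal: "univ.subspace V \<Longrightarrow> x \<in> V \<Longrightarrow> c *\<^sub>k x \<in> V"
  by (rule univ.subspace_scale)
lemma swt_in: "univ.subspace V \<Longrightarrow> (\<And>a b. f a b \<in> V) \<Longrightarrow> swt t f \<in> V"
  unfolding swt_def by (intro univ.subspace_sum univ.subspace_scale) (auto split: tree_ix.splits simp: univ.subspace_0)

lemma tensor_ext:
  assumes "t \<in> V \<otimes>\<^sub>V W" "lin f" "lin g" "\<And>v w. v \<in> V \<Longrightarrow> w \<in> W \<Longrightarrow> f (v \<otimes>\<^sub>k w) = g (v \<otimes>\<^sub>k w)"
  shows "f t = g t"
  using tens_ext[OF lin_Linear[OF assms(2)] lin_Linear[OF assms(3)] _ assms(1)] assms(4) by blast

lemma retr_tensor: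
  assumes "retr p V" "retr q W"
  shows "retr (\<lambda>t. swt t (\<lambda>a b. p a \<otimes>\<^sub>k q b)) (V \<otimes>\<^sub>V W)"
proof -
  note p = retrD[OF assms(1)] and q = retrD[OF assms(2)]
  note [simp] = lin_op[OF p(1)] lin_op[OF q(1)]
  have "swt t (\<lambda>a b. p a \<otimes>\<^sub>k q b) = t" if "t \<in> V \<otimes>\<^sub>V W" for t
    by (rule tensor_ext[OF that, of _ "\<lambda>t. t"]) (simp_all add: p q)
  then show ?thesis
    by (auto simp: retr_def p q intro!: swt_in)
qed

lemma swt_tensor_retr:
  assumes "retr p V" "retr q W" "t \<in> V \<otimes>\<^sub>V W" shows "swt t (\<lambda>a b. p a \<otimes>\<^sub>k q b) = t"
  using retrD(3)[OF retr_tensor[OF assms(1,2)] assms(3)] .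

lemma swt_tens_id:
  assumes "t \<in> V \<otimes>\<^sub>V W" shows "swt t (\<otimes>\<^sub>k) = t"
  by (rule tensor_ext[OF assms, of "\<lambda>t. swt t (\<otimes>\<^sub>k)" "\<lambda>t. t"]) simp_all

text \<open>The predicate under \<open>SOME\<close> depends on f only through its values on V
  \<times> W, so these are enough. As a congruence rule it supplies the memberships when the
  simplifier works below \<open>sw\<close>.\<close>

lemma sw_cong [cong]:
  assumes "V = V'" "W = W'" "t = t'" "\<And>a b. a \<in> V' \<Longrightarrow> b \<in> W' \<Longrightarrow> f a b = g a b"
  shows "sw V W t f = sw V' W' t' g"
proof -
  have "(\<lambda>L. Vector_Spaces.linear scal scal L \<and> (\<forall>v\<in>V'. \<forall>w\<in>W'. L (v \<otimes>\<^sub>k w) = f v w)) = (\<lambda>L. Vector_Spaces.linear scal scal L \<and> (\<forall>v\<in>V'. \<forall>w\<in>W'. L (v \<otimes>\<^sub>k w) = g v w))"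
    using assms(4) by auto
  then show ?thesis by (simp add: sw_def assms(1-3))
qed

lemma sw_form_cong [cong]:
  assumes "V = V'" "W = W'" "t = t'" "\<And>a b. a \<in> V' \<Longrightarrow> b \<in> W' \<Longrightarrow> f a b = g a b"
  shows "sw_form V W t f = sw_form V' W' t' g"
proof -
  have "(\<lambda>L. Vector_Spaces.linear scal times L \<and> (\<forall>v\<in>V'. \<forall>w\<in>W'. L (v \<otimes>\<^sub>k w) = f v w)) = (\<lambda>L. Vector_Spaces.linear scal times L \<and> (\<forall>v\<in>V'. \<forall>w\<in>W'. L (v \<otimes>\<^sub>k w) = g v w))"
    using assms(4) by auto
  then show ?thesis by (simp add: sw_form_def assms(1-3))
qed

lemma bilinear_on_bil: "bil f \<Longrightarrow> bilinear_on V W UNIV f"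
  by (auto simp: bil_def lin_def bilinear_on_def linear_on_def)

text \<open>The bridge from the given \<open>sw\<close> to \<open>swt\<close>: both are linear in t
  and agree on pure tensors.\<close>

lemma sw_swt [simp]:
  assumes "t \<in> V \<otimes>\<^sub>V W" "univ.subspace V" "univ.subspace W" "\<And>y. lin (\<lambda>x. f x y)" "\<And>x. lin (f x)"
  shows "sw V W t f = swt t f"
proof -
  have b: "bilinear_on V W UNIV f" using assms by (intro bilinear_on_bil) (simp add: bil_def)
  show ?thesis
  proof (rule tensor_ext[OF assms(1)])
    show "lin (\<lambda>t. sw V W t f)" using sw_tens(1)[OF assms(2,3) b] by (simp add: lin_iff)
  qed (simp_all add: sw_tens(2)[OF assms(2,3) b] assms)
qed

lemma sw_form_swt:
  assumes "t \<in> V \<otimes>\<^sub>V W" "univ.subspace V" "univ.subspace W" "\<And>y. linf (\<lambda>x. f x y)" "\<And>x. linf (f x)"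
  shows "sw_form V W t f *\<^sub>k w = swt t (\<lambda>a b. f a b *\<^sub>k w)"
proof -
  have b: "bilinear_form_on V W f" using assms(4,5) by (auto simp: bilinear_form_on_def linear_form_on_def linf_def)
  have "linf (\<lambda>t. sw_form V W t f)"
    using sw_form_tens(1)[OF assms(2,3) b] by (simp add: linf_def Vector_Spaces.linear_def module_hom_def module_hom_axioms_def)
  then show ?thesis
  proof (intro tensor_ext[OF assms(1), of "\<lambda>t. sw_form V W t f *\<^sub>k w"])
    fix a b assume "a \<in> V" "b \<in> W"
    then show "sw_form V W (a \<otimes>\<^sub>k b) f *\<^sub>k w = swt (a \<otimes>\<^sub>k b) (\<lambda>a b. f a b *\<^sub>k w)"
      using sw_form_tens(2)[OF assms(2,3) b] assms(4,5) by simp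
  qed (simp_all add: lin_swt_arg)
qed

lemma linear_on_lin: "linear_on V W f \<Longrightarrow> retr p V \<Longrightarrow> lin (\<lambda>x. f (p x))"
  using retrD[of p V] by (auto simp: linear_on_def lin_def)
lemma linear_form_on_linf: "linear_form_on V f \<Longrightarrow> retr p V \<Longrightarrow> linf (\<lambda>x. f (p x))"
  using retrD[of p V] by (auto simp: linear_form_on_def lin_def linf_def)
lemma bilinear_on_retr:
  assumes "bilinear_on V W X f" "retr p V" "retr q W" shows "bil (\<lambda>x y. f (p x) (q y))"
proof (rule bilI)
  fix y
  have "linear_on V X (\<lambda>v. f v (q y))" using assms(1) retrD(2)[OF assms(3)] by (simp add: bilinear_on_def)
  from linear_on_lin[OF this assms(2)] show "lin (\<lambda>x. f (p x) (q y))" .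
next
  fix x
  have "linear_on W X (f (p x))" using assms(1) retrD(2)[OF assms(2)] by (simp add: bilinear_on_def)
  from linear_on_lin[OF this assms(3)] show "lin (\<lambda>y. f (p x) (q y))" .
qed

section \<open>Total operations obtained from algebras and coalgebras on carriers\<close>

definition "tp A = pj (carr A)"
definition "tm A x y = mul A (tp A x) (tp A y)"
definition "td A x = comul A (tp A x)"
definition "te A x = counit A (tp A x)"
definition "tS A x = antipode A (tp A x)"
definition "tSi A x = antipode_inv A (tp A x)"

lemma total_algebra_on: assumes "algebra_on A" shows "total_algebra (tp A) (tm A) (one A)" and "retr (tp A) (carr A)"
proof -
  have A: "univ.subspace (carr A)" "bilinear_on (carr A) (carr A) (carr A) (mul A)" "one A \<in> carr A"
    "\<And>x y z. x \<in> carr A \<Longrightarrow> y \<in> carr A \<Longrightarrow> z \<in> carr A \<Longrightarrow> mul A (mul A x y) z = mul A x (mul A y z)"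
    "\<And>x. x \<in> carr A \<Longrightarrow> mul A (one A) x = x \<and> mul A x (one A) = x"
    using assms by (auto simp: algebra_on_def)
  show r: "retr (tp A) (carr A)" unfolding tp_def by (rule retr_pj[OF A(1)])
  note r' [simp] = retrD(2-4)[OF r]
  have [simp]: "x \<in> carr A \<Longrightarrow> y \<in> carr A \<Longrightarrow> mul A x y \<in> carr A" for x y
    using A(2) by (auto simp: bilinear_on_def linear_on_def)
  show "total_algebra (tp A) (tm A) (one A)"
    by unfold_locales (use A r' in \<open>simp_all add: tm_def retrD(1)[OF r] bilinear_on_retr[OF A(2) r r] tm_def[abs_def]\<close>)
qed

lemma total_coalgebra_on: assumes "coalgebra_on A" shows "total_coalgebra (tp A) (td A) (te A)" and "retr (tp A) (carr A)"
    "\<And>x. td A x \<in> carr A \<otimes>\<^sub>V carr A"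
proof -
  have A: "univ.subspace (carr A)" "linear_on (carr A) (carr A \<otimes>\<^sub>V carr A) (comul A)" "linear_form_on (carr A) (counit A)"
    "\<And>x. x \<in> carr A \<Longrightarrow> sw2 A x (\<lambda>x' x3. sw2 A x' (\<lambda>x1 x2. x1 \<otimes>\<^sub>k x2 \<otimes>\<^sub>k x3)) = sw3 A x (\<lambda>x1 x2 x3. x1 \<otimes>\<^sub>k x2 \<otimes>\<^sub>k x3)"
    "\<And>x. x \<in> carr A \<Longrightarrow> sw2 A x (\<lambda>x1 x2. counit A x1 *\<^sub>k x2) = x \<and> sw2 A x (\<lambda>x1 x2. counit A x2 *\<^sub>k x1) = x"
    using assms by (auto simp: coalgebra_on_def)
  show r: "retr (tp A) (carr A)" unfolding tp_def by (rule retr_pj[OF A(1)])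
  note r' [simp] = retrD(2-4)[OF r]
  show td: "\<And>x. td A x \<in> carr A \<otimes>\<^sub>V carr A" using A(2) by (auto simp: linear_on_def td_def)
  have l: "lin (td A)" "linf (te A)" using linear_on_lin[OF A(2) r] linear_form_on_linf[OF A(3) r] by (simp_all add: td_def[abs_def] te_def[abs_def])
  have [simp]: "x \<in> carr A \<Longrightarrow> comul A x = td A x" "x \<in> carr A \<Longrightarrow> counit A x = te A x" for x
    by (simp_all add: td_def te_def)
  have a: "td A (tp A x) = td A x" "te A (tp A x) = te A x" for x by (simp_all only: td_def te_def r'(3))
  note [simp] = lin_op[OF l(1)] linf_comp[OF l(2)]
  show "total_coalgebra (tp A) (td A) (te A)"
  proof unfold_locales
    fix x
    show "swt (td A x) (\<lambda>a b. swt (td A a) (\<lambda>a1 a2. a1 \<otimes>\<^sub>k a2 \<otimes>\<^sub>k b)) = swt (td A x) (\<lambda>a b. swt (td A b) (\<lambda>b1 b2. a \<otimes>\<^sub>k b1 \<otimes>\<^sub>k b2))"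
      using A(4)[OF r'(1)[of x]] by (simp add: sw2_def sw3_def td A(1) a)
    show "swt (td A x) (\<lambda>a b. te A a *\<^sub>k b) = tp A x"
      using A(5)[OF r'(1)[of x]] by (simp add: sw2_def td A(1) a)
    show "swt (td A x) (\<lambda>a b. te A b *\<^sub>k a) = tp A x"
      using A(5)[OF r'(1)[of x]] by (simp add: sw2_def td A(1) a)
    show "swt (td A x) (\<lambda>a b. tp A a \<otimes>\<^sub>k tp A b) = td A x" by (rule swt_tensor_retr[OF r r td])
  qed (simp_all add: retrD(1)[OF r] l a)
qed

text \<open>S = S * (id * S') = (S * id) * S' = S' for the convolution product.\<close>

lemma convolution_inverse_unique:
  assumes "total_algebra p m u" "total_coalgebra p d e" "lin S" "lin S'"
    and "\<And>x. p (S x) = S x" "\<And>x. p (S' x) = S' x" "\<And>x. S (p x) = S x" "\<And>x. S' (p x) = S' x"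
    and l: "\<And>x. swt (d x) (\<lambda>a b. m (S a) b) = e x *\<^sub>k u" and r: "\<And>x. swt (d x) (\<lambda>a b. m a (S' b)) = e x *\<^sub>k u"
  shows "S x = S' x"
proof -
  interpret total_algebra p m u by fact
  interpret total_coalgebra p d e by fact
  note [simp] = lin_op[OF assms(3)] lin_op[OF assms(4)]
  have "S x = swt (d x) (\<lambda>a b. m (S a) (swt (d b) (\<lambda>a b. m a (S' b))))"
    by (simp only: r) (simp add: assms)
  also have "\<dots> = swt (d x) (\<lambda>a b. m (swt (d a) (\<lambda>a b. m (S a) b)) (S' b))"
    by simp
  also have "\<dots> = S' x"
    by (simp only: l) (simp add: assms)
  finally show ?thesis .
qed

lemma swt_mem [simp]: "univ.subspace V \<Longrightarrow> (\<And>a b. f a b \<in> V) \<Longrightarrow> swt t f \<in> V"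
  by (rule swt_in)

text \<open>Membership has to be known only for arguments in V and W: a projection onto Z fixes the
  sum, because it does so on pure tensors.\<close>

lemma swt_in_on:
  assumes "t \<in> V \<otimes>\<^sub>V W" "univ.subspace Z" "\<And>y. lin (\<lambda>x. f x y)" "\<And>x. lin (f x)" "\<And>a b. a \<in> V \<Longrightarrow> b \<in> W \<Longrightarrow> f a b \<in> Z"
  shows "swt t f \<in> Z"
proof -
  obtain q where q: "retr q Z" using retr_pj[OF assms(2)] by blast
  note [simp] = lin_op[OF retrD(1)[OF q]]
  have "q (swt t f) = swt t f"
    by (rule tensor_ext[OF assms(1)]) (simp_all add: assms retrD(3)[OF q])
  with retrD(2)[OF q, of "swt t f"] show ?thesis by simp
qed

lemma retr_mem_iff: assumes "retr p V" shows "x \<in> V \<longleftrightarrow> p x = x"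
proof
  assume "p x = x"
  with retrD(2)[OF assms, of x] show "x \<in> V" by simp
qed (rule retrD(3)[OF assms])

text \<open>Uniqueness gives \<open>THE\<close> in \<open>antipode\<close> its meaning. Convolution
  inverses agree on the carrier, and being extensional they agree everywhere.\<close>

lemma antipode_on:
  assumes alg: "algebra_on A" and coalg: "coalgebra_on A" and ex: "\<exists>S. is_antipode A S"
  shows "is_antipode A (antipode A)" "lin (tS A)" "\<And>x. tS A x \<in> carr A" "\<And>x. tS A (tp A x) = tS A x"
    "\<And>x. swt (td A x) (\<lambda>a b. tm A (tS A a) b) = te A x *\<^sub>k one A"
    "\<And>x. swt (td A x) (\<lambda>a b. tm A a (tS A b)) = te A x *\<^sub>k one A"
    and antipode_eqI: "\<And>S. is_antipode A S \<Longrightarrow> antipode A = S"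
proof -
  interpret total_algebra "tp A" "tm A" "one A" by (rule total_algebra_on[OF alg])
  interpret total_coalgebra "tp A" "td A" "te A" by (rule total_coalgebra_on[OF coalg])
  note r = total_algebra_on(2)[OF alg] and td = total_coalgebra_on(3)[OF coalg]
  note r' [simp] = retrD(2,3)[OF r]
  have sub [simp]: "univ.subspace (carr A)" using r by (rule retr_subspace)
  have [simp]: "x \<in> carr A \<Longrightarrow> y \<in> carr A \<Longrightarrow> mul A x y = tm A x y"
    "x \<in> carr A \<Longrightarrow> comul A x = td A x" "x \<in> carr A \<Longrightarrow> counit A x = te A x" for x y
    by (simp_all add: tm_def td_def te_def)
  have tot: "lin (\<lambda>x. S (tp A x))" "S (tp A x) \<in> carr A"
    "swt (td A x) (\<lambda>a b. tm A (S (tp A a)) b) = te A x *\<^sub>k one A"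
    "swt (td A x) (\<lambda>a b. tm A a (S (tp A b))) = te A x *\<^sub>k one A" if S: "is_antipode A S" for S x
  proof -
    have l: "linear_on (carr A) (carr A) S" and S2: "\<And>x. x \<in> carr A \<Longrightarrow> sw2 A x (\<lambda>x1 x2. mul A (S x1) x2) = counit A x *\<^sub>k one A"
      "\<And>x. x \<in> carr A \<Longrightarrow> sw2 A x (\<lambda>x1 x2. mul A x1 (S x2)) = counit A x *\<^sub>k one A"
      using S by (simp_all add: is_antipode_def)
    show lS: "lin (\<lambda>x. S (tp A x))" using linear_on_lin[OF l r] .
    show mem: "S (tp A x) \<in> carr A" for x using l by (simp add: linear_on_def)
    define S' where "S' x = S (tp A x)" for x
    have lS': "lin S'" using lS by (simp only: S'_def[abs_def])
    have [simp]: "x \<in> carr A \<Longrightarrow> S x = S' x" "S' x \<in> carr A" for x using mem by (simp_all add: S'_def)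
    note [simp] = lin_op[OF lS']
    have "swt (td A x) (\<lambda>a b. tm A (S' a) b) = te A x *\<^sub>k one A" "swt (td A x) (\<lambda>a b. tm A a (S' b)) = te A x *\<^sub>k one A"
      using S2[OF r'(1)[of x]] by (simp_all add: sw2_def td)
    then show "swt (td A x) (\<lambda>a b. tm A (S (tp A a)) b) = te A x *\<^sub>k one A"
      "swt (td A x) (\<lambda>a b. tm A a (S (tp A b))) = te A x *\<^sub>k one A"
      by (simp_all only: S'_def)
  qed
  have uniq: "S = S'" if S: "is_antipode A S" and S': "is_antipode A S'" for S S'
  proof
    fix x
    have "S (tp A x) = S' (tp A x)"
      by (rule convolution_inverse_unique[of "tp A" "tm A" "one A" "td A" "te A" "\<lambda>x. S (tp A x)" "\<lambda>x. S' (tp A x)", OF total_algebra_axioms total_coalgebra_axioms])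
        (use tot[OF S] tot[OF S'] in \<open>simp_all\<close>)
    then show "S x = S' x"
    proof (cases "x \<in> carr A")
      case False
      then show ?thesis using S S' by (simp add: is_antipode_def extensional_def)
    qed simp
  qed
  show eqI: "\<And>S. is_antipode A S \<Longrightarrow> antipode A = S"
    unfolding antipode_def by (rule the_equality) (auto dest: uniq)
  then show ant: "is_antipode A (antipode A)" using ex by auto
  note t = tot[OF ant]
  have tS: "tS A = (\<lambda>x. antipode A (tp A x))" by (simp add: tS_def fun_eq_iff)
  show "lin (tS A)" using t(1) by (simp only: tS)
  show "\<And>x. tS A x \<in> carr A" using t(2) by (simp only: tS)
  show "\<And>x. tS A (tp A x) = tS A x" by (simp only: tS p_p)
  show "\<And>x. swt (td A x) (\<lambda>a b. tm A (tS A a) b) = te A x *\<^sub>k one A" using t(3) by (simp only: tS)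
  show "\<And>x. swt (td A x) (\<lambda>a b. tm A a (tS A b)) = te A x *\<^sub>k one A" using t(4) by (simp only: tS)
qed

lemma antipode_inv_on:
  assumes r: "retr (tp A) (carr A)" and l: "lin (tS A)" and bij: "bijective_antipode A"
  shows "lin (tSi A)" "\<And>x. tSi A x \<in> carr A" "\<And>x. tSi A (tp A x) = tSi A x" "\<And>x. tS A (tSi A x) = tp A x" "\<And>x. tSi A (tS A x) = tp A x"
proof -
  note r' [simp] = retrD(2-4)[OF r]
  have inj: "inj_on (antipode A) (carr A)" and im: "antipode A ` carr A = carr A" using bij by (auto simp: bijective_antipode_def bij_betw_def)
  show mem: "\<And>x. tSi A x \<in> carr A"
    unfolding tSi_def antipode_inv_def by (rule the_inv_into_into[OF inj]) (simp_all add: im)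
  show "\<And>x. tSi A (tp A x) = tSi A x" by (simp only: tSi_def r'(3))
  show 1: "tS A (tSi A x) = tp A x" for x
  proof -
    have "tp A (tSi A x) = tSi A x" using mem by (rule r'(2))
    then have "tS A (tSi A x) = antipode A (tSi A x)" by (simp only: tS_def)
    also have "\<dots> = tp A x"
      unfolding tSi_def antipode_inv_def by (rule f_the_inv_into_f[OF inj]) (simp only: im r'(1))
    finally show ?thesis .
  qed
  have ant: "antipode A x \<in> carr A" if "x \<in> carr A" for x using im that by blast
  show 2: "tSi A (tS A x) = tp A x" for x
  proof -
    have "tp A (antipode A (tp A x)) = antipode A (tp A x)" by (rule r'(2)[OF ant[OF r'(1)]])
    then show ?thesis
      unfolding tSi_def tS_def antipode_inv_def by (simp only: the_inv_into_f_f[OF inj r'(1)])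
  qed
  show "lin (tSi A)"
    unfolding lin_def
  proof safe
    fix x y c
    have *: "tSi A z = w" if "tS A w = tp A z" "w \<in> carr A" for z w
    proof -
      have "tSi A z = tSi A (tp A z)" by (simp only: tSi_def r'(3))
      also have "\<dots> = tp A w" by (simp only: that(1)[symmetric] 2)
      finally show ?thesis using that(2) by (simp only: r'(2))
    qed
    show "tSi A (x + y) = tSi A x + tSi A y"
      by (rule *) (simp_all add: lin_add[OF l] 1 lin_add[OF retrD(1)[OF r]] mem univ.subspace_add[OF retr_subspace[OF r]])
    show "tSi A (c *\<^sub>k x) = c *\<^sub>k tSi A x"
      by (rule *) (simp_all add: lin_scal[OF l] 1 lin_scal[OF retrD(1)[OF r]] mem univ.subspace_scale[OF retr_subspace[OF r]])
  qed
qed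

section \<open>The given Hopf algebras H and R as total structures\<close>

locale hopf_bij = hopf_algebra H for H :: "('a, 'k::field) bialg_data" +
  assumes bij_H: "bijective_antipode H"
begin

lemma retr_H: "retr (tp H) (carr H)" by (rule total_algebra_on(2)[OF algebra])
lemma subspace_H [simp]: "univ.subspace (carr H)" using retr_H by (rule retr_subspace)
lemmas retr_H' [simp] = retrD(2,3)[OF retr_H]
lemma H_conv [simp]: "x \<in> carr H \<Longrightarrow> y \<in> carr H \<Longrightarrow> mul H x y = tm H x y"
    "x \<in> carr H \<Longrightarrow> comul H x = td H x" "x \<in> carr H \<Longrightarrow> counit H x = te H x"
    "x \<in> carr H \<Longrightarrow> antipode H x = tS H x" "x \<in> carr H \<Longrightarrow> antipode_inv H x = tSi H x"
  by (simp_all add: tm_def td_def te_def tS_def tSi_def)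
lemmas td_H [simp] = total_coalgebra_on(3)[OF coalgebra]
lemmas ant_H = antipode_on[OF algebra coalgebra antipode_ex]
lemmas inv_H = antipode_inv_on[OF retr_H ant_H(2) bij_H]
lemma one_H [simp]: "one H \<in> carr H" using algebra by (simp add: algebra_on_def)
lemma tm_H [simp]: "tm H x y \<in> carr H"
  using algebra unfolding algebra_on_def bilinear_on_def linear_on_def tm_def by simp
lemmas tS_H [simp] = ant_H(3) inv_H(2)

sublocale H: total_hopf_bij "tp H" "tm H" "one H" "td H" "te H" "tS H" "tSi H"
proof -
  interpret total_algebra "tp H" "tm H" "one H" by (rule total_algebra_on[OF algebra])
  interpret total_coalgebra "tp H" "td H" "te H" by (rule total_coalgebra_on[OF coalgebra])
  have S_lin [simp]: "lin (tS H)" "lin (tSi H)" by (rule ant_H(2) inv_H(1))+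
  show "total_hopf_bij (tp H) (tm H) (one H) (td H) (te H) (tS H) (tSi H)"
  proof unfold_locales
    fix x y
    show "td H (tm H x y) = swt (td H x) (\<lambda>x1 x2. swt (td H y) (\<lambda>y1 y2. tm H x1 y1 \<otimes>\<^sub>k tm H x2 y2))"
      using comul_mul[of "tp H x" "tp H y"] by (simp add: sw2_def)
    show "td H (one H) = one H \<otimes>\<^sub>k one H" using comul_one by simp
    show "te H (tm H x y) = te H x * te H y" using counit_mul[of "tp H x" "tp H y"] by simp
    show "te H (one H) = 1" using counit_one by simp
  qed (use ant_H(3-6) inv_H in \<open>simp_all\<close>)
qed
end

text \<open>Colinearity of the counit of R is an equation in H \<otimes> \<open>unit_space\<close>;
  this removes the second factor.\<close>

lemma tens_unit_vec_inj: assumes "x \<otimes>\<^sub>k unit_vec = y \<otimes>\<^sub>k (unit_vec :: ('a, 'k::field) univ)" shows "x = y"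
proof (rule poly_mapping_eqI)
  fix i
  show "Poly_Mapping.lookup x i = Poly_Mapping.lookup y i"
    using arg_cong[OF assms, of "\<lambda>t. Poly_Mapping.lookup t (PairIx i UnitIx)"]
    by (simp add: lookup_tens_Pair unit_vec_def lookup_single)
qed
lemma unit_vec_mem [simp]: "unit_vec \<in> unit_space" "c *\<^sub>k unit_vec \<in> unit_space" "univ.subspace unit_space"
  by (simp_all add: unit_space_def univ.span_base univ.span_scale univ.subspace_span)
lemma unit_coeff_unit_vec [simp]: "unit_coeff unit_vec = 1" "unit_coeff (c *\<^sub>k x) = c * unit_coeff x"
  by (simp_all add: unit_coeff_def unit_vec_def lookup_single)
lemmas lin_unit_coeff [simp] = linf_comp[OF linf_unit_coeff] linf_unit_coeff

definition "thact H R h x = hact R (tp H h) (tp R x)"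
definition "thco R x = hcoact R (tp R x)"

locale yd_hopf_bij = yd_hopf_algebra H R + hopf_bij H
  for H :: "('a, 'k::field) bialg_data" and R :: "('a, 'k) yd_bialg_data" +
  assumes bij_R: "bijective_antipode R"
begin
lemma retr_R: "retr (tp R) (carr R)" by (rule total_algebra_on(2)[OF algebra_R])
lemma subspace_R [simp]: "univ.subspace (carr R)" using retr_R by (rule retr_subspace)
lemmas retr_R' [simp] = retrD(2,3)[OF retr_R]
lemma ant_ex: "\<exists>S. is_antipode R S" using antipode_ex_R by blast
lemma R_conv [simp]: "x \<in> carr R \<Longrightarrow> y \<in> carr R \<Longrightarrow> mul R x y = tm R x y"
    "x \<in> carr R \<Longrightarrow> comul R x = td R x" "x \<in> carr R \<Longrightarrow> counit R x = te R x"
    "x \<in> carr R \<Longrightarrow> h \<in> carr H \<Longrightarrow> hact R h x = thact H R h x" "x \<in> carr R \<Longrightarrow> hcoact R x = thco R x"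
  by (simp_all add: tm_def td_def te_def thact_def thco_def)
lemmas td_R [simp] = total_coalgebra_on(3)[OF coalgebra_R]
lemmas ant_R = antipode_on[OF algebra_R coalgebra_R ant_ex]
lemmas inv_R = antipode_inv_on[OF retr_R ant_R(2) bij_R]
lemma one_R [simp]: "one R \<in> carr R" using algebra_R by (simp add: algebra_on_def)
lemma tm_R [simp]: "tm R x y \<in> carr R"
  using algebra_R unfolding algebra_on_def bilinear_on_def linear_on_def tm_def by simp
lemmas tS_R [simp] = ant_R(3) inv_R(2)
lemma yd_R: "left_module H (yd_obj R)" "left_comodule H (yd_obj R)" using yd by (simp_all add: left_yd_def)
lemma thact_R [simp]: "thact H R h x \<in> carr R"
  using yd_R(1) unfolding left_module_def bilinear_on_def linear_on_def thact_def yd_obj_def by simp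
lemma thco_R [simp]: "thco R x \<in> carr H \<otimes>\<^sub>V carr R"
  using yd_R(2) unfolding left_comodule_def linear_on_def thco_def yd_obj_def by simp

lemmas swt_in_R [simp] = swt_in_on[OF td_H] swt_in_on[OF td_R] swt_in_on[OF thco_R]

lemma R_lin: "bil (thact H R)" "lin (thco R)" "lin (tS R)" "lin (tSi R)"
proof -
  have b: "bilinear_on (carr H) (carr R) (carr R) (hact R)" and c: "linear_on (carr R) (carr H \<otimes>\<^sub>V carr R) (hcoact R)"
    using yd_R unfolding left_module_def left_comodule_def yd_obj_def by simp_all
  show "bil (thact H R)" unfolding thact_def[abs_def] by (rule bilinear_on_retr[OF b retr_H retr_R])
  show "lin (thco R)" unfolding thco_def[abs_def] by (rule linear_on_lin[OF c retr_R])
  show "lin (tS R)" "lin (tSi R)" by (rule ant_R(2) inv_R(1))+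
qed

text \<open>Each axiom is the given one at projected elements. The conditions that multiplication,
  unit, comultiplication and counit are morphisms are evaluated at pure tensors or at
  \<open>unit_vec\<close>, where \<open>left_tensor\<close> and \<open>left_unit\<close> can be
  computed.\<close>

lemma total_yd_hopf_R: "total_yd_hopf (tp H) (tm H) (one H) (td H) (te H) (tS H) (tSi H) (tp R) (tm R) (one R) (td R) (te R) (thact H R) (thco R) (tS R) (tSi R)"
proof -
  interpret R: total_algebra "tp R" "tm R" "one R" by (rule total_algebra_on[OF algebra_R])
  interpret R: total_coalgebra "tp R" "td R" "te R" by (rule total_coalgebra_on[OF coalgebra_R])
  note [simp] = bil_op[OF R_lin(1)] lin_op[OF R_lin(2)] lin_op[OF R_lin(3)] lin_op[OF R_lin(4)]
  have abs: "thact H R (tp H h) x = thact H R h x" "thact H R h (tp R x) = thact H R h x" "thco R (tp R x) = thco R x" for h x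
    by (simp_all only: thact_def thco_def retrD(4)[OF retr_H] retrD(4)[OF retr_R])
  show ?thesis
  proof unfold_locales
    show "bil (thact H R)" "lin (thco R)" "lin (tS R)" "lin (tSi R)" by (rule R_lin)+
    fix h g x y
    show "thact H R (tp H h) x = thact H R h x" "thact H R h (tp R x) = thact H R h x" "thco R (tp R x) = thco R x" by (fact abs)+
    show "thact H R (tm H g h) x = thact H R g (thact H R h x)" "thact H R (one H) x = tp R x"
    proof -
      have "\<And>a b x. a \<in> carr H \<Longrightarrow> b \<in> carr H \<Longrightarrow> x \<in> carr R \<Longrightarrow> hact R (mul H a b) x = hact R a (hact R b x)" "\<And>x. x \<in> carr R \<Longrightarrow> hact R (one H) x = x"
        using yd_R by (simp_all add: left_module_def yd_obj_def del: H_conv R_conv)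
      from this(1)[of "tp H g" "tp H h" "tp R x"] this(2)[of "tp R x"]
      show "thact H R (tm H g h) x = thact H R g (thact H R h x)" "thact H R (one H) x = tp R x"
        by (simp_all add: abs)
    qed
    show "swt (thco R x) (\<lambda>g y. tp H g \<otimes>\<^sub>k tp R y) = thco R x" by (rule swt_tensor_retr[OF retr_H retr_R thco_R])
    show "swt (thco R x) (\<lambda>g y. swt (thco R y) (\<lambda>g' y'. g \<otimes>\<^sub>k g' \<otimes>\<^sub>k y')) = swt (thco R x) (\<lambda>g y. swt (td H g) (\<lambda>g1 g2. g1 \<otimes>\<^sub>k g2 \<otimes>\<^sub>k y))"
      "swt (thco R x) (\<lambda>g y. te H g *\<^sub>k y) = tp R x"
    proof -
      have "\<forall>x\<in>carr R. sw (carr H) (carr R) (hcoact R x) (\<lambda>c x0. sw2 H c (\<lambda>c1 c2. c1 \<otimes>\<^sub>k c2 \<otimes>\<^sub>k x0)) = sw (carr H) (carr R) (hcoact R x) (\<lambda>c x0. c \<otimes>\<^sub>k hcoact R x0)"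
        "\<forall>x\<in>carr R. sw (carr H) (carr R) (hcoact R x) (\<lambda>c x0. counit H c *\<^sub>k x0) = x"
        using yd_R unfolding left_comodule_def yd_obj_def by simp_all
      from bspec[OF this(1), of "tp R x"] bspec[OF this(2), of "tp R x"]
      have "swt (thco R x) (\<lambda>g y. swt (td H g) (\<lambda>g1 g2. g1 \<otimes>\<^sub>k g2 \<otimes>\<^sub>k y)) = swt (thco R x) (\<lambda>g y. g \<otimes>\<^sub>k thco R y)"
        and 2: "swt (thco R x) (\<lambda>g y. te H g *\<^sub>k y) = tp R x"
        by (simp_all add: sw2_def abs)
      moreover have "g \<otimes>\<^sub>k thco R y = swt (thco R y) (\<lambda>g' y'. g \<otimes>\<^sub>k g' \<otimes>\<^sub>k y')" for g y
        using arg_cong[OF swt_tens_id[OF thco_R, of y], of "\<lambda>t. g \<otimes>\<^sub>k t"] by simp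
      ultimately show "swt (thco R x) (\<lambda>g y. swt (thco R y) (\<lambda>g' y'. g \<otimes>\<^sub>k g' \<otimes>\<^sub>k y')) = swt (thco R x) (\<lambda>g y. swt (td H g) (\<lambda>g1 g2. g1 \<otimes>\<^sub>k g2 \<otimes>\<^sub>k y))"
        by simp
      show "swt (thco R x) (\<lambda>g y. te H g *\<^sub>k y) = tp R x" by (rule 2)
    qed
    show "thco R (thact H R h x) = swt (thco R x) (\<lambda>g y. swt (td H h) (\<lambda>h1 t. swt (td H t) (\<lambda>h2 h3. tm H h1 (tm H g (tS H h3)) \<otimes>\<^sub>k thact H R h2 y)))"
    proof -
      have "\<forall>b\<in>carr H. \<forall>x\<in>carr R. hcoact R (hact R b x) = sw3 H b (\<lambda>b1 b2 b3. sw (carr H) (carr R) (hcoact R x) (\<lambda>c x0. mul H (mul H (id b1) c) (id (antipode H b3)) \<otimes>\<^sub>k hact R b2 x0))"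
        using yd unfolding left_yd_def by (simp add: yd_obj_def)
      from bspec[OF bspec[OF this, of "tp H h"], of "tp R x"] show ?thesis
        by (simp add: sw3_def sw2_def abs swt_swap[where s = "thco R x"])
    qed
    have mh: "thact H R h (sw (carr R) (carr R) t (mul R)) = sw (carr R) (carr R) (mact (left_tensor H H (yd_obj R) (yd_obj R)) h t) (mul R)"
      "thco R (sw (carr R) (carr R) t (mul R)) = sw (carr H) (carr R \<otimes>\<^sub>V carr R) (mcoact (left_tensor H H (yd_obj R) (yd_obj R)) t) (\<lambda>c x0. c \<otimes>\<^sub>k sw (carr R) (carr R) x0 (mul R))"
      if "h \<in> carr H" "t \<in> carr R \<otimes>\<^sub>V carr R" for h t
      using mul_hom that unfolding left_hom_def linear_on_def by (simp_all add: yd_obj_def left_tensor_def)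
    show "thact H R h (tm R x y) = swt (td H h) (\<lambda>h1 h2. tm R (thact H R h1 x) (thact H R h2 y))"
      using mh(1)[of "tp H h" "tp R x \<otimes>\<^sub>k tp R y"] by (simp add: left_tensor_def restrict2_def yd_obj_def sw2_def abs)
    show "thco R (tm R x y) = swt (thco R x) (\<lambda>g x0. swt (thco R y) (\<lambda>g' y0. tm H g g' \<otimes>\<^sub>k tm R x0 y0))"
      using mh(2)[of "one H" "tp R x \<otimes>\<^sub>k tp R y"] by (simp add: left_tensor_def restrict2_def yd_obj_def sw2_def abs)
    have oh: "unit_coeff (mact (left_unit H H) h unit_vec :: ('a, 'k) univ) *\<^sub>k one R = thact H R h (one R)"
        "thco R (one R) = sw (carr H) unit_space (mcoact (left_unit H H) unit_vec) (\<lambda>c x0. c \<otimes>\<^sub>k unit_coeff x0 *\<^sub>k one R)"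
      if "h \<in> carr H" for h
    proof -
      have "\<forall>b\<in>carr H. \<forall>x\<in>unit_space. unit_coeff (mact (left_unit H H) b x) *\<^sub>k one R = hact R b (unit_coeff x *\<^sub>k one R)"
        "\<forall>x\<in>unit_space. hcoact R (unit_coeff x *\<^sub>k one R) = sw (carr H) unit_space (mcoact (left_unit H H) x) (\<lambda>c x0. c \<otimes>\<^sub>k unit_coeff x0 *\<^sub>k one R)"
        using one_hom unfolding left_hom_def yd_obj_def by (simp_all add: left_unit_def)
      from bspec[OF bspec[OF this(1) that] unit_vec_mem(1)] bspec[OF this(2) unit_vec_mem(1)] that
      show "unit_coeff (mact (left_unit H H) h unit_vec :: ('a, 'k) univ) *\<^sub>k one R = thact H R h (one R)"
        "thco R (one R) = sw (carr H) unit_space (mcoact (left_unit H H) unit_vec) (\<lambda>c x0. c \<otimes>\<^sub>k unit_coeff x0 *\<^sub>k one R)"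
        by simp_all
    qed
    show "thact H R h (one R) = te H h *\<^sub>k one R"
      using oh(1)[of "tp H h"] by (simp add: left_unit_def restrict2_def abs)
    show "thco R (one R) = one H \<otimes>\<^sub>k one R"
      using oh(2)[OF one_H] by (simp add: left_unit_def)
    have ch: "td R (thact H R h x) = mact (left_tensor H H (yd_obj R) (yd_obj R)) h (td R x)"
       "mcoact (left_tensor H H (yd_obj R) (yd_obj R)) (td R x) = sw (carr H) (carr R) (thco R x) (\<lambda>c x0. c \<otimes>\<^sub>k td R x0)"
       if "h \<in> carr H" "x \<in> carr R" for h x
      using comul_hom that unfolding left_hom_def by (simp_all add: yd_obj_def)
    show "td R (thact H R h x) = swt (td R x) (\<lambda>x1 x2. swt (td H h) (\<lambda>h1 h2. thact H R h1 x1 \<otimes>\<^sub>k thact H R h2 x2))"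
      using ch(1)[of "tp H h" "tp R x"] by (simp add: left_tensor_def restrict2_def yd_obj_def sw2_def abs swt_swap[where s = "td R x"])
    have "g \<otimes>\<^sub>k td R y = swt (td R y) (\<lambda>y1 y2. g \<otimes>\<^sub>k y1 \<otimes>\<^sub>k y2)" for g y
      using arg_cong[OF swt_tens_id[OF td_R, of y], of "\<lambda>t. g \<otimes>\<^sub>k t"] by simp
    with ch(2)[of "one H" "tp R x"] show "swt (thco R x) (\<lambda>g y. swt (td R y) (\<lambda>y1 y2. g \<otimes>\<^sub>k y1 \<otimes>\<^sub>k y2)) = swt (td R x) (\<lambda>x1 x2. swt (thco R x1) (\<lambda>g y1. swt (thco R x2) (\<lambda>g' y2. tm H g g' \<otimes>\<^sub>k y1 \<otimes>\<^sub>k y2)))"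
      by (simp add: left_tensor_def yd_obj_def abs)
    have uh: "te R (thact H R h x) *\<^sub>k unit_vec = (mact (left_unit H H) h (te R x *\<^sub>k unit_vec) :: ('a, 'k) univ)"
       "mcoact (left_unit H H) (te R x *\<^sub>k unit_vec) = sw (carr H) (carr R) (thco R x) (\<lambda>c x0. c \<otimes>\<^sub>k te R x0 *\<^sub>k unit_vec)"
       if "h \<in> carr H" "x \<in> carr R" for h x
      using counit_hom that unfolding left_hom_def by (simp_all add: yd_obj_def)
    have "te R (thact H R h x) *\<^sub>k unit_vec = (te H h * te R x) *\<^sub>k (unit_vec :: ('a, 'k) univ)"
      using uh(1)[of "tp H h" "tp R x"] by (simp add: left_unit_def restrict2_def abs)
    then show "te R (thact H R h x) = te H h * te R x" by (simp only: scal_unit_vec_iff)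
    have "swt (thco R x) (\<lambda>g y. te R y *\<^sub>k g) \<otimes>\<^sub>k unit_vec = (te R x *\<^sub>k one H) \<otimes>\<^sub>k unit_vec"
      using uh(2)[of "one H" "tp R x"] by (simp add: left_unit_def abs)
    then show "swt (thco R x) (\<lambda>g y. te R y *\<^sub>k g) = te R x *\<^sub>k one H" by (rule tens_unit_vec_inj)
    show "td R (tm R x y) = swt (td R x) (\<lambda>x1 x2. swt (td R y) (\<lambda>y1 y2. swt (thco R x2) (\<lambda>g x20. tm R x1 (thact H R g y1) \<otimes>\<^sub>k tm R x20 y2)))"
      using comul_mul_R[of "tp R x" "tp R y"] by (simp add: sw2_def yd_braiding_def yd_obj_def)
    show "td R (one R) = one R \<otimes>\<^sub>k one R" using comul_one_R by simp
    show "te R (tm R x y) = te R x * te R y" using counit_mul_R[of "tp R x" "tp R y"] by simp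
    show "te R (one R) = 1" using counit_one_R by simp
    show "lin (tp R)" by (rule retrD(1)[OF retr_R])
    show "tp R (tp R x) = tp R x" "tp R (thact H R h x) = thact H R h x" "tp R (tS R x) = tS R x" "tp R (tSi R x) = tSi R x"
      by simp_all
    show "tS R (tp R x) = tS R x" "swt (td R x) (\<lambda>a b. tm R (tS R a) b) = te R x *\<^sub>k one R" "swt (td R x) (\<lambda>a b. tm R a (tS R b)) = te R x *\<^sub>k one R"
      by (rule ant_R)+
    show "tSi R (tp R x) = tSi R x" "tS R (tSi R x) = tp R x" "tSi R (tS R x) = tp R x"
      by (rule inv_R)+
  qed
qed

end

text \<open>Total operations together with their agreement with H and R on the carriers. Keeping the
  operations as parameters makes the earlier calculations available without unfolding how the
  extensions were made.\<close>

locale yd_hopf_carriers = total_yd_hopf p m u d e S Si pR mR uR dR eR ac co SR SRi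
  for p :: "('a, 'k::field) univ \<Rightarrow> ('a, 'k) univ" and m u d e S Si pR mR uR dR eR ac co SR SRi +
  fixes H :: "('a, 'k) bialg_data" and R :: "('a, 'k) yd_bialg_data"
  assumes retr_H: "retr p (carr H)" and retr_R: "retr pR (carr R)"
    and H_conv [simp]: "\<And>x y. x \<in> carr H \<Longrightarrow> y \<in> carr H \<Longrightarrow> mul H x y = m x y"
    "\<And>x. x \<in> carr H \<Longrightarrow> comul H x = d x" "\<And>x. x \<in> carr H \<Longrightarrow> counit H x = e x" "one H = u"
    "\<And>x. x \<in> carr H \<Longrightarrow> antipode H x = S x" "\<And>x. x \<in> carr H \<Longrightarrow> antipode_inv H x = Si x"
    and R_conv [simp]: "\<And>x y. x \<in> carr R \<Longrightarrow> y \<in> carr R \<Longrightarrow> mul R x y = mR x y"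
    "\<And>x. x \<in> carr R \<Longrightarrow> comul R x = dR x" "\<And>x. x \<in> carr R \<Longrightarrow> counit R x = eR x" "one R = uR"
    "\<And>h x. h \<in> carr H \<Longrightarrow> x \<in> carr R \<Longrightarrow> hact R h x = ac h x" "\<And>x. x \<in> carr R \<Longrightarrow> hcoact R x = co x"
begin
lemma mem_fix: "x \<in> carr H \<longleftrightarrow> p x = x" "x \<in> carr R \<longleftrightarrow> pR x = x"
  by (rule retr_mem_iff[OF retr_H] retr_mem_iff[OF retr_R])+
lemma sub_HR [simp]: "univ.subspace (carr H)" "univ.subspace (carr R)"
  using retr_H retr_R by (simp_all add: retr_subspace)
lemma mem_HR [simp]: "p x \<in> carr H" "m x y \<in> carr H" "u \<in> carr H" "S x \<in> carr H" "Si x \<in> carr H"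
  "pR x \<in> carr R" "mR x y \<in> carr R" "uR \<in> carr R" "ac h x \<in> carr R"
  by (simp_all add: mem_fix)
lemma p_mem [simp]: "x \<in> carr H \<Longrightarrow> p x = x" "x \<in> carr R \<Longrightarrow> pR x = x"
  by (simp_all add: mem_fix)
lemma mem_d [simp]: "d x \<in> carr H \<otimes>\<^sub>V carr H" "dR x \<in> carr R \<otimes>\<^sub>V carr R" "co x \<in> carr H \<otimes>\<^sub>V carr R"
proof -
  have "swt (d x) (\<lambda>a b. p a \<otimes>\<^sub>k p b) \<in> carr H \<otimes>\<^sub>V carr H" "swt (dR x) (\<lambda>a b. pR a \<otimes>\<^sub>k pR b) \<in> carr R \<otimes>\<^sub>V carr R"
    "swt (co x) (\<lambda>a b. p a \<otimes>\<^sub>k pR b) \<in> carr H \<otimes>\<^sub>V carr R"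
    by (intro swt_in tens_in subspace_tensor; simp)+
  then show "d x \<in> carr H \<otimes>\<^sub>V carr H" "dR x \<in> carr R \<otimes>\<^sub>V carr R" "co x \<in> carr H \<otimes>\<^sub>V carr R"
    by (simp_all only: d_pp R.d_pp co_pq)
qed

section \<open>The bosonization on its carrier\<close>

abbreviation "A \<equiv> bosonization H R"
lemma carr_A: "carr A = carr R \<otimes>\<^sub>V carr H" by (simp add: bosonization_def)
lemma retr_A: "retr pA (carr A)"
  using retr_tensor[OF retr_R retr_H] by (simp add: carr_A pA_def[abs_def])
lemma pA_mem [simp]: "t \<in> carr A \<Longrightarrow> pA t = t" and mem_A [simp]: "pA t \<in> carr A"
  by (rule retrD[OF retr_A], assumption) (rule retrD[OF retr_A])
lemma sub_A [simp]: "univ.subspace (carr A)" using retr_A by (rule retr_subspace)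
lemma mem_fix_A: "t \<in> carr A \<longleftrightarrow> pA t = t" by (rule retr_mem_iff[OF retr_A])
lemma mem_mA [simp]: "mA x y \<in> carr A" "uA \<in> carr A" "SA x \<in> carr A" "SAi x \<in> carr A" "iH h \<in> carr A" "iR r \<in> carr A"
  by (simp_all add: mem_fix_A)
lemma mem_pi [simp]: "piA x \<in> carr H" "thA x \<in> carr R"
  by (simp_all add: mem_fix)
lemma mem_dA [simp]: "dA x \<in> carr A \<otimes>\<^sub>V carr A"
proof -
  have "swt (dA x) (\<lambda>a b. pA a \<otimes>\<^sub>k pA b) \<in> carr A \<otimes>\<^sub>V carr A"
    by (intro swt_in tens_in subspace_tensor; simp)
  then show ?thesis by (simp only: A.d_pp)
qed
lemma mul_A [simp]: "s \<in> carr A \<Longrightarrow> t \<in> carr A \<Longrightarrow> mul A s t = mA s t"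
  by (simp add: carr_A) (simp add: bosonization_def mA_def sw2_def)
lemma one_A [simp]: "one A = uA" by (simp add: bosonization_def uA_def)
lemma comul_A [simp]: "t \<in> carr A \<Longrightarrow> comul A t = dA t"
proof -
  assume t: "t \<in> carr A"
  have "comul A t = sw (carr R) (carr H) t (\<lambda>r h. sw (carr R) (carr R) (comul R r) (\<lambda>r1 r2. sw (carr H) (carr H) (comul H h) (\<lambda>h1 h2.
      sw (carr H) (carr R) (hcoact R r2) (\<lambda>g r2'. (pR r1 \<otimes>\<^sub>k mul H g h1) \<otimes>\<^sub>k (pR r2' \<otimes>\<^sub>k p h2)))))"
    by (simp add: bosonization_def sw2_def del: sw_swt)
  also have "\<dots> = dA t"
    using t by (simp add: carr_A dA_def del: p_mem)
  finally show ?thesis .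
qed
lemma counit_A [simp]: "t \<in> carr A \<Longrightarrow> counit A t = eA t"
proof -
  assume t: "t \<in> carr A"
  have "counit A t *\<^sub>k (unit_vec :: ('a, 'k) univ) = eA t *\<^sub>k unit_vec"
    using t by (simp add: carr_A) (simp add: bosonization_def sw_form_swt)
  then show ?thesis by (simp only: scal_unit_vec_iff)
qed
end

context yd_hopf_carriers begin

lemma algebra_A: "algebra_on A"
proof -
  have "bilinear_on (carr A) (carr A) (carr A) (mul A)"
    unfolding bilinear_on_def linear_on_def
    by (auto simp: univ.subspace_add univ.subspace_scale lin_add[OF A.m_op(1)[OF lin_ident]] lin_add[OF A.m_op(2)[OF lin_ident]])
  then show ?thesis by (simp add: algebra_on_def)
qed
lemma coalgebra_A: "coalgebra_on A"
proof -
  have "linear_on (carr A) (carr A \<otimes>\<^sub>V carr A) (comul A)"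
    unfolding linear_on_def by (auto simp: univ.subspace_add univ.subspace_scale lin_add[OF lin_dA])
  moreover have "linear_form_on (carr A) (counit A)"
    using A.linf_e unfolding linear_form_on_def by (auto simp: univ.subspace_add univ.subspace_scale linf_def)
  moreover have "x \<otimes>\<^sub>k dA y = swt (dA y) (\<lambda>a b. x \<otimes>\<^sub>k a \<otimes>\<^sub>k b)" for x y
    using arg_cong[OF swt_tens_id[OF mem_dA, of y], of "\<lambda>t. x \<otimes>\<^sub>k t"] by simp
  ultimately show ?thesis by (simp add: coalgebra_on_def sw2_def sw3_def del: eA_scal)
qed
text \<open>\<open>is_antipode\<close> demands an extensional map, hence the restriction; by
  uniqueness this map is the antipode.\<close>

lemma is_antipode_A: "is_antipode A (restrict SA (carr A))"
proof -
  have "linear_on (carr A) (carr A) (restrict SA (carr A))"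
    unfolding linear_on_def by (auto simp: univ.subspace_add univ.subspace_scale lin_add[OF A.lin_S])
  then show ?thesis by (simp add: is_antipode_def sw2_def A.S_l0 A.S_r0 del: eA_scal)
qed
lemma antipode_A [simp]: "t \<in> carr A \<Longrightarrow> antipode A t = SA t"
proof -
  assume t: "t \<in> carr A"
  have "antipode A = restrict SA (carr A)"
    by (rule antipode_eqI[OF algebra_A coalgebra_A _ is_antipode_A]) (use is_antipode_A in blast)
  with t show ?thesis by simp
qed
lemma antipode_inv_A [simp]: assumes "t \<in> carr A" shows "antipode_inv A t = SAi t"
  unfolding antipode_inv_def
proof (rule the_inv_into_f_eq)
  show "inj_on (antipode A) (carr A)"
  proof (rule inj_on_inverseI[of _ SAi])
    fix x assume "x \<in> carr A"
    then show "SAi (antipode A x) = x" by simp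
  qed
qed (use assms in simp_all)
lemma proj_A [simp]: "t \<in> carr A \<Longrightarrow> proj_H H R t = piA t" "t \<in> carr A \<Longrightarrow> proj_R H R t = thA t"
proof -
  assume t: "t \<in> carr A"
  have "proj_H H R t = sw (carr R) (carr H) t (\<lambda>r h. eR r *\<^sub>k p h)" "proj_R H R t = sw (carr R) (carr H) t (\<lambda>r h. e h *\<^sub>k pR r)"
    by (simp_all add: proj_H_def proj_R_def del: sw_swt)
  then show "proj_H H R t = piA t" "proj_R H R t = thA t"
    using t by (simp_all add: carr_A piA_def thA_def del: p_mem)
qed
lemma incl_A [simp]: "h \<in> carr H \<Longrightarrow> incl_H R h = iH h" "r \<in> carr R \<Longrightarrow> incl_R H r = iR r"
  by (simp_all add: incl_H_def incl_R_def iH_def iR_def)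

text \<open>
  \<open>M\<close> is given on its carrier by the operations \<open>dl\<close> and \<open>ra\<close>, where \<open>q\<close> is a projection onto \<open>M\<close>.
\<close>
definition "robj M q dl ra \<longleftrightarrow> retr q (msp M) \<and> (\<forall>x\<in>msp M. \<forall>h\<in>carr H. mact M x h = ra x h) \<and> (\<forall>x\<in>msp M. mcoact M x = dl x) \<and>
  mact M = restrict2 (msp M) (carr H) (mact M) \<and> mcoact M \<in> extensional (msp M)"
abbreviation "isright q dl ra \<equiv> right_yd_object p m u d e S Si pR mR uR dR eR ac co SR SRi q dl ra"

lemma robj_obs:
  assumes "robj M q dl ra" "isright q dl ra"
  shows "M \<in> YD_right_obs H R"
proof -
  interpret M: right_yd_object p m u d e S Si pR mR uR dR eR ac co SR SRi q dl ra by fact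
  have q: "retr q (msp M)" and c [simp]: "\<And>x h. x \<in> msp M \<Longrightarrow> h \<in> carr H \<Longrightarrow> mact M x h = ra x h" "\<And>x. x \<in> msp M \<Longrightarrow> mcoact M x = dl x"
    and ext: "mact M = restrict2 (msp M) (carr H) (mact M)" "mcoact M \<in> extensional (msp M)"
    using assms(1) unfolding robj_def by blast+
  note q' [simp] = retrD(2,3)[OF q]
  have [simp]: "univ.subspace (msp M)" using q by (rule retr_subspace)
  have mem: "x \<in> msp M \<longleftrightarrow> q x = x" for x using q by (rule retr_mem_iff)
  have [simp]: "ra x h \<in> msp M" for x h by (simp add: mem)
  have dl [simp]: "dl x \<in> msp M \<otimes>\<^sub>V carr A" for x
  proof -
    have "swt (dl x) (\<lambda>a b. q a \<otimes>\<^sub>k pA b) \<in> msp M \<otimes>\<^sub>V carr A" by (intro swt_in tens_in subspace_tensor; simp)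
    then show ?thesis by (simp only: M.M.dl_qp)
  qed
  have 1: "right_module H M"
  proof -
    have "bilinear_on (msp M) (carr H) (msp M) (mact M)"
      unfolding bilinear_on_def linear_on_def
      by (auto simp: univ.subspace_add univ.subspace_scale lin_add[OF M.ra_op(1)[OF lin_ident]] lin_add[OF M.ra_op(2)[OF lin_ident]])
    then show ?thesis by (simp add: right_module_def)
  qed
  have 2: "right_comodule A M"
  proof -
    have "linear_on (msp M) (msp M \<otimes>\<^sub>V carr A) (mcoact M)"
      unfolding linear_on_def by (auto simp: univ.subspace_add univ.subspace_scale lin_add[OF M.M.lin_dl])
    moreover have "x \<otimes>\<^sub>k dA y = swt (dA y) (\<lambda>a b. x \<otimes>\<^sub>k a \<otimes>\<^sub>k b)" for x y
      using arg_cong[OF swt_tens_id[OF mem_dA, of y], of "\<lambda>t. x \<otimes>\<^sub>k t"] by simp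
    ultimately show ?thesis by (simp add: right_comodule_def del: eA_scal)
  qed
  show ?thesis
    using 1 2 ext by (simp add: YD_right_obs_def Let_def sw3_def sw2_def)
qed

text \<open>Converse of \<open>robj_obs\<close>: any projection onto the object extends its
  operations to total ones. The free choice of q matters later, when two objects on one space are
  compared.\<close>

lemma obs_robj:
  assumes M: "M \<in> YD_right_obs H R" and q: "retr q (msp M)"
  defines "dl \<equiv> \<lambda>x. mcoact M (q x)" and "ra \<equiv> \<lambda>x h. mact M (q x) (p h)"
  shows "robj M q dl ra" "isright q dl ra"
proof -
  note q' [simp] = retrD(2-4)[OF q]
  note lq [simp] = lin_op[OF retrD(1)[OF q]]
  have sub [simp]: "univ.subspace (msp M)" using q by (rule retr_subspace)
  have M': "right_module H M" "right_comodule A M" "mact M = restrict2 (msp M) (carr H) (mact M)" "mcoact M \<in> extensional (msp M)"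
    "\<And>x h. x \<in> msp M \<Longrightarrow> h \<in> carr H \<Longrightarrow> mcoact M (mact M x h) = sw3 H h (\<lambda>h1 h2 h3. sw (msp M) (carr A) (mcoact M x) (\<lambda>m0 m1.
        mact M m0 h2 \<otimes>\<^sub>k mul A (mul A (incl_H R (antipode H h1)) m1) (incl_H R h3)))"
    using M by (simp_all only: YD_right_obs_def Let_def mem_Collect_eq)
  show "robj M q dl ra" using M'(3,4) q unfolding robj_def dl_def ra_def by simp
  define dl' where "dl' = dl"
  define ra' where "ra' = ra"
  have l: "lin dl'" "bil ra'"
    unfolding dl'_def ra'_def dl_def ra_def
    using linear_on_lin[OF _ q] bilinear_on_retr[OF _ q retr_H] M'(1,2) unfolding right_module_def right_comodule_def by blast+
  have abs: "dl' (q x) = dl' x" "ra' (q x) h = ra' x h" "ra' x (p h) = ra' x h" for x h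
    by (simp_all add: dl'_def dl_def ra'_def ra_def)
  have mem: "dl' x \<in> msp M \<otimes>\<^sub>V carr A" "ra' x h \<in> msp M" for x h
    using M'(1,2) unfolding right_module_def right_comodule_def linear_on_def bilinear_on_def dl'_def dl_def ra'_def ra_def by simp_all
  have c: "x \<in> msp M \<Longrightarrow> h \<in> carr H \<Longrightarrow> mact M x h = ra' x h" "x \<in> msp M \<Longrightarrow> mcoact M x = dl' x" for x h
    by (simp_all add: dl'_def dl_def ra'_def ra_def)
  note [simp] = lin_op[OF l(1)] bil_op[OF l(2)] abs mem c
  have "isright q dl' ra'"
  proof unfold_locales
    show "lin q" by (rule retrD(1)[OF q])
    show "lin dl'" "bil ra'" by (rule l)+
    fix x g h
    show "q (q x) = q x" "dl' (q x) = dl' x" "q (ra' x h) = ra' x h" "ra' x (p h) = ra' x h" "ra' (q x) h = ra' x h" by simp_all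
    show "swt (dl' x) (\<lambda>y a. q y \<otimes>\<^sub>k pA a) = dl' x" by (rule swt_tensor_retr[OF q retr_A mem(1)])
    have rc: "\<forall>m\<in>msp M. sw (msp M) (carr A) (mcoact M m) (\<lambda>m0 c. sw (msp M) (carr A) (mcoact M m0) (\<lambda>m00 c'. m00 \<otimes>\<^sub>k c' \<otimes>\<^sub>k c)) =
      sw (msp M) (carr A) (mcoact M m) (\<lambda>m0 c. m0 \<otimes>\<^sub>k comul A c)" "\<forall>m\<in>msp M. sw (msp M) (carr A) (mcoact M m) (\<lambda>m0 c. counit A c *\<^sub>k m0) = m"
      using M'(2) unfolding right_comodule_def by blast+
    have "x \<otimes>\<^sub>k dA y = swt (dA y) (\<lambda>a b. x \<otimes>\<^sub>k a \<otimes>\<^sub>k b)" for x y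
      using arg_cong[OF swt_tens_id[OF mem_dA, of y], of "\<lambda>t. x \<otimes>\<^sub>k t"] by simp
    then show "swt (dl' x) (\<lambda>y a. swt (dl' y) (\<lambda>z b. z \<otimes>\<^sub>k b \<otimes>\<^sub>k a)) = swt (dl' x) (\<lambda>y a. swt (dA a) (\<lambda>b c. y \<otimes>\<^sub>k b \<otimes>\<^sub>k c))"
      using bspec[OF rc(1), of "q x"] by simp
    show "swt (dl' x) (\<lambda>y a. eA a *\<^sub>k y) = q x"
      using bspec[OF rc(2), of "q x"] by (simp del: eA_scal)
    have rm: "\<forall>m\<in>msp M. \<forall>a\<in>carr H. \<forall>b\<in>carr H. mact M m (mul H a b) = mact M (mact M m a) b" "\<forall>m\<in>msp M. mact M m (one H) = m"
      using M'(1) unfolding right_module_def by blast+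
    show "ra' (ra' x g) h = ra' x (m g h)" "ra' x u = q x"
      using bspec[OF bspec[OF bspec[OF rm(1), of "q x"], of "p g"], of "p h"] bspec[OF rm(2), of "q x"] by simp_all
    show "dl' (ra' x h) = swt (dl' x) (\<lambda>y a. swt (d h) (\<lambda>h1 t. swt (d t) (\<lambda>h2 h3. ra' y h2 \<otimes>\<^sub>k mA (iH (S h1)) (mA a (iH h3)))))"
      using M'(5)[of "q x" "p h"] by (simp add: sw3_def sw2_def swt_swap[where s = "dl' x"])
  qed
  then show "isright q dl ra" by (simp only: dl'_def ra'_def)
qed

text \<open>The left-handed analogue of \<open>robj\<close>. Below, \<open>robj\<close> is used for
  the bosonization of R and \<open>lobj\<close> for that of the dual, so both are developed for an
  arbitrary R.\<close>

definition "lobj X q lam ba \<longleftrightarrow> retr q (msp X) \<and> (\<forall>b\<in>carr A. \<forall>x\<in>msp X. mact X b x = ba b x) \<and> (\<forall>x\<in>msp X. mcoact X x = lam x) \<and>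
  mact X = restrict2 (carr A) (msp X) (mact X) \<and> mcoact X \<in> extensional (msp X)"
abbreviation "isleft q lam ba \<equiv> left_yd_object p m u d e S Si pR mR uR dR eR ac co SR SRi q lam ba"

lemma lobj_left_yd:
  assumes "lobj X q lam ba" "isleft q lam ba"
  shows "left_yd A H (proj_H H R) X"
proof -
  interpret X: left_yd_object p m u d e S Si pR mR uR dR eR ac co SR SRi q lam ba by fact
  have q: "retr q (msp X)" and c [simp]: "\<And>x b. b \<in> carr A \<Longrightarrow> x \<in> msp X \<Longrightarrow> mact X b x = ba b x" "\<And>x. x \<in> msp X \<Longrightarrow> mcoact X x = lam x"
    using assms(1) unfolding lobj_def by blast+
  note q' [simp] = retrD(2,3)[OF q]
  have [simp]: "univ.subspace (msp X)" using q by (rule retr_subspace)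
  have mem: "x \<in> msp X \<longleftrightarrow> q x = x" for x using q by (rule retr_mem_iff)
  have [simp]: "ba b x \<in> msp X" for x b by (simp add: mem)
  have lam [simp]: "lam x \<in> carr H \<otimes>\<^sub>V msp X" for x
  proof -
    have "swt (lam x) (\<lambda>a b. p a \<otimes>\<^sub>k q b) \<in> carr H \<otimes>\<^sub>V msp X" by (intro swt_in tens_in subspace_tensor; simp)
    then show ?thesis by (simp only: X.M.co_pq)
  qed
  have 1: "left_module A X"
  proof -
    have "bilinear_on (carr A) (msp X) (msp X) (mact X)"
      unfolding bilinear_on_def linear_on_def
      by (auto simp: univ.subspace_add univ.subspace_scale lin_add[OF X.B.ac_op(1)[OF lin_ident]] lin_add[OF X.B.ac_op(2)[OF lin_ident]])
    then show ?thesis by (simp add: left_module_def)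
  qed
  have 2: "left_comodule H X"
  proof -
    have "linear_on (msp X) (carr H \<otimes>\<^sub>V msp X) (mcoact X)"
      unfolding linear_on_def by (auto simp: univ.subspace_add univ.subspace_scale lin_add[OF X.M.lin_co])
    moreover have "g \<otimes>\<^sub>k lam y = swt (lam y) (\<lambda>a b. g \<otimes>\<^sub>k a \<otimes>\<^sub>k b)" for g y
      using arg_cong[OF swt_tens_id[OF lam, of y], of "\<lambda>t. g \<otimes>\<^sub>k t"] by simp
    ultimately show ?thesis by (simp add: left_comodule_def sw2_def)
  qed
  show ?thesis
    using 1 2 by (simp add: left_yd_def sw3_def sw2_def)
qed

lemma left_yd_lobj:
  assumes X: "left_yd A H (proj_H H R) X" and q: "retr q (msp X)"
    and ext: "mact X = restrict2 (carr A) (msp X) (mact X)" "mcoact X \<in> extensional (msp X)"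
  defines "lam \<equiv> \<lambda>x. mcoact X (q x)" and "ba \<equiv> \<lambda>b x. mact X (pA b) (q x)"
  shows "lobj X q lam ba" "isleft q lam ba"
proof -
  note q' [simp] = retrD(2-4)[OF q]
  note lq [simp] = lin_op[OF retrD(1)[OF q]]
  have sub [simp]: "univ.subspace (msp X)" using q by (rule retr_subspace)
  have M': "left_module A X" "left_comodule H X"
    "\<forall>b\<in>carr A. \<forall>x\<in>msp X. mcoact X (mact X b x) =
      sw3 A b (\<lambda>b1 b2 b3. sw (carr H) (msp X) (mcoact X x) (\<lambda>c x0.
        mul H (mul H (proj_H H R b1) c) (proj_H H R (antipode A b3)) \<otimes>\<^sub>k mact X b2 x0))"
    using X unfolding left_yd_def by blast+
  show "lobj X q lam ba" using ext q unfolding lobj_def lam_def ba_def by simp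
  define lam' where "lam' = lam"
  define ba' where "ba' = ba"
  have l: "lin lam'" "bil ba'"
    unfolding lam'_def ba'_def lam_def ba_def
    using linear_on_lin[OF _ q] bilinear_on_retr[OF _ retr_A q] M'(1,2) unfolding left_module_def left_comodule_def by blast+
  have abs: "lam' (q x) = lam' x" "ba' b (q x) = ba' b x" "ba' (pA b) x = ba' b x" for x b
    by (simp_all add: lam'_def lam_def ba'_def ba_def)
  have mem: "lam' x \<in> carr H \<otimes>\<^sub>V msp X" "ba' b x \<in> msp X" for x b
    using M'(1,2) unfolding left_module_def left_comodule_def linear_on_def bilinear_on_def lam'_def lam_def ba'_def ba_def by simp_all
  have c: "b \<in> carr A \<Longrightarrow> x \<in> msp X \<Longrightarrow> mact X b x = ba' b x" "x \<in> msp X \<Longrightarrow> mcoact X x = lam' x" for x b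
    by (simp_all add: lam'_def lam_def ba'_def ba_def)
  note [simp] = lin_op[OF l(1)] bil_op[OF l(2)] abs mem c
  have "isleft q lam' ba'"
  proof (intro left_yd_object.intro left_yd_object_axioms.intro total_yd_hopf_axioms)
    show "total_comodule p d e q lam'"
    proof unfold_locales
      show "lin q" by (rule retrD(1)[OF q])
      show "lin lam'" by (rule l)
      fix x
      show "q (q x) = q x" "lam' (q x) = lam' x" by simp_all
      show "swt (lam' x) (\<lambda>g y. p g \<otimes>\<^sub>k q y) = lam' x" by (rule swt_tensor_retr[OF retr_H q mem(1)])
      have rc: "\<forall>x\<in>msp X. sw (carr H) (msp X) (mcoact X x) (\<lambda>c x0. sw2 H c (\<lambda>c1 c2. c1 \<otimes>\<^sub>k c2 \<otimes>\<^sub>k x0)) =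
        sw (carr H) (msp X) (mcoact X x) (\<lambda>c x0. c \<otimes>\<^sub>k mcoact X x0)" "\<forall>x\<in>msp X. sw (carr H) (msp X) (mcoact X x) (\<lambda>c x0. counit H c *\<^sub>k x0) = x"
        using M'(2) unfolding left_comodule_def by blast+
      have "g \<otimes>\<^sub>k lam' y = swt (lam' y) (\<lambda>a b. g \<otimes>\<^sub>k a \<otimes>\<^sub>k b)" for g y
        using arg_cong[OF swt_tens_id[OF mem(1), of y], of "\<lambda>t. g \<otimes>\<^sub>k t"] by simp
      then show "swt (lam' x) (\<lambda>g y. swt (lam' y) (\<lambda>g' y'. g \<otimes>\<^sub>k g' \<otimes>\<^sub>k y')) = swt (lam' x) (\<lambda>g y. swt (d g) (\<lambda>g1 g2. g1 \<otimes>\<^sub>k g2 \<otimes>\<^sub>k y))"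
        using bspec[OF rc(1), of "q x"] by (simp add: sw2_def)
      show "swt (lam' x) (\<lambda>g y. e g *\<^sub>k y) = q x"
        using bspec[OF rc(2), of "q x"] by simp
    qed
    show "total_module pA mA uA dA eA SA SAi q ba'"
    proof unfold_locales
      show "lin q" by (rule retrD(1)[OF q])
      show "bil ba'" by (rule l)
      fix x a b
      show "q (q x) = q x" "q (ba' b x) = ba' b x" "ba' b (q x) = ba' b x" "ba' (pA b) x = ba' b x" by simp_all
      have rm: "\<forall>a\<in>carr A. \<forall>b\<in>carr A. \<forall>x\<in>msp X. mact X (mul A a b) x = mact X a (mact X b x)" "\<forall>x\<in>msp X. mact X (one A) x = x"
        using M'(1) unfolding left_module_def by blast+
      show "ba' (mA a b) x = ba' a (ba' b x)" "ba' uA x = q x"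
        using bspec[OF bspec[OF bspec[OF rm(1), of "pA a"], of "pA b"], of "q x"] bspec[OF rm(2), of "q x"] by simp_all
    qed
    fix b x
    show "lam' (ba' b x) = swt (dA b) (\<lambda>b1 t. swt (dA t) (\<lambda>b2 b3. swt (lam' x) (\<lambda>g y. m (piA b1) (m g (piA (SA b3))) \<otimes>\<^sub>k ba' b2 y)))"
      using bspec[OF bspec[OF M'(3), of "pA b"], of "q x"] by (simp add: sw3_def sw2_def)
  qed
  then show "isleft q lam ba" by (simp only: lam'_def ba'_def)
qed
end

section \<open>Concrete monoidal categories\<close>

definition "asc t = swt t (\<lambda>s z. swt s (\<lambda>x y. x \<otimes>\<^sub>k y \<otimes>\<^sub>k z))"
definition "asci t = swt t (\<lambda>x s. swt s (\<lambda>y z. (x \<otimes>\<^sub>k y) \<otimes>\<^sub>k z))"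
definition "lun t = swt t (\<lambda>c x. unit_coeff c *\<^sub>k x)"
definition "luni x = unit_vec \<otimes>\<^sub>k x"
definition "run t = swt t (\<lambda>x c. unit_coeff c *\<^sub>k x)"
definition "runi x = x \<otimes>\<^sub>k unit_vec"

lemma lin_asc [simp]: "lin asc" "lin asci" "lin lun" "lin luni" "lin run" "lin runi"
  by (simp_all add: asc_def[abs_def] asci_def[abs_def] lun_def[abs_def] luni_def[abs_def] run_def[abs_def] runi_def[abs_def])
lemmas lin_asc_op [simp] = lin_op[OF lin_asc(1)] lin_op[OF lin_asc(2)] lin_op[OF lin_asc(3)] lin_op[OF lin_asc(4)] lin_op[OF lin_asc(5)] lin_op[OF lin_asc(6)]

lemma unit_spaceD: "c \<in> unit_space \<Longrightarrow> unit_coeff c *\<^sub>k unit_vec = c"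
  unfolding unit_space_def by (induction rule: univ.span_induct_alt) (auto simp: unit_coeff_def lookup_add univ.scale_left_distrib unit_vec_def lookup_single)

context
  fixes V W U :: "('a, 'k::field) univ set"
  assumes sub [simp]: "univ.subspace V" "univ.subspace W" "univ.subspace U"
begin
lemma asc_mem: "t \<in> (V \<otimes>\<^sub>V W) \<otimes>\<^sub>V U \<Longrightarrow> asc t \<in> V \<otimes>\<^sub>V W \<otimes>\<^sub>V U"
  unfolding asc_def by (erule swt_in_on; (erule swt_in_on)?; simp)
lemma asci_mem: "t \<in> V \<otimes>\<^sub>V W \<otimes>\<^sub>V U \<Longrightarrow> asci t \<in> (V \<otimes>\<^sub>V W) \<otimes>\<^sub>V U"
  unfolding asci_def by (erule swt_in_on; (erule swt_in_on)?; simp)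
lemma asci_asc: "t \<in> (V \<otimes>\<^sub>V W) \<otimes>\<^sub>V U \<Longrightarrow> asci (asc t) = t"
proof (rule tensor_ext[of t "V \<otimes>\<^sub>V W" U "\<lambda>t. asci (asc t)" "\<lambda>t. t"])
  fix s z assume "s \<in> V \<otimes>\<^sub>V W"
  then show "asci (asc (s \<otimes>\<^sub>k z)) = s \<otimes>\<^sub>k z"
    by (rule tensor_ext[of s V W "\<lambda>s. asci (asc (s \<otimes>\<^sub>k z))" "\<lambda>s. s \<otimes>\<^sub>k z"]) (simp_all add: asc_def asci_def)
qed simp_all
lemma asc_asci: "t \<in> V \<otimes>\<^sub>V W \<otimes>\<^sub>V U \<Longrightarrow> asc (asci t) = t"
proof (rule tensor_ext[of t V "W \<otimes>\<^sub>V U" "\<lambda>t. asc (asci t)" "\<lambda>t. t"])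
  fix s z assume "s \<in> W \<otimes>\<^sub>V U"
  then show "asc (asci (z \<otimes>\<^sub>k s)) = z \<otimes>\<^sub>k s"
    by (rule tensor_ext[of s W U "\<lambda>s. asc (asci (z \<otimes>\<^sub>k s))" "\<lambda>s. z \<otimes>\<^sub>k s"]) (simp_all add: asc_def asci_def)
qed simp_all
end
lemma lun_mem: "univ.subspace V \<Longrightarrow> t \<in> unit_space \<otimes>\<^sub>V V \<Longrightarrow> lun t \<in> V"
  and run_mem: "univ.subspace V \<Longrightarrow> t \<in> V \<otimes>\<^sub>V unit_space \<Longrightarrow> run t \<in> V"
  unfolding lun_def run_def by (erule swt_in_on; simp add: subspace_scal)+
lemma luni_lun: "t \<in> unit_space \<otimes>\<^sub>V V \<Longrightarrow> luni (lun t) = t"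
proof (rule tensor_ext[of t unit_space V "\<lambda>t. luni (lun t)" "\<lambda>t. t"])
  fix c w :: "('a, 'b) univ" assume c: "c \<in> unit_space"
  have "luni (lun (c \<otimes>\<^sub>k w)) = (unit_coeff c *\<^sub>k unit_vec) \<otimes>\<^sub>k w" by (simp add: lun_def luni_def)
  then show "luni (lun (c \<otimes>\<^sub>k w)) = c \<otimes>\<^sub>k w" by (simp only: unit_spaceD[OF c])
qed simp_all
lemma runi_run: "t \<in> V \<otimes>\<^sub>V unit_space \<Longrightarrow> runi (run t) = t"
proof (rule tensor_ext[of t V unit_space "\<lambda>t. runi (run t)" "\<lambda>t. t"])
  fix w c :: "('a, 'b) univ" assume c: "c \<in> unit_space"
  have "runi (run (w \<otimes>\<^sub>k c)) = w \<otimes>\<^sub>k (unit_coeff c *\<^sub>k unit_vec)" by (simp add: run_def runi_def)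
  then show "runi (run (w \<otimes>\<^sub>k c)) = w \<otimes>\<^sub>k c" by (simp only: unit_spaceD[OF c])
qed simp_all
lemma lun_luni: "lun (luni x) = x" and run_runi: "run (runi x) = x"
  by (simp_all add: lun_def luni_def run_def runi_def)

lemma tens_swt_fun: "(\<otimes>\<^sub>k) (swt t f) = (\<lambda>y. swt t (\<lambda>a b. f a b \<otimes>\<^sub>k y))"
  by (simp add: fun_eq_iff)

text \<open>What has to be checked for \<open>concrete_monoidal\<close> to be a monoidal category.
  Coherence is inherited from vector spaces, so only closure of objects and the morphism property of
  the structure maps remain; \<open>hom_inv\<close> covers their inverses.\<close>

locale concrete_data =
  fixes Obj :: "('a, 'k::field) mod_data set" and is_hom ten un
  assumes obj_sub [simp]: "X \<in> Obj \<Longrightarrow> univ.subspace (msp X)"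
    and hom_lin: "X \<in> Obj \<Longrightarrow> Y \<in> Obj \<Longrightarrow> is_hom X Y f \<Longrightarrow> linear_on (msp X) (msp Y) f"
    and hom_cong: "X \<in> Obj \<Longrightarrow> Y \<in> Obj \<Longrightarrow> is_hom X Y f \<Longrightarrow> (\<And>x. x \<in> msp X \<Longrightarrow> f x = g x) \<Longrightarrow> is_hom X Y g"
    and hom_id: "X \<in> Obj \<Longrightarrow> is_hom X X (\<lambda>x. x)"
    and hom_comp: "X \<in> Obj \<Longrightarrow> Y \<in> Obj \<Longrightarrow> Z \<in> Obj \<Longrightarrow> is_hom X Y f \<Longrightarrow> is_hom Y Z g \<Longrightarrow> is_hom X Z (\<lambda>x. g (f x))"
    and hom_inv: "X \<in> Obj \<Longrightarrow> Y \<in> Obj \<Longrightarrow> is_hom X Y f \<Longrightarrow> lin f \<Longrightarrow> lin g \<Longrightarrow> (\<And>y. y \<in> msp Y \<Longrightarrow> g y \<in> msp X) \<Longrightarrow>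
      (\<And>x. x \<in> msp X \<Longrightarrow> g (f x) = x) \<Longrightarrow> (\<And>y. y \<in> msp Y \<Longrightarrow> f (g y) = y) \<Longrightarrow> is_hom Y X g"
    and ten_obj [simp]: "X \<in> Obj \<Longrightarrow> Y \<in> Obj \<Longrightarrow> ten X Y \<in> Obj"
    and ten_msp [simp]: "msp (ten X Y) = msp X \<otimes>\<^sub>V msp Y"
    and un_obj [simp]: "un \<in> Obj" and un_msp [simp]: "msp un = unit_space"
    and ten_hom: "X \<in> Obj \<Longrightarrow> X' \<in> Obj \<Longrightarrow> Y \<in> Obj \<Longrightarrow> Y' \<in> Obj \<Longrightarrow> is_hom X X' f \<Longrightarrow> is_hom Y Y' g \<Longrightarrow> lin f \<Longrightarrow> lin g \<Longrightarrow>
      is_hom (ten X Y) (ten X' Y') (\<lambda>t. swt t (\<lambda>x y. f x \<otimes>\<^sub>k g y))"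
    and asc_hom: "X \<in> Obj \<Longrightarrow> Y \<in> Obj \<Longrightarrow> Z \<in> Obj \<Longrightarrow> is_hom (ten (ten X Y) Z) (ten X (ten Y Z)) asc"
    and lun_hom: "X \<in> Obj \<Longrightarrow> is_hom (ten un X) X lun"
    and run_hom: "X \<in> Obj \<Longrightarrow> is_hom (ten X un) X run"
begin

abbreviation "C \<equiv> concrete_monoidal Obj is_hom ten un"

lemma C_simps [simp]: "Ob C = Obj" "Dom C = (\<lambda>(X, f, Y). X)" "Cod C = (\<lambda>(X, f, Y). Y)"
  "Ide C X = (X, restrict (\<lambda>x. x) (msp X), X)" "Comp C (Y, g, Z) (X, f, Y') = (X, compose (msp X) g f, Z)"
  "TenO C = ten" "UnitO C = un"
  by (simp_all add: concrete_monoidal_def)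

text \<open>An arrow given by a map F on all of \<open>univ\<close>, restricted to its domain. By
  \<open>homE\<close> every arrow has such a form with F linear, so equations of arrows become
  identities between \<open>swt\<close> expressions.\<close>

definition rep :: "('a, 'k) mod_data \<Rightarrow> ('a, 'k) mod_data \<Rightarrow> (('a, 'k) univ \<Rightarrow> ('a, 'k) univ) \<Rightarrow> ('a, 'k) mod_arrow"
  where "rep X Y F = (X, restrict F (msp X), Y)"
definition "good X Y F \<longleftrightarrow> X \<in> Obj \<and> Y \<in> Obj \<and> lin F \<and> (\<forall>x\<in>msp X. F x \<in> msp Y) \<and> is_hom X Y F"

lemma goodD: assumes "good X Y F" shows "X \<in> Obj" "Y \<in> Obj" "lin F" "\<And>x. x \<in> msp X \<Longrightarrow> F x \<in> msp Y" "is_hom X Y F"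
  using assms by (auto simp: good_def)

lemma rep_hom: "good X Y F \<Longrightarrow> rep X Y F \<in> homs C X Y"
  using hom_cong[of X Y F "restrict F (msp X)"]
  by (auto simp: homs_def rep_def good_def concrete_monoidal_def)

lemma homE: assumes "a \<in> homs C X Y" obtains F where "good X Y F" "a = rep X Y F"
proof -
  obtain f where f: "a = (X, f, Y)" "X \<in> Obj" "Y \<in> Obj" "f \<in> extensional (msp X)" "is_hom X Y f"
    using assms by (auto simp: homs_def concrete_monoidal_def)
  note q = retr_pj[OF obj_sub[OF f(2)]]
  have l: "linear_on (msp X) (msp Y) f" by (rule hom_lin[OF f(2,3,5)])
  have e: "f (pj (msp X) x) = f x" if "x \<in> msp X" for x using retrD(3)[OF q that] by simp
  have "good X Y (\<lambda>x. f (pj (msp X) x))"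
    unfolding good_def using f linear_on_lin[OF l q] l e hom_cong[OF f(2,3,5)] by (auto simp: linear_on_def)
  moreover have "a = rep X Y (\<lambda>x. f (pj (msp X) x))"
    using f(1,4) e by (auto simp: rep_def extensional_def fun_eq_iff)
  ultimately show ?thesis using that by blast
qed

lemma rep_eq: "X \<in> Obj \<Longrightarrow> (\<And>x. x \<in> msp X \<Longrightarrow> F x = G x) \<Longrightarrow> rep X Y F = rep X Y G"
  by (auto simp: rep_def)

lemma rep_Ide: "Ide C X = rep X X (\<lambda>x. x)" by (simp add: rep_def)
lemma rep_Comp: "good X Y F \<Longrightarrow> Comp C (rep Y Z G) (rep X Y F) = rep X Z (\<lambda>x. G (F x))"
  by (auto simp: rep_def good_def compose_def)
lemma rep_TenA:
  assumes "good X X' F" "good Y Y' G"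
  shows "TenA C (rep X X' F) (rep Y Y' G) = rep (ten X Y) (ten X' Y') (\<lambda>t. swt t (\<lambda>x y. F x \<otimes>\<^sub>k G y))"
proof -
  note [simp] = goodD[OF assms(1)] goodD[OF assms(2)] lin_op[OF goodD(3)[OF assms(1)]] lin_op[OF goodD(3)[OF assms(2)]]
  show ?thesis by (auto simp: rep_def concrete_monoidal_def restrict_def fun_eq_iff)
qed
lemma rep_Assoc: "X \<in> Obj \<Longrightarrow> Y \<in> Obj \<Longrightarrow> Z \<in> Obj \<Longrightarrow> Assoc C X Y Z = rep (ten (ten X Y) Z) (ten X (ten Y Z)) asc"
  by (simp add: rep_def concrete_monoidal_def asc_def fun_eq_iff)
lemma rep_LUnit: "X \<in> Obj \<Longrightarrow> LUnit C X = rep (ten un X) X lun"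
  by (simp add: rep_def concrete_monoidal_def lun_def fun_eq_iff)
lemma rep_RUnit: "X \<in> Obj \<Longrightarrow> RUnit C X = rep (ten X un) X run"
  by (simp add: rep_def concrete_monoidal_def run_def fun_eq_iff)

lemma good_id: "X \<in> Obj \<Longrightarrow> good X X (\<lambda>x. x)" by (simp add: good_def hom_id)
lemma good_comp: "good X Y F \<Longrightarrow> good Y Z G \<Longrightarrow> good X Z (\<lambda>x. G (F x))"
  using hom_comp[of X Y Z F G] by (auto simp: good_def lin_comp)
lemma good_ten:
  assumes "good X X' F" "good Y Y' G"
  shows "good (ten X Y) (ten X' Y') (\<lambda>t. swt t (\<lambda>x y. F x \<otimes>\<^sub>k G y))"
proof -
  note [simp] = goodD[OF assms(1)] goodD[OF assms(2)] lin_op[OF goodD(3)[OF assms(1)]] lin_op[OF goodD(3)[OF assms(2)]]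
  show ?thesis unfolding good_def by (auto intro!: ten_hom elim!: swt_in_on)
qed
lemma good_asc: "X \<in> Obj \<Longrightarrow> Y \<in> Obj \<Longrightarrow> Z \<in> Obj \<Longrightarrow> good (ten (ten X Y) Z) (ten X (ten Y Z)) asc"
  using asc_mem[OF obj_sub obj_sub obj_sub] by (simp add: good_def asc_hom)
lemma good_lun: "X \<in> Obj \<Longrightarrow> good (ten un X) X lun" and good_run: "X \<in> Obj \<Longrightarrow> good (ten X un) X run"
  using lun_mem[OF obj_sub] run_mem[OF obj_sub] by (simp_all add: good_def lun_hom run_hom)

text \<open>By \<open>hom_inv\<close> the inverse is a morphism as soon as it is linear with the
  right domain and range; its compatibility with the actions and coactions needs no separate
  check.\<close>

lemma isosI:
  assumes F: "good X Y F" and G: "lin G" "\<And>y. y \<in> msp Y \<Longrightarrow> G y \<in> msp X"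
    and inv: "\<And>x. x \<in> msp X \<Longrightarrow> G (F x) = x" "\<And>y. y \<in> msp Y \<Longrightarrow> F (G y) = y"
  shows "rep X Y F \<in> isos C X Y"
proof -
  note F' = goodD[OF F]
  have G': "good Y X G" using hom_inv[OF F'(1,2,5,3) G inv] F' G by (simp add: good_def)
  have "Comp C (rep Y X G) (rep X Y F) = Ide C X" "Comp C (rep X Y F) (rep Y X G) = Ide C Y"
    by (simp_all only: rep_Ide rep_Comp[OF F] rep_Comp[OF G']) (auto intro!: rep_eq simp: F' inv)
  then show ?thesis unfolding isos_def using rep_hom[OF F] rep_hom[OF G'] by blast
qed

text \<open>With linear representatives, each axiom reduces to an identity for iterated tensors in
  \<open>univ\<close>.\<close>

lemma monoidal_category_C: "monoidal_category C"
proof unfold_locales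
  fix f assume "f \<in> Arr C"
  then show "Dom C f \<in> Ob C" "Cod C f \<in> Ob C" by (auto simp: concrete_monoidal_def)
next
  fix X assume X: "X \<in> Ob C"
  show "Ide C X \<in> homs C X X" using X by (simp only: rep_Ide) (simp add: rep_hom good_id)
next
  fix f g X Y Z assume "f \<in> homs C X Y" "g \<in> homs C Y Z"
  then show "Comp C g f \<in> homs C X Z" by (elim homE) (simp add: rep_Comp rep_hom good_comp del: C_simps)
next
  fix f g h W X Y Z assume "f \<in> homs C W X" "g \<in> homs C X Y" "h \<in> homs C Y Z"
  then show "Comp C h (Comp C g f) = Comp C (Comp C h g) f"
    by (elim homE) (simp add: rep_Comp good_comp del: C_simps)
next
  fix f X Y assume "f \<in> homs C X Y"
  then show "Comp C f (Ide C X) = f \<and> Comp C (Ide C Y) f = f"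
    by (elim homE) (simp add: rep_Ide rep_Comp good_id goodD(1) del: C_simps)
next
  fix X Y assume "X \<in> Ob C" "Y \<in> Ob C" then show "TenO C X Y \<in> Ob C" by simp
next
  fix f g X X' Y Y' assume "f \<in> homs C X X'" "g \<in> homs C Y Y'"
  then show "TenA C f g \<in> homs C (TenO C X Y) (TenO C X' Y')"
    by (elim homE) (simp add: rep_TenA rep_hom good_ten del: C_simps(1-5))
next
  fix X Y assume "X \<in> Ob C" "Y \<in> Ob C"
  then show "TenA C (Ide C X) (Ide C Y) = Ide C (TenO C X Y)"
    by (simp only: rep_Ide C_simps(1,6)) (simp only: rep_TenA[OF good_id good_id], rule rep_eq, auto simp: swt_tens_id)
next
  fix f f' g g' X X' X'' Y Y' Y''
  assume "f \<in> homs C X X'" "f' \<in> homs C X' X''" "g \<in> homs C Y Y'" "g' \<in> homs C Y' Y''"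
  then obtain F F' G G' where a: "f = rep X X' F" "f' = rep X' X'' F'" "g = rep Y Y' G" "g' = rep Y' Y'' G'"
    and g: "good X X' F" "good X' X'' F'" "good Y Y' G" "good Y' Y'' G'"
    by (elim homE)
  note [simp] = lin_op[OF g(1)[THEN goodD(3)]] lin_op[OF g(2)[THEN goodD(3)]] lin_op[OF g(3)[THEN goodD(3)]] lin_op[OF g(4)[THEN goodD(3)]]
  show "TenA C (Comp C f' f) (Comp C g' g) = Comp C (TenA C f' g') (TenA C f g)"
    unfolding a rep_Comp[OF g(1)] rep_Comp[OF g(3)] rep_TenA[OF g(1,3)] rep_TenA[OF g(2,4)]
      rep_TenA[OF good_comp[OF g(1,2)] good_comp[OF g(3,4)]] rep_Comp[OF good_ten[OF g(1,3)]]
    by simp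
next
  show "UnitO C \<in> Ob C" by simp
next
  fix X Y Z assume "X \<in> Ob C" "Y \<in> Ob C" "Z \<in> Ob C"
  then have [simp]: "X \<in> Obj" "Y \<in> Obj" "Z \<in> Obj" by simp_all
  show "Assoc C X Y Z \<in> isos C (TenO C (TenO C X Y) Z) (TenO C X (TenO C Y Z))"
    unfolding C_simps(6) rep_Assoc[OF \<open>X \<in> Obj\<close> \<open>Y \<in> Obj\<close> \<open>Z \<in> Obj\<close>]
    by (rule isosI[where G = asci]) (simp_all add: good_asc asci_mem asci_asc[of "msp X" "msp Y" "msp Z"] asc_asci[of "msp X" "msp Y" "msp Z"])
next
  fix f g h X X' Y Y' Z Z'
  assume "f \<in> homs C X X'" "g \<in> homs C Y Y'" "h \<in> homs C Z Z'"
  then obtain F G K where a: "f = rep X X' F" "g = rep Y Y' G" "h = rep Z Z' K"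
    and g: "good X X' F" "good Y Y' G" "good Z Z' K" by (elim homE)
  note [simp] = goodD(1,2)[OF g(1)] goodD(1,2)[OF g(2)] goodD(1,2)[OF g(3)]
    lin_op[OF g(1)[THEN goodD(3)]] lin_op[OF g(2)[THEN goodD(3)]] lin_op[OF g(3)[THEN goodD(3)]]
  show "Comp C (Assoc C X' Y' Z') (TenA C (TenA C f g) h) = Comp C (TenA C f (TenA C g h)) (Assoc C X Y Z)"
    unfolding a rep_TenA[OF g(1,2)] rep_TenA[OF g(2,3)] rep_TenA[OF good_ten[OF g(1,2)] g(3)] rep_TenA[OF g(1) good_ten[OF g(2,3)]]
      rep_Assoc[OF goodD(1)[OF g(1)] goodD(1)[OF g(2)] goodD(1)[OF g(3)]] rep_Assoc[OF goodD(2)[OF g(1)] goodD(2)[OF g(2)] goodD(2)[OF g(3)]]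
      rep_Comp[OF good_ten[OF good_ten[OF g(1,2)] g(3)]] rep_Comp[OF good_asc[OF goodD(1)[OF g(1)] goodD(1)[OF g(2)] goodD(1)[OF g(3)]]]
    by (simp add: asc_def)
next
  fix X assume "X \<in> Ob C" then have [simp]: "X \<in> Obj" by simp
  show "LUnit C X \<in> isos C (TenO C (UnitO C) X) X"
    unfolding C_simps(6,7) rep_LUnit[OF \<open>X \<in> Obj\<close>]
    by (rule isosI[where G = luni]) (simp_all add: good_lun luni_lun lun_luni, simp add: luni_def unit_vec_mem)
  show "RUnit C X \<in> isos C (TenO C X (UnitO C)) X"
    unfolding C_simps(6,7) rep_RUnit[OF \<open>X \<in> Obj\<close>]
    by (rule isosI[where G = runi]) (simp_all add: good_run runi_run run_runi, simp add: runi_def unit_vec_mem)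
next
  fix f X X' assume "f \<in> homs C X X'"
  then obtain F where a: "f = rep X X' F" and g: "good X X' F" by (elim homE)
  note [simp] = goodD(1,2)[OF g] lin_op[OF g[THEN goodD(3)]]
  note u = good_id[OF un_obj]
  show "Comp C (LUnit C X') (TenA C (Ide C (UnitO C)) f) = Comp C f (LUnit C X)"
    unfolding rep_Ide C_simps(7) a rep_TenA[OF u g] rep_LUnit[OF goodD(1)[OF g]] rep_LUnit[OF goodD(2)[OF g]]
      rep_Comp[OF good_ten[OF u g]] rep_Comp[OF good_lun[OF goodD(1)[OF g]]]
    by (simp add: lun_def)
  show "Comp C (RUnit C X') (TenA C f (Ide C (UnitO C))) = Comp C f (RUnit C X)"
    unfolding rep_Ide C_simps(7) a rep_TenA[OF g u] rep_RUnit[OF goodD(1)[OF g]] rep_RUnit[OF goodD(2)[OF g]]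
      rep_Comp[OF good_ten[OF g u]] rep_Comp[OF good_run[OF goodD(1)[OF g]]]
    by (simp add: run_def)
next
  fix W X Y Z assume "W \<in> Ob C" "X \<in> Ob C" "Y \<in> Ob C" "Z \<in> Ob C"
  then have o [simp]: "W \<in> Obj" "X \<in> Obj" "Y \<in> Obj" "Z \<in> Obj" by simp_all
  note a = good_asc[OF o(2-4)] good_asc[OF o(1-3)] good_asc[OF o(1) ten_obj[OF o(2,3)] o(4)] good_asc[OF ten_obj[OF o(1,2)] o(3,4)]
    and i = good_id[OF o(1)] good_id[OF o(4)]
  show "Comp C (Assoc C W X (TenO C Y Z)) (Assoc C (TenO C W X) Y Z) =
          Comp C (TenA C (Ide C W) (Assoc C X Y Z))
            (Comp C (Assoc C W (TenO C X Y) Z) (TenA C (Assoc C W X Y) (Ide C Z)))"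
    unfolding rep_Ide C_simps(6) rep_Assoc[OF o(1-3)] rep_Assoc[OF o(2-4)] rep_Assoc[OF o(1) ten_obj[OF o(2,3)] o(4)]
      rep_Assoc[OF ten_obj[OF o(1,2)] o(3,4)] rep_Assoc[OF o(1,2) ten_obj[OF o(3,4)]] rep_TenA[OF i(1) a(1)] rep_TenA[OF a(2) i(2)]
      rep_Comp[OF a(4)] rep_Comp[OF good_ten[OF a(2) i(2)]] rep_Comp[OF good_comp[OF good_ten[OF a(2) i(2)] a(3)]]
    by (simp add: asc_def)
next
  fix X Y assume "X \<in> Ob C" "Y \<in> Ob C"
  then have o [simp]: "X \<in> Obj" "Y \<in> Obj" by simp_all
  note i = good_id[OF o(1)] good_id[OF o(2)]
  show "Comp C (TenA C (Ide C X) (LUnit C Y)) (Assoc C X (UnitO C) Y) = TenA C (RUnit C X) (Ide C Y)"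
    unfolding rep_Ide C_simps(7) rep_LUnit[OF o(2)] rep_RUnit[OF o(1)] rep_Assoc[OF o(1) un_obj o(2)] rep_TenA[OF i(1) good_lun[OF o(2)]]
      rep_TenA[OF good_run[OF o(1)] i(2)] rep_Comp[OF good_asc[OF o(1) un_obj o(2)]]
    by (simp add: asc_def lun_def run_def tens_swt_fun)
qed
end

section \<open>Morphisms and tensor products in the two categories\<close>

text \<open>Linear maps of the objects, extended to \<open>univ\<close>: q and q' are the
  projections onto source and target, so F is determined on the source and has values in the
  target.\<close>

definition "total_map q q' F \<longleftrightarrow> lin F \<and> (\<forall>x. q' (F x) = F x) \<and> (\<forall>x. F (q x) = F x)"
definition "right_map q dl ra q' dl' ra' F \<longleftrightarrow> total_map q q' F \<and> (\<forall>x h. F (ra x h) = ra' (F x) h) \<and>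
  (\<forall>x. dl' (F x) = swt (dl x) (\<lambda>y a. F y \<otimes>\<^sub>k a))"
definition "left_map q lam ba q' lam' ba' F \<longleftrightarrow> total_map q q' F \<and> (\<forall>b x. F (ba b x) = ba' b (F x)) \<and>
  (\<forall>x. lam' (F x) = swt (lam x) (\<lambda>g y. g \<otimes>\<^sub>k F y))"

lemma total_mapD: assumes "total_map q q' F" shows "lin F" "q' (F x) = F x" "F (q x) = F x"
  using assms by (simp_all add: total_map_def)
lemma right_mapD: assumes "right_map q dl ra q' dl' ra' F"
  shows "total_map q q' F" "F (ra x h) = ra' (F x) h" "dl' (F x) = swt (dl x) (\<lambda>y a. F y \<otimes>\<^sub>k a)"
  using assms by (simp_all add: right_map_def)
lemma left_mapD: assumes "left_map q lam ba q' lam' ba' F"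
  shows "total_map q q' F" "F (ba b x) = ba' b (F x)" "lam' (F x) = swt (lam x) (\<lambda>g y. g \<otimes>\<^sub>k F y)"
  using assms by (simp_all add: left_map_def)

lemma linear_on_iff:
  assumes "retr q V" "retr q' W"
  shows "linear_on V W f \<longleftrightarrow> total_map q q' (\<lambda>x. f (q x))"
proof
  note q [simp] = retrD(2-4)[OF assms(1)] and q' [simp] = retrD(2-4)[OF assms(2)]
  { assume f: "linear_on V W f"
    then have "\<And>x. x \<in> V \<Longrightarrow> f x \<in> W" by (simp add: linear_on_def)
    then show "total_map q q' (\<lambda>x. f (q x))" using linear_on_lin[OF f assms(1)] by (simp add: total_map_def) }
  assume f: "total_map q q' (\<lambda>x. f (q x))"
  note n = total_mapD[OF f]
  note sub = retr_subspace[OF assms(1)]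
  show "linear_on V W f" unfolding linear_on_def
  proof (intro conjI ballI allI)
    fix x y c assume "x \<in> V" "y \<in> V"
    then show "f (x + y) = f x + f y"
      using lin_add[OF n(1), of x y] univ.subspace_add[OF sub, of x y] by simp
  next
    fix x c assume "x \<in> V"
    then show "f (c *\<^sub>k x) = c *\<^sub>k f x"
      using lin_scal[OF n(1), of c x] univ.subspace_scale[OF sub, of x c] by simp
  next
    fix x assume "x \<in> V"
    then have "q' (f x) = f x" using n(2)[of x] by simp
    then show "f x \<in> W" by (rule subst) (rule q'(1))
  qed
qed

lemma right_map_comp: "right_map q dl ra q' dl' ra' F \<Longrightarrow> right_map q' dl' ra' q'' dl'' ra'' G \<Longrightarrow> right_map q dl ra q'' dl'' ra'' (\<lambda>x. G (F x))"
  by (simp add: right_map_def total_map_def lin_op)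
lemma left_map_comp: "left_map q lam ba q' lam' ba' F \<Longrightarrow> left_map q' lam' ba' q'' lam'' ba'' G \<Longrightarrow> left_map q lam ba q'' lam'' ba'' (\<lambda>x. G (F x))"
  by (simp add: left_map_def total_map_def lin_op)

context right_yd_pair begin
text \<open>The pair of objects serves here as source and target. Applying G to the colinearity of F
  turns F into q, which is absorbed by \<open>dl_qp\<close>.\<close>

lemma right_map_inv:
  assumes F: "right_map q dl ra q' dl' ra' F" and G: "total_map q' q G" and inv: "\<And>x. G (F x) = q x" "\<And>y. F (G y) = q' y"
  shows "right_map q' dl' ra' q dl ra G"
proof -
  note f = right_mapD(2,3)[OF F] and g = total_mapD[OF G]
  note [simp] = lin_op[OF total_mapD(1)[OF right_mapD(1)[OF F]]] lin_op[OF g(1)]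
  have "G (ra' y h) = ra (G y) h" for y h
    using inv(1)[of "ra (G y) h"] by (simp add: f inv)
  moreover have "dl (G y) = swt (dl' y) (\<lambda>y a. G y \<otimes>\<^sub>k a)" for y
  proof -
    have e: "dl' y = swt (dl (G y)) (\<lambda>y a. F y \<otimes>\<^sub>k a)" using f(2)[of "G y"] by (simp add: inv)
    have "swt (dl' y) (\<lambda>y a. G y \<otimes>\<^sub>k a) = swt (dl (G y)) (\<lambda>y a. q y \<otimes>\<^sub>k a)"
      unfolding e by (simp add: inv)
    also have "\<dots> = swt (swt (dl (G y)) (\<lambda>y a. q y \<otimes>\<^sub>k pA a)) (\<lambda>y a. q y \<otimes>\<^sub>k a)" by (simp only: M.M.dl_qp)
    also have "\<dots> = swt (dl (G y)) (\<lambda>y a. q y \<otimes>\<^sub>k pA a)" by simp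
    also have "\<dots> = dl (G y)" by (rule M.M.dl_qp)
    finally show ?thesis by simp
  qed
  ultimately show ?thesis using G by (simp add: right_map_def)
qed
end

context left_yd_pair begin
lemma left_map_inv:
  assumes F: "left_map q lam ba q' lam' ba' F" and G: "total_map q' q G" and inv: "\<And>x. G (F x) = q x" "\<And>y. F (G y) = q' y"
  shows "left_map q' lam' ba' q lam ba G"
proof -
  note f = left_mapD(2,3)[OF F] and g = total_mapD[OF G]
  note [simp] = lin_op[OF total_mapD(1)[OF left_mapD(1)[OF F]]] lin_op[OF g(1)]
  have "G (ba' b y) = ba b (G y)" for y b
    using inv(1)[of "ba b (G y)"] by (simp add: f inv)
  moreover have "lam (G y) = swt (lam' y) (\<lambda>g y. g \<otimes>\<^sub>k G y)" for y
  proof -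
    have e: "lam' y = swt (lam (G y)) (\<lambda>a y. a \<otimes>\<^sub>k F y)" using f(2)[of "G y"] by (simp add: inv)
    have "swt (lam' y) (\<lambda>a y. a \<otimes>\<^sub>k G y) = swt (lam (G y)) (\<lambda>a y. a \<otimes>\<^sub>k q y)"
      unfolding e by (simp add: inv)
    also have "\<dots> = swt (swt (lam (G y)) (\<lambda>a y. p a \<otimes>\<^sub>k q y)) (\<lambda>a y. a \<otimes>\<^sub>k q y)" by (simp only: X.M.co_pq)
    also have "\<dots> = swt (lam (G y)) (\<lambda>a y. p a \<otimes>\<^sub>k q y)" by simp
    also have "\<dots> = lam (G y)" by (rule X.M.co_pq)
    finally show ?thesis by simp
  qed
  ultimately show ?thesis using G by (simp add: left_map_def)
qed
end

context yd_hopf_carriers begin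

text \<open>If f is not linear from M to N, both sides are false; otherwise \<open>sw\<close> may be
  replaced by \<open>swt\<close>, which is the reason for the case distinction.\<close>

lemma right_hom_iff:
  assumes M: "robj M q dl ra" "isright q dl ra" and N: "robj N q' dl' ra'" "isright q' dl' ra'"
  shows "right_hom H A M N f \<longleftrightarrow> right_map q dl ra q' dl' ra' (\<lambda>x. f (q x))"
proof (cases "total_map q q' (\<lambda>x. f (q x))")
  case False
  then show ?thesis using linear_on_iff[of q "msp M" q' "msp N" f] M(1) N(1) by (simp add: right_hom_def right_map_def robj_def)
next
  case True
  interpret M: right_yd_object p m u d e S Si pR mR uR dR eR ac co SR SRi q dl ra by fact
  interpret N: right_yd_object p m u d e S Si pR mR uR dR eR ac co SR SRi q' dl' ra' by fact
  have q: "retr q (msp M)" and c: "\<And>x h. x \<in> msp M \<Longrightarrow> h \<in> carr H \<Longrightarrow> mact M x h = ra x h" "\<And>x. x \<in> msp M \<Longrightarrow> mcoact M x = dl x"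
    using M(1) unfolding robj_def by blast+
  have q': "retr q' (msp N)" and c': "\<And>x h. x \<in> msp N \<Longrightarrow> h \<in> carr H \<Longrightarrow> mact N x h = ra' x h" "\<And>x. x \<in> msp N \<Longrightarrow> mcoact N x = dl' x"
    using N(1) unfolding robj_def by blast+
  note [simp] = retrD(2,3)[OF q] retrD(2,3)[OF q'] retr_subspace[OF q] c c'
  have mem: "x \<in> msp M \<longleftrightarrow> q x = x" for x using q by (rule retr_mem_iff)
  have mem': "x \<in> msp N \<longleftrightarrow> q' x = x" for x using q' by (rule retr_mem_iff)
  have [simp]: "ra x h \<in> msp M" for x h by (simp add: mem)
  have [simp]: "f (q x) \<in> msp N" for x using total_mapD(2)[OF True, of x] by (simp add: mem')
  have f [simp]: "x \<in> msp M \<Longrightarrow> f x \<in> msp N" for x using \<open>f (q x) \<in> msp N\<close> by simp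
  have dl [simp]: "dl x \<in> msp M \<otimes>\<^sub>V carr A" for x
  proof -
    have "swt (dl x) (\<lambda>a b. q a \<otimes>\<^sub>k pA b) \<in> msp M \<otimes>\<^sub>V carr A" by (intro swt_in tens_in subspace_tensor; simp)
    then show ?thesis by (simp only: M.M.dl_qp)
  qed
  note [simp] = lin_op[OF total_mapD(1)[OF True]]
  have "(\<forall>m\<in>msp M. \<forall>b\<in>carr H. f (mact M m b) = mact N (f m) b) \<longleftrightarrow> (\<forall>x h. f (q (ra x h)) = ra' (f (q x)) h)" (is "?a \<longleftrightarrow> ?b")
  proof
    assume a: ?a
    show ?b
    proof (intro allI)
      fix x h show "f (q (ra x h)) = ra' (f (q x)) h" using a[rule_format, of "q x" "p h"] by simp
    qed
  next
    assume ?b then show ?a by simp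
  qed
  moreover have s: "sw (msp M) (carr A) t (\<lambda>m0 c. f m0 \<otimes>\<^sub>k c) = swt t (\<lambda>y a. f (q y) \<otimes>\<^sub>k a)" if "t \<in> msp M \<otimes>\<^sub>V carr A" for t
  proof -
    have "sw (msp M) (carr A) t (\<lambda>m0 c. f m0 \<otimes>\<^sub>k c) = sw (msp M) (carr A) t (\<lambda>m0 c. f (q m0) \<otimes>\<^sub>k c)" by (rule sw_cong) simp_all
    then show ?thesis by (subst (asm) sw_swt) (simp_all add: that)
  qed
  have "(\<forall>m\<in>msp M. mcoact N (f m) = sw (msp M) (carr A) (mcoact M m) (\<lambda>m0 c. f m0 \<otimes>\<^sub>k c)) \<longleftrightarrow>
    (\<forall>x. dl' (f (q x)) = swt (dl x) (\<lambda>y a. f (q y) \<otimes>\<^sub>k a))" (is "?a \<longleftrightarrow> ?b")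
  proof
    assume a: ?a
    show ?b
    proof
      fix x show "dl' (f (q x)) = swt (dl x) (\<lambda>y a. f (q y) \<otimes>\<^sub>k a)" using a[rule_format, of "q x"] by (simp add: s)
    qed
  next
    assume b: ?b
    show ?a
    proof
      fix m assume "m \<in> msp M" then show "mcoact N (f m) = sw (msp M) (carr A) (mcoact M m) (\<lambda>m0 c. f m0 \<otimes>\<^sub>k c)"
        using b[rule_format, of m] by (simp add: s)
    qed
  qed
  ultimately show ?thesis using True linear_on_iff[OF q q', of f] unfolding right_hom_def right_map_def by blast
qed

lemma left_hom_iff:
  assumes M: "lobj M q lam ba" "isleft q lam ba" and N: "lobj N q' lam' ba'" "isleft q' lam' ba'"
  shows "left_hom A H M N f \<longleftrightarrow> left_map q lam ba q' lam' ba' (\<lambda>x. f (q x))"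
proof (cases "total_map q q' (\<lambda>x. f (q x))")
  case False
  then show ?thesis using linear_on_iff[of q "msp M" q' "msp N" f] M(1) N(1) by (simp add: left_hom_def left_map_def lobj_def)
next
  case True
  interpret M: left_yd_object p m u d e S Si pR mR uR dR eR ac co SR SRi q lam ba by fact
  interpret N: left_yd_object p m u d e S Si pR mR uR dR eR ac co SR SRi q' lam' ba' by fact
  have q: "retr q (msp M)" and c: "\<And>x b. x \<in> msp M \<Longrightarrow> b \<in> carr A \<Longrightarrow> mact M b x = ba b x" "\<And>x. x \<in> msp M \<Longrightarrow> mcoact M x = lam x"
    using M(1) unfolding lobj_def by blast+
  have q': "retr q' (msp N)" and c': "\<And>x b. x \<in> msp N \<Longrightarrow> b \<in> carr A \<Longrightarrow> mact N b x = ba' b x" "\<And>x. x \<in> msp N \<Longrightarrow> mcoact N x = lam' x"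
    using N(1) unfolding lobj_def by blast+
  note [simp] = retrD(2,3)[OF q] retrD(2,3)[OF q'] retr_subspace[OF q] c c'
  have mem: "x \<in> msp M \<longleftrightarrow> q x = x" for x using q by (rule retr_mem_iff)
  have mem': "x \<in> msp N \<longleftrightarrow> q' x = x" for x using q' by (rule retr_mem_iff)
  have [simp]: "ba b x \<in> msp M" for x b by (simp add: mem)
  have [simp]: "f (q x) \<in> msp N" for x using total_mapD(2)[OF True, of x] by (simp add: mem')
  have f [simp]: "x \<in> msp M \<Longrightarrow> f x \<in> msp N" for x using \<open>f (q x) \<in> msp N\<close> by simp
  have lam [simp]: "lam x \<in> carr H \<otimes>\<^sub>V msp M" for x
  proof -
    have "swt (lam x) (\<lambda>a b. p a \<otimes>\<^sub>k q b) \<in> carr H \<otimes>\<^sub>V msp M" by (intro swt_in tens_in subspace_tensor; simp)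
    then show ?thesis by (simp only: M.M.co_pq)
  qed
  note [simp] = lin_op[OF total_mapD(1)[OF True]]
  have "(\<forall>b\<in>carr A. \<forall>m\<in>msp M. f (mact M b m) = mact N b (f m)) \<longleftrightarrow> (\<forall>b x. f (q (ba b x)) = ba' b (f (q x)))" (is "?a \<longleftrightarrow> ?b")
  proof
    assume a: ?a
    show ?b
    proof (intro allI)
      fix x b show "f (q (ba b x)) = ba' b (f (q x))" using a[rule_format, of "pA b" "q x"] by simp
    qed
  next
    assume ?b then show ?a by simp
  qed
  moreover have s: "sw (carr H) (msp M) t (\<lambda>c m0. c \<otimes>\<^sub>k f m0) = swt t (\<lambda>a y. a \<otimes>\<^sub>k f (q y))" if "t \<in> carr H \<otimes>\<^sub>V msp M" for t
  proof -
    have "sw (carr H) (msp M) t (\<lambda>c m0. c \<otimes>\<^sub>k f m0) = sw (carr H) (msp M) t (\<lambda>c m0. c \<otimes>\<^sub>k f (q m0))" by (rule sw_cong) simp_all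
    then show ?thesis by (subst (asm) sw_swt) (simp_all add: that)
  qed
  have "(\<forall>m\<in>msp M. mcoact N (f m) = sw (carr H) (msp M) (mcoact M m) (\<lambda>c m0. c \<otimes>\<^sub>k f m0)) \<longleftrightarrow>
    (\<forall>x. lam' (f (q x)) = swt (lam x) (\<lambda>g y. g \<otimes>\<^sub>k f (q y)))" (is "?a \<longleftrightarrow> ?b")
  proof
    assume a: ?a
    show ?b
    proof
      fix x show "lam' (f (q x)) = swt (lam x) (\<lambda>g y. g \<otimes>\<^sub>k f (q y))" using a[rule_format, of "q x"] by (simp add: s)
    qed
  next
    assume b: ?b
    show ?a
    proof
      fix m assume "m \<in> msp M" then show "mcoact N (f m) = sw (carr H) (msp M) (mcoact M m) (\<lambda>c m0. c \<otimes>\<^sub>k f m0)"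
        using b[rule_format, of m] by (simp add: s)
    qed
  qed
  ultimately show ?thesis using True linear_on_iff[OF q q', of f] unfolding left_hom_def left_map_def by blast
qed

lemma robj_tensor:
  assumes M: "robj M q dl ra" "isright q dl ra" and N: "robj N q' dl' ra'" "isright q' dl' ra'"
  shows "robj (right_tensor H A M N) (right_yd_pair.qT q q') (right_yd_pair.dlT m d mR ac q dl q' dl') (right_yd_pair.raT d ra ra')"
proof -
  interpret T: right_yd_pair p m u d e S Si pR mR uR dR eR ac co SR SRi q dl ra q' dl' ra'
    by (intro right_yd_pair.intro total_yd_hopf_axioms M N)
  have q: "retr q (msp M)" and c: "\<And>x h. x \<in> msp M \<Longrightarrow> h \<in> carr H \<Longrightarrow> mact M x h = ra x h" "\<And>x. x \<in> msp M \<Longrightarrow> mcoact M x = dl x"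
    using M(1) unfolding robj_def by blast+
  have q': "retr q' (msp N)" and c': "\<And>x h. x \<in> msp N \<Longrightarrow> h \<in> carr H \<Longrightarrow> mact N x h = ra' x h" "\<And>x. x \<in> msp N \<Longrightarrow> mcoact N x = dl' x"
    using N(1) unfolding robj_def by blast+
  note [simp] = retrD(2,3)[OF q] retrD(2,3)[OF q'] retr_subspace[OF q] retr_subspace[OF q'] c c'
  have dl [simp]: "dl x \<in> msp M \<otimes>\<^sub>V carr A" "dl' y \<in> msp N \<otimes>\<^sub>V carr A" for x y
  proof -
    have "swt (dl x) (\<lambda>a b. q a \<otimes>\<^sub>k pA b) \<in> msp M \<otimes>\<^sub>V carr A" "swt (dl' y) (\<lambda>a b. q' a \<otimes>\<^sub>k pA b) \<in> msp N \<otimes>\<^sub>V carr A" by (intro swt_in tens_in subspace_tensor; simp)+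
    then show "dl x \<in> msp M \<otimes>\<^sub>V carr A" "dl' y \<in> msp N \<otimes>\<^sub>V carr A" by (simp_all only: T.M.M.dl_qp T.N.M.dl_qp)
  qed
  have 1: "retr T.qT (msp M \<otimes>\<^sub>V msp N)" unfolding T.qT_def[abs_def] by (rule retr_tensor[OF q q'])
  note qq = retrD(3)[OF q] retrD(3)[OF q']
  have 2: "(sw (msp M) (msp N) t (\<lambda>x y. sw (msp M) (carr A) (mcoact M x) (\<lambda>m0 c. sw (msp N) (carr A) (mcoact N y) (\<lambda>n0 d. (m0 \<otimes>\<^sub>k n0) \<otimes>\<^sub>k mul A c d)))) = T.dlT t"
    if t: "t \<in> msp M \<otimes>\<^sub>V msp N" for t
  proof -
    have "(sw (msp M) (msp N) t (\<lambda>x y. sw (msp M) (carr A) (mcoact M x) (\<lambda>m0 c. sw (msp N) (carr A) (mcoact N y) (\<lambda>n0 d. (m0 \<otimes>\<^sub>k n0) \<otimes>\<^sub>k mul A c d)))) =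
      (sw (msp M) (msp N) t (\<lambda>x y. sw (msp M) (carr A) (dl x) (\<lambda>m0 c. sw (msp N) (carr A) (dl' y) (\<lambda>n0 d. (q m0 \<otimes>\<^sub>k q' n0) \<otimes>\<^sub>k mA c d))))"
      by (intro sw_cong) simp_all
    then show ?thesis using t by (simp add: T.dlT_def del: qq)
  qed
  show ?thesis unfolding robj_def right_tensor_def
    using 1 2 by (simp add: T.raT_def sw2_def swt_swap[where s = "d _"] restrict2_def fun_eq_iff)
qed

lemma lobj_tensor:
  assumes M: "lobj M q lam ba" "isleft q lam ba" and N: "lobj N q' lam' ba'" "isleft q' lam' ba'"
  shows "lobj (left_tensor A H M N) (left_yd_pair.qT q q') (left_yd_pair.lamT m q lam q' lam') (left_yd_pair.baT p m d pR dR co ba ba')"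
proof -
  interpret T: left_yd_pair p m u d e S Si pR mR uR dR eR ac co SR SRi q lam ba q' lam' ba'
    by (intro left_yd_pair.intro total_yd_hopf_axioms M N)
  have q: "retr q (msp M)" and c: "\<And>x b. x \<in> msp M \<Longrightarrow> b \<in> carr A \<Longrightarrow> mact M b x = ba b x" "\<And>x. x \<in> msp M \<Longrightarrow> mcoact M x = lam x"
    using M(1) unfolding lobj_def by blast+
  have q': "retr q' (msp N)" and c': "\<And>x b. x \<in> msp N \<Longrightarrow> b \<in> carr A \<Longrightarrow> mact N b x = ba' b x" "\<And>x. x \<in> msp N \<Longrightarrow> mcoact N x = lam' x"
    using N(1) unfolding lobj_def by blast+
  note [simp] = retrD(2,3)[OF q] retrD(2,3)[OF q'] retr_subspace[OF q] retr_subspace[OF q'] c c'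
  have lam [simp]: "lam x \<in> carr H \<otimes>\<^sub>V msp M" "lam' y \<in> carr H \<otimes>\<^sub>V msp N" for x y
  proof -
    have "swt (lam x) (\<lambda>a b. p a \<otimes>\<^sub>k q b) \<in> carr H \<otimes>\<^sub>V msp M" "swt (lam' y) (\<lambda>a b. p a \<otimes>\<^sub>k q' b) \<in> carr H \<otimes>\<^sub>V msp N" by (intro swt_in tens_in subspace_tensor; simp)+
    then show "lam x \<in> carr H \<otimes>\<^sub>V msp M" "lam' y \<in> carr H \<otimes>\<^sub>V msp N" by (simp_all only: T.X.M.co_pq T.Y.M.co_pq)
  qed
  have 1: "retr T.qT (msp M \<otimes>\<^sub>V msp N)" unfolding T.qT_def[abs_def] by (rule retr_tensor[OF q q'])
  note qq = retrD(3)[OF q] retrD(3)[OF q']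
  have 2: "(sw (msp M) (msp N) t (\<lambda>x y. sw (carr H) (msp M) (mcoact M x) (\<lambda>c m0. sw (carr H) (msp N) (mcoact N y) (\<lambda>d n0. mul H c d \<otimes>\<^sub>k (m0 \<otimes>\<^sub>k n0))))) = T.lamT t"
    if t: "t \<in> msp M \<otimes>\<^sub>V msp N" for t
  proof -
    have "(sw (msp M) (msp N) t (\<lambda>x y. sw (carr H) (msp M) (mcoact M x) (\<lambda>c m0. sw (carr H) (msp N) (mcoact N y) (\<lambda>d n0. mul H c d \<otimes>\<^sub>k (m0 \<otimes>\<^sub>k n0))))) =
      (sw (msp M) (msp N) t (\<lambda>x y. sw (carr H) (msp M) (lam x) (\<lambda>c m0. sw (carr H) (msp N) (lam' y) (\<lambda>d n0. m c d \<otimes>\<^sub>k (q m0 \<otimes>\<^sub>k q' n0)))))"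
      by (intro sw_cong) simp_all
    then show ?thesis using t by (simp add: T.lamT_def del: qq)
  qed
  show ?thesis unfolding lobj_def left_tensor_def
    using 1 2 by (simp add: T.baT_def sw2_def swt_swap[where s = "dA _"] restrict2_def fun_eq_iff)
qed

lemma retr_qU: "retr qU unit_space"
  unfolding retr_def using lin_qU unit_spaceD by (auto simp: qU_def)
lemma robj_unit: "robj (right_unit H A) qU dlU raU"
  using retrD(3)[OF retr_qU] by (simp add: robj_def right_unit_def retr_qU raU_def dlU_def restrict2_def fun_eq_iff)
lemma lobj_unit: "lobj (left_unit A H) qU lamU baU"
  using retrD(3)[OF retr_qU] by (simp add: lobj_def left_unit_def retr_qU baU_def lamU_def restrict2_def fun_eq_iff del: eA_scal)
end

section \<open>The source category is monoidal\<close>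

context yd_hopf_carriers begin

lemma right_obsE:
  assumes "M \<in> YD_right_obs H R"
  obtains q dl ra where "robj M q dl ra" "isright q dl ra"
proof -
  have "univ.subspace (msp M)" using assms by (simp add: YD_right_obs_def Let_def right_module_def)
  then show ?thesis using obs_robj[OF assms retr_pj] that by blast
qed

lemma right_map_id: assumes "isright q dl ra" shows "right_map q dl ra q dl ra q"
proof -
  interpret M: right_yd_object p m u d e S Si pR mR uR dR eR ac co SR SRi q dl ra by fact
  have "swt (dl x) (\<lambda>y a. q y \<otimes>\<^sub>k a) = dl x" for x
  proof -
    have "swt (dl x) (\<lambda>y a. q y \<otimes>\<^sub>k a) = swt (swt (dl x) (\<lambda>y a. q y \<otimes>\<^sub>k pA a)) (\<lambda>y a. q y \<otimes>\<^sub>k a)" by (simp only: M.M.dl_qp)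
    also have "\<dots> = swt (dl x) (\<lambda>y a. q y \<otimes>\<^sub>k pA a)" by simp
    also have "\<dots> = dl x" by (rule M.M.dl_qp)
    finally show ?thesis .
  qed
  then show ?thesis by (simp add: right_map_def total_map_def M.M.lin_q')
qed

lemma right_map_tensor:
  assumes "isright q1 dl1 ra1" "isright q2 dl2 ra2" "isright q1' dl1' ra1'" "isright q2' dl2' ra2'"
    and F: "right_map q1 dl1 ra1 q1' dl1' ra1' F" and G: "right_map q2 dl2 ra2 q2' dl2' ra2' G"
  shows "right_map (right_yd_pair.qT q1 q2) (right_yd_pair.dlT m d mR ac q1 dl1 q2 dl2) (right_yd_pair.raT d ra1 ra2)
    (right_yd_pair.qT q1' q2') (right_yd_pair.dlT m d mR ac q1' dl1' q2' dl2') (right_yd_pair.raT d ra1' ra2') (\<lambda>t. swt t (\<lambda>x y. F x \<otimes>\<^sub>k G y))"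
proof -
  interpret T: right_yd_pair p m u d e S Si pR mR uR dR eR ac co SR SRi q1 dl1 ra1 q2 dl2 ra2
    by (intro right_yd_pair.intro total_yd_hopf_axioms assms)
  interpret T': right_yd_pair p m u d e S Si pR mR uR dR eR ac co SR SRi q1' dl1' ra1' q2' dl2' ra2'
    by (intro right_yd_pair.intro total_yd_hopf_axioms assms)
  note [simp] = right_mapD(2,3)[OF F] right_mapD(2,3)[OF G] total_mapD[OF right_mapD(1)[OF F]] total_mapD[OF right_mapD(1)[OF G]]
   lin_op[OF total_mapD(1)[OF right_mapD(1)[OF F]]] lin_op[OF total_mapD(1)[OF right_mapD(1)[OF G]]]
  show ?thesis unfolding right_map_def total_map_def
    by (simp add: T.qT_def T'.qT_def T.raT_def T'.raT_def T.dlT_def T'.dlT_def)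
qed

lemma right_map_asc:
  assumes "isright q1 dl1 ra1" "isright q2 dl2 ra2" "isright q3 dl3 ra3"
  defines "q12 \<equiv> right_yd_pair.qT q1 q2" and "dl12 \<equiv> right_yd_pair.dlT m d mR ac q1 dl1 q2 dl2" and "ra12 \<equiv> right_yd_pair.raT d ra1 ra2"
    and "q23 \<equiv> right_yd_pair.qT q2 q3" and "dl23 \<equiv> right_yd_pair.dlT m d mR ac q2 dl2 q3 dl3" and "ra23 \<equiv> right_yd_pair.raT d ra2 ra3"
  shows "right_map (right_yd_pair.qT q12 q3) (right_yd_pair.dlT m d mR ac q12 dl12 q3 dl3) (right_yd_pair.raT d ra12 ra3)
    (right_yd_pair.qT q1 q23) (right_yd_pair.dlT m d mR ac q1 dl1 q23 dl23) (right_yd_pair.raT d ra1 ra23) (\<lambda>t. asc (right_yd_pair.qT q12 q3 t))"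
proof -
  interpret T12: right_yd_pair p m u d e S Si pR mR uR dR eR ac co SR SRi q1 dl1 ra1 q2 dl2 ra2
    by (intro right_yd_pair.intro total_yd_hopf_axioms assms)
  interpret T23: right_yd_pair p m u d e S Si pR mR uR dR eR ac co SR SRi q2 dl2 ra2 q3 dl3 ra3
    by (intro right_yd_pair.intro total_yd_hopf_axioms assms)
  have 1: "isright q12 dl12 ra12" "isright q23 dl23 ra23"
    unfolding q12_def dl12_def ra12_def q23_def dl23_def ra23_def by (rule T12.right_yd_object_tensor T23.right_yd_object_tensor)+
  interpret T12_3: right_yd_pair p m u d e S Si pR mR uR dR eR ac co SR SRi q12 dl12 ra12 q3 dl3 ra3
    by (intro right_yd_pair.intro total_yd_hopf_axioms assms 1)
  interpret T1_23: right_yd_pair p m u d e S Si pR mR uR dR eR ac co SR SRi q1 dl1 ra1 q23 dl23 ra23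
    by (intro right_yd_pair.intro total_yd_hopf_axioms assms 1)
  note defs = T12_3.qT_def T12_3.raT_def T12_3.dlT_def T1_23.qT_def T1_23.raT_def T1_23.dlT_def
    T12.qT_def[folded q12_def] T12.raT_def[folded ra12_def] T12.dlT_def[folded dl12_def]
    T23.qT_def[folded q23_def] T23.raT_def[folded ra23_def] T23.dlT_def[folded dl23_def]
  have l: "lin (\<lambda>t. asc (T12_3.qT t))" by (simp add: asc_def defs)
  show ?thesis unfolding right_map_def total_map_def
    by (intro conjI l allI; simp add: asc_def defs; simp add: swt_swap[where t = "d _"])
qed

lemma right_map_lun:
  assumes "isright q dl ra"
  shows "right_map (right_yd_pair.qT qU q) (right_yd_pair.dlT m d mR ac qU dlU q dl) (right_yd_pair.raT d raU ra) q dl ra (\<lambda>t. lun (right_yd_pair.qT qU q t))"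
proof -
  interpret T: right_yd_pair p m u d e S Si pR mR uR dR eR ac co SR SRi qU dlU raU q dl ra
    by (intro right_yd_pair.intro total_yd_hopf_axioms assms right_yd_object_unit)
  have l: "lin (\<lambda>t. lun (T.qT t))" by (simp add: lun_def T.qT_def linf_comp[OF linf_unit_coeff])
  have c: "linf (\<lambda>x. unit_coeff (f x))" if "lin f" for f :: "('a, 'k) univ \<Rightarrow> ('a, 'k) univ" using that by (rule linf_comp[OF linf_unit_coeff])
  have q: "unit_coeff (qU x) = unit_coeff x" for x :: "('a, 'k) univ" by (simp add: qU_def unit_coeff_def unit_vec_def lookup_single)
  have s: "unit_coeff (c *\<^sub>k x) = c * unit_coeff x" for c and x :: "('a, 'k) univ" by (simp add: unit_coeff_def)
  show ?thesis unfolding right_map_def total_map_def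
    by (intro conjI l allI) (simp_all add: lun_def T.qT_def T.raT_def T.dlT_def raU_def dlU_def q s c T.N.M.dl_qp)
qed
lemma right_map_run:
  assumes "isright q dl ra"
  shows "right_map (right_yd_pair.qT q qU) (right_yd_pair.dlT m d mR ac q dl qU dlU) (right_yd_pair.raT d ra raU) q dl ra (\<lambda>t. run (right_yd_pair.qT q qU t))"
proof -
  interpret T: right_yd_pair p m u d e S Si pR mR uR dR eR ac co SR SRi q dl ra qU dlU raU
    by (intro right_yd_pair.intro total_yd_hopf_axioms assms right_yd_object_unit)
  have l: "lin (\<lambda>t. run (T.qT t))" by (simp add: run_def T.qT_def linf_comp[OF linf_unit_coeff])
  have c: "linf (\<lambda>x. unit_coeff (f x))" if "lin f" for f :: "('a, 'k) univ \<Rightarrow> ('a, 'k) univ" using that by (rule linf_comp[OF linf_unit_coeff])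
  have q: "unit_coeff (qU x) = unit_coeff x" for x :: "('a, 'k) univ" by (simp add: qU_def unit_coeff_def unit_vec_def lookup_single)
  have s: "unit_coeff (c *\<^sub>k x) = c * unit_coeff x" for c and x :: "('a, 'k) univ" by (simp add: unit_coeff_def)
  show ?thesis unfolding right_map_def total_map_def
    by (intro conjI l allI) (simp_all add: run_def T.qT_def T.raT_def T.dlT_def raU_def dlU_def q s c T.M.M.dl_qp)
qed

lemma concrete_right: "concrete_data (YD_right_obs H R) (right_hom H A) (right_tensor H A) (right_unit H A)"
proof
  show "right_unit H A \<in> YD_right_obs H R" by (rule robj_obs[OF robj_unit right_yd_object_unit])
  show "msp (right_unit H A) = unit_space" by (simp add: right_unit_def)
  show "msp (right_tensor H A X Y) = msp X \<otimes>\<^sub>V msp Y" for X Y by (simp add: right_tensor_def)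
next
  fix X assume X: "X \<in> YD_right_obs H R"
  then show "univ.subspace (msp X)" by (simp add: YD_right_obs_def Let_def right_module_def)
  obtain q dl ra where x: "robj X q dl ra" "isright q dl ra" by (rule right_obsE[OF X])
  show "right_hom H A X X (\<lambda>x. x)"
    by (simp add: right_hom_iff[OF x x] right_map_id[OF x(2)])
  have "isright qU dlU raU" by (rule right_yd_object_unit)
  interpret L: right_yd_pair p m u d e S Si pR mR uR dR eR ac co SR SRi qU dlU raU q dl ra
    by (intro right_yd_pair.intro total_yd_hopf_axioms x right_yd_object_unit)
  interpret R: right_yd_pair p m u d e S Si pR mR uR dR eR ac co SR SRi q dl ra qU dlU raU
    by (intro right_yd_pair.intro total_yd_hopf_axioms x right_yd_object_unit)
  show "right_hom H A (right_tensor H A (right_unit H A) X) X lun"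
    by (simp add: right_hom_iff[OF robj_tensor[OF robj_unit right_yd_object_unit x] L.right_yd_object_tensor x] right_map_lun x)
  show "right_hom H A (right_tensor H A X (right_unit H A)) X run"
    by (simp add: right_hom_iff[OF robj_tensor[OF x robj_unit right_yd_object_unit] R.right_yd_object_tensor x] right_map_run x)
next
  fix X Y assume X: "X \<in> YD_right_obs H R" and Y: "Y \<in> YD_right_obs H R"
  obtain q dl ra where x: "robj X q dl ra" "isright q dl ra" by (rule right_obsE[OF X])
  obtain q' dl' ra' where y: "robj Y q' dl' ra'" "isright q' dl' ra'" by (rule right_obsE[OF Y])
  interpret T: right_yd_pair p m u d e S Si pR mR uR dR eR ac co SR SRi q dl ra q' dl' ra'
    by (intro right_yd_pair.intro total_yd_hopf_axioms x y)
  show "right_tensor H A X Y \<in> YD_right_obs H R" by (rule robj_obs[OF robj_tensor[OF x y] T.right_yd_object_tensor])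
  have q: "retr q (msp X)" and q': "retr q' (msp Y)" using x(1) y(1) unfolding robj_def by blast+
  fix f assume f: "right_hom H A X Y f"
  show "linear_on (msp X) (msp Y) f" using f by (simp add: right_hom_def)
  { fix g assume "\<And>x. x \<in> msp X \<Longrightarrow> f x = g x"
    then show "right_hom H A X Y g" using f retrD(2)[OF q] by (simp add: right_hom_iff[OF x y]) }
  { fix Z g assume Z: "Z \<in> YD_right_obs H R" and g: "right_hom H A Y Z g"
    obtain q'' dl'' ra'' where z: "robj Z q'' dl'' ra''" "isright q'' dl'' ra''" by (rule right_obsE[OF Z])
    show "right_hom H A X Z (\<lambda>x. g (f x))"
      using right_map_comp[OF f[unfolded right_hom_iff[OF x y]] g[unfolded right_hom_iff[OF y z]]] total_mapD(2)[OF right_mapD(1)[OF f[unfolded right_hom_iff[OF x y]]]]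
      by (simp add: right_hom_iff[OF x z]) }
  fix g assume g: "lin f" "lin g" "\<And>y. y \<in> msp Y \<Longrightarrow> g y \<in> msp X" "\<And>x. x \<in> msp X \<Longrightarrow> g (f x) = x" "\<And>y. y \<in> msp Y \<Longrightarrow> f (g y) = y"
  note n = right_mapD(1)[OF f[unfolded right_hom_iff[OF x y]]]
  show "right_hom H A Y X g"
    unfolding right_hom_iff[OF y x]
  proof (rule T.right_map_inv[OF f[unfolded right_hom_iff[OF x y]]])
    show "total_map q' q (\<lambda>x. g (q' x))"
      using lin_comp[OF g(2) retrD(1)[OF q']] g(3)[OF retrD(2)[OF q']] retrD(3)[OF q] retrD(4)[OF q'] by (simp add: total_map_def)
    fix t show "g (q' (f (q t))) = q t" using total_mapD(2)[OF n, of t] g(4)[OF retrD(2)[OF q]] by simp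
    show "f (q (g (q' t))) = q' t" using g(3)[OF retrD(2)[OF q']] g(5)[OF retrD(2)[OF q']] retrD(3)[OF q] by simp
  qed
next
  fix X X' Y Y' f g assume o: "X \<in> YD_right_obs H R" "X' \<in> YD_right_obs H R" "Y \<in> YD_right_obs H R" "Y' \<in> YD_right_obs H R"
    and f: "right_hom H A X X' f" and g: "right_hom H A Y Y' g" and l: "lin f" "lin g"
  obtain q1 dl1 ra1 where x: "robj X q1 dl1 ra1" "isright q1 dl1 ra1" by (rule right_obsE[OF o(1)])
  obtain q1' dl1' ra1' where x': "robj X' q1' dl1' ra1'" "isright q1' dl1' ra1'" by (rule right_obsE[OF o(2)])
  obtain q2 dl2 ra2 where y: "robj Y q2 dl2 ra2" "isright q2 dl2 ra2" by (rule right_obsE[OF o(3)])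
  obtain q2' dl2' ra2' where y': "robj Y' q2' dl2' ra2'" "isright q2' dl2' ra2'" by (rule right_obsE[OF o(4)])
  interpret T: right_yd_pair p m u d e S Si pR mR uR dR eR ac co SR SRi q1 dl1 ra1 q2 dl2 ra2
    by (intro right_yd_pair.intro total_yd_hopf_axioms x y)
  interpret T': right_yd_pair p m u d e S Si pR mR uR dR eR ac co SR SRi q1' dl1' ra1' q2' dl2' ra2'
    by (intro right_yd_pair.intro total_yd_hopf_axioms x' y')
  note [simp] = lin_op[OF l(1)] lin_op[OF l(2)]
  show "right_hom H A (right_tensor H A X Y) (right_tensor H A X' Y') (\<lambda>t. swt t (\<lambda>x y. f x \<otimes>\<^sub>k g y))"
    using right_map_tensor[OF x(2) y(2) x'(2) y'(2) f[unfolded right_hom_iff[OF x x']] g[unfolded right_hom_iff[OF y y']]]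
    unfolding right_hom_iff[OF robj_tensor[OF x y] T.right_yd_object_tensor robj_tensor[OF x' y'] T'.right_yd_object_tensor]
    by (simp add: T.qT_def)
next
  fix X Y Z assume o: "X \<in> YD_right_obs H R" "Y \<in> YD_right_obs H R" "Z \<in> YD_right_obs H R"
  obtain q1 dl1 ra1 where x: "robj X q1 dl1 ra1" "isright q1 dl1 ra1" by (rule right_obsE[OF o(1)])
  obtain q2 dl2 ra2 where y: "robj Y q2 dl2 ra2" "isright q2 dl2 ra2" by (rule right_obsE[OF o(2)])
  obtain q3 dl3 ra3 where z: "robj Z q3 dl3 ra3" "isright q3 dl3 ra3" by (rule right_obsE[OF o(3)])
  interpret XY: right_yd_pair p m u d e S Si pR mR uR dR eR ac co SR SRi q1 dl1 ra1 q2 dl2 ra2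
    by (intro right_yd_pair.intro total_yd_hopf_axioms x y)
  interpret YZ: right_yd_pair p m u d e S Si pR mR uR dR eR ac co SR SRi q2 dl2 ra2 q3 dl3 ra3
    by (intro right_yd_pair.intro total_yd_hopf_axioms y z)
  note xy = robj_tensor[OF x y] XY.right_yd_object_tensor and yz = robj_tensor[OF y z] YZ.right_yd_object_tensor
  have xy_z: "isright (right_yd_pair.qT XY.qT q3) (right_yd_pair.dlT m d mR ac XY.qT XY.dlT q3 dl3) (right_yd_pair.raT d XY.raT ra3)"
    by (intro right_yd_pair.right_yd_object_tensor right_yd_pair.intro total_yd_hopf_axioms xy z)
  have x_yz: "isright (right_yd_pair.qT q1 YZ.qT) (right_yd_pair.dlT m d mR ac q1 dl1 YZ.qT YZ.dlT) (right_yd_pair.raT d ra1 YZ.raT)"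
    by (intro right_yd_pair.right_yd_object_tensor right_yd_pair.intro total_yd_hopf_axioms yz x)
  show "right_hom H A (right_tensor H A (right_tensor H A X Y) Z) (right_tensor H A X (right_tensor H A Y Z)) asc"
    unfolding right_hom_iff[OF robj_tensor[OF xy z] xy_z robj_tensor[OF x yz] x_yz]
    by (rule right_map_asc[OF x(2) y(2) z(2)])
qed
end

section \<open>Monoidal categories of left modules over a bosonization\<close>

context yd_hopf_carriers begin

text \<open>The objects of the target category without rationality, which involves the pairing and
  cannot be expressed for a single Hopf algebra.\<close>

definition "left_yd_obs = {X. left_yd A H (proj_H H R) X \<and> mact X = restrict2 (carr A) (msp X) (mact X) \<and> mcoact X \<in> extensional (msp X)}"
lemma lobj_obs:
  assumes "lobj X q lam ba" "isleft q lam ba"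
  shows "X \<in> left_yd_obs"
  using lobj_left_yd[OF assms] assms(1) unfolding lobj_def left_yd_obs_def by blast
lemma left_obsE:
  assumes "X \<in> left_yd_obs"
  obtains q lam ba where "lobj X q lam ba" "isleft q lam ba"
proof -
  have "univ.subspace (msp X)" using assms by (simp add: left_yd_obs_def left_yd_def left_module_def)
  then show ?thesis using left_yd_lobj[OF _ retr_pj, of X] assms that by (simp add: left_yd_obs_def)
qed

lemma left_map_id: assumes "isleft q lam ba" shows "left_map q lam ba q lam ba q"
proof -
  interpret M: left_yd_object p m u d e S Si pR mR uR dR eR ac co SR SRi q lam ba by fact
  have "swt (lam x) (\<lambda>y a. y \<otimes>\<^sub>k q a) = lam x" for x
  proof -
    have "swt (lam x) (\<lambda>y a. y \<otimes>\<^sub>k q a) = swt (swt (lam x) (\<lambda>y a. p y \<otimes>\<^sub>k q a)) (\<lambda>y a. y \<otimes>\<^sub>k q a)" by (simp only: M.M.co_pq)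
    also have "\<dots> = swt (lam x) (\<lambda>y a. p y \<otimes>\<^sub>k q a)" by simp
    also have "\<dots> = lam x" by (rule M.M.co_pq)
    finally show ?thesis .
  qed
  then show ?thesis by (simp add: left_map_def total_map_def M.M.lin_q')
qed

lemma left_map_tensor:
  assumes "isleft q1 lam1 ba1" "isleft q2 lam2 ba2" "isleft q1' lam1' ba1'" "isleft q2' lam2' ba2'"
    and F: "left_map q1 lam1 ba1 q1' lam1' ba1' F" and G: "left_map q2 lam2 ba2 q2' lam2' ba2' G"
  shows "left_map (left_yd_pair.qT q1 q2) (left_yd_pair.lamT m q1 lam1 q2 lam2) (left_yd_pair.baT p m d pR dR co ba1 ba2)
    (left_yd_pair.qT q1' q2') (left_yd_pair.lamT m q1' lam1' q2' lam2') (left_yd_pair.baT p m d pR dR co ba1' ba2') (\<lambda>t. swt t (\<lambda>x y. F x \<otimes>\<^sub>k G y))"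
proof -
  interpret T: left_yd_pair p m u d e S Si pR mR uR dR eR ac co SR SRi q1 lam1 ba1 q2 lam2 ba2
    by (intro left_yd_pair.intro total_yd_hopf_axioms assms)
  interpret T': left_yd_pair p m u d e S Si pR mR uR dR eR ac co SR SRi q1' lam1' ba1' q2' lam2' ba2'
    by (intro left_yd_pair.intro total_yd_hopf_axioms assms)
  note [simp] = left_mapD(2,3)[OF F] left_mapD(2,3)[OF G] total_mapD[OF left_mapD(1)[OF F]] total_mapD[OF left_mapD(1)[OF G]]
   lin_op[OF total_mapD(1)[OF left_mapD(1)[OF F]]] lin_op[OF total_mapD(1)[OF left_mapD(1)[OF G]]]
  show ?thesis unfolding left_map_def total_map_def
    by (simp add: T.qT_def T'.qT_def T.baT_def T'.baT_def T.lamT_def T'.lamT_def)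
qed

lemma left_map_asc:
  assumes "isleft q1 lam1 ba1" "isleft q2 lam2 ba2" "isleft q3 lam3 ba3"
  defines "q12 \<equiv> left_yd_pair.qT q1 q2" and "lam12 \<equiv> left_yd_pair.lamT m q1 lam1 q2 lam2" and "ba12 \<equiv> left_yd_pair.baT p m d pR dR co ba1 ba2"
    and "q23 \<equiv> left_yd_pair.qT q2 q3" and "lam23 \<equiv> left_yd_pair.lamT m q2 lam2 q3 lam3" and "ba23 \<equiv> left_yd_pair.baT p m d pR dR co ba2 ba3"
  shows "left_map (left_yd_pair.qT q12 q3) (left_yd_pair.lamT m q12 lam12 q3 lam3) (left_yd_pair.baT p m d pR dR co ba12 ba3)
    (left_yd_pair.qT q1 q23) (left_yd_pair.lamT m q1 lam1 q23 lam23) (left_yd_pair.baT p m d pR dR co ba1 ba23) (\<lambda>t. asc (left_yd_pair.qT q12 q3 t))"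
proof -
  interpret T12: left_yd_pair p m u d e S Si pR mR uR dR eR ac co SR SRi q1 lam1 ba1 q2 lam2 ba2
    by (intro left_yd_pair.intro total_yd_hopf_axioms assms)
  interpret T23: left_yd_pair p m u d e S Si pR mR uR dR eR ac co SR SRi q2 lam2 ba2 q3 lam3 ba3
    by (intro left_yd_pair.intro total_yd_hopf_axioms assms)
  have 1: "isleft q12 lam12 ba12" "isleft q23 lam23 ba23"
    unfolding q12_def lam12_def ba12_def q23_def lam23_def ba23_def by (rule T12.left_yd_object_tensor T23.left_yd_object_tensor)+
  interpret T12_3: left_yd_pair p m u d e S Si pR mR uR dR eR ac co SR SRi q12 lam12 ba12 q3 lam3 ba3
    by (intro left_yd_pair.intro total_yd_hopf_axioms assms 1)
  interpret T1_23: left_yd_pair p m u d e S Si pR mR uR dR eR ac co SR SRi q1 lam1 ba1 q23 lam23 ba23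
    by (intro left_yd_pair.intro total_yd_hopf_axioms assms 1)
  note defs = T12_3.qT_def T12_3.baT_def T12_3.lamT_def T1_23.qT_def T1_23.baT_def T1_23.lamT_def
    T12.qT_def[folded q12_def] T12.baT_def[folded ba12_def] T12.lamT_def[folded lam12_def]
    T23.qT_def[folded q23_def] T23.baT_def[folded ba23_def] T23.lamT_def[folded lam23_def]
  have l: "lin (\<lambda>t. asc (T12_3.qT t))" by (simp add: asc_def defs)
  show ?thesis unfolding left_map_def total_map_def
    by (intro conjI l allI; simp add: asc_def defs; (simp add: swt_swap[where t = "dA _"])?)
qed

lemma left_map_lun:
  assumes "isleft q lam ba"
  shows "left_map (left_yd_pair.qT qU q) (left_yd_pair.lamT m qU lamU q lam) (left_yd_pair.baT p m d pR dR co baU ba) q lam ba (\<lambda>t. lun (left_yd_pair.qT qU q t))"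
proof -
  interpret T: left_yd_pair p m u d e S Si pR mR uR dR eR ac co SR SRi qU lamU baU q lam ba
    by (intro left_yd_pair.intro total_yd_hopf_axioms assms left_yd_object_unit)
  have l: "lin (\<lambda>t. lun (T.qT t))" by (simp add: lun_def T.qT_def linf_comp[OF linf_unit_coeff])
  have c: "linf (\<lambda>x. unit_coeff (f x))" if "lin f" for f :: "('a, 'k) univ \<Rightarrow> ('a, 'k) univ" using that by (rule linf_comp[OF linf_unit_coeff])
  have q: "unit_coeff (qU x) = unit_coeff x" for x :: "('a, 'k) univ" by (simp add: qU_def unit_coeff_def unit_vec_def lookup_single)
  have s: "unit_coeff (c *\<^sub>k x) = c * unit_coeff x" for c and x :: "('a, 'k) univ" by (simp add: unit_coeff_def)
  show ?thesis unfolding left_map_def total_map_def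
    by (intro conjI l allI) (simp_all add: lun_def T.qT_def T.baT_def T.lamT_def baU_def lamU_def q s c T.Y.M.co_pq del: eA_scal)
qed
lemma left_map_run:
  assumes "isleft q lam ba"
  shows "left_map (left_yd_pair.qT q qU) (left_yd_pair.lamT m q lam qU lamU) (left_yd_pair.baT p m d pR dR co ba baU) q lam ba (\<lambda>t. run (left_yd_pair.qT q qU t))"
proof -
  interpret T: left_yd_pair p m u d e S Si pR mR uR dR eR ac co SR SRi q lam ba qU lamU baU
    by (intro left_yd_pair.intro total_yd_hopf_axioms assms left_yd_object_unit)
  have l: "lin (\<lambda>t. run (T.qT t))" by (simp add: run_def T.qT_def linf_comp[OF linf_unit_coeff])
  have c: "linf (\<lambda>x. unit_coeff (f x))" if "lin f" for f :: "('a, 'k) univ \<Rightarrow> ('a, 'k) univ" using that by (rule linf_comp[OF linf_unit_coeff])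
  have q: "unit_coeff (qU x) = unit_coeff x" for x :: "('a, 'k) univ" by (simp add: qU_def unit_coeff_def unit_vec_def lookup_single)
  have s: "unit_coeff (c *\<^sub>k x) = c * unit_coeff x" for c and x :: "('a, 'k) univ" by (simp add: unit_coeff_def)
  show ?thesis unfolding left_map_def total_map_def
    by (intro conjI l allI) (simp_all add: run_def T.qT_def T.baT_def T.lamT_def baU_def lamU_def q s c T.X.M.co_pq del: eA_scal)
qed

text \<open>Stated for any class of objects that contains the unit and is closed under tensor
  products, so that it applies to the rational ones.\<close>

lemma concrete_left:
  assumes Obj: "Obj \<subseteq> left_yd_obs" "left_unit A H \<in> Obj" "\<And>X Y. X \<in> Obj \<Longrightarrow> Y \<in> Obj \<Longrightarrow> left_tensor A H X Y \<in> Obj"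
  shows "concrete_data Obj (left_hom A H) (left_tensor A H) (left_unit A H)"
proof
  show "left_unit A H \<in> Obj" by (rule Obj(2))
  show "msp (left_unit A H) = unit_space" by (simp add: left_unit_def)
  show "msp (left_tensor A H X Y) = msp X \<otimes>\<^sub>V msp Y" for X Y by (simp add: left_tensor_def)
next
  fix X assume X: "X \<in> Obj"
  then show "univ.subspace (msp X)" using Obj(1) by (auto simp: left_yd_obs_def left_yd_def left_module_def)
  obtain q lam ba where x: "lobj X q lam ba" "isleft q lam ba" by (rule left_obsE[OF subsetD[OF Obj(1) X]])
  show "left_hom A H X X (\<lambda>x. x)"
    by (simp add: left_hom_iff[OF x x] left_map_id[OF x(2)])
  have "isleft qU lamU baU" by (rule left_yd_object_unit)
  interpret L: left_yd_pair p m u d e S Si pR mR uR dR eR ac co SR SRi qU lamU baU q lam ba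
    by (intro left_yd_pair.intro total_yd_hopf_axioms x left_yd_object_unit)
  interpret R: left_yd_pair p m u d e S Si pR mR uR dR eR ac co SR SRi q lam ba qU lamU baU
    by (intro left_yd_pair.intro total_yd_hopf_axioms x left_yd_object_unit)
  show "left_hom A H (left_tensor A H (left_unit A H) X) X lun"
    by (simp add: left_hom_iff[OF lobj_tensor[OF lobj_unit left_yd_object_unit x] L.left_yd_object_tensor x] left_map_lun x)
  show "left_hom A H (left_tensor A H X (left_unit A H)) X run"
    by (simp add: left_hom_iff[OF lobj_tensor[OF x lobj_unit left_yd_object_unit] R.left_yd_object_tensor x] left_map_run x)
next
  fix X Y assume X: "X \<in> Obj" and Y: "Y \<in> Obj"
  obtain q lam ba where x: "lobj X q lam ba" "isleft q lam ba" by (rule left_obsE[OF subsetD[OF Obj(1) X]])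
  obtain q' lam' ba' where y: "lobj Y q' lam' ba'" "isleft q' lam' ba'" by (rule left_obsE[OF subsetD[OF Obj(1) Y]])
  interpret T: left_yd_pair p m u d e S Si pR mR uR dR eR ac co SR SRi q lam ba q' lam' ba'
    by (intro left_yd_pair.intro total_yd_hopf_axioms x y)
  show "left_tensor A H X Y \<in> Obj" by (rule Obj(3)[OF X Y])
  have q: "retr q (msp X)" and q': "retr q' (msp Y)" using x(1) y(1) unfolding lobj_def by blast+
  fix f assume f: "left_hom A H X Y f"
  show "linear_on (msp X) (msp Y) f" using f by (simp add: left_hom_def)
  { fix g assume "\<And>x. x \<in> msp X \<Longrightarrow> f x = g x"
    then show "left_hom A H X Y g" using f retrD(2)[OF q] by (simp add: left_hom_iff[OF x y]) }
  { fix Z g assume Z: "Z \<in> Obj" and g: "left_hom A H Y Z g"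
    obtain q'' lam'' ba'' where z: "lobj Z q'' lam'' ba''" "isleft q'' lam'' ba''" by (rule left_obsE[OF subsetD[OF Obj(1) Z]])
    show "left_hom A H X Z (\<lambda>x. g (f x))"
      using left_map_comp[OF f[unfolded left_hom_iff[OF x y]] g[unfolded left_hom_iff[OF y z]]] total_mapD(2)[OF left_mapD(1)[OF f[unfolded left_hom_iff[OF x y]]]]
      by (simp add: left_hom_iff[OF x z]) }
  fix g assume g: "lin f" "lin g" "\<And>y. y \<in> msp Y \<Longrightarrow> g y \<in> msp X" "\<And>x. x \<in> msp X \<Longrightarrow> g (f x) = x" "\<And>y. y \<in> msp Y \<Longrightarrow> f (g y) = y"
  note n = left_mapD(1)[OF f[unfolded left_hom_iff[OF x y]]]
  show "left_hom A H Y X g"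
    unfolding left_hom_iff[OF y x]
  proof (rule T.left_map_inv[OF f[unfolded left_hom_iff[OF x y]]])
    show "total_map q' q (\<lambda>x. g (q' x))"
      using lin_comp[OF g(2) retrD(1)[OF q']] g(3)[OF retrD(2)[OF q']] retrD(3)[OF q] retrD(4)[OF q'] by (simp add: total_map_def)
    fix t show "g (q' (f (q t))) = q t" using total_mapD(2)[OF n, of t] g(4)[OF retrD(2)[OF q]] by simp
    show "f (q (g (q' t))) = q' t" using g(3)[OF retrD(2)[OF q']] g(5)[OF retrD(2)[OF q']] retrD(3)[OF q] by simp
  qed
next
  fix X X' Y Y' f g assume o: "X \<in> Obj" "X' \<in> Obj" "Y \<in> Obj" "Y' \<in> Obj"
    and f: "left_hom A H X X' f" and g: "left_hom A H Y Y' g" and l: "lin f" "lin g"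
  obtain q1 lam1 ba1 where x: "lobj X q1 lam1 ba1" "isleft q1 lam1 ba1" by (rule left_obsE[OF subsetD[OF Obj(1) o(1)]])
  obtain q1' lam1' ba1' where x': "lobj X' q1' lam1' ba1'" "isleft q1' lam1' ba1'" by (rule left_obsE[OF subsetD[OF Obj(1) o(2)]])
  obtain q2 lam2 ba2 where y: "lobj Y q2 lam2 ba2" "isleft q2 lam2 ba2" by (rule left_obsE[OF subsetD[OF Obj(1) o(3)]])
  obtain q2' lam2' ba2' where y': "lobj Y' q2' lam2' ba2'" "isleft q2' lam2' ba2'" by (rule left_obsE[OF subsetD[OF Obj(1) o(4)]])
  interpret T: left_yd_pair p m u d e S Si pR mR uR dR eR ac co SR SRi q1 lam1 ba1 q2 lam2 ba2
    by (intro left_yd_pair.intro total_yd_hopf_axioms x y)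
  interpret T': left_yd_pair p m u d e S Si pR mR uR dR eR ac co SR SRi q1' lam1' ba1' q2' lam2' ba2'
    by (intro left_yd_pair.intro total_yd_hopf_axioms x' y')
  note [simp] = lin_op[OF l(1)] lin_op[OF l(2)]
  show "left_hom A H (left_tensor A H X Y) (left_tensor A H X' Y') (\<lambda>t. swt t (\<lambda>x y. f x \<otimes>\<^sub>k g y))"
    using left_map_tensor[OF x(2) y(2) x'(2) y'(2) f[unfolded left_hom_iff[OF x x']] g[unfolded left_hom_iff[OF y y']]]
    unfolding left_hom_iff[OF lobj_tensor[OF x y] T.left_yd_object_tensor lobj_tensor[OF x' y'] T'.left_yd_object_tensor]
    by (simp add: T.qT_def)
next
  fix X Y Z assume o: "X \<in> Obj" "Y \<in> Obj" "Z \<in> Obj"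
  obtain q1 lam1 ba1 where x: "lobj X q1 lam1 ba1" "isleft q1 lam1 ba1" by (rule left_obsE[OF subsetD[OF Obj(1) o(1)]])
  obtain q2 lam2 ba2 where y: "lobj Y q2 lam2 ba2" "isleft q2 lam2 ba2" by (rule left_obsE[OF subsetD[OF Obj(1) o(2)]])
  obtain q3 lam3 ba3 where z: "lobj Z q3 lam3 ba3" "isleft q3 lam3 ba3" by (rule left_obsE[OF subsetD[OF Obj(1) o(3)]])
  interpret XY: left_yd_pair p m u d e S Si pR mR uR dR eR ac co SR SRi q1 lam1 ba1 q2 lam2 ba2
    by (intro left_yd_pair.intro total_yd_hopf_axioms x y)
  interpret YZ: left_yd_pair p m u d e S Si pR mR uR dR eR ac co SR SRi q2 lam2 ba2 q3 lam3 ba3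
    by (intro left_yd_pair.intro total_yd_hopf_axioms y z)
  note xy = lobj_tensor[OF x y] XY.left_yd_object_tensor and yz = lobj_tensor[OF y z] YZ.left_yd_object_tensor
  have xy_z: "isleft (left_yd_pair.qT XY.qT q3) (left_yd_pair.lamT m XY.qT XY.lamT q3 lam3) (left_yd_pair.baT p m d pR dR co XY.baT ba3)"
    by (intro left_yd_pair.left_yd_object_tensor left_yd_pair.intro total_yd_hopf_axioms xy z)
  have x_yz: "isleft (left_yd_pair.qT q1 YZ.qT) (left_yd_pair.lamT m q1 lam1 YZ.qT YZ.lamT) (left_yd_pair.baT p m d pR dR co ba1 YZ.baT)"
    by (intro left_yd_pair.left_yd_object_tensor left_yd_pair.intro total_yd_hopf_axioms yz x)
  show "left_hom A H (left_tensor A H (left_tensor A H X Y) Z) (left_tensor A H X (left_tensor A H Y Z)) asc"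
    unfolding left_hom_iff[OF lobj_tensor[OF xy z] xy_z lobj_tensor[OF x yz] x_yz]
    by (rule left_map_asc[OF x(2) y(2) z(2)])
qed
end

section \<open>The functor on morphisms\<close>

text \<open>Morphisms in the intermediate category of R-comodules, through which the morphism
  conditions of source and target are compared.\<close>

definition "comodule_map q lac lam rho q' lac' lam' rho' F \<longleftrightarrow> total_map q q' F \<and> (\<forall>h x. F (lac h x) = lac' h (F x)) \<and>
  (\<forall>x. lam' (F x) = swt (lam x) (\<lambda>g y. g \<otimes>\<^sub>k F y)) \<and> (\<forall>x. rho' (F x) = swt (rho x) (\<lambda>r y. r \<otimes>\<^sub>k F y))"
lemma comodule_mapD: assumes "comodule_map q lac lam rho q' lac' lam' rho' F"
  shows "total_map q q' F" "F (lac h x) = lac' h (F x)" "lam' (F x) = swt (lam x) (\<lambda>g y. g \<otimes>\<^sub>k F y)" "rho' (F x) = swt (rho x) (\<lambda>r y. r \<otimes>\<^sub>k F y)"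
  using assms by (simp_all add: comodule_map_def)

context right_yd_pair begin
lemma right_map_comodule_map:
  assumes F: "right_map q dl ra q' dl' ra' F"
  shows "comodule_map q M.lac M.lam M.rho q' N.lac N.lam N.rho F"
proof -
  note [simp] = right_mapD(2,3)[OF F] total_mapD[OF right_mapD(1)[OF F]] lin_op[OF total_mapD(1)[OF right_mapD(1)[OF F]]]
  show ?thesis using right_mapD(1)[OF F] by (simp add: comodule_map_def M.lac_def N.lac_def M.lam_def N.lam_def M.rho_def N.rho_def)
qed

lemma lac_tensor: "right_yd_object.lac Si raT h t = swt t (\<lambda>x y. swt (d h) (\<lambda>h1 h2. M.lac h2 x \<otimes>\<^sub>k N.lac h1 y))"
proof -
  interpret T: right_yd_object p m u d e S Si pR mR uR dR eR ac co SR SRi qT dlT raT by (rule right_yd_object_tensor)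
  show ?thesis by (simp add: T.lac_def raT_def M.lac_def N.lac_def)
qed
lemma lam_tensor: "right_yd_object.lam p m u d S mR uR eR ac co SR qT dlT t = swt t (\<lambda>x y. swt (M.lam x) (\<lambda>g x0. swt (N.lam y) (\<lambda>g' y0. m g' g \<otimes>\<^sub>k q x0 \<otimes>\<^sub>k q' y0)))"
proof -
  interpret T: right_yd_object p m u d e S Si pR mR uR dR eR ac co SR SRi qT dlT raT by (rule right_yd_object_tensor)
  show ?thesis by (simp add: T.lam_def dlT_def qT_def M.lam_def N.lam_def)
qed
lemma rho_tensor: "right_yd_object.rho m u d e S pR mR uR ac co SR qT dlT t = swt t (\<lambda>x y. swt (M.rho x) (\<lambda>r x'. swt (N.rho y) (\<lambda>r' y'. swt (N.lam y') (\<lambda>g y0.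
  mR r' (ac g r) \<otimes>\<^sub>k q x' \<otimes>\<^sub>k q' y0))))"
proof -
  interpret T: right_yd_object p m u d e S Si pR mR uR dR eR ac co SR SRi qT dlT raT by (rule right_yd_object_tensor)
  show ?thesis by (simp add: T.rho_def dlT_def qT_def M.rho_def N.lam_def N.rho_def thA_mA_gen)
qed
end

context dual_yd_comodule_pair begin
lemma comodule_map_right_map:
  assumes F: "comodule_map q lac lam rho q' lac' lam' rho' F"
  shows "right_map q X.M.dl X.M.ra q' Y.M.dl Y.M.ra F"
proof -
  note [simp] = comodule_mapD(2-4)[OF F] total_mapD[OF comodule_mapD(1)[OF F]] lin_op[OF total_mapD(1)[OF comodule_mapD(1)[OF F]]]
  show ?thesis using comodule_mapD(1)[OF F] by (simp add: right_map_def X.M.ra_def Y.M.ra_def X.M.dl_def Y.M.dl_def)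
qed
lemma comodule_map_left_map:
  assumes F: "comodule_map q lac lam rho q' lac' lam' rho' F"
  shows "left_map q lam X.T.ba q' lam' Y.T.ba F"
proof -
  note [simp] = comodule_mapD(2-4)[OF F] total_mapD[OF comodule_mapD(1)[OF F]] lin_op[OF total_mapD(1)[OF comodule_mapD(1)[OF F]]] fs_out[OF total_mapD(1)[OF comodule_mapD(1)[OF F]]]
  show ?thesis using comodule_mapD(1)[OF F] by (simp add: left_map_def X.T.ba_def Y.T.ba_def X.xa_def Y.xa_def)
qed
text \<open>Colinearity for R follows from linearity for the dual: contracting both sides with \<xi>
  gives \<xi>F(x) and F(\<xi>x), and \<open>separate\<close> applies.\<close>

lemma left_map_comodule_map:
  assumes F: "left_map q lam X.T.ba q' lam' Y.T.ba F"
  shows "comodule_map q lac lam rho q' lac' lam' rho' F"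
proof -
  note n [simp] = total_mapD[OF left_mapD(1)[OF F]]
  note l [simp] = lin_op[OF n(1)] fs_out[OF n(1)]
  have 1: "F (lac h x) = lac' h (F x)" for h x using left_mapD(2)[OF F, of "V.iH h" x] by simp
  have 2: "F (X.xa \<xi> x) = Y.xa \<xi> (F x)" for \<xi> x using left_mapD(2)[OF F, of "V.iR \<xi>" x] by simp
  have "rho' (F x) = swt (rho x) (\<lambda>r y. r \<otimes>\<^sub>k F y)" for x
  proof (rule separate)
    have "swt (rho y) (\<lambda>r y. pR r \<otimes>\<^sub>k G y) = swt (rho y) (\<lambda>r y. r \<otimes>\<^sub>k G y)" if G: "lin G" "\<And>x. G (q x) = G x" for y G
    proof -
      note [simp] = lin_op[OF G(1)]
      have "swt (rho y) (\<lambda>r y. pR r \<otimes>\<^sub>k G y) = swt (swt (rho y) (\<lambda>r y. pR r \<otimes>\<^sub>k q y)) (\<lambda>r y. r \<otimes>\<^sub>k G y)" by (simp add: G)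
      then show ?thesis by (simp only: X.M.rho.co_pq)
    qed
    then show "swt (swt (rho x) (\<lambda>r y. r \<otimes>\<^sub>k F y)) (\<lambda>r y. pR r \<otimes>\<^sub>k y) = swt (rho x) (\<lambda>r y. r \<otimes>\<^sub>k F y)" by simp
    have "swt (rho' y) (\<lambda>r y. pR r \<otimes>\<^sub>k y) = rho' y" for y
    proof -
      have "swt (rho' y) (\<lambda>r y. pR r \<otimes>\<^sub>k y) = swt (swt (rho' y) (\<lambda>r y. pR r \<otimes>\<^sub>k q' y)) (\<lambda>r y. pR r \<otimes>\<^sub>k y)" by (simp only: Y.M.rho.co_pq)
      also have "\<dots> = swt (rho' y) (\<lambda>r y. pR r \<otimes>\<^sub>k q' y)" by simp
      finally show ?thesis by (simp only: Y.M.rho.co_pq)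
    qed
    then show "swt (rho' (F x)) (\<lambda>r y. pR r \<otimes>\<^sub>k y) = rho' (F x)" .
    fix \<xi>
    have "swt (rho' (F x)) (fs \<xi>) = swt (swt (rho' (F x)) (\<lambda>r y. pR r \<otimes>\<^sub>k q' y)) (fs \<xi>)" by (simp only: Y.M.rho.co_pq)
    also have "\<dots> = Y.xa \<xi> (F x)" by (simp add: Y.xa_def)
    also have "\<dots> = F (X.xa \<xi> x)" by (simp add: 2)
    also have "\<dots> = swt (swt (rho x) (\<lambda>r y. r \<otimes>\<^sub>k F y)) (fs \<xi>)" by (simp add: X.xa_def)
    finally show "swt (rho' (F x)) (fs \<xi>) = swt (swt (rho x) (\<lambda>r y. r \<otimes>\<^sub>k F y)) (fs \<xi>)" .
  qed
  then show ?thesis using left_mapD(1,3)[OF F] 1 by (simp add: comodule_map_def)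
qed
end

context total_dual_pair begin
text \<open>\<open>isduco\<close> abbreviates the full locale predicate for an R-comodule in the
  setting of the dual pair; \<open>isrho\<close>, defined next, relates such a coaction to an
  action.\<close>

abbreviation "isduco q lac lam rho \<equiv> dual_yd_comodule p m u d e S Si pR mR uR dR eR ac co SR SRi pV mV uV dV eV acv cov SV SVi fm q lac lam rho"
definition "isrho q ba rho \<longleftrightarrow> (\<forall>x. swt (rho x) (\<lambda>r y. pR r \<otimes>\<^sub>k q y) = rho x) \<and> (\<forall>\<xi> x. swt (rho x) (fs \<xi>) = ba (V.iR \<xi>) x)"

text \<open>The passage from a module to a comodule and back returns the action started
  with.\<close>

lemma left_duco:
  assumes X: "left_yd_object p m u d e S Si pV mV uV dV eV acv cov SV SVi q lam ba" and rho: "isrho q ba rho"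
  shows "isduco q (left_yd_object.lac p uV ba) lam rho" "yd_module.ba (left_yd_object.lac p uV ba) (dual_yd_comodule.xa fm q rho) = ba"
proof -
  interpret X: left_yd_object p m u d e S Si pV mV uV dV eV acv cov SV SVi q lam ba by fact
  interpret D: dual_yd_module p m u d e S Si pR mR uR dR eR ac co SR SRi pV mV uV dV eV acv cov SV SVi fm q X.lac lam X.xa rho
    using rho by (intro dual_yd_module.intro total_dual_pair_axioms X.yd_module dual_yd_module_axioms.intro) (simp_all add: isrho_def X.xa_def)
  show d: "isduco q X.lac lam rho" by (intro dual_yd_comodule.intro total_dual_pair_axioms D.yd_comodule)
  interpret E: dual_yd_comodule p m u d e S Si pR mR uR dR eR ac co SR SRi pV mV uV dV eV acv cov SV SVi fm q X.lac lam rho by (rule d)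
  have e: "E.xa = X.xa" using D.rho_xa_gen[of q] by (auto simp: fun_eq_iff E.xa_def)
  show "yd_module.ba X.lac E.xa = ba" unfolding e by (intro ext X.ba_yd_module)
qed

lemma right_duco:
  assumes "right_yd_object p m u d e S Si pR mR uR dR eR ac co SR SRi q dl ra"
  shows "isduco q (right_yd_object.lac Si ra) (right_yd_object.lam p m u d S mR uR eR ac co SR q dl) (right_yd_object.rho m u d e S pR mR uR ac co SR q dl)"
  by (intro dual_yd_comodule.intro total_dual_pair_axioms right_yd_object.yd_comodule assms)
end

context dual_yd_comodule_pair begin
text \<open>Provides rationality of tensor products: the coaction that induces the diagonal action
  is explicit, so no finite-dimensional subspaces have to be combined.\<close>

lemma isrho_tensor: "isrho FF.qT FF.baT rhoF"
  by (simp add: isrho_def baT_rhoF) (simp add: rhoF_def FF.qT_def)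
end
context total_dual_pair begin
lemma isrho_unit: "isrho qU V.baU (\<lambda>x. uR \<otimes>\<^sub>k qU x)"
  by (simp add: isrho_def V.baU_def V.iR_def)
end

section \<open>Rationality\<close>

context total_dual_pair begin
text \<open>Linear algebra behind rationality: a linear map vanishing on the common kernel of
  finitely many functionals is a combination of them with vector coefficients. The induction on B
  does not assume the functionals independent.\<close>

lemma fin_annihilator:
  assumes "finite B" "lin L" "\<And>\<xi>. (\<And>b. b \<in> B \<Longrightarrow> fm \<xi> b = 0) \<Longrightarrow> L \<xi> = 0"
  shows "\<exists>y. \<forall>\<xi>. L \<xi> = (\<Sum>b\<in>B. fm \<xi> b *\<^sub>k y b)"
  using assms
proof (induction B arbitrary: L rule: finite_induct)
  case empty
  then show ?case by simp
next
  case (insert b B)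
  have ext: "\<exists>y. \<forall>\<xi>. L \<xi> = (\<Sum>b\<in>insert b B. fm \<xi> b *\<^sub>k y b)" if y: "\<And>\<xi>. L \<xi> = fm \<xi> b *\<^sub>k z + (\<Sum>b\<in>B. fm \<xi> b *\<^sub>k y b)" for z y
  proof (intro exI allI)
    fix \<xi>
    have "(\<Sum>b\<in>B. fm \<xi> b *\<^sub>k y b) = (\<Sum>c\<in>B. fm \<xi> c *\<^sub>k (y(b := z)) c)"
      using insert.hyps by (intro sum.cong) auto
    then show "L \<xi> = (\<Sum>c\<in>insert b B. fm \<xi> c *\<^sub>k (y(b := z)) c)" using insert.hyps by (simp add: y)
  qed
  have fm: "fm (c *\<^sub>k \<xi>) x = c * fm \<xi> x" "fm (\<xi> - \<eta>) x = fm \<xi> x - fm \<eta> x" for c \<xi> \<eta> x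
  proof -
    note l = fm_lin(2)[of x, unfolded linf_def, THEN conjunct1] fm_lin(2)[of x, unfolded linf_def, THEN conjunct2]
    show "fm (c *\<^sub>k \<xi>) x = c * fm \<xi> x" using l by blast
    show "fm (\<xi> - \<eta>) x = fm \<xi> x - fm \<eta> x" using l(1)[rule_format, of "\<xi> - \<eta>" \<eta>] by simp
  qed
  show ?case
  proof (cases "\<exists>\<xi>. (\<forall>c\<in>B. fm \<xi> c = 0) \<and> fm \<xi> b \<noteq> 0")
    case True
    then obtain \<xi>' where x: "\<And>c. c \<in> B \<Longrightarrow> fm \<xi>' c = 0" "fm \<xi>' b \<noteq> 0" by blast
    \<comment> \<open>Pairs to 1 with b and to 0 with B. Subtracting its contribution from L leaves
      a map that vanishes on the annihilator of B alone.\<close>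
    define \<xi>0 where "\<xi>0 = inverse (fm \<xi>' b) *\<^sub>k \<xi>'"
    have x0: "\<And>c. c \<in> B \<Longrightarrow> fm \<xi>0 c = 0" "fm \<xi>0 b = 1" using x by (simp_all add: \<xi>0_def fm)
    have "\<exists>y. \<forall>\<xi>. L \<xi> - fm \<xi> b *\<^sub>k L \<xi>0 = (\<Sum>b\<in>B. fm \<xi> b *\<^sub>k y b)"
    proof (rule insert.IH)
      show "lin (\<lambda>\<xi>. L \<xi> - fm \<xi> b *\<^sub>k L \<xi>0)"
        using insert.prems(1) fm_lin(2)[of b] by (simp add: lin_def linf_def univ.scale_right_diff_distrib univ.scale_left_distrib)
      fix \<xi> assume k: "\<And>c. c \<in> B \<Longrightarrow> fm \<xi> c = 0"
      have "L (\<xi> - fm \<xi> b *\<^sub>k \<xi>0) = 0"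
        by (rule insert.prems(2)) (auto simp: fm k x0)
      then show "L \<xi> - fm \<xi> b *\<^sub>k L \<xi>0 = 0" by (simp add: lin_diff[OF insert.prems(1)] lin_scal[OF insert.prems(1)])
    qed
    then obtain y where "\<And>\<xi>. L \<xi> - fm \<xi> b *\<^sub>k L \<xi>0 = (\<Sum>b\<in>B. fm \<xi> b *\<^sub>k y b)" by blast
    then have "\<And>\<xi>. L \<xi> = fm \<xi> b *\<^sub>k L \<xi>0 + (\<Sum>b\<in>B. fm \<xi> b *\<^sub>k y b)" by (metis add.commute diff_add_cancel)
    then show ?thesis by (rule ext)
  next
    \<comment> \<open>Pairing with b now vanishes on the annihilator of B, so the induction
      hypothesis applies to L itself and b gets coefficient 0.\<close>
    case False
    then have "\<exists>y. \<forall>\<xi>. L \<xi> = (\<Sum>b\<in>B. fm \<xi> b *\<^sub>k y b)"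
      using insert.prems by (intro insert.IH) auto
    then obtain y where "\<And>\<xi>. L \<xi> = fm \<xi> b *\<^sub>k 0 + (\<Sum>b\<in>B. fm \<xi> b *\<^sub>k y b)" by auto
    then show ?thesis by (rule ext)
  qed
qed
end

locale dual_pair_carriers = total_dual_pair p m u d e S Si pR mR uR dR eR ac co SR SRi pV mV uV dV eV acv cov SV SVi fm
  + RR: yd_hopf_carriers p m u d e S Si pR mR uR dR eR ac co SR SRi H R
  + VV: yd_hopf_carriers p m u d e S Si pV mV uV dV eV acv cov SV SVi H Rv
  for p :: "('a, 'k::field) univ \<Rightarrow> ('a, 'k) univ" and m u d e S Si pR mR uR dR eR ac co SR SRi pV mV uV dV eV acv cov SV SVi fm
    and H :: "('a, 'k) bialg_data" and R Rv :: "('a, 'k) yd_bialg_data" +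
  fixes form :: "('a, 'k) univ \<Rightarrow> ('a, 'k) univ \<Rightarrow> 'k"
  assumes form_conv [simp]: "\<And>\<xi> x. \<xi> \<in> carr Rv \<Longrightarrow> x \<in> carr R \<Longrightarrow> form \<xi> x = fm \<xi> x"
begin

lemma rational_isrho:
  assumes X: "VV.lobj X q lam ba" "VV.isleft q lam ba" and rat: "rational H R Rv form X"
  shows "\<exists>rho. isrho q ba rho"
proof -
  interpret X: left_yd_object p m u d e S Si pV mV uV dV eV acv cov SV SVi q lam ba by fact
  have q: "retr q (msp X)" and c: "\<And>x b. b \<in> carr VV.A \<Longrightarrow> x \<in> msp X \<Longrightarrow> mact X b x = ba b x"
    using X(1) unfolding VV.lobj_def by blast+
  have "\<forall>x. \<exists>t. swt t (\<lambda>r y. pR r \<otimes>\<^sub>k q y) = t \<and> (\<forall>\<xi>. swt t (fs \<xi>) = ba (V.iR \<xi>) x)"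
  proof
    fix x
    obtain E where E: "E \<in> fin_subspaces (carr R)" "\<And>\<xi>. \<xi> \<in> left_perp (carr Rv) form E \<Longrightarrow> mact X (incl_R H \<xi>) (q x) = 0"
      using rat retrD(2)[OF q, of x] unfolding rational_def by blast
    then obtain B where B: "finite B" "E = univ.span B" and ER: "E \<subseteq> carr R" by (auto simp: fin_subspaces_def fin_dim_def)
    have "\<exists>y. \<forall>\<xi>. ba (V.iR \<xi>) x = (\<Sum>b\<in>B. fm \<xi> b *\<^sub>k y b)"
    proof (rule fin_annihilator[OF B(1)])
      show "lin (\<lambda>\<xi>. ba (V.iR \<xi>) x)" by simp
      fix \<xi> assume k: "\<And>b. b \<in> B \<Longrightarrow> fm \<xi> b = 0"
      have "fm \<xi> x = 0" if "x \<in> univ.span B" for x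
        using that
      proof (induction rule: univ.span_induct_alt)
        case base
        show ?case using fm_lin(1)[of \<xi>, unfolded linf_def, THEN conjunct2, rule_format, of 0 0] by simp
      next
        case (step c x y)
        then show ?case using fm_lin(1)[of \<xi>] k by (simp add: linf_def)
      qed
      then have "pV \<xi> \<in> left_perp (carr Rv) form E"
        using ER unfolding left_perp_def B(2) by (auto simp: fm_pV subset_iff)
      from E(2)[OF this] show "ba (V.iR \<xi>) x = 0"
        by (simp add: c retrD(2)[OF q])
    qed
    then obtain y where y: "\<And>\<xi>. ba (V.iR \<xi>) x = (\<Sum>b\<in>B. fm \<xi> b *\<^sub>k y b)" by blast
    \<comment> \<open>The required element of R \<otimes> X is the sum of all b \<otimes> y(b); its
      contraction with \<xi> is the expansion of \<xi>x just obtained.\<close>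
    define t where "t = (\<Sum>b\<in>B. pR b \<otimes>\<^sub>k q (y b))"
    have 1: "swt t f = (\<Sum>b\<in>B. swt (pR b \<otimes>\<^sub>k q (y b)) f)" for f
      unfolding t_def by (rule lin_sum[OF lin_swt_arg])
    have "swt t (fs \<xi>) = ba (V.iR \<xi>) x" for \<xi>
    proof -
      have "swt t (fs \<xi>) = (\<Sum>b\<in>B. fm \<xi> b *\<^sub>k q (y b))" by (simp add: 1) (simp add: fs_def)
      also have "\<dots> = q (\<Sum>b\<in>B. fm \<xi> b *\<^sub>k y b)" by (simp add: lin_sum[OF retrD(1)[OF q]] lin_scal[OF retrD(1)[OF q]])
      finally show ?thesis by (simp add: y[symmetric])
    qed
    moreover have "swt t (\<lambda>r y. pR r \<otimes>\<^sub>k q y) = t" by (simp add: 1) (simp add: t_def)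
    ultimately show "\<exists>t. swt t (\<lambda>r y. pR r \<otimes>\<^sub>k q y) = t \<and> (\<forall>\<xi>. swt t (fs \<xi>) = ba (V.iR \<xi>) x)" by blast
  qed
  then show ?thesis unfolding isrho_def by metis
qed

lemma isrho_rational:
  assumes X: "VV.lobj X q lam ba" and rho: "isrho q ba rho"
  shows "rational H R Rv form X"
  unfolding rational_def
proof
  fix x assume x: "x \<in> msp X"
  have c: "\<And>x b. b \<in> carr VV.A \<Longrightarrow> x \<in> msp X \<Longrightarrow> mact X b x = ba b x"
    using X unfolding VV.lobj_def by blast
  \<comment> \<open>The left factors of the basis tensors occurring in \<open>rho x\<close>,
    projected to R. If \<xi> annihilates them, every term of the contraction vanishes.\<close>
  define B where "B = (\<lambda>k. case k of PairIx i j \<Rightarrow> pR (Poly_Mapping.single i 1) | _ \<Rightarrow> 0) ` Poly_Mapping.keys (rho x)"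
  have fin: "finite B" by (simp add: B_def)
  have "B \<subseteq> carr R" by (auto simp: B_def univ.subspace_0 split: tree_ix.splits)
  then have E: "univ.span B \<in> fin_subspaces (carr R)"
    unfolding fin_subspaces_def fin_dim_def using univ.span_minimal[of B "carr R"] fin by auto
  show "\<exists>E\<in>fin_subspaces (carr R). \<forall>\<xi>\<in>left_perp (carr Rv) form E. mact X (incl_R H \<xi>) x = 0"
  proof (rule bexI[OF _ E], rule ballI)
    fix \<xi> assume \<xi>: "\<xi> \<in> left_perp (carr Rv) form (univ.span B)"
    then have xi: "\<xi> \<in> carr Rv" by (simp add: left_perp_def)
    have k: "fm \<xi> (Poly_Mapping.single i 1) = 0" if "PairIx i j \<in> Poly_Mapping.keys (rho x)" for i j
    proof -
      have "pR (Poly_Mapping.single i 1) \<in> B" using that by (force simp: B_def)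
      then have "form \<xi> (pR (Poly_Mapping.single i 1)) = 0" using \<xi> univ.span_base[of _ B] unfolding left_perp_def by blast
      then show ?thesis using xi by (simp add: fm_pR)
    qed
    have "swt (rho x) (fs \<xi>) = 0"
      unfolding swt_def by (intro sum.neutral) (auto simp: fs_def k split: tree_ix.splits)
    then show "mact X (incl_R H \<xi>) x = 0" using rho xi x by (simp add: c isrho_def)
  qed
qed

abbreviation "RY \<equiv> YD_rat_obs H R Rv form"
lemma RY_eq: "RY = {X \<in> VV.left_yd_obs. rational H R Rv form X}"
  by (auto simp: YD_rat_obs_def VV.left_yd_obs_def Let_def)

lemma rat_obs:
  assumes "VV.lobj X q lam ba" "VV.isleft q lam ba" "isrho q ba rho" shows "X \<in> RY"
  using VV.lobj_obs[OF assms(1,2)] isrho_rational[OF assms(1,3)] by (simp add: RY_eq)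

lemma rat_obsE:
  assumes "X \<in> RY"
  obtains q lac lam rho where "isduco q lac lam rho" "VV.lobj X q lam (yd_module.ba lac (dual_yd_comodule.xa fm q rho))" "VV.isleft q lam (yd_module.ba lac (dual_yd_comodule.xa fm q rho))"
proof -
  obtain q lam ba where x: "VV.lobj X q lam ba" "VV.isleft q lam ba" using assms VV.left_obsE unfolding RY_eq by blast
  obtain rho where rho: "isrho q ba rho" using rational_isrho[OF x] assms unfolding RY_eq by blast
  show ?thesis using that[OF left_duco(1)[OF x(2) rho]] x unfolding left_duco(2)[OF x(2) rho] by blast
qed

lemma concrete_rat: "concrete_data RY (left_hom VV.A H) (left_tensor VV.A H) (left_unit VV.A H)"
proof (rule VV.concrete_left)
  show "RY \<subseteq> VV.left_yd_obs" by (auto simp: RY_eq)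
  show "left_unit VV.A H \<in> RY" by (rule rat_obs[OF VV.lobj_unit V.left_yd_object_unit isrho_unit])
  fix X Y assume "X \<in> RY" "Y \<in> RY"
  obtain q lac lam rho where x: "isduco q lac lam rho" "VV.lobj X q lam (yd_module.ba lac (dual_yd_comodule.xa fm q rho))" "VV.isleft q lam (yd_module.ba lac (dual_yd_comodule.xa fm q rho))"
    using \<open>X \<in> RY\<close> by (rule rat_obsE)
  obtain q' lac' lam' rho' where y: "isduco q' lac' lam' rho'" "VV.lobj Y q' lam' (yd_module.ba lac' (dual_yd_comodule.xa fm q' rho'))" "VV.isleft q' lam' (yd_module.ba lac' (dual_yd_comodule.xa fm q' rho'))"
    using \<open>Y \<in> RY\<close> by (rule rat_obsE)
  interpret D: dual_yd_comodule_pair p m u d e S Si pR mR uR dR eR ac co SR SRi pV mV uV dV eV acv cov SV SVi fm q lac lam rho q' lac' lam' rho'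
    by (intro dual_yd_comodule_pair.intro total_dual_pair_axioms x y)
  show "left_tensor VV.A H X Y \<in> RY"
    by (rule rat_obs[OF VV.lobj_tensor[OF x(2,3) y(2,3)] D.FF.left_yd_object_tensor D.isrho_tensor])
qed

section \<open>The functor on objects\<close>

abbreviation "F \<equiv> F_obj H R Rv form"

text \<open>Identifies F(M) with the module built from \<open>lac\<close>, \<open>lam\<close> and
  \<open>rho\<close>. The last two claims match the actions displayed in the theorem with
  \<open>lac\<close> and with evaluation of \<open>rho\<close>.\<close>

lemma lobj_F:
  assumes M: "RR.robj M q dl ra" "RR.isright q dl ra"
  defines "lac \<equiv> right_yd_object.lac Si ra" and "lam \<equiv> right_yd_object.lam p m u d S mR uR eR ac co SR q dl" and "rho \<equiv> right_yd_object.rho m u d e S pR mR uR ac co SR q dl"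
  shows "VV.lobj (F M) q lam (yd_module.ba lac (dual_yd_comodule.xa fm q rho))"
    and "\<And>h x. h \<in> carr H \<Longrightarrow> x \<in> msp M \<Longrightarrow> F_act_H H M h x = lac h x"
    and "\<And>\<xi> x. \<xi> \<in> carr Rv \<Longrightarrow> x \<in> msp M \<Longrightarrow> F_act_Rv H R form M \<xi> x = dual_yd_comodule.xa fm q rho \<xi> x"
proof -
  interpret M: right_yd_object p m u d e S Si pR mR uR dR eR ac co SR SRi q dl ra by fact
  interpret D: dual_yd_comodule p m u d e S Si pR mR uR dR eR ac co SR SRi pV mV uV dV eV acv cov SV SVi fm q lac lam rho
    unfolding lac_def lam_def rho_def by (rule right_duco[OF M(2)])
  have q: "retr q (msp M)" and c: "\<And>x h. x \<in> msp M \<Longrightarrow> h \<in> carr H \<Longrightarrow> mact M x h = ra x h" "\<And>x. x \<in> msp M \<Longrightarrow> mcoact M x = dl x"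
    using M(1) unfolding RR.robj_def by blast+
  note [simp] = retrD(2)[OF q] retr_subspace[OF q] c
  note qq [simp] = retrD(3)[OF q]
  have mem: "x \<in> msp M \<longleftrightarrow> q x = x" for x using q by (rule retr_mem_iff)
  have dl [simp]: "dl x \<in> msp M \<otimes>\<^sub>V carr RR.A" for x
  proof -
    have "swt (dl x) (\<lambda>a b. q a \<otimes>\<^sub>k pA b) \<in> msp M \<otimes>\<^sub>V carr RR.A" by (intro swt_in tens_in subspace_tensor; simp)
    then show ?thesis by (simp only: M.M.dl_qp)
  qed
  show 1: "F_act_H H M h x = lac h x" if "h \<in> carr H" "x \<in> msp M" for h x
    using that by (simp add: F_act_H_def lac_def M.lac_def)
  show 2: "F_act_Rv H R form M \<xi> x = D.xa \<xi> x" if "\<xi> \<in> carr Rv" "x \<in> msp M" for \<xi> x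
  proof -
    have "F_act_Rv H R form M \<xi> x = sw (msp M) (carr RR.A) (dl x) (\<lambda>y a. fs \<xi> (thA (SA a)) (q y))"
      unfolding F_act_Rv_def Let_def by (intro sw_cong) (simp_all add: that fs_def)
    also have "\<dots> = D.xa \<xi> x" unfolding D.xa_def by (simp add: rho_def M.rho_def del: qq)
    finally show ?thesis .
  qed
  have [simp]: "lac h x \<in> msp M" for h x by (simp add: mem)
  have 3: "sw (carr Rv) (carr H) b (\<lambda>\<xi> h. F_act_Rv H R form M \<xi> (F_act_H H M h x)) = D.T.ba b x" if "b \<in> carr VV.A" "x \<in> msp M" for b x
  proof -
    have "sw (carr Rv) (carr H) b (\<lambda>\<xi> h. F_act_Rv H R form M \<xi> (F_act_H H M h x)) = sw (carr Rv) (carr H) b (\<lambda>\<xi> h. D.xa \<xi> (lac h x))"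
      by (intro sw_cong) (simp_all add: that 1 2)
    then show ?thesis using that by (simp add: D.T.ba_def VV.carr_A)
  qed
  have 4: "F_coact H R M x = lam x" if "x \<in> msp M" for x
  proof -
    have "F_coact H R M x = sw (msp M) (carr RR.A) (dl x) (\<lambda>y a. piA (SA a) \<otimes>\<^sub>k q y)"
      unfolding F_coact_def Let_def by (intro sw_cong) (simp_all add: that)
    then show ?thesis by (simp add: lam_def M.lam_def del: qq)
  qed
  show "VV.lobj (F M) q lam D.T.ba"
    unfolding VV.lobj_def F_obj_def using q 3 4 by (simp add: restrict2_def fun_eq_iff)
qed
end

section \<open>The isomorphism of categories\<close>

lemma concrete_functor:
  assumes C: "concrete_data Obj is_hom ten un" and D: "concrete_data Obj' is_hom' ten' un'"
    and Fo: "\<And>X. X \<in> Obj \<Longrightarrow> Fo X \<in> Obj'" "\<And>X. X \<in> Obj \<Longrightarrow> msp (Fo X) = msp X"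
    and Fa: "\<And>X Y f. X \<in> Obj \<Longrightarrow> Y \<in> Obj \<Longrightarrow> is_hom X Y f \<Longrightarrow> is_hom' (Fo X) (Fo Y) f"
  shows "cat_functor (concrete_monoidal Obj is_hom ten un) (concrete_monoidal Obj' is_hom' ten' un') Fo (\<lambda>(X, f, Y). (Fo X, f, Fo Y))"
proof -
  interpret C: concrete_data Obj is_hom ten un by fact
  interpret D: concrete_data Obj' is_hom' ten' un' by fact
  interpret MC: monoidal_category C.C by (rule C.monoidal_category_C)
  interpret MD: monoidal_category D.C by (rule D.monoidal_category_C)
  show ?thesis
  proof
    fix f X Y assume "f \<in> homs C.C X Y"
    then show "(\<lambda>(X, f, Y). (Fo X, f, Fo Y)) f \<in> homs D.C (Fo X) (Fo Y)"
      by (auto simp: homs_def concrete_monoidal_def Fo Fa)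
  next
    fix f g X Y Z assume "f \<in> homs C.C X Y" "g \<in> homs C.C Y Z"
    then show "(\<lambda>(X, f, Y). (Fo X, f, Fo Y)) (Comp C.C g f) =
         Comp D.C ((\<lambda>(X, f, Y). (Fo X, f, Fo Y)) g) ((\<lambda>(X, f, Y). (Fo X, f, Fo Y)) f)"
      by (auto simp: homs_def concrete_monoidal_def Fo)
  qed (simp_all add: Fo)
qed

text \<open>For a functor that changes neither spaces nor maps, bijectivity on objects and
  equivalence of the morphism conditions suffice: the inverse on objects is set-theoretic and its
  functoriality is the same equivalence read backwards.\<close>

lemma concrete_isomorphism:
  assumes C: "concrete_data Obj is_hom ten un" and D: "concrete_data Obj' is_hom' ten' un'"
    and Fo: "\<And>X. X \<in> Obj \<Longrightarrow> Fo X \<in> Obj'" "\<And>X. X \<in> Obj \<Longrightarrow> msp (Fo X) = msp X"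
      "inj_on Fo Obj" "\<And>Y. Y \<in> Obj' \<Longrightarrow> \<exists>X\<in>Obj. Fo X = Y"
    and Fa: "\<And>X Y f. X \<in> Obj \<Longrightarrow> Y \<in> Obj \<Longrightarrow> is_hom' (Fo X) (Fo Y) f \<longleftrightarrow> is_hom X Y f"
  shows "isomorphism_of_categories (concrete_monoidal Obj is_hom ten un) (concrete_monoidal Obj' is_hom' ten' un') Fo (\<lambda>(X, f, Y). (Fo X, f, Fo Y))"
proof -
  define Go where "Go = inv_into Obj Fo"
  have G: "Go Y \<in> Obj" "Fo (Go Y) = Y" if "Y \<in> Obj'" for Y
    using Fo(4)[OF that] inv_into_into[of Y Fo Obj] f_inv_into_f[of Y Fo Obj] by (auto simp: Go_def)
  have GF: "Go (Fo X) = X" if "X \<in> Obj" for X using Fo(3) that by (simp add: Go_def)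
  have "cat_functor (concrete_monoidal Obj is_hom ten un) (concrete_monoidal Obj' is_hom' ten' un') Fo (\<lambda>(X, f, Y). (Fo X, f, Fo Y))"
    by (rule concrete_functor[OF C D]) (simp_all add: Fo Fa)
  moreover have "cat_functor (concrete_monoidal Obj' is_hom' ten' un') (concrete_monoidal Obj is_hom ten un) Go (\<lambda>(X, f, Y). (Go X, f, Go Y))"
  proof (rule concrete_functor[OF D C])
    show "msp (Go Y) = msp Y" if "Y \<in> Obj'" for Y using Fo(2)[OF G(1)[OF that]] G(2)[OF that] by simp
    show "is_hom (Go X) (Go Y) f" if "X \<in> Obj'" "Y \<in> Obj'" "is_hom' X Y f" for X Y f
      using Fa[OF G(1)[OF that(1)] G(1)[OF that(2)], of f] that G(2) by simp
  qed (rule G)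
  ultimately show ?thesis unfolding isomorphism_of_categories_def
    by (intro conjI exI[of _ Go] exI[of _ "\<lambda>(X, f, Y). (Go X, f, Go Y)"]) (auto simp: concrete_monoidal_def G GF)
qed

text \<open>Objects are extensional records, so agreement on the carrier is equality.\<close>

lemma (in yd_hopf_carriers) robj_unique:
  fixes M N :: "('a, 'k) mod_data"
  assumes M: "robj M q dl ra" and N: "robj N q dl ra" and s: "msp M = msp N" shows "M = N"
proof -
  have e: "mact X = restrict2 (msp X) (carr H) ra \<and> mcoact X = restrict dl (msp X)" if X: "robj X q dl ra" for X :: "('a, 'k) mod_data"
  proof -
    have r: "mact X = restrict2 (msp X) (carr H) (mact X)" "mcoact X \<in> extensional (msp X)"
      and c: "\<forall>x\<in>msp X. \<forall>h\<in>carr H. mact X x h = ra x h" "\<forall>x\<in>msp X. mcoact X x = dl x" using X unfolding robj_def by blast+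
    have "restrict2 (msp X) (carr H) (mact X) = restrict2 (msp X) (carr H) ra" "restrict (mcoact X) (msp X) = restrict dl (msp X)"
      using c by (auto simp: restrict2_def fun_eq_iff)
    then show ?thesis using r extensional_restrict[OF r(2)] by simp
  qed
  show ?thesis using e[OF M] e[OF N] s by (intro mod_data.equality) auto
qed
lemma (in yd_hopf_carriers) lobj_unique:
  fixes M N :: "('a, 'k) mod_data"
  assumes M: "lobj M q dl ba" and N: "lobj N q dl ba" and s: "msp M = msp N" shows "M = N"
proof -
  have e: "mact X = restrict2 (carr A) (msp X) ba \<and> mcoact X = restrict dl (msp X)" if X: "lobj X q dl ba" for X :: "('a, 'k) mod_data"
  proof -
    have r: "mact X = restrict2 (carr A) (msp X) (mact X)" "mcoact X \<in> extensional (msp X)"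
      and c: "\<forall>b\<in>carr A. \<forall>x\<in>msp X. mact X b x = ba b x" "\<forall>x\<in>msp X. mcoact X x = dl x" using X unfolding lobj_def by blast+
    have "restrict2 (carr A) (msp X) (mact X) = restrict2 (carr A) (msp X) ba" "restrict (mcoact X) (msp X) = restrict dl (msp X)"
      using c by (auto simp: restrict2_def fun_eq_iff)
    then show ?thesis using r extensional_restrict[OF r(2)] by simp
  qed
  show ?thesis using e[OF M] e[OF N] s by (intro mod_data.equality) auto
qed

context dual_yd_comodule begin
lemma isrho_self: "isrho q T.ba rho"
proof -
  have "swt (rho x) (fs \<xi>) = xa \<xi> x" for x \<xi>
  proof -
    have "swt (rho x) (fs \<xi>) = swt (swt (rho x) (\<lambda>r y. pR r \<otimes>\<^sub>k q y)) (fs \<xi>)" by (simp only: M.rho.co_pq)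
    then show ?thesis by (simp add: xa_def)
  qed
  then show ?thesis by (simp add: isrho_def M.rho.co_pq)
qed
end

context dual_pair_carriers begin

lemma msp_F [simp]: "msp (F M) = msp M" by (simp add: F_obj_def)

lemma F_obs: assumes "M \<in> YD_right_obs H R" shows "F M \<in> RY"
proof -
  obtain q dl ra where M: "RR.robj M q dl ra" "RR.isright q dl ra" by (rule RR.right_obsE[OF assms])
  interpret D: dual_yd_comodule p m u d e S Si pR mR uR dR eR ac co SR SRi pV mV uV dV eV acv cov SV SVi fm
    q "right_yd_object.lac Si ra" "right_yd_object.lam p m u d S mR uR eR ac co SR q dl" "right_yd_object.rho m u d e S pR mR uR ac co SR q dl"
    by (rule right_duco[OF M(2)])
  show ?thesis by (rule rat_obs[OF lobj_F(1)[OF M] D.T.left_yd_object D.isrho_self])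
qed

text \<open>Both conditions are equivalent to \<open>comodule_map\<close> for the associated
  R-comodules.\<close>

lemma F_full:
  assumes "M \<in> YD_right_obs H R" "N \<in> YD_right_obs H R"
  shows "left_hom VV.A H (F M) (F N) f \<longleftrightarrow> right_hom H RR.A M N f"
proof -
  obtain q dl ra where M: "RR.robj M q dl ra" "RR.isright q dl ra" by (rule RR.right_obsE[OF assms(1)])
  obtain q' dl' ra' where N: "RR.robj N q' dl' ra'" "RR.isright q' dl' ra'" by (rule RR.right_obsE[OF assms(2)])
  interpret T: right_yd_pair p m u d e S Si pR mR uR dR eR ac co SR SRi q dl ra q' dl' ra'
    by (intro right_yd_pair.intro total_yd_hopf_axioms M N)
  interpret D: dual_yd_comodule_pair p m u d e S Si pR mR uR dR eR ac co SR SRi pV mV uV dV eV acv cov SV SVi fm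
    q T.M.lac T.M.lam T.M.rho q' T.N.lac T.N.lam T.N.rho
    by (intro dual_yd_comodule_pair.intro total_dual_pair_axioms right_duco M N)
  \<comment> \<open>The round trip from a right comodule to \<open>lam\<close>, \<open>rho\<close>
    and back; without it \<open>comodule_map_right_map\<close> would speak about a different
    coaction.\<close>
  have e: "D.X.M.dl = dl" "D.X.M.ra = ra" "D.Y.M.dl = dl'" "D.Y.M.ra = ra'"
    by (intro ext T.M.dl_yd_comodule T.M.ra_yd_comodule T.N.dl_yd_comodule T.N.ra_yd_comodule)+
  have "left_hom VV.A H (F M) (F N) f \<longleftrightarrow> left_map q T.M.lam D.X.T.ba q' T.N.lam D.Y.T.ba (\<lambda>x. f (q x))"
    by (rule VV.left_hom_iff[OF lobj_F(1)[OF M] D.X.T.left_yd_object lobj_F(1)[OF N] D.Y.T.left_yd_object])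
  moreover have "right_hom H RR.A M N f \<longleftrightarrow> right_map q dl ra q' dl' ra' (\<lambda>x. f (q x))"
    by (rule RR.right_hom_iff[OF M N])
  ultimately show ?thesis
    using D.left_map_comodule_map D.comodule_map_left_map D.comodule_map_right_map T.right_map_comodule_map unfolding e by blast
qed

text \<open>
  If \<open>F M = F N\<close>, then the identity is a morphism from \<open>F M\<close> to \<open>F N\<close>, so by the previous lemma it
  is a morphism from \<open>M\<close> to \<open>N\<close>.
\<close>
lemma F_inj: "inj_on F (YD_right_obs H R)"
proof (rule inj_onI)
  fix M N assume M: "M \<in> YD_right_obs H R" and N: "N \<in> YD_right_obs H R" and e: "F M = F N"
  interpret C: concrete_data RY "left_hom VV.A H" "left_tensor VV.A H" "left_unit VV.A H" by (rule concrete_rat)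
  have "left_hom VV.A H (F M) (F N) (\<lambda>x. x)" using C.hom_id[OF F_obs[OF M]] e by simp
  then have h: "right_hom H RR.A M N (\<lambda>x. x)" by (simp only: F_full[OF M N])
  have s: "msp M = msp N" using arg_cong[OF e, of msp] by simp
  obtain q dl ra where m: "RR.robj M q dl ra" "RR.isright q dl ra" by (rule RR.right_obsE[OF M])
  \<comment> \<open>M and N live on the same space, so the projection chosen for M serves N as well
    and the total operations become comparable.\<close>
  have q: "retr q (msp N)" using m(1) s by (simp add: RR.robj_def)
  note n = RR.obs_robj[OF N q]
  note r = right_mapD[OF h[unfolded RR.right_hom_iff[OF m n]]]
  interpret T: right_yd_pair p m u d e S Si pR mR uR dR eR ac co SR SRi q dl ra q "\<lambda>x. mcoact N (q x)" "\<lambda>x h. mact N (q x) (p h)"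
    by (intro right_yd_pair.intro total_yd_hopf_axioms m n)
  have "mcoact N (q x) = dl x" for x
  proof -
    have "dl x = swt (dl x) (\<lambda>y a. q y \<otimes>\<^sub>k a)"
      using right_mapD(3)[OF RR.right_map_id[OF m(2)], of x] by simp
    also have "\<dots> = mcoact N (q x)" using r(3)[of x] by (simp add: retrD(4)[OF q])
    finally show ?thesis by simp
  qed
  moreover have "mact N (q x) (p h) = ra x h" for x h
    using r(2)[of x h] by (simp add: retrD(4)[OF q])
  ultimately have "RR.robj N q dl ra" using n(1) by simp
  then show "M = N" by (rule RR.robj_unique[OF m(1) _ s])
qed

text \<open>The preimage carries the right action and coaction constructed from the R-comodule
  belonging to X; the opposite round trip identifies its image with X.\<close>

lemma F_surj: assumes "X \<in> RY" shows "\<exists>M\<in>YD_right_obs H R. F M = X"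
proof -
  obtain q lac lam rho where x: "isduco q lac lam rho" "VV.lobj X q lam (yd_module.ba lac (dual_yd_comodule.xa fm q rho))" "VV.isleft q lam (yd_module.ba lac (dual_yd_comodule.xa fm q rho))"
    using assms by (rule rat_obsE)
  interpret D: dual_yd_comodule p m u d e S Si pR mR uR dR eR ac co SR SRi pV mV uV dV eV acv cov SV SVi fm q lac lam rho by (rule x(1))
  have q: "retr q (msp X)" using x(2) by (simp add: VV.lobj_def)
  note [simp] = retrD(2)[OF q]
  define M where "M = \<lparr> msp = msp X, mact = restrict2 (msp X) (carr H) D.M.ra, mcoact = restrict D.M.dl (msp X) \<rparr>"
  have m: "RR.robj M q D.M.dl D.M.ra" using q by (simp add: RR.robj_def M_def restrict2_def fun_eq_iff)
  have e: "right_yd_object.lac Si D.M.ra = lac" "right_yd_object.lam p m u d S mR uR eR ac co SR q D.M.dl = lam"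
      "right_yd_object.rho m u d e S pR mR uR ac co SR q D.M.dl = rho"
    by (intro ext D.M.lac_right_yd_object D.M.lam_right_yd_object D.M.rho_right_yd_object)+
  have "F M = X"
    using lobj_F(1)[OF m D.M.right_yd_object] x(2) unfolding e by (rule VV.lobj_unique) (simp add: M_def)
  then show ?thesis using RR.robj_obs[OF m D.M.right_yd_object] by blast
qed

lemma F_isomorphism: "isomorphism_of_categories (YD_right H R) (YD_rat H R Rv form) F (F_arr H R Rv form)"
  unfolding YD_right_def YD_rat_def F_arr_def Let_def
  by (rule concrete_isomorphism[OF RR.concrete_right concrete_rat]) (simp_all add: F_obs F_full F_inj F_surj)

lemma F_act:
  assumes M: "M \<in> YD_right_obs H R" and x: "x \<in> msp M"
  shows "h \<in> carr H \<Longrightarrow> mact (F M) (incl_H Rv h) x = F_act_H H M h x"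
    and "\<xi> \<in> carr Rv \<Longrightarrow> mact (F M) (incl_R H \<xi>) x = F_act_Rv H R form M \<xi> x"
proof -
  obtain q dl ra where m: "RR.robj M q dl ra" "RR.isright q dl ra" by (rule RR.right_obsE[OF M])
  interpret D: dual_yd_comodule p m u d e S Si pR mR uR dR eR ac co SR SRi pV mV uV dV eV acv cov SV SVi fm
    q "right_yd_object.lac Si ra" "right_yd_object.lam p m u d S mR uR eR ac co SR q dl" "right_yd_object.rho m u d e S pR mR uR ac co SR q dl"
    by (rule right_duco[OF m(2)])
  have c: "\<And>b x. b \<in> carr VV.A \<Longrightarrow> x \<in> msp M \<Longrightarrow> mact (F M) b x = D.T.ba b x"
    using lobj_F(1)[OF m] by (simp add: VV.lobj_def)
  show "h \<in> carr H \<Longrightarrow> mact (F M) (incl_H Rv h) x = F_act_H H M h x"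
    using x by (simp add: c lobj_F(2)[OF m])
  show "\<xi> \<in> carr Rv \<Longrightarrow> mact (F M) (incl_R H \<xi>) x = F_act_Rv H R form M \<xi> x"
    using x by (simp add: c lobj_F(3)[OF m])
qed
end

section \<open>The monoidal isomorphism\<close>

context dual_yd_comodule_pair begin
lemma lin_phi: "lin phi" "lin phii" by (simp_all add: phi_def[abs_def] phii_def[abs_def])
lemma phi_q: "FF.qT (phi t) = phi t" "phi (FF.qT t) = phi t" "FF.qT (phii t) = phii t"
  by (simp_all add: phi_def phii_def FF.qT_def)
lemma FF_lac: "left_yd_object.lac p uV FF.baT h t = swt t (\<lambda>x y. swt (d h) (\<lambda>h1 h2. lac h1 x \<otimes>\<^sub>k lac' h2 y))"
proof -
  interpret L: left_yd_object p m u d e S Si pV mV uV dV eV acv cov SV SVi FF.qT FF.lamT FF.baT by (rule FF.left_yd_object_tensor)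
  show ?thesis by (simp add: L.lac_def FF.baT_def)
qed
end

context dual_pair_carriers begin

abbreviation "rlac ra \<equiv> right_yd_object.lac Si ra"
abbreviation "rlam q dl \<equiv> right_yd_object.lam p m u d S mR uR eR ac co SR q dl"
abbreviation "rrho q dl \<equiv> right_yd_object.rho m u d e S pR mR uR ac co SR q dl"
abbreviation "ph ra q' dl' \<equiv> dual_yd_comodule_pair.phi Si (rlac ra) q' (rlam q' dl')"
abbreviation "tenq q q' \<equiv> right_yd_pair.qT q q'"
abbreviation "tend q dl q' dl' \<equiv> right_yd_pair.dlT m d mR ac q dl q' dl'"
abbreviation "tenr ra ra' \<equiv> right_yd_pair.raT d ra ra'"

sublocale CC: concrete_data "YD_right_obs H R" "right_hom H RR.A" "right_tensor H RR.A" "right_unit H RR.A"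
  by (rule RR.concrete_right)
sublocale DD: concrete_data RY "left_hom VV.A H" "left_tensor VV.A H" "left_unit VV.A H"
  by (rule concrete_rat)

lemma F_unit: "F (right_unit H RR.A) = left_unit VV.A H"
proof -
  interpret U: right_yd_object p m u d e S Si pR mR uR dR eR ac co SR SRi qU dlU raU by (rule right_yd_object_unit)
  interpret D: dual_yd_comodule p m u d e S Si pR mR uR dR eR ac co SR SRi pV mV uV dV eV acv cov SV SVi fm qU U.lac U.lam U.rho
    by (rule right_duco[OF right_yd_object_unit])
  have "U.lam = V.lamU" by (simp add: fun_eq_iff U.lam_def V.lamU_def dlU_def)
  moreover have "D.T.ba = V.baU"
    by (simp add: fun_eq_iff D.T.ba_def D.xa_def U.lac_def U.rho_def V.baU_def dlU_def raU_def univ.scale_left_commute)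
  ultimately show ?thesis
    using lobj_F(1)[OF RR.robj_unit right_yd_object_unit] VV.lobj_unit by (intro VV.lobj_unique) (simp_all add: right_unit_def left_unit_def)
qed

text \<open>Explains the formula for \<phi>: with g = \<pi>S(n1), the element \<pi>S^{-1}(n1) is
  S^{-2}(g), and acting by it from the right is the left action of S^{-1}(g).\<close>

lemma F_phi_rep:
  assumes M: "RR.robj M q dl ra" "RR.isright q dl ra" and N: "RR.robj N q' dl' ra'" "RR.isright q' dl' ra'"
  shows "F_phi H R Rv form M N = DD.rep (left_tensor VV.A H (F M) (F N)) (F (right_tensor H RR.A M N)) (ph ra q' dl')"
proof -
  interpret T: right_yd_pair p m u d e S Si pR mR uR dR eR ac co SR SRi q dl ra q' dl' ra'
    by (intro right_yd_pair.intro total_yd_hopf_axioms M N)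
  interpret D: dual_yd_comodule_pair p m u d e S Si pR mR uR dR eR ac co SR SRi pV mV uV dV eV acv cov SV SVi fm
    q T.M.lac T.M.lam T.M.rho q' T.N.lac T.N.lam T.N.rho
    by (intro dual_yd_comodule_pair.intro total_dual_pair_axioms right_duco M N)
  have q: "retr q (msp M)" and c: "\<And>x h. x \<in> msp M \<Longrightarrow> h \<in> carr H \<Longrightarrow> mact M x h = ra x h" "\<And>x. x \<in> msp M \<Longrightarrow> mcoact M x = dl x"
    using M(1) unfolding RR.robj_def by blast+
  have q': "retr q' (msp N)" and c': "\<And>x h. x \<in> msp N \<Longrightarrow> h \<in> carr H \<Longrightarrow> mact N x h = ra' x h" "\<And>x. x \<in> msp N \<Longrightarrow> mcoact N x = dl' x"
    using N(1) unfolding RR.robj_def by blast+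
  note [simp] = retrD(2)[OF q] retrD(2)[OF q'] retr_subspace[OF q] retr_subspace[OF q'] c c'
  note qq [simp] = retrD(3)[OF q] retrD(3)[OF q']
  have dl [simp]: "dl' y \<in> msp N \<otimes>\<^sub>V carr RR.A" for y
  proof -
    have "swt (dl' y) (\<lambda>a b. q' a \<otimes>\<^sub>k pA b) \<in> msp N \<otimes>\<^sub>V carr RR.A" by (intro swt_in tens_in subspace_tensor; simp)
    then show ?thesis by (simp only: T.N.M.dl_qp)
  qed
  have "sw (msp M) (msp N) t (\<lambda>m n. sw (msp N) (carr RR.A) (mcoact N n) (\<lambda>n0 n1.
       mact M m (proj_H H R (antipode_inv RR.A n1)) \<otimes>\<^sub>k n0)) = D.phi t" if t: "t \<in> msp M \<otimes>\<^sub>V msp N" for t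
  proof -
    have "sw (msp M) (msp N) t (\<lambda>m n. sw (msp N) (carr RR.A) (mcoact N n) (\<lambda>n0 n1.
       mact M m (proj_H H R (antipode_inv RR.A n1)) \<otimes>\<^sub>k n0)) =
       sw (msp M) (msp N) t (\<lambda>x y. sw (msp N) (carr RR.A) (dl' y) (\<lambda>y0 a. ra x (piA (SAi a)) \<otimes>\<^sub>k q' y0))"
      by (intro sw_cong) simp_all
    then show ?thesis using t by (simp add: D.phi_def T.N.lam_def T.M.lac_def del: qq)
  qed
  then show ?thesis by (simp add: F_phi_def Let_def DD.rep_def left_tensor_def restrict_def fun_eq_iff)
qed

text \<open>The checks for \<open>phi\<close> were made for comodules; they become a statement on
  left modules by \<open>comodule_map_left_map\<close>.\<close>

lemma phi_good:
  assumes M: "RR.robj M q dl ra" "RR.isright q dl ra" and N: "RR.robj N q' dl' ra'" "RR.isright q' dl' ra'"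
  defines "X \<equiv> left_tensor VV.A H (F M) (F N)" and "Y \<equiv> F (right_tensor H RR.A M N)"
  shows "DD.good X Y (ph ra q' dl')" and "DD.rep X Y (ph ra q' dl') \<in> isos DD.C X Y"
proof -
  interpret T: right_yd_pair p m u d e S Si pR mR uR dR eR ac co SR SRi q dl ra q' dl' ra'
    by (intro right_yd_pair.intro total_yd_hopf_axioms M N)
  interpret D: dual_yd_comodule_pair p m u d e S Si pR mR uR dR eR ac co SR SRi pV mV uV dV eV acv cov SV SVi fm
    q T.M.lac T.M.lam T.M.rho q' T.N.lac T.N.lam T.N.rho
    by (intro dual_yd_comodule_pair.intro total_dual_pair_axioms right_duco M N)
  note lT = left_duco[OF D.FF.left_yd_object_tensor D.isrho_tensor]
  \<comment> \<open>F(M) \<otimes> F(N) and F(M \<otimes> N) are taken as source and target of a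
    comodule map, not as tensor factors.\<close>
  interpret E: dual_yd_comodule_pair p m u d e S Si pR mR uR dR eR ac co SR SRi pV mV uV dV eV acv cov SV SVi fm
    D.FF.qT "left_yd_object.lac p uV D.FF.baT" D.FF.lamT D.rhoF T.qT "rlac T.raT" "rlam T.qT T.dlT" "rrho T.qT T.dlT"
    by (intro dual_yd_comodule_pair.intro total_dual_pair_axioms lT right_duco T.right_yd_object_tensor)
  have qT: "D.FF.qT = T.qT" by (simp add: fun_eq_iff D.FF.qT_def T.qT_def)
  have "comodule_map D.FF.qT (left_yd_object.lac p uV D.FF.baT) D.FF.lamT D.rhoF T.qT (rlac T.raT) (rlam T.qT T.dlT) (rrho T.qT T.dlT) D.phi"
    unfolding comodule_map_def total_map_def
    using D.lin_phi D.phi_q D.phi_lac D.phi_lam D.phi_rho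
    by (simp add: qT D.FF_lac T.lac_tensor T.lam_tensor T.rho_tensor D.lacM_def[symmetric] D.lamM_def[symmetric] D.rhoM_def[symmetric])
  then have l: "left_map D.FF.qT D.FF.lamT D.FF.baT T.qT (rlam T.qT T.dlT) E.Y.T.ba D.phi"
    using E.comodule_map_left_map lT(2) by simp
  note x = VV.lobj_tensor[OF lobj_F(1)[OF M] D.X.T.left_yd_object lobj_F(1)[OF N] D.Y.T.left_yd_object] D.FF.left_yd_object_tensor
  note y = lobj_F(1)[OF RR.robj_tensor[OF M N] T.right_yd_object_tensor] E.Y.T.left_yd_object
  have h: "left_hom VV.A H X Y D.phi"
    unfolding X_def Y_def VV.left_hom_iff[OF x y] using l by (simp add: D.phi_q)
  have o: "X \<in> RY" "Y \<in> RY"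
    unfolding X_def Y_def using RR.robj_obs[OF M] RR.robj_obs[OF N] F_obs by (simp_all add: CC.ten_obj)
  have mem: "t \<in> msp X \<longleftrightarrow> D.FF.qT t = t" "t \<in> msp Y \<longleftrightarrow> D.FF.qT t = t" for t
    using retr_mem_iff[of D.FF.qT "msp X" t] retr_mem_iff[of T.qT "msp Y" t] x(1) y(1) unfolding X_def Y_def VV.lobj_def qT by blast+
  show g: "DD.good X Y D.phi" using o h by (simp add: DD.good_def D.lin_phi mem D.phi_q)
  show "DD.rep X Y D.phi \<in> isos DD.C X Y"
    by (rule DD.isosI[OF g D.lin_phi(2)]) (simp_all add: mem D.phi_q D.phi_phii D.phii_phi)
qed

text \<open>Only linearity of f0 over H and colinearity of g0 over H enter, since \<open>phi\<close>
  is built from \<open>lac\<close> and \<open>lam'\<close>.\<close>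

lemma phi_natural_pt:
  assumes M: "RR.isright q dl ra" and N: "RR.isright q' dl' ra'" and M2: "RR.isright q2 dl2 ra2" and N2: "RR.isright q2' dl2' ra2'"
    and f: "right_map q dl ra q2 dl2 ra2 f0" and g: "right_map q' dl' ra' q2' dl2' ra2' g0"
  shows "ph ra2 q2' dl2' (f0 x \<otimes>\<^sub>k g0 y) = swt (ph ra q' dl' (x \<otimes>\<^sub>k y)) (\<lambda>x y. f0 x \<otimes>\<^sub>k g0 y)"
proof -
  interpret T: right_yd_pair p m u d e S Si pR mR uR dR eR ac co SR SRi q dl ra q' dl' ra'
    by (intro right_yd_pair.intro total_yd_hopf_axioms M N)
  interpret D: dual_yd_comodule_pair p m u d e S Si pR mR uR dR eR ac co SR SRi pV mV uV dV eV acv cov SV SVi fm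
    q T.M.lac T.M.lam T.M.rho q' T.N.lac T.N.lam T.N.rho
    by (intro dual_yd_comodule_pair.intro total_dual_pair_axioms right_duco M N)
  interpret T2: right_yd_pair p m u d e S Si pR mR uR dR eR ac co SR SRi q2 dl2 ra2 q2' dl2' ra2'
    by (intro right_yd_pair.intro total_yd_hopf_axioms M2 N2)
  interpret D2: dual_yd_comodule_pair p m u d e S Si pR mR uR dR eR ac co SR SRi pV mV uV dV eV acv cov SV SVi fm
    q2 T2.M.lac T2.M.lam T2.M.rho q2' T2.N.lac T2.N.lam T2.N.rho
    by (intro dual_yd_comodule_pair.intro total_dual_pair_axioms right_duco M2 N2)
  interpret P: right_yd_pair p m u d e S Si pR mR uR dR eR ac co SR SRi q dl ra q2 dl2 ra2
    by (intro right_yd_pair.intro total_yd_hopf_axioms M M2)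
  interpret Q: right_yd_pair p m u d e S Si pR mR uR dR eR ac co SR SRi q' dl' ra' q2' dl2' ra2'
    by (intro right_yd_pair.intro total_yd_hopf_axioms N N2)
  note cF = P.right_map_comodule_map[OF f] and cG = Q.right_map_comodule_map[OF g]
  note [simp] = comodule_mapD(2)[OF cF, symmetric] comodule_mapD(3)[OF cG] total_mapD(2,3)[OF comodule_mapD(1)[OF cF]] total_mapD(2,3)[OF comodule_mapD(1)[OF cG]]
    lin_op[OF total_mapD(1)[OF comodule_mapD(1)[OF cF]]] lin_op[OF total_mapD(1)[OF comodule_mapD(1)[OF cG]]]
  show ?thesis by (simp add: D.phi_def D2.phi_def)
qed

text \<open>The coaction of S^{-1}(k)y \<otimes> z0 contains a component of k from z0 directly
  before an S^{-1} of the preceding one. After this cancellation both composites act on the three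
  factors by the same elements.\<close>

lemma phi_assoc_pt:
  assumes M: "RR.isright q1 dl1 ra1" and N: "RR.isright q2 dl2 ra2" and L: "RR.isright q3 dl3 ra3"
  shows "asc (ph (tenr ra1 ra2) q3 dl3 (swt t (\<lambda>s z. ph ra1 q2 dl2 s \<otimes>\<^sub>k z))) =
    ph ra1 (tenq q2 q3) (tend q2 dl2 q3 dl3) (swt (asc t) (\<lambda>x s. x \<otimes>\<^sub>k ph ra2 q3 dl3 s))"
proof -
  interpret T12: right_yd_pair p m u d e S Si pR mR uR dR eR ac co SR SRi q1 dl1 ra1 q2 dl2 ra2
    by (intro right_yd_pair.intro total_yd_hopf_axioms M N)
  interpret T23: right_yd_pair p m u d e S Si pR mR uR dR eR ac co SR SRi q2 dl2 ra2 q3 dl3 ra3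
    by (intro right_yd_pair.intro total_yd_hopf_axioms N L)
  interpret D12: dual_yd_comodule_pair p m u d e S Si pR mR uR dR eR ac co SR SRi pV mV uV dV eV acv cov SV SVi fm
    q1 "rlac ra1" "rlam q1 dl1" "rrho q1 dl1" q2 "rlac ra2" "rlam q2 dl2" "rrho q2 dl2"
    by (intro dual_yd_comodule_pair.intro total_dual_pair_axioms right_duco M N)
  interpret D23: dual_yd_comodule_pair p m u d e S Si pR mR uR dR eR ac co SR SRi pV mV uV dV eV acv cov SV SVi fm
    q2 "rlac ra2" "rlam q2 dl2" "rrho q2 dl2" q3 "rlac ra3" "rlam q3 dl3" "rrho q3 dl3"
    by (intro dual_yd_comodule_pair.intro total_dual_pair_axioms right_duco N L)
  interpret D12_3: dual_yd_comodule_pair p m u d e S Si pR mR uR dR eR ac co SR SRi pV mV uV dV eV acv cov SV SVi fm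
    T12.qT "rlac T12.raT" "rlam T12.qT T12.dlT" "rrho T12.qT T12.dlT" q3 "rlac ra3" "rlam q3 dl3" "rrho q3 dl3"
    by (intro dual_yd_comodule_pair.intro total_dual_pair_axioms right_duco T12.right_yd_object_tensor L)
  interpret D1_23: dual_yd_comodule_pair p m u d e S Si pR mR uR dR eR ac co SR SRi pV mV uV dV eV acv cov SV SVi fm
    q1 "rlac ra1" "rlam q1 dl1" "rrho q1 dl1" T23.qT "rlac T23.raT" "rlam T23.qT T23.dlT" "rrho T23.qT T23.dlT"
    by (intro dual_yd_comodule_pair.intro total_dual_pair_axioms right_duco T23.right_yd_object_tensor M)
  have "ph ra1 (tenq q2 q3) (tend q2 dl2 q3 dl3) (swt (asc t) (\<lambda>x s. x \<otimes>\<^sub>k ph ra2 q3 dl3 s)) =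
    swt t (\<lambda>s z. swt s (\<lambda>x y. swt (rlam q2 dl2 y) (\<lambda>g y0. swt (rlam q3 dl3 z) (\<lambda>k z0. swt (d k) (\<lambda>k1 s. swt (d s) (\<lambda>k2 w.
      rlac ra1 (Si k1) (rlac ra1 (Si g) (rlac ra1 (Si (swt (d w) (\<lambda>a b. m b (Si a)))) x)) \<otimes>\<^sub>k rlac ra2 (Si k2) y0 \<otimes>\<^sub>k q3 z0))))))"
    by (simp add: D1_23.phi_def T23.lam_tensor T23.qT_def) (simp add: D23.phi_def asc_def)
  also have "\<dots> = asc (ph (tenr ra1 ra2) q3 dl3 (swt t (\<lambda>s z. ph ra1 q2 dl2 s \<otimes>\<^sub>k z)))"
    by (simp add: Si_r0) (simp add: D12_3.phi_def T12.lac_tensor D12.phi_def asc_def swt_swap[where t = "rlam q3 dl3 _"])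
  finally show ?thesis by simp
qed

lemma phi_unit_pt:
  assumes M: "RR.isright q dl ra"
  shows "lun (ph raU q dl (c \<otimes>\<^sub>k x)) = unit_coeff c *\<^sub>k q x" and "run (ph ra qU dlU (x \<otimes>\<^sub>k c)) = unit_coeff c *\<^sub>k q x"
proof -
  interpret U: right_yd_object p m u d e S Si pR mR uR dR eR ac co SR SRi qU dlU raU by (rule right_yd_object_unit)
  interpret M: right_yd_object p m u d e S Si pR mR uR dR eR ac co SR SRi q dl ra by (rule M)
  interpret L: dual_yd_comodule_pair p m u d e S Si pR mR uR dR eR ac co SR SRi pV mV uV dV eV acv cov SV SVi fm
    qU U.lac U.lam U.rho q M.lac M.lam M.rho
    by (intro dual_yd_comodule_pair.intro total_dual_pair_axioms right_duco M right_yd_object_unit)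
  interpret R: dual_yd_comodule_pair p m u d e S Si pR mR uR dR eR ac co SR SRi pV mV uV dV eV acv cov SV SVi fm
    q M.lac M.lam M.rho qU U.lac U.lam U.rho
    by (intro dual_yd_comodule_pair.intro total_dual_pair_axioms right_duco M right_yd_object_unit)
  have s: "unit_coeff (c *\<^sub>k x) = c * unit_coeff x" "unit_coeff (qU x) = unit_coeff x" for c and x :: "('a, 'k) univ"
    by (simp_all add: unit_coeff_def qU_def unit_vec_def lookup_single)
  show "lun (L.phi (c \<otimes>\<^sub>k x)) = unit_coeff c *\<^sub>k q x"
    by (simp add: L.phi_def U.lac_def raU_def lun_def s linf_comp[OF linf_unit_coeff])
  show "run (R.phi (x \<otimes>\<^sub>k c)) = unit_coeff c *\<^sub>k q x"
    by (simp add: R.phi_def U.lam_def dlU_def run_def s linf_comp[OF linf_unit_coeff])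
qed
end

section \<open>Assembling the monoidal functor\<close>

context dual_pair_carriers begin

lemma F_arr_rep: "F_arr H R Rv form (CC.rep X Y f) = DD.rep (F X) (F Y) f"
  by (simp add: F_arr_def CC.rep_def DD.rep_def)
lemma F_good: "CC.good X Y f \<Longrightarrow> DD.good (F X) (F Y) f"
  by (simp add: CC.good_def DD.good_def F_obs F_full)

lemma F_monoidal: "monoidal_functor (YD_right H R) (YD_rat H R Rv form) F (F_arr H R Rv form) (F_phi H R Rv form)"
proof -
  interpret MC: monoidal_category CC.C by (rule CC.monoidal_category_C)
  interpret MD: monoidal_category DD.C by (rule DD.monoidal_category_C)
  interpret FF: cat_functor CC.C DD.C F "F_arr H R Rv form"
    using F_isomorphism unfolding isomorphism_of_categories_def YD_right_def YD_rat_def Let_def by blast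
  show ?thesis unfolding YD_right_def YD_rat_def Let_def
  proof
    show "F (UnitO CC.C) = UnitO DD.C" by (simp add: F_unit)
  next
    fix X Y assume "X \<in> Ob CC.C" "Y \<in> Ob CC.C"
    then have o: "X \<in> YD_right_obs H R" "Y \<in> YD_right_obs H R" by simp_all
    obtain q dl ra where x: "RR.robj X q dl ra" "RR.isright q dl ra" by (rule RR.right_obsE[OF o(1)])
    obtain q' dl' ra' where y: "RR.robj Y q' dl' ra'" "RR.isright q' dl' ra'" by (rule RR.right_obsE[OF o(2)])
    show "F_phi H R Rv form X Y \<in> isos DD.C (TenO DD.C (F X) (F Y)) (F (TenO CC.C X Y))"
      unfolding F_phi_rep[OF x y] CC.C_simps(6) DD.C_simps(6) by (rule phi_good(2)[OF x y])
  next
    fix f g X X' Y Y' assume "f \<in> homs CC.C X X'" "g \<in> homs CC.C Y Y'"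
    then obtain f0 g0 where f: "CC.good X X' f0" "f = CC.rep X X' f0" and g: "CC.good Y Y' g0" "g = CC.rep Y Y' g0"
      by (elim CC.homE)
    note f1 = CC.goodD[OF f(1)] and g1 = CC.goodD[OF g(1)]
    obtain q dl ra where x: "RR.robj X q dl ra" "RR.isright q dl ra" by (rule RR.right_obsE[OF f1(1)])
    obtain q2 dl2 ra2 where x2: "RR.robj X' q2 dl2 ra2" "RR.isright q2 dl2 ra2" by (rule RR.right_obsE[OF f1(2)])
    obtain q' dl' ra' where y: "RR.robj Y q' dl' ra'" "RR.isright q' dl' ra'" by (rule RR.right_obsE[OF g1(1)])
    obtain q2' dl2' ra2' where y2: "RR.robj Y' q2' dl2' ra2'" "RR.isright q2' dl2' ra2'" by (rule RR.right_obsE[OF g1(2)])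
    note P = phi_good(1)[OF x y] and P2 = phi_good(1)[OF x2 y2]
    have q: "retr q (msp X)" and q': "retr q' (msp Y)" using x(1) y(1) by (simp_all add: RR.robj_def)
    note [simp] = lin_op[OF f1(3)] lin_op[OF g1(3)] lin_op[OF DD.goodD(3)[OF P]] lin_op[OF DD.goodD(3)[OF P2]]
    note n = phi_natural_pt[OF x(2) y(2) x2(2) y2(2) f1(5)[unfolded RR.right_hom_iff[OF x x2]] g1(5)[unfolded RR.right_hom_iff[OF y y2]]]
    have pt: "ph ra2 q2' dl2' (swt t (\<lambda>x y. f0 x \<otimes>\<^sub>k g0 y)) = swt (ph ra q' dl' t) (\<lambda>x y. f0 x \<otimes>\<^sub>k g0 y)"
      if t: "t \<in> msp X \<otimes>\<^sub>V msp Y" for t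
    proof (rule tensor_ext[OF t])
      fix a b assume ab: "a \<in> msp X" "b \<in> msp Y"
      interpret T: right_yd_pair p m u d e S Si pR mR uR dR eR ac co SR SRi q dl ra q' dl' ra'
        by (intro right_yd_pair.intro total_yd_hopf_axioms x y)
      interpret D: dual_yd_comodule_pair p m u d e S Si pR mR uR dR eR ac co SR SRi pV mV uV dV eV acv cov SV SVi fm
        q T.M.lac T.M.lam T.M.rho q' T.N.lac T.N.lam T.N.rho
        by (intro dual_yd_comodule_pair.intro total_dual_pair_axioms right_duco x y)
      have "swt (D.phi t) (\<lambda>x y. f0 (q x) \<otimes>\<^sub>k g0 (q' y)) = swt (D.phi t) (\<lambda>x y. f0 x \<otimes>\<^sub>k g0 y)" for t
        by (simp add: D.phi_def lin_op[OF retrD(1)[OF q]] lin_op[OF retrD(1)[OF q']] retrD(4)[OF q'])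
      then show "ph ra2 q2' dl2' (swt (a \<otimes>\<^sub>k b) (\<lambda>x y. f0 x \<otimes>\<^sub>k g0 y)) = swt (ph ra q' dl' (a \<otimes>\<^sub>k b)) (\<lambda>x y. f0 x \<otimes>\<^sub>k g0 y)"
        using n[of a b] ab by (simp add: retrD(3)[OF q] retrD(3)[OF q'])
    qed simp_all
    show "Comp DD.C (F_phi H R Rv form X' Y') (TenA DD.C (F_arr H R Rv form f) (F_arr H R Rv form g)) =
         Comp DD.C (F_arr H R Rv form (TenA CC.C f g)) (F_phi H R Rv form X Y)"
      unfolding f(2) g(2) F_arr_rep CC.rep_TenA[OF f(1) g(1)] DD.rep_TenA[OF F_good[OF f(1)] F_good[OF g(1)]]
        F_phi_rep[OF x y] F_phi_rep[OF x2 y2] DD.rep_Comp[OF DD.good_ten[OF F_good[OF f(1)] F_good[OF g(1)]]] DD.rep_Comp[OF P]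
      by (rule DD.rep_eq) (simp_all only: DD.ten_obj F_obs f1 g1 DD.ten_msp msp_F pt)
  next
    fix X Y Z assume "X \<in> Ob CC.C" "Y \<in> Ob CC.C" "Z \<in> Ob CC.C"
    then have o: "X \<in> YD_right_obs H R" "Y \<in> YD_right_obs H R" "Z \<in> YD_right_obs H R" by simp_all
    obtain q1 dl1 ra1 where x: "RR.robj X q1 dl1 ra1" "RR.isright q1 dl1 ra1" by (rule RR.right_obsE[OF o(1)])
    obtain q2 dl2 ra2 where y: "RR.robj Y q2 dl2 ra2" "RR.isright q2 dl2 ra2" by (rule RR.right_obsE[OF o(2)])
    obtain q3 dl3 ra3 where z: "RR.robj Z q3 dl3 ra3" "RR.isright q3 dl3 ra3" by (rule RR.right_obsE[OF o(3)])
    have xy: "RR.robj (right_tensor H RR.A X Y) (tenq q1 q2) (tend q1 dl1 q2 dl2) (tenr ra1 ra2)" "RR.isright (tenq q1 q2) (tend q1 dl1 q2 dl2) (tenr ra1 ra2)"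
      by (intro RR.robj_tensor x y right_yd_pair.right_yd_object_tensor right_yd_pair.intro total_yd_hopf_axioms)+
    have yz: "RR.robj (right_tensor H RR.A Y Z) (tenq q2 q3) (tend q2 dl2 q3 dl3) (tenr ra2 ra3)" "RR.isright (tenq q2 q3) (tend q2 dl2 q3 dl3) (tenr ra2 ra3)"
      by (intro RR.robj_tensor z y right_yd_pair.right_yd_object_tensor right_yd_pair.intro total_yd_hopf_axioms)+
    note P = phi_good(1)[OF x y] phi_good(1)[OF y z] phi_good(1)[OF xy z] phi_good(1)[OF x yz]
    note i = DD.good_id[OF F_obs[OF o(1)]] DD.good_id[OF F_obs[OF o(3)]]
    note a = F_obs[OF o(1)] F_obs[OF o(2)] F_obs[OF o(3)]
    show "Comp DD.C (F_arr H R Rv form (Assoc CC.C X Y Z))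
         (Comp DD.C (F_phi H R Rv form (TenO CC.C X Y) Z) (TenA DD.C (F_phi H R Rv form X Y) (Ide DD.C (F Z)))) =
        Comp DD.C (F_phi H R Rv form X (TenO CC.C Y Z))
         (Comp DD.C (TenA DD.C (Ide DD.C (F X)) (F_phi H R Rv form Y Z)) (Assoc DD.C (F X) (F Y) (F Z)))"
      unfolding CC.C_simps(6) CC.rep_Assoc[OF o] F_arr_rep DD.rep_Assoc[OF a] DD.rep_Ide
        F_phi_rep[OF x y] F_phi_rep[OF y z] F_phi_rep[OF xy z] F_phi_rep[OF x yz]
        DD.rep_TenA[OF P(1) i(2)] DD.rep_TenA[OF i(1) P(2)]
        DD.rep_Comp[OF DD.good_ten[OF P(1) i(2)]] DD.rep_Comp[OF DD.good_asc[OF a]]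
        DD.rep_Comp[OF DD.good_comp[OF DD.good_ten[OF P(1) i(2)] P(3)]]
        DD.rep_Comp[OF DD.good_comp[OF DD.good_asc[OF a] DD.good_ten[OF i(1) P(2)]]]
      by (rule DD.rep_eq) (simp_all only: phi_assoc_pt[OF x(2) y(2) z(2)] DD.ten_obj a)
  next
    fix X assume "X \<in> Ob CC.C"
    then have o: "X \<in> YD_right_obs H R" by simp
    obtain q dl ra where x: "RR.robj X q dl ra" "RR.isright q dl ra" by (rule RR.right_obsE[OF o])
    have q: "retr q (msp X)" using x(1) by (simp add: RR.robj_def)
    note P = phi_good(1)[OF RR.robj_unit right_yd_object_unit x, unfolded F_unit] phi_good(1)[OF x RR.robj_unit right_yd_object_unit, unfolded F_unit]
    note l = DD.goodD(3)[OF P(1)] DD.goodD(3)[OF P(2)]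
    have 1: "lun (ph raU q dl t) = lun t" if t: "t \<in> unit_space \<otimes>\<^sub>V msp X" for t
      by (rule tensor_ext[OF t]) (simp_all add: lin_op[OF l(1)] phi_unit_pt[OF x(2)] retrD(3)[OF q], simp add: lun_def)
    have 2: "run (ph ra qU dlU t) = run t" if t: "t \<in> msp X \<otimes>\<^sub>V unit_space" for t
      by (rule tensor_ext[OF t]) (simp_all add: lin_op[OF l(2)] phi_unit_pt[OF x(2)] retrD(3)[OF q], simp add: run_def)
    show "Comp DD.C (F_arr H R Rv form (LUnit CC.C X)) (F_phi H R Rv form (UnitO CC.C) X) = LUnit DD.C (F X)"
      unfolding CC.C_simps(7) CC.rep_LUnit[OF o] DD.rep_LUnit[OF F_obs[OF o]] F_arr_rep
        F_phi_rep[OF RR.robj_unit right_yd_object_unit x] DD.rep_Comp[OF P(1)] F_unit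
      by (rule DD.rep_eq) (simp_all add: 1 F_obs o)
    show "Comp DD.C (F_arr H R Rv form (RUnit CC.C X)) (F_phi H R Rv form X (UnitO CC.C)) = RUnit DD.C (F X)"
      unfolding CC.C_simps(7) CC.rep_RUnit[OF o] DD.rep_RUnit[OF F_obs[OF o]] F_arr_rep
        F_phi_rep[OF x RR.robj_unit right_yd_object_unit] DD.rep_Comp[OF P(2)] F_unit
      by (rule DD.rep_eq) (simp_all add: 2 F_obs o)
  qed
qed

lemma F_monoidal_isomorphism:
  "(\<forall>M\<in>Ob (YD_right H R). \<forall>m\<in>msp M.
      (\<forall>h\<in>carr H. mact (F M) (incl_H Rv h) m = F_act_H H M h m) \<and>
      (\<forall>\<xi>\<in>carr Rv. mact (F M) (incl_R H \<xi>) m = F_act_Rv H R form M \<xi> m))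
   \<and> monoidal_isomorphism (YD_right H R) (YD_rat H R Rv form) F (F_arr H R Rv form) (F_phi H R Rv form)"
proof -
  have "Ob (YD_right H R) = YD_right_obs H R" by (simp add: YD_right_def Let_def)
  then show ?thesis using F_monoidal F_isomorphism F_act unfolding monoidal_isomorphism_def by simp
qed
end

section \<open>From the given dual pair to total structures\<close>

lemma (in yd_hopf_bij) R_abs: "tm R (tp R x) (tp R y) = tm R x y" "td R (tp R x) = td R x" "te R (tp R x) = te R x"
  "thact H R (tp H h) x = thact H R h x" "thact H R h (tp R x) = thact H R h x" "thco R (tp R x) = thco R x"
  by (simp_all only: tm_def td_def te_def thact_def thco_def retrD(4)[OF retr_H] retrD(4)[OF retr_R])

lemma (in yd_hopf_bij) yd_hopf_carriers_R:
  "yd_hopf_carriers (tp H) (tm H) (one H) (td H) (te H) (tS H) (tSi H) (tp R) (tm R) (one R) (td R) (te R) (thact H R) (thco R) (tS R) (tSi R) H R"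
  by (intro yd_hopf_carriers.intro total_yd_hopf_R yd_hopf_carriers_axioms.intro) (simp_all add: retr_H retr_R)

text \<open>\<open>F_obj\<close> defines the action for \<xi>#h at once; the first conjunct
  certifies that on the two subalgebras it is given by the displayed formulas.\<close>

theorem theorem5p5:
  fixes H :: "('a, 'k::field) bialg_data"
    and R Rv :: "('a, 'k) yd_bialg_data"
    and form :: "('a, 'k) univ \<Rightarrow> ('a, 'k) univ \<Rightarrow> 'k"
  assumes "hopf_algebra H" and "bijective_antipode H"
    and "dual_pair H R Rv form"
    and "bijective_antipode R" and "bijective_antipode Rv"
  shows "(\<forall>M\<in>Ob (YD_right H R). \<forall>m\<in>msp M.
            (\<forall>h\<in>carr H. mact (F_obj H R Rv form M) (incl_H Rv h) m = F_act_H H M h m) \<and>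
            (\<forall>\<xi>\<in>carr Rv. mact (F_obj H R Rv form M) (incl_R H \<xi>) m = F_act_Rv H R form M \<xi> m))
       \<and> monoidal_isomorphism (YD_right H R) (YD_rat H R Rv form)
            (F_obj H R Rv form) (F_arr H R Rv form) (F_phi H R Rv form)"
proof -
  interpret P: dual_pair H R Rv form by (rule assms(3))
  interpret R: yd_hopf_bij H R using assms(2,4) by unfold_locales
  interpret V: yd_hopf_bij H Rv using assms(2,5) by unfold_locales
  \<comment> \<open>The pairing extended along the two projections, hence bilinear on the whole
    space.\<close>
  define fm where "fm \<xi> x = form (tp Rv \<xi>) (tp R x)" for \<xi> x
  have b: "linear_form_on (carr R) (form (tp Rv \<xi>))" "linear_form_on (carr Rv) (\<lambda>\<xi>. form \<xi> (tp R x))" for \<xi> x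
    using P.form_bilinear by (simp_all add: bilinear_form_on_def)
  have lin: "linf (fm \<xi>)" "linf (\<lambda>\<xi>. fm \<xi> x)" for \<xi> x
    unfolding fm_def[abs_def] using linear_form_on_linf[OF b(1) R.retr_R] linear_form_on_linf[OF b(2) V.retr_R] by simp_all
  have lin' [simp]: "lin F \<Longrightarrow> linf (\<lambda>t. fm \<xi> (F t))" "lin F \<Longrightarrow> linf (\<lambda>t. fm (F t) x)" for F \<xi> x
    using linf_comp[OF lin(1)] linf_comp[OF lin(2)] by auto
  have conv: "form \<xi> x = fm \<xi> x" if "\<xi> \<in> carr Rv" "x \<in> carr R" for \<xi> x
    using that by (simp add: fm_def)
  have abs: "fm (tp Rv \<xi>) x = fm \<xi> x" "fm \<xi> (tp R x) = fm \<xi> x" for \<xi> x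
    by (simp_all add: fm_def)
  have "total_dual_pair (tp H) (tm H) (one H) (td H) (te H) (tS H) (tSi H) (tp R) (tm R) (one R) (td R) (te R) (thact H R) (thco R) (tS R) (tSi R)
    (tp Rv) (tm Rv) (one Rv) (td Rv) (te Rv) (thact H Rv) (thco Rv) (tS Rv) (tSi Rv) fm"
  proof (intro total_dual_pair.intro R.total_yd_hopf_R V.total_yd_hopf_R total_dual_pair_axioms.intro)
    fix \<xi> \<eta> x y h w
    show "linf (fm \<xi>)" "linf (\<lambda>\<xi>. fm \<xi> x)" by (rule lin)+
    show "fm (tp Rv \<xi>) x = fm \<xi> x" "fm \<xi> (tp R x) = fm \<xi> x" by (rule abs)+
    show "fm (thact H Rv h \<xi>) x = fm \<xi> (thact H R (tS H h) x)"
      using P.form_act[of "tp H h" "tp Rv \<xi>" "tp R x"] by (simp add: conv abs R.R_abs V.R_abs)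
    have "sw (carr H) (carr Rv) (thco Rv \<xi>) (\<lambda>g \<xi>0. form \<xi>0 (tp R x) *\<^sub>k g) = swt (thco Rv \<xi>) (\<lambda>g \<xi>0. fm \<xi>0 x *\<^sub>k g)"
    proof -
      have "sw (carr H) (carr Rv) (thco Rv \<xi>) (\<lambda>g \<xi>0. form \<xi>0 (tp R x) *\<^sub>k g) = sw (carr H) (carr Rv) (thco Rv \<xi>) (\<lambda>g \<xi>0. fm \<xi>0 x *\<^sub>k g)"
        by (intro sw_cong) (simp_all add: conv abs)
      then show ?thesis by simp
    qed
    moreover have "sw (carr H) (carr R) (thco R x) (\<lambda>g x0. form (tp Rv \<xi>) x0 *\<^sub>k antipode_inv H g) = swt (thco R x) (\<lambda>g x0. fm \<xi> x0 *\<^sub>k tSi H g)"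
    proof -
      have "sw (carr H) (carr R) (thco R x) (\<lambda>g x0. form (tp Rv \<xi>) x0 *\<^sub>k antipode_inv H g) = sw (carr H) (carr R) (thco R x) (\<lambda>g x0. fm \<xi> x0 *\<^sub>k tSi H g)"
        by (intro sw_cong) (simp_all add: conv abs)
      then show ?thesis by simp
    qed
    ultimately show "swt (thco Rv \<xi>) (\<lambda>g \<xi>0. fm \<xi>0 x *\<^sub>k g) = swt (thco R x) (\<lambda>g x0. fm \<xi> x0 *\<^sub>k tSi H g)"
      using P.form_coact[of "tp Rv \<xi>" "tp R x"] by (simp add: R.R_abs V.R_abs)
    show "fm \<xi> (tm R x y) *\<^sub>k w = swt (td Rv \<xi>) (\<lambda>\<xi>1 \<xi>2. fm \<xi>1 y *\<^sub>k fm \<xi>2 x *\<^sub>k w)"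
    proof -
      have "fm \<xi> (tm R x y) = form (tp Rv \<xi>) (mul R (tp R x) (tp R y))" by (simp add: conv abs R.R_abs)
      also have "\<dots> = sw_form (carr Rv) (carr Rv) (td Rv \<xi>) (\<lambda>\<xi>1 \<xi>2. form \<xi>1 (tp R y) * form \<xi>2 (tp R x))"
        using P.form_mul_R[of "tp Rv \<xi>" "tp R x" "tp R y"] by (simp add: V.R_abs)
      also have "\<dots> = sw_form (carr Rv) (carr Rv) (td Rv \<xi>) (\<lambda>\<xi>1 \<xi>2. fm \<xi>1 y * fm \<xi>2 x)"
        by (intro sw_form_cong) (simp_all add: conv abs)
      finally show ?thesis by (simp add: sw_form_swt)
    qed
    show "fm (tm Rv \<xi> \<eta>) x *\<^sub>k w = swt (td R x) (\<lambda>x1 x2. fm \<xi> x2 *\<^sub>k fm \<eta> x1 *\<^sub>k w)"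
    proof -
      have "fm (tm Rv \<xi> \<eta>) x = form (mul Rv (tp Rv \<xi>) (tp Rv \<eta>)) (tp R x)" by (simp add: conv abs V.R_abs)
      also have "\<dots> = sw_form (carr R) (carr R) (td R x) (\<lambda>x1 x2. form (tp Rv \<xi>) x2 * form (tp Rv \<eta>) x1)"
        using P.form_mul_Rv[of "tp Rv \<xi>" "tp Rv \<eta>" "tp R x"] by (simp add: R.R_abs)
      also have "\<dots> = sw_form (carr R) (carr R) (td R x) (\<lambda>x1 x2. fm \<xi> x2 * fm \<eta> x1)"
        by (intro sw_form_cong) (simp_all add: conv abs)
      finally show ?thesis by (simp add: sw_form_swt)
    qed
    show "fm (one Rv) x = te R x" "fm \<xi> (one R) = te Rv \<xi>"
      using P.form_one_Rv[of "tp R x"] P.form_one_R[of "tp Rv \<xi>"] by (simp_all add: conv abs R.R_abs V.R_abs)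
  next
    fix x assume "\<And>\<xi>. fm \<xi> x = 0"
    then have "tp R x \<in> right_perp (carr R) form (carr Rv)" by (simp add: right_perp_def conv abs)
    then show "tp R x = 0" using P.nondegenerate_right by blast
  qed
  then interpret dual_pair_carriers "tp H" "tm H" "one H" "td H" "te H" "tS H" "tSi H" "tp R" "tm R" "one R" "td R" "te R" "thact H R" "thco R" "tS R" "tSi R"
    "tp Rv" "tm Rv" "one Rv" "td Rv" "te Rv" "thact H Rv" "thco Rv" "tS Rv" "tSi Rv" fm H R Rv form
    by (intro dual_pair_carriers.intro R.yd_hopf_carriers_R V.yd_hopf_carriers_R dual_pair_carriers_axioms.intro conv)
  show ?thesis by (rule F_monoidal_isomorphism)
qed

end
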